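(* Let $X$ be a smooth projective variety and let $\mathcal{E}$ be a vector bundle on $X$. Suppose a hierarchical filtration of $\mathcal{E}$ is given by a finite sequence of elementary transforms $$\mathcal{E}=V_0\supset V_1\supset\cdots\supset V_h,\qquad V_{k+1}=\ker\big(V_k\xrightarrow{\ \varphi_k\ }\mathcal{Q}_k\big),$$ where for each $k$ the sheaf $\mathcal{Q}_k$ is a nonzero torsion sheaf supported on an effective Cartier divisor $D_k\subset X$. Assume that the set of divisors $\{D_k\}$ is partitioned into two disjoint collections $\mathcal{A}=\{D_{a_1},\dots,D_{a_r}\}$ and $\mathcal{B}=\{D_{b_1},\dots,D_{b_s}\}$ such that $\mathrm{Supp}(D_a)\cap\mathrm{Supp}(D_b)=\varnothing$ for all $D_a\in\mathcal{A}$, $D_b\in\mathcal{B}$. Then: (1) For every pair $D_a\in\mathcal{A}$ and $D_b\in\mathcal{B}$, the elementary transforms along $D_a$ and $D_b$ commute. More precisely, for any surjective morphisms $\varphi_a:\mathcal{E}\to\mathcal{Q}_a$ and $\varphi_b:\mathcal{E}\to\mathcal{Q}_b$ with $\mathrm{Supp}(\mathcal{Q}_a)\subset D_a$ and $\mathrm{Supp}(\mathcal{Q}_b)\subset D_b$, one has, as subsheaves of $\mathcal{E}$, $$\ker\Big(\ker(\mathcal{E}\xrightarrow{\varphi_a}\mathcal{Q}_a)\xrightarrow{\overline{\varphi}_b}\mathcal{Q}_b\Big)=\ker\Big(\ker(\mathcal{E}\xrightarrow{\varphi_b}\mathcal{Q}_b)\xrightarrow{\overline{\varphi}_a}\mathcal{Q}_a\Big)=\ker\Big(\mathcal{E}\xrightarrow{(\varphi_a,\varphi_b)}\mathcal{Q}_a\oplus\mathcal{Q}_b\Big),$$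 where $\overline{\varphi}_j$ denotes the map induced by $\varphi_j$ on the kernel of the other map $\varphi_i$. (2) By repeatedly interchanging adjacent transforms involving one divisor from $\mathcal{A}$ and one from $\mathcal{B}$, the filtration can be reordered into another hierarchical filtration of the same length $h$, in which all transforms supported on divisors in $\mathcal{A}$ occur before all transforms supported on divisors in $\mathcal{B}$. (3) In particular, increments supported on disjoint divisors impose no obstruction to achieving the maximal possible hierarchical depth: their order can be rearranged arbitrarily without changing the total number of steps.
   Context: Varieties are integral projective schemes over an algebraically closed field of arbitrary characteristic; all sheaves are coherent. For a torsion-free sheaf of rank $\rho$, $\det(\mathcal{E})=(\wedge^{\rho}\mathcal{E})^{\vee\vee}$. An elementary transform of $\mathcal{E}$ along an effective divisor $D$ is a sheaf $\mathcal{E}'$ fitting into an exact sequence $0\to\mathcal{E}'\to\mathcal{E}\to\mathcal{T}\to 0$ with $\mathcal{T}$ a torsion sheaf supported on $D$, with $\det(\mathcal{E}')\simeq\det(\mathcal{E})(-D)$. Hierarchical filtration. Given $\Lambda_0\in\mathrm{Pic}(X)$ and a vector bundle $\mathcal{E}$ of rank $\rho$, a hierarchical filtration of $\mathcal{E}$ normalized by $\Lambda_0$, of length $h$, is a chain $\mathcal{E}_0\subset\mathcal{E}_1\subset\cdots\subset\mathcal{E}_h=\mathcal{E}$ of vector bundles of rank $\rho$ (so each quotient $\mathcal{E}_i/\mathcal{E}_{i-1}$ is torsion) such that for each $i\ge 1$ there is a nonzero effective Cartier divisor $D_i$ with $\det(\mathcal{E}_i)\simeq\det(\mathcal{E}_{i-1})\otimes\mathcal{O}_X(D_i)$,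 and $\det(\mathcal{E}_0)\simeq\Lambda_0$. The determinant condition is regarded by the paper as equivalent to $\mathcal{E}_{i-1}$ being an elementary transform of $\mathcal{E}_i$ along $D_i$ (the cokernel is torsion, supported on $D_i$, with determinant $\mathcal{O}_X(D_i)$). Here the filtration is written in descending order, $V_k=\mathcal{E}_{h-k}$, with normalization $\Lambda_0=\det(V_h)$. The hierarchical depth $h_{\Lambda_0}(\mathcal{E})$ is the maximal length of a hierarchical filtration of $\mathcal{E}$ normalized by $\Lambda_0$ (and $-\infty$ if none exists). *)

theory Defs
  imports
    "HOL-Algebra.Algebra"
    "HOL-Analysis.Abstract_Topology"
    "HOL-Combinatorics.Permutations"
    "HOL-Library.Extended_Nat"
    "HOL-Library.Extended_Real"
begin

text \<open>Frees the identifier \<open>X\<close>, which \<^theory>\<open>HOL-Algebra.Polynomials\<close> uses as notation.\<close>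

no_notation var (\<open>X\<index>\<close>)

section \<open>Sheaves and ringed spaces\<close>

text \<open>
  Presheaf data are indexed by all sets of points, but only the values on open sets matter;
  a restriction map \<open>r U V\<close> goes from \<open>U\<close> to \<open>V \<subseteq> U\<close>.  Taking the empty cover of the empty set,
  \<open>is_sheaf\<close> forces a single section over the empty set.
\<close>

definition is_presheaf ::
  "'p topology \<Rightarrow> ('p set \<Rightarrow> 'a set) \<Rightarrow> ('p set \<Rightarrow> 'p set \<Rightarrow> 'a \<Rightarrow> 'a) \<Rightarrow> bool" where
  "is_presheaf T C r \<longleftrightarrow>
     (\<forall>U V. openin T U \<and> openin T V \<and> V \<subseteq> U \<longrightarrow> r U V \<in> C U \<rightarrow> C V) \<and>
     (\<forall>U. openin T U \<longrightarrow> (\<forall>s\<in>C U. r U U s = s)) \<and>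
     (\<forall>U V W. openin T U \<and> openin T V \<and> openin T W \<and> W \<subseteq> V \<and> V \<subseteq> U \<longrightarrow>
        (\<forall>s\<in>C U. r V W (r U V s) = r U W s))"

definition is_sheaf ::
  "'p topology \<Rightarrow> ('p set \<Rightarrow> 'a set) \<Rightarrow> ('p set \<Rightarrow> 'p set \<Rightarrow> 'a \<Rightarrow> 'a) \<Rightarrow> bool" where
  "is_sheaf T C r \<longleftrightarrow> is_presheaf T C r \<and>
     (\<forall>\<U>. (\<forall>V\<in>\<U>. openin T V) \<longrightarrow>
        (\<forall>s\<in>C (\<Union>\<U>). \<forall>t\<in>C (\<Union>\<U>). (\<forall>V\<in>\<U>. r (\<Union>\<U>) V s = r (\<Union>\<U>) V t) \<longrightarrow> s = t) \<and>
        (\<forall>f. (\<forall>V\<in>\<U>. f V \<in> C V) \<and> (\<forall>V\<in>\<U>. \<forall>W\<in>\<U>. r V (V \<inter> W) (f V) = r W (V \<inter> W) (f W)) \<longrightarrow>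
           (\<exists>s\<in>C (\<Union>\<U>). \<forall>V\<in>\<U>. r (\<Union>\<U>) V s = f V)))"

definition germ_of ::
  "'p topology \<Rightarrow> ('p set \<Rightarrow> 'a set) \<Rightarrow> ('p set \<Rightarrow> 'p set \<Rightarrow> 'a \<Rightarrow> 'a)
     \<Rightarrow> 'p \<Rightarrow> 'p set \<Rightarrow> 'a \<Rightarrow> ('p set \<times> 'a) set" where
  "germ_of T C r x U s =
     {(V, t). openin T V \<and> x \<in> V \<and> t \<in> C V \<and>
        (\<exists>W. openin T W \<and> x \<in> W \<and> W \<subseteq> U \<inter> V \<and> r U W s = r V W t)}"

record ('p, 'r) ringed_space =
  tps :: "'p topology"
  sec :: "'p set \<Rightarrow> 'r ring"
  res :: "'p set \<Rightarrow> 'p set \<Rightarrow> 'r \<Rightarrow> 'r"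

definition sheaf_of_rings :: "('p, 'r) ringed_space \<Rightarrow> bool" where
  "sheaf_of_rings X \<longleftrightarrow>
     is_sheaf (tps X) (\<lambda>U. carrier (sec X U)) (res X) \<and>
     (\<forall>U. openin (tps X) U \<longrightarrow> cring (sec X U)) \<and>
     (\<forall>U V. openin (tps X) U \<and> openin (tps X) V \<and> V \<subseteq> U \<longrightarrow>
        res X U V \<in> ring_hom (sec X U) (sec X V))"

definition germ :: "('p, 'r) ringed_space \<Rightarrow> 'p \<Rightarrow> 'p set \<Rightarrow> 'r \<Rightarrow> ('p set \<times> 'r) set" where
  "germ X = germ_of (tps X) (\<lambda>U. carrier (sec X U)) (res X)"

text \<open>
  Operations on equivalence classes are written as unions over representatives: all members of such
  a union are the same class.  The same device is used for localizations, sheafification and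
  quotient modules below.
\<close>

definition stalk :: "('p, 'r) ringed_space \<Rightarrow> 'p \<Rightarrow> ('p set \<times> 'r) set ring" where
  "stalk X x =
     \<lparr> carrier = {germ X x U s | U s. openin (tps X) U \<and> x \<in> U \<and> s \<in> carrier (sec X U)},
       monoid.mult = (\<lambda>A B. \<Union>(U, s)\<in>A. \<Union>(V, t)\<in>B.
          germ X x (U \<inter> V) (res X U (U \<inter> V) s \<otimes>\<^bsub>sec X (U \<inter> V)\<^esub> res X V (U \<inter> V) t)),
       one = germ X x (topspace (tps X)) \<one>\<^bsub>sec X (topspace (tps X))\<^esub>,
       ring.zero = germ X x (topspace (tps X)) \<zero>\<^bsub>sec X (topspace (tps X))\<^esub>,
       add = (\<lambda>A B. \<Union>(U, s)\<in>A. \<Union>(V, t)\<in>B.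
          germ X x (U \<inter> V) (res X U (U \<inter> V) s \<oplus>\<^bsub>sec X (U \<inter> V)\<^esub> res X V (U \<inter> V) t)) \<rparr>"

definition local_ring :: "'a ring \<Rightarrow> bool" where
  "local_ring R \<longleftrightarrow> cring R \<and> (\<exists>!m. maximalideal m R)"

definition locally_ringed_space :: "('p, 'r) ringed_space \<Rightarrow> bool" where
  "locally_ringed_space X \<longleftrightarrow>
     sheaf_of_rings X \<and> (\<forall>x\<in>topspace (tps X). local_ring (stalk X x))"

definition open_subspace :: "('p, 'r) ringed_space \<Rightarrow> 'p set \<Rightarrow> ('p, 'r) ringed_space" where
  "open_subspace X U = \<lparr> tps = subtopology (tps X) U, sec = sec X, res = res X \<rparr>"

definition preim :: "('p, 'r) ringed_space \<Rightarrow> ('p \<Rightarrow> 'q) \<Rightarrow> 'q set \<Rightarrow> 'p set" where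
  "preim X f V = {x \<in> topspace (tps X). f x \<in> V}"

definition rs_morphism ::
  "('p, 'r) ringed_space \<Rightarrow> ('q, 's) ringed_space \<Rightarrow> ('p \<Rightarrow> 'q) \<Rightarrow> ('q set \<Rightarrow> 's \<Rightarrow> 'r) \<Rightarrow> bool" where
  "rs_morphism X Y f g \<longleftrightarrow>
     continuous_map (tps X) (tps Y) f \<and>
     (\<forall>V. openin (tps Y) V \<longrightarrow> g V \<in> ring_hom (sec Y V) (sec X (preim X f V))) \<and>
     (\<forall>V W. openin (tps Y) V \<and> openin (tps Y) W \<and> W \<subseteq> V \<longrightarrow>
        (\<forall>s\<in>carrier (sec Y V). g W (res Y V W s) = res X (preim X f V) (preim X f W) (g V s)))"

definition local_morphism ::
  "('p, 'r) ringed_space \<Rightarrow> ('q, 's) ringed_space \<Rightarrow> ('p \<Rightarrow> 'q) \<Rightarrow> ('q set \<Rightarrow> 's \<Rightarrow> 'r) \<Rightarrow> bool" where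
  "local_morphism X Y f g \<longleftrightarrow> rs_morphism X Y f g \<and>
     (\<forall>x\<in>topspace (tps X). \<forall>V. openin (tps Y) V \<and> f x \<in> V \<longrightarrow>
        (\<forall>s\<in>carrier (sec Y V).
           germ X x (preim X f V) (g V s) \<in> Units (stalk X x) \<longrightarrow>
           germ Y (f x) V s \<in> Units (stalk Y (f x))))"

definition rs_isomorphic :: "('p, 'r) ringed_space \<Rightarrow> ('q, 's) ringed_space \<Rightarrow> bool" where
  "rs_isomorphic X Y \<longleftrightarrow>
     (\<exists>f g. rs_morphism X Y f g \<and> homeomorphic_map (tps X) (tps Y) f \<and>
        (\<forall>V. openin (tps Y) V \<longrightarrow> bij_betw (g V) (carrier (sec Y V)) (carrier (sec X (preim X f V)))))"

definition closed_immersion ::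
  "('p, 'r) ringed_space \<Rightarrow> ('q, 's) ringed_space \<Rightarrow> ('p \<Rightarrow> 'q) \<Rightarrow> ('q set \<Rightarrow> 's \<Rightarrow> 'r) \<Rightarrow> bool" where
  "closed_immersion X Y f g \<longleftrightarrow>
     local_morphism X Y f g \<and> embedding_map (tps X) (tps Y) f \<and>
     closedin (tps Y) (f ` topspace (tps X)) \<and>
     (\<forall>V. openin (tps Y) V \<longrightarrow> (\<forall>t\<in>carrier (sec X (preim X f V)). \<forall>y\<in>V.
        \<exists>W. openin (tps Y) W \<and> y \<in> W \<and> W \<subseteq> V \<and>
          (\<exists>s\<in>carrier (sec Y W). g W s = res X (preim X f V) (preim X f W) t)))"


section \<open>Spec, Proj and schemes\<close>

text \<open>The class of \<open>a/s\<close> in the localization of \<open>R\<close> at the multiplicative set \<open>S\<close>.\<close>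

definition fraction :: "'a ring \<Rightarrow> 'a set \<Rightarrow> 'a \<Rightarrow> 'a \<Rightarrow> ('a \<times> 'a) set" where
  "fraction R S a s =
     {(b, t). b \<in> carrier R \<and> t \<in> S \<and> (\<exists>u\<in>S. u \<otimes>\<^bsub>R\<^esub> (a \<otimes>\<^bsub>R\<^esub> t) = u \<otimes>\<^bsub>R\<^esub> (b \<otimes>\<^bsub>R\<^esub> s))}"

definition localization :: "'a ring \<Rightarrow> 'a set \<Rightarrow> ('a \<times> 'a) set ring" where
  "localization R S =
     \<lparr> carrier = {fraction R S a s | a s. a \<in> carrier R \<and> s \<in> S},
       monoid.mult = (\<lambda>A B. \<Union>(a, s)\<in>A. \<Union>(b, t)\<in>B. fraction R S (a \<otimes>\<^bsub>R\<^esub> b) (s \<otimes>\<^bsub>R\<^esub> t)),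
       one = fraction R S \<one>\<^bsub>R\<^esub> \<one>\<^bsub>R\<^esub>,
       ring.zero = fraction R S \<zero>\<^bsub>R\<^esub> \<one>\<^bsub>R\<^esub>,
       add = (\<lambda>A B. \<Union>(a, s)\<in>A. \<Union>(b, t)\<in>B.
          fraction R S ((a \<otimes>\<^bsub>R\<^esub> t) \<oplus>\<^bsub>R\<^esub> (b \<otimes>\<^bsub>R\<^esub> s)) (s \<otimes>\<^bsub>R\<^esub> t)) \<rparr>"

text \<open>
  The common pattern behind the structure sheaves of Spec and Proj: sections over \<open>U\<close> are functions
  \<open>x \<mapsto> s x\<close> into the localizations at the sets of denominators \<open>den x\<close> that are locally given by one
  fraction \<open>a/f\<close> with \<open>(a, f)\<close> in a set \<open>adm\<close> of admissible pairs (all pairs for Spec,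
  homogeneous pairs of equal degree for Proj).
\<close>

definition fraction_space ::
  "'a ring \<Rightarrow> 'a set topology \<Rightarrow> ('a set \<Rightarrow> 'a set) \<Rightarrow> ('a \<times> 'a) set
     \<Rightarrow> ('a set, 'a set \<Rightarrow> ('a \<times> 'a) set) ringed_space" where
  "fraction_space R T den adm =
     \<lparr> tps = T,
       sec = (\<lambda>U. \<lparr>
         carrier = {s \<in> extensional U. \<forall>x\<in>U. \<exists>V. openin T V \<and> x \<in> V \<and> V \<subseteq> U \<and>
            (\<exists>a f. (a, f) \<in> adm \<and> (\<forall>y\<in>V. f \<in> den y \<and> s y = fraction R (den y) a f))},
         monoid.mult = (\<lambda>s t. \<lambda>x\<in>U. s x \<otimes>\<^bsub>localization R (den x)\<^esub> t x),
         one = (\<lambda>x\<in>U. \<one>\<^bsub>localization R (den x)\<^esub>),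
         ring.zero = (\<lambda>x\<in>U. \<zero>\<^bsub>localization R (den x)\<^esub>),
         add = (\<lambda>s t. \<lambda>x\<in>U. s x \<oplus>\<^bsub>localization R (den x)\<^esub> t x) \<rparr>),
       res = (\<lambda>U V s. restrict s V) \<rparr>"

definition Spec :: "'a ring \<Rightarrow> ('a set, 'a set \<Rightarrow> ('a \<times> 'a) set) ringed_space" where
  "Spec R = fraction_space R
     (topology_generated_by {{p. primeideal p R \<and> f \<notin> p} | f. f \<in> carrier R})
     (\<lambda>p. carrier R - p) (carrier R \<times> carrier R)"

text \<open>In \<open>Proj S G\<close>, the set \<open>G d\<close> is the homogeneous part of degree \<open>d\<close> of \<open>S\<close>.\<close>

definition proj_points :: "'a ring \<Rightarrow> (nat \<Rightarrow> 'a set) \<Rightarrow> 'a set set" where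
  "proj_points S G =
     {p. primeideal p S \<and> p = genideal S (p \<inter> (\<Union>d. G d)) \<and> (\<exists>d>0. \<not> G d \<subseteq> p)}"

definition Proj ::
  "'a ring \<Rightarrow> (nat \<Rightarrow> 'a set) \<Rightarrow> ('a set, 'a set \<Rightarrow> ('a \<times> 'a) set) ringed_space" where
  "Proj S G = fraction_space S
     (topology_generated_by {{p \<in> proj_points S G. f \<notin> p} | f. \<exists>d>0. f \<in> G d})
     (\<lambda>p. (\<Union>d. G d) - p) {(a, f). \<exists>d. a \<in> G d \<and> f \<in> G d}"

definition scheme :: "('p, 'r) ringed_space \<Rightarrow> bool" where
  "scheme X \<longleftrightarrow> locally_ringed_space X \<and>
     (\<forall>x\<in>topspace (tps X). \<exists>U. openin (tps X) U \<and> x \<in> U \<and>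
        (\<exists>R :: 'r ring. cring R \<and> rs_isomorphic (open_subspace X U) (Spec R)))"

definition integral_scheme :: "('p, 'r) ringed_space \<Rightarrow> bool" where
  "integral_scheme X \<longleftrightarrow> scheme X \<and> topspace (tps X) \<noteq> {} \<and>
     (\<forall>U. openin (tps X) U \<and> U \<noteq> {} \<longrightarrow> domain (sec X U))"

text \<open>The polynomial ring \<open>k[x\<^sub>0, \<dots>, x\<^sub>n]\<close>; monomials are multisets of variable indices.\<close>

definition mpoly_ring :: "'k ring \<Rightarrow> nat \<Rightarrow> (nat multiset \<Rightarrow> 'k) ring" where
  "mpoly_ring k n =
     \<lparr> carrier = {f. (\<forall>m. f m \<in> carrier k) \<and> finite {m. f m \<noteq> \<zero>\<^bsub>k\<^esub>} \<and>
          (\<forall>m. \<not> set_mset m \<subseteq> {..n} \<longrightarrow> f m = \<zero>\<^bsub>k\<^esub>)},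
       monoid.mult = (\<lambda>f g m. finsum k (\<lambda>a. f a \<otimes>\<^bsub>k\<^esub> g (m - a)) {a. a \<subseteq># m}),
       one = (\<lambda>m. if m = {#} then \<one>\<^bsub>k\<^esub> else \<zero>\<^bsub>k\<^esub>),
       ring.zero = (\<lambda>m. \<zero>\<^bsub>k\<^esub>),
       add = (\<lambda>f g m. f m \<oplus>\<^bsub>k\<^esub> g m) \<rparr>"

definition projective_space ::
  "'k ring \<Rightarrow> nat \<Rightarrow> ((nat multiset \<Rightarrow> 'k) set,
     (nat multiset \<Rightarrow> 'k) set \<Rightarrow> ((nat multiset \<Rightarrow> 'k) \<times> (nat multiset \<Rightarrow> 'k)) set) ringed_space" where
  "projective_space k n = Proj (mpoly_ring k n)
     (\<lambda>d. {f \<in> carrier (mpoly_ring k n). \<forall>m. size m \<noteq> d \<longrightarrow> f m = \<zero>\<^bsub>k\<^esub>})"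

definition proj_const ::
  "'k ring \<Rightarrow> nat \<Rightarrow> 'k \<Rightarrow>
     (nat multiset \<Rightarrow> 'k) set \<Rightarrow> ((nat multiset \<Rightarrow> 'k) \<times> (nat multiset \<Rightarrow> 'k)) set" where
  "proj_const k n c = (\<lambda>p\<in>topspace (tps (projective_space k n)).
     fraction (mpoly_ring k n)
       ((\<Union>d. {f \<in> carrier (mpoly_ring k n). \<forall>m. size m \<noteq> d \<longrightarrow> f m = \<zero>\<^bsub>k\<^esub>}) - p)
       (\<lambda>m. if m = {#} then c else \<zero>\<^bsub>k\<^esub>) \<one>\<^bsub>mpoly_ring k n\<^esub>)"

text \<open>
  A \<open>k\<close>-structure on \<open>X\<close>, i.e. a morphism to \<open>Spec k\<close>, is given by a ring homomorphism \<open>\<iota>\<close> from \<open>k\<close>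
  to the global functions.
\<close>

definition projective_over :: "'k ring \<Rightarrow> ('k \<Rightarrow> 'r) \<Rightarrow> ('p, 'r) ringed_space \<Rightarrow> bool" where
  "projective_over k \<iota> X \<longleftrightarrow>
     \<iota> \<in> ring_hom k (sec X (topspace (tps X))) \<and>
     (\<exists>n f g. closed_immersion X (projective_space k n) f g \<and>
        (\<forall>c\<in>carrier k. g (topspace (tps (projective_space k n))) (proj_const k n c) = \<iota> c))"

definition krull_dim :: "'a ring \<Rightarrow> enat" where
  "krull_dim R = Sup {enat n | n. \<exists>P :: nat \<Rightarrow> 'a set.
     (\<forall>i\<le>n. primeideal (P i) R) \<and> (\<forall>i<n. P i \<subset> P (Suc i))}"

definition regular_local_ring :: "'a ring \<Rightarrow> bool" where
  "regular_local_ring R \<longleftrightarrow> local_ring R \<and> noetherian_ring R \<and>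
     (\<exists>S\<subseteq>carrier R. finite S \<and> enat (card S) = krull_dim R \<and> maximalideal (genideal R S) R)"

text \<open>Over an algebraically closed field, smooth means that all local rings are regular.\<close>

definition smooth_projective_variety :: "'k ring \<Rightarrow> ('k \<Rightarrow> 'r) \<Rightarrow> ('p, 'r) ringed_space \<Rightarrow> bool" where
  "smooth_projective_variety k \<iota> X \<longleftrightarrow>
     algebraically_closed k \<and> integral_scheme X \<and> projective_over k \<iota> X \<and>
     (\<forall>x\<in>topspace (tps X). regular_local_ring (stalk X x))"


section \<open>Sheaves of modules\<close>

text \<open>The \<open>mult\<close> and \<open>one\<close> components of a module record carry no meaning.\<close>

definition mk_module :: "'m set \<Rightarrow> 'm \<Rightarrow> ('m \<Rightarrow> 'm \<Rightarrow> 'm) \<Rightarrow> ('r \<Rightarrow> 'm \<Rightarrow> 'm) \<Rightarrow> ('r, 'm) module" where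
  "mk_module C z a s =
     \<lparr> carrier = C, monoid.mult = undefined, one = undefined, ring.zero = z, add = a, smult = s \<rparr>"

record ('p, 'r, 'm) modsheaf =
  msec :: "'p set \<Rightarrow> ('r, 'm) module"
  mres :: "'p set \<Rightarrow> 'p set \<Rightarrow> 'm \<Rightarrow> 'm"

definition sheaf_of_modules :: "('p, 'r) ringed_space \<Rightarrow> ('p, 'r, 'm) modsheaf \<Rightarrow> bool" where
  "sheaf_of_modules X E \<longleftrightarrow>
     is_sheaf (tps X) (\<lambda>U. carrier (msec E U)) (mres E) \<and>
     (\<forall>U. openin (tps X) U \<longrightarrow> module (sec X U) (msec E U)) \<and>
     (\<forall>U V. openin (tps X) U \<and> openin (tps X) V \<and> V \<subseteq> U \<longrightarrow>
        (\<forall>s\<in>carrier (msec E U). \<forall>t\<in>carrier (msec E U).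
           mres E U V (s \<oplus>\<^bsub>msec E U\<^esub> t) = mres E U V s \<oplus>\<^bsub>msec E V\<^esub> mres E U V t) \<and>
        (\<forall>a\<in>carrier (sec X U). \<forall>s\<in>carrier (msec E U).
           mres E U V (a \<odot>\<^bsub>msec E U\<^esub> s) = res X U V a \<odot>\<^bsub>msec E V\<^esub> mres E U V s))"

definition mgerm ::
  "('p, 'r) ringed_space \<Rightarrow> ('p, 'r, 'm) modsheaf \<Rightarrow> 'p \<Rightarrow> 'p set \<Rightarrow> 'm \<Rightarrow> ('p set \<times> 'm) set" where
  "mgerm X E = germ_of (tps X) (\<lambda>U. carrier (msec E U)) (mres E)"

definition structure_module :: "('p, 'r) ringed_space \<Rightarrow> ('p, 'r, 'r) modsheaf" where
  "structure_module X =
     \<lparr> msec = (\<lambda>U. mk_module (carrier (sec X U)) \<zero>\<^bsub>sec X U\<^esub> (add (sec X U)) (monoid.mult (sec X U))),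
       mres = res X \<rparr>"

definition free_sheaf :: "('p, 'r) ringed_space \<Rightarrow> nat \<Rightarrow> ('p, 'r, nat \<Rightarrow> 'r) modsheaf" where
  "free_sheaf X n =
     \<lparr> msec = (\<lambda>U. mk_module ({..<n} \<rightarrow>\<^sub>E carrier (sec X U)) (\<lambda>i\<in>{..<n}. \<zero>\<^bsub>sec X U\<^esub>)
          (\<lambda>v w. \<lambda>i\<in>{..<n}. v i \<oplus>\<^bsub>sec X U\<^esub> w i) (\<lambda>a v. \<lambda>i\<in>{..<n}. a \<otimes>\<^bsub>sec X U\<^esub> v i)),
       mres = (\<lambda>U V v. \<lambda>i\<in>{..<n}. res X U V (v i)) \<rparr>"

definition direct_sum_sheaf ::
  "('p, 'r, 'm) modsheaf \<Rightarrow> ('p, 'r, 'n) modsheaf \<Rightarrow> ('p, 'r, 'm \<times> 'n) modsheaf" where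
  "direct_sum_sheaf E F =
     \<lparr> msec = (\<lambda>U. mk_module (carrier (msec E U) \<times> carrier (msec F U)) (\<zero>\<^bsub>msec E U\<^esub>, \<zero>\<^bsub>msec F U\<^esub>)
          (\<lambda>(a, b) (c, d). (a \<oplus>\<^bsub>msec E U\<^esub> c, b \<oplus>\<^bsub>msec F U\<^esub> d))
          (\<lambda>r (a, b). (r \<odot>\<^bsub>msec E U\<^esub> a, r \<odot>\<^bsub>msec F U\<^esub> b))),
       mres = (\<lambda>U V (a, b). (mres E U V a, mres F U V b)) \<rparr>"


subsection \<open>Homomorphisms\<close>

text \<open>
  \<open>sheaf_hom X U E F\<close> is the set of homomorphisms from the restriction of \<open>E\<close> to \<open>U\<close> to that of \<open>F\<close>.
  Families of maps are made unique as functions by being undefined off the open subsets of \<open>U\<close> and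
  off the carriers.
\<close>

definition on_opens ::
  "('p, 'r) ringed_space \<Rightarrow> 'p set \<Rightarrow> ('p set \<Rightarrow> 'm \<Rightarrow> 'n) \<Rightarrow> 'p set \<Rightarrow> 'm \<Rightarrow> 'n" where
  "on_opens X U \<phi> = (\<lambda>W. if openin (tps X) W \<and> W \<subseteq> U then \<phi> W else (\<lambda>_. undefined))"

definition linear_maps ::
  "'r ring \<Rightarrow> ('r, 'm) module \<Rightarrow> ('r, 'n) module \<Rightarrow> ('m \<Rightarrow> 'n) set" where
  "linear_maps R M N = {f \<in> carrier M \<rightarrow>\<^sub>E carrier N.
     (\<forall>x\<in>carrier M. \<forall>y\<in>carrier M. f (x \<oplus>\<^bsub>M\<^esub> y) = f x \<oplus>\<^bsub>N\<^esub> f y) \<and>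
     (\<forall>a\<in>carrier R. \<forall>x\<in>carrier M. f (a \<odot>\<^bsub>M\<^esub> x) = a \<odot>\<^bsub>N\<^esub> f x)}"

definition sheaf_hom ::
  "('p, 'r) ringed_space \<Rightarrow> 'p set \<Rightarrow> ('p, 'r, 'm) modsheaf \<Rightarrow> ('p, 'r, 'n) modsheaf
     \<Rightarrow> ('p set \<Rightarrow> 'm \<Rightarrow> 'n) set" where
  "sheaf_hom X U E F = {\<phi>. \<phi> = on_opens X U \<phi> \<and>
     (\<forall>W. openin (tps X) W \<and> W \<subseteq> U \<longrightarrow> \<phi> W \<in> linear_maps (sec X W) (msec E W) (msec F W)) \<and>
     (\<forall>W W'. openin (tps X) W \<and> openin (tps X) W' \<and> W' \<subseteq> W \<and> W \<subseteq> U \<longrightarrow>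
        (\<forall>s\<in>carrier (msec E W). \<phi> W' (mres E W W' s) = mres F W W' (\<phi> W s)))}"

abbreviation homs ::
  "('p, 'r) ringed_space \<Rightarrow> ('p, 'r, 'm) modsheaf \<Rightarrow> ('p, 'r, 'n) modsheaf
     \<Rightarrow> ('p set \<Rightarrow> 'm \<Rightarrow> 'n) set" where
  "homs X \<equiv> sheaf_hom X (topspace (tps X))"

definition isomorphic_on ::
  "('p, 'r) ringed_space \<Rightarrow> 'p set \<Rightarrow> ('p, 'r, 'm) modsheaf \<Rightarrow> ('p, 'r, 'n) modsheaf \<Rightarrow> bool" where
  "isomorphic_on X U E F \<longleftrightarrow> (\<exists>\<phi>\<in>sheaf_hom X U E F.
     \<forall>W. openin (tps X) W \<and> W \<subseteq> U \<longrightarrow> bij_betw (\<phi> W) (carrier (msec E W)) (carrier (msec F W)))"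

abbreviation isomorphic ::
  "('p, 'r) ringed_space \<Rightarrow> ('p, 'r, 'm) modsheaf \<Rightarrow> ('p, 'r, 'n) modsheaf \<Rightarrow> bool" where
  "isomorphic X \<equiv> isomorphic_on X (topspace (tps X))"

text \<open>Surjectivity as a morphism of sheaves, i.e. local surjectivity.\<close>

definition surjective_morphism ::
  "('p, 'r) ringed_space \<Rightarrow> ('p, 'r, 'm) modsheaf \<Rightarrow> ('p, 'r, 'n) modsheaf
     \<Rightarrow> ('p set \<Rightarrow> 'm \<Rightarrow> 'n) \<Rightarrow> bool" where
  "surjective_morphism X E F \<phi> \<longleftrightarrow> \<phi> \<in> homs X E F \<and>
     (\<forall>U. openin (tps X) U \<longrightarrow> (\<forall>t\<in>carrier (msec F U). \<forall>x\<in>U.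
        \<exists>V. openin (tps X) V \<and> x \<in> V \<and> V \<subseteq> U \<and> (\<exists>s\<in>carrier (msec E V). \<phi> V s = mres F U V t)))"

definition pair_morphism ::
  "('p, 'r) ringed_space \<Rightarrow> ('p, 'r, 'm) modsheaf \<Rightarrow> ('p set \<Rightarrow> 'm \<Rightarrow> 'n) \<Rightarrow> ('p set \<Rightarrow> 'm \<Rightarrow> 'q)
     \<Rightarrow> 'p set \<Rightarrow> 'm \<Rightarrow> 'n \<times> 'q" where
  "pair_morphism X E \<phi> \<psi> =
     on_opens X (topspace (tps X)) (\<lambda>U. \<lambda>s\<in>carrier (msec E U). (\<phi> U s, \<psi> U s))"


subsection \<open>Subsheaves\<close>

text \<open>
  A subsheaf of \<open>E\<close> is a family of subsets of the carriers of \<open>E\<close>, empty off the open sets so that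
  equality of subsheaves is equality of functions; \<open>subobj E S\<close> is the sheaf of modules it defines.
\<close>

definition opens_only :: "('p, 'r) ringed_space \<Rightarrow> ('p set \<Rightarrow> 'm set) \<Rightarrow> 'p set \<Rightarrow> 'm set" where
  "opens_only X S = (\<lambda>U. if openin (tps X) U then S U else {})"

definition subobj :: "('p, 'r, 'm) modsheaf \<Rightarrow> ('p set \<Rightarrow> 'm set) \<Rightarrow> ('p, 'r, 'm) modsheaf" where
  "subobj E S = \<lparr> msec = (\<lambda>U. (msec E U)\<lparr>carrier := S U\<rparr>), mres = mres E \<rparr>"

definition subsheaf ::
  "('p, 'r) ringed_space \<Rightarrow> ('p, 'r, 'm) modsheaf \<Rightarrow> ('p set \<Rightarrow> 'm set) \<Rightarrow> bool" where
  "subsheaf X E S \<longleftrightarrow> S = opens_only X S \<and>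
     (\<forall>U. openin (tps X) U \<longrightarrow> submodule (S U) (sec X U) (msec E U)) \<and>
     is_sheaf (tps X) S (mres E)"

definition whole ::
  "('p, 'r) ringed_space \<Rightarrow> ('p, 'r, 'm) modsheaf \<Rightarrow> 'p set \<Rightarrow> 'm set" where
  "whole X E = opens_only X (\<lambda>U. carrier (msec E U))"

definition kernel_sheaf ::
  "('p, 'r) ringed_space \<Rightarrow> ('p, 'r, 'm) modsheaf \<Rightarrow> ('p, 'r, 'n) modsheaf
     \<Rightarrow> ('p set \<Rightarrow> 'm \<Rightarrow> 'n) \<Rightarrow> 'p set \<Rightarrow> 'm set" where
  "kernel_sheaf X E F \<phi> = opens_only X (\<lambda>U. {s \<in> carrier (msec E U). \<phi> U s = \<zero>\<^bsub>msec F U\<^esub>})"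

definition induced ::
  "('p, 'r) ringed_space \<Rightarrow> ('p set \<Rightarrow> 'm set) \<Rightarrow> ('p set \<Rightarrow> 'm \<Rightarrow> 'n) \<Rightarrow> 'p set \<Rightarrow> 'm \<Rightarrow> 'n" where
  "induced X S \<phi> = on_opens X (topspace (tps X)) (\<lambda>U. restrict (\<phi> U) (S U))"


subsection \<open>Vector bundles, coherent and torsion sheaves, supports\<close>

definition vector_bundle :: "('p, 'r) ringed_space \<Rightarrow> nat \<Rightarrow> ('p, 'r, 'm) modsheaf \<Rightarrow> bool" where
  "vector_bundle X \<rho> E \<longleftrightarrow> sheaf_of_modules X E \<and>
     (\<forall>x\<in>topspace (tps X). \<exists>U. openin (tps X) U \<and> x \<in> U \<and> isomorphic_on X U (free_sheaf X \<rho>) E)"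

definition lincomb ::
  "('p, 'r, 'm) modsheaf \<Rightarrow> 'p set \<Rightarrow> nat \<Rightarrow> (nat \<Rightarrow> 'm) \<Rightarrow> 'p set \<Rightarrow> (nat \<Rightarrow> 'r) \<Rightarrow> 'm" where
  "lincomb F U n s W a = finsum (msec F W) (\<lambda>i. a i \<odot>\<^bsub>msec F W\<^esub> mres F U W (s i)) {..<n}"

definition finite_type_on ::
  "('p, 'r) ringed_space \<Rightarrow> 'p set \<Rightarrow> ('p, 'r, 'm) modsheaf \<Rightarrow> bool" where
  "finite_type_on X U F \<longleftrightarrow> (\<forall>x\<in>U. \<exists>V n s. openin (tps X) V \<and> x \<in> V \<and> V \<subseteq> U \<and>
     s \<in> {..<n} \<rightarrow> carrier (msec F V) \<and>
     (\<forall>W. openin (tps X) W \<and> W \<subseteq> V \<longrightarrow> (\<forall>t\<in>carrier (msec F W). \<forall>y\<in>W.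
        \<exists>W'. openin (tps X) W' \<and> y \<in> W' \<and> W' \<subseteq> W \<and>
          (\<exists>a\<in>{..<n} \<rightarrow> carrier (sec X W'). mres F W W' t = lincomb F V n s W' a))))"

text \<open>
  Coherence for ringed spaces: finite type, and over every open set all relation sheaves of finitely
  many sections are of finite type.
\<close>

definition coherent :: "('p, 'r) ringed_space \<Rightarrow> ('p, 'r, 'm) modsheaf \<Rightarrow> bool" where
  "coherent X F \<longleftrightarrow> sheaf_of_modules X F \<and> finite_type_on X (topspace (tps X)) F \<and>
     (\<forall>U n s. openin (tps X) U \<and> s \<in> {..<n} \<rightarrow> carrier (msec F U) \<longrightarrow>
        finite_type_on X U (subobj (free_sheaf X n)
          (\<lambda>W. {a \<in> {..<n} \<rightarrow>\<^sub>E carrier (sec X W). lincomb F U n s W a = \<zero>\<^bsub>msec F W\<^esub>})))"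

definition sheaf_support :: "('p, 'r) ringed_space \<Rightarrow> ('p, 'r, 'm) modsheaf \<Rightarrow> 'p set" where
  "sheaf_support X F = {x \<in> topspace (tps X). \<exists>U s. openin (tps X) U \<and> x \<in> U \<and> s \<in> carrier (msec F U) \<and>
     mgerm X F x U s \<noteq> mgerm X F x U \<zero>\<^bsub>msec F U\<^esub>}"

definition nonzero_sheaf :: "('p, 'r) ringed_space \<Rightarrow> ('p, 'r, 'm) modsheaf \<Rightarrow> bool" where
  "nonzero_sheaf X F \<longleftrightarrow> (\<exists>U. openin (tps X) U \<and> carrier (msec F U) \<noteq> {\<zero>\<^bsub>msec F U\<^esub>})"

text \<open>On an integral scheme: all stalks are torsion modules over the local domains.\<close>

definition torsion_sheaf :: "('p, 'r) ringed_space \<Rightarrow> ('p, 'r, 'm) modsheaf \<Rightarrow> bool" where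
  "torsion_sheaf X F \<longleftrightarrow>
     (\<forall>U x s. openin (tps X) U \<and> x \<in> U \<and> s \<in> carrier (msec F U) \<longrightarrow>
        (\<exists>V a. openin (tps X) V \<and> x \<in> V \<and> V \<subseteq> U \<and> a \<in> carrier (sec X V) \<and>
           germ X x V a \<noteq> \<zero>\<^bsub>stalk X x\<^esub> \<and>
           mgerm X F x V (a \<odot>\<^bsub>msec F V\<^esub> mres F U V s) = mgerm X F x V \<zero>\<^bsub>msec F V\<^esub>))"


section \<open>Tensor products, exterior powers, duals and determinants\<close>

definition free_module :: "'r ring \<Rightarrow> 'i set \<Rightarrow> ('r, 'i \<Rightarrow> 'r) module" where
  "free_module R I = mk_module
     {f. (\<forall>i. f i \<in> carrier R) \<and> finite {i. f i \<noteq> \<zero>\<^bsub>R\<^esub>} \<and> (\<forall>i. i \<notin> I \<longrightarrow> f i = \<zero>\<^bsub>R\<^esub>)}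
     (\<lambda>i. \<zero>\<^bsub>R\<^esub>) (\<lambda>f g i. f i \<oplus>\<^bsub>R\<^esub> g i) (\<lambda>a f i. a \<otimes>\<^bsub>R\<^esub> f i)"

definition basis_vector :: "'r ring \<Rightarrow> 'i \<Rightarrow> 'i \<Rightarrow> 'r" where
  "basis_vector R i = (\<lambda>j. if j = i then \<one>\<^bsub>R\<^esub> else \<zero>\<^bsub>R\<^esub>)"

text \<open>The map of free modules induced by a map \<open>\<sigma>\<close> of rings and a map \<open>g\<close> of bases.\<close>

definition free_map ::
  "'r ring \<Rightarrow> 'r ring \<Rightarrow> ('r \<Rightarrow> 'r) \<Rightarrow> ('i \<Rightarrow> 'i) \<Rightarrow> ('i \<Rightarrow> 'r) \<Rightarrow> 'i \<Rightarrow> 'r" where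
  "free_map R R' \<sigma> g f = (\<lambda>j. finsum R' (\<lambda>i. \<sigma> (f i)) {i. f i \<noteq> \<zero>\<^bsub>R\<^esub> \<and> g i = j})"

definition span_module :: "'r ring \<Rightarrow> ('r, 'm) module \<Rightarrow> 'm set \<Rightarrow> 'm set" where
  "span_module R M S = \<Inter>{N. submodule N R M \<and> S \<subseteq> N}"

definition quotient_module :: "('r, 'm) module \<Rightarrow> 'm set \<Rightarrow> ('r, 'm set) module" where
  "quotient_module M N = mk_module (A_RCOSETS M N) N (set_add M)
     (\<lambda>a A. \<Union>x\<in>A. a_r_coset M N (a \<odot>\<^bsub>M\<^esub> x))"

definition ext_relations :: "'r ring \<Rightarrow> nat \<Rightarrow> ('r, 'm) module \<Rightarrow> ((nat \<Rightarrow> 'm) \<Rightarrow> 'r) set" where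
  "ext_relations R n M =
     (let S = {..<n} \<rightarrow>\<^sub>E carrier M; P = free_module R S; e = basis_vector R in
      {e (v(i := x \<oplus>\<^bsub>M\<^esub> y)) \<ominus>\<^bsub>P\<^esub> (e (v(i := x)) \<oplus>\<^bsub>P\<^esub> e (v(i := y))) | v i x y.
         v \<in> S \<and> i < n \<and> x \<in> carrier M \<and> y \<in> carrier M} \<union>
      {e (v(i := a \<odot>\<^bsub>M\<^esub> x)) \<ominus>\<^bsub>P\<^esub> (a \<odot>\<^bsub>P\<^esub> e (v(i := x))) | v i a x.
         v \<in> S \<and> i < n \<and> a \<in> carrier R \<and> x \<in> carrier M} \<union>
      {e v | v. v \<in> S \<and> (\<exists>i<n. \<exists>j<n. i \<noteq> j \<and> v i = v j)})"

definition ext_submodule :: "'r ring \<Rightarrow> nat \<Rightarrow> ('r, 'm) module \<Rightarrow> ((nat \<Rightarrow> 'm) \<Rightarrow> 'r) set" where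
  "ext_submodule R n M =
     span_module R (free_module R ({..<n} \<rightarrow>\<^sub>E carrier M)) (ext_relations R n M)"

definition ext_power_module ::
  "'r ring \<Rightarrow> nat \<Rightarrow> ('r, 'm) module \<Rightarrow> ('r, ((nat \<Rightarrow> 'm) \<Rightarrow> 'r) set) module" where
  "ext_power_module R n M =
     quotient_module (free_module R ({..<n} \<rightarrow>\<^sub>E carrier M)) (ext_submodule R n M)"

definition tensor_relations ::
  "'r ring \<Rightarrow> ('r, 'm) module \<Rightarrow> ('r, 'n) module \<Rightarrow> ('m \<times> 'n \<Rightarrow> 'r) set" where
  "tensor_relations R M N =
     (let P = free_module R (carrier M \<times> carrier N); e = basis_vector R in
      {e (x \<oplus>\<^bsub>M\<^esub> x', y) \<ominus>\<^bsub>P\<^esub> (e (x, y) \<oplus>\<^bsub>P\<^esub> e (x', y)) | x x' y.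
         x \<in> carrier M \<and> x' \<in> carrier M \<and> y \<in> carrier N} \<union>
      {e (x, y \<oplus>\<^bsub>N\<^esub> y') \<ominus>\<^bsub>P\<^esub> (e (x, y) \<oplus>\<^bsub>P\<^esub> e (x, y')) | x y y'.
         x \<in> carrier M \<and> y \<in> carrier N \<and> y' \<in> carrier N} \<union>
      {e (a \<odot>\<^bsub>M\<^esub> x, y) \<ominus>\<^bsub>P\<^esub> (a \<odot>\<^bsub>P\<^esub> e (x, y)) | a x y.
         a \<in> carrier R \<and> x \<in> carrier M \<and> y \<in> carrier N} \<union>
      {e (x, a \<odot>\<^bsub>N\<^esub> y) \<ominus>\<^bsub>P\<^esub> (a \<odot>\<^bsub>P\<^esub> e (x, y)) | a x y.
         a \<in> carrier R \<and> x \<in> carrier M \<and> y \<in> carrier N})"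

definition tensor_submodule ::
  "'r ring \<Rightarrow> ('r, 'm) module \<Rightarrow> ('r, 'n) module \<Rightarrow> ('m \<times> 'n \<Rightarrow> 'r) set" where
  "tensor_submodule R M N =
     span_module R (free_module R (carrier M \<times> carrier N)) (tensor_relations R M N)"

definition tensor_module ::
  "'r ring \<Rightarrow> ('r, 'm) module \<Rightarrow> ('r, 'n) module \<Rightarrow> ('r, ('m \<times> 'n \<Rightarrow> 'r) set) module" where
  "tensor_module R M N =
     quotient_module (free_module R (carrier M \<times> carrier N)) (tensor_submodule R M N)"

definition sheafify ::
  "('p, 'r) ringed_space \<Rightarrow> ('p, 'r, 'm) modsheaf \<Rightarrow> ('p, 'r, 'p \<Rightarrow> ('p set \<times> 'm) set) modsheaf" where
  "sheafify X P =
     \<lparr> msec = (\<lambda>U. mk_module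
         {s \<in> extensional U. \<forall>x\<in>U. \<exists>V t. openin (tps X) V \<and> x \<in> V \<and> V \<subseteq> U \<and>
            t \<in> carrier (msec P V) \<and> (\<forall>y\<in>V. s y = mgerm X P y V t)}
         (\<lambda>x\<in>U. mgerm X P x U \<zero>\<^bsub>msec P U\<^esub>)
         (\<lambda>s t. \<lambda>x\<in>U. \<Union>(V, a)\<in>s x. \<Union>(W, b)\<in>t x.
            mgerm X P x (V \<inter> W) (mres P V (V \<inter> W) a \<oplus>\<^bsub>msec P (V \<inter> W)\<^esub> mres P W (V \<inter> W) b))
         (\<lambda>c s. \<lambda>x\<in>U. \<Union>(V, a)\<in>s x.
            mgerm X P x (U \<inter> V) (res X U (U \<inter> V) c \<odot>\<^bsub>msec P (U \<inter> V)\<^esub> mres P V (U \<inter> V) a))),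
       mres = (\<lambda>U V s. restrict s V) \<rparr>"

definition ext_power_sheaf ::
  "('p, 'r) ringed_space \<Rightarrow> nat \<Rightarrow> ('p, 'r, 'm) modsheaf
     \<Rightarrow> ('p, 'r, 'p \<Rightarrow> ('p set \<times> ((nat \<Rightarrow> 'm) \<Rightarrow> 'r) set) set) modsheaf" where
  "ext_power_sheaf X n E = sheafify X
     \<lparr> msec = (\<lambda>U. ext_power_module (sec X U) n (msec E U)),
       mres = (\<lambda>U V A. \<Union>f\<in>A.
          a_r_coset (free_module (sec X V) ({..<n} \<rightarrow>\<^sub>E carrier (msec E V)))
            (ext_submodule (sec X V) n (msec E V))
            (free_map (sec X U) (sec X V) (res X U V) (\<lambda>v. \<lambda>i\<in>{..<n}. mres E U V (v i)) f)) \<rparr>"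

definition tensor_sheaf ::
  "('p, 'r) ringed_space \<Rightarrow> ('p, 'r, 'm) modsheaf \<Rightarrow> ('p, 'r, 'n) modsheaf
     \<Rightarrow> ('p, 'r, 'p \<Rightarrow> ('p set \<times> ('m \<times> 'n \<Rightarrow> 'r) set) set) modsheaf" where
  "tensor_sheaf X E F = sheafify X
     \<lparr> msec = (\<lambda>U. tensor_module (sec X U) (msec E U) (msec F U)),
       mres = (\<lambda>U V A. \<Union>f\<in>A.
          a_r_coset (free_module (sec X V) (carrier (msec E V) \<times> carrier (msec F V)))
            (tensor_submodule (sec X V) (msec E V) (msec F V))
            (free_map (sec X U) (sec X V) (res X U V) (\<lambda>(x, y). (mres E U V x, mres F U V y)) f)) \<rparr>"

definition hom_sheaf ::
  "('p, 'r) ringed_space \<Rightarrow> ('p, 'r, 'm) modsheaf \<Rightarrow> ('p, 'r, 'n) modsheaf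
     \<Rightarrow> ('p, 'r, 'p set \<Rightarrow> 'm \<Rightarrow> 'n) modsheaf" where
  "hom_sheaf X E F =
     \<lparr> msec = (\<lambda>U. mk_module (sheaf_hom X U E F)
         (on_opens X U (\<lambda>W. \<lambda>s\<in>carrier (msec E W). \<zero>\<^bsub>msec F W\<^esub>))
         (\<lambda>\<phi> \<psi>. on_opens X U (\<lambda>W. \<lambda>s\<in>carrier (msec E W). \<phi> W s \<oplus>\<^bsub>msec F W\<^esub> \<psi> W s))
         (\<lambda>a \<phi>. on_opens X U (\<lambda>W. \<lambda>s\<in>carrier (msec E W). res X U W a \<odot>\<^bsub>msec F W\<^esub> \<phi> W s))),
       mres = (\<lambda>U V \<phi>. on_opens X V \<phi>) \<rparr>"

definition dual_sheaf ::
  "('p, 'r) ringed_space \<Rightarrow> ('p, 'r, 'm) modsheaf \<Rightarrow> ('p, 'r, 'p set \<Rightarrow> 'm \<Rightarrow> 'r) modsheaf" where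
  "dual_sheaf X E = hom_sheaf X E (structure_module X)"

definition det_sheaf where
  "det_sheaf X \<rho> E = dual_sheaf X (dual_sheaf X (ext_power_sheaf X \<rho> E))"


section \<open>Effective Cartier divisors\<close>

text \<open>
  A divisor is represented by its ideal sheaf \<open>D = \<O>\<^sub>X(-D)\<close>, a subsheaf of the structure sheaf;
  it is effective Cartier when this ideal sheaf is invertible.  The line bundle \<open>\<O>\<^sub>X(D)\<close> is the
  dual of the ideal sheaf.
\<close>

type_synonym ('p, 'r) divisor = "'p set \<Rightarrow> 'r set"

definition effective_cartier :: "('p, 'r) ringed_space \<Rightarrow> ('p, 'r) divisor \<Rightarrow> bool" where
  "effective_cartier X D \<longleftrightarrow>
     subsheaf X (structure_module X) D \<and> vector_bundle X 1 (subobj (structure_module X) D)"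

definition divisor_nonzero :: "('p, 'r) ringed_space \<Rightarrow> ('p, 'r) divisor \<Rightarrow> bool" where
  "divisor_nonzero X D \<longleftrightarrow> D \<noteq> whole X (structure_module X)"

text \<open>The points where the stalk of the ideal sheaf is not the whole local ring.\<close>

definition divisor_support :: "('p, 'r) ringed_space \<Rightarrow> ('p, 'r) divisor \<Rightarrow> 'p set" where
  "divisor_support X D =
     {x \<in> topspace (tps X). \<forall>U. openin (tps X) U \<and> x \<in> U \<longrightarrow> \<one>\<^bsub>sec X U\<^esub> \<notin> D U}"

definition divisor_bundle where
  "divisor_bundle X D = dual_sheaf X (subobj (structure_module X) D)"


section \<open>Hierarchical filtrations\<close>

text \<open>
  Filtrations are indexed in descending order, \<open>E = V 0 \<supseteq> V 1 \<supseteq> \<dots> \<supseteq> V h\<close>; values of \<open>V\<close> beyond \<open>h\<close>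
  and of \<open>D\<close> beyond \<open>h - 1\<close> are irrelevant.
\<close>

definition hierarchical_filtration where
  "hierarchical_filtration X \<rho> E \<Lambda> h V D \<longleftrightarrow>
     V 0 = whole X E \<and>
     (\<forall>k\<le>h. subsheaf X E (V k) \<and> vector_bundle X \<rho> (subobj E (V k))) \<and>
     (\<forall>k<h. (\<forall>U. V (Suc k) U \<subseteq> V k U) \<and>
        effective_cartier X (D k) \<and> divisor_nonzero X (D k) \<and>
        isomorphic X (det_sheaf X \<rho> (subobj E (V k)))
          (tensor_sheaf X (det_sheaf X \<rho> (subobj E (V (Suc k)))) (divisor_bundle X (D k)))) \<and>
     isomorphic X (det_sheaf X \<rho> (subobj E (V h))) \<Lambda>"

text \<open>The supremum of the empty set is \<open>-\<infinity>\<close> in \<^typ>\<open>ereal\<close>.\<close>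

definition hierarchical_depth where
  "hierarchical_depth X \<rho> E \<Lambda> =
     Sup {ereal (real h) | h. \<exists>V D. hierarchical_filtration X \<rho> E \<Lambda> h V D}"

definition attains_depth where
  "attains_depth X \<rho> E \<Lambda> h V D \<longleftrightarrow>
     hierarchical_filtration X \<rho> E \<Lambda> h V D \<and> ereal (real h) = hierarchical_depth X \<rho> E \<Lambda>"

text \<open>
  A sequence of elementary transforms: \<open>V\<^sub>k\<close> = \<open>stage k\<close>, \<open>D\<^sub>k\<close> = \<open>dvr k\<close>, \<open>Q\<^sub>k\<close> = \<open>quo k\<close> and
  \<open>\<phi>\<^sub>k\<close> = \<open>emap k\<close>.
\<close>

record ('p, 'r, 'm, 'q) transforms =
  stage :: "nat \<Rightarrow> 'p set \<Rightarrow> 'm set"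
  dvr :: "nat \<Rightarrow> ('p, 'r) divisor"
  quo :: "nat \<Rightarrow> ('p, 'r, 'q) modsheaf"
  emap :: "nat \<Rightarrow> 'p set \<Rightarrow> 'm \<Rightarrow> 'q"

abbreviation bundle_at ::
  "('p, 'r, 'm) modsheaf \<Rightarrow> ('p, 'r, 'm, 'q) transforms \<Rightarrow> nat \<Rightarrow> ('p, 'r, 'm) modsheaf" where
  "bundle_at E F k \<equiv> subobj E (stage F k)"

definition transform_filtration ::
  "('p, 'r) ringed_space \<Rightarrow> nat \<Rightarrow> ('p, 'r, 'm) modsheaf \<Rightarrow> nat \<Rightarrow> ('p, 'r, 'm, 'q) transforms \<Rightarrow> bool"
  where
  "transform_filtration X \<rho> E h F \<longleftrightarrow>
     hierarchical_filtration X \<rho> E (det_sheaf X \<rho> (bundle_at E F h)) h (stage F) (dvr F) \<and>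
     (\<forall>k<h. coherent X (quo F k) \<and> torsion_sheaf X (quo F k) \<and> nonzero_sheaf X (quo F k) \<and>
        sheaf_support X (quo F k) \<subseteq> divisor_support X (dvr F k) \<and>
        surjective_morphism X (bundle_at E F k) (quo F k) (emap F k) \<and>
        stage F (Suc k) = kernel_sheaf X (bundle_at E F k) (quo F k) (emap F k))"

text \<open>
  One interchange of the adjacent transforms \<open>k\<close> and \<open>k + 1\<close>.  With \<open>\<phi>\<close> = \<open>emap F k\<close> and \<open>\<psi>\<close> the two
  surjections on \<open>V\<^sub>k\<close>, the old sequence takes \<open>ker \<phi>\<close> and then the kernel of the map induced by \<open>\<psi>\<close>
  on it; the new one takes \<open>ker \<psi>\<close> and then the kernel of the map induced by \<open>\<phi>\<close> on it.
\<close>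

definition interchange ::
  "('p, 'r) ringed_space \<Rightarrow> nat \<Rightarrow> ('p, 'r, 'm) modsheaf \<Rightarrow> nat
     \<Rightarrow> ('p, 'r) divisor set \<Rightarrow> ('p, 'r) divisor set
     \<Rightarrow> ('p, 'r, 'm, 'q) transforms \<Rightarrow> ('p, 'r, 'm, 'q) transforms \<Rightarrow> bool" where
  "interchange X \<rho> E h \<A> \<B> F G \<longleftrightarrow>
     transform_filtration X \<rho> E h F \<and> transform_filtration X \<rho> E h G \<and>
     (\<exists>k \<psi>. Suc k < h \<and>
        (dvr F k \<in> \<A> \<and> dvr F (Suc k) \<in> \<B> \<or> dvr F k \<in> \<B> \<and> dvr F (Suc k) \<in> \<A>) \<and>
        surjective_morphism X (bundle_at E F k) (quo F (Suc k)) \<psi> \<and>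
        emap F (Suc k) = induced X (stage F (Suc k)) \<psi> \<and>
        (let K = kernel_sheaf X (bundle_at E F k) (quo F (Suc k)) \<psi> in
         G = \<lparr> stage = (stage F)(Suc k := K),
               dvr = (dvr F)(k := dvr F (Suc k), Suc k := dvr F k),
               quo = (quo F)(k := quo F (Suc k), Suc k := quo F k),
               emap = (emap F)(k := \<psi>, Suc k := induced X K (emap F k)) \<rparr>))"

end

theory Submission
  imports Defs
begin

text \<open>
  Let \<open>V\<^sub>0 \<supseteq> V\<^sub>1 \<supseteq> V\<^sub>2\<close> be two consecutive elementary transforms with quotients \<open>Q\<^sub>1\<close>, \<open>Q\<^sub>2\<close> along
  divisors \<open>D\<^sub>1\<close>, \<open>D\<^sub>2\<close> with disjoint supports, and let \<open>U\<^sub>1\<close>, \<open>U\<^sub>2\<close> be the complements of the two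
  supports; they form an open cover.  Over \<open>U\<^sub>1\<close> the sheaf \<open>Q\<^sub>1\<close> vanishes, so \<open>V\<^sub>1 = V\<^sub>0\<close>, and over
  \<open>U\<^sub>2\<close> likewise \<open>V\<^sub>2 = V\<^sub>1\<close>.  The surjection \<open>V\<^sub>1 \<rightarrow> Q\<^sub>2\<close> is therefore defined on \<open>V\<^sub>0\<close> over \<open>U\<^sub>1\<close>, and
  together with zero over \<open>U\<^sub>2\<close> it glues to a surjection \<open>\<psi>\<close> from \<open>V\<^sub>0\<close> to \<open>Q\<^sub>2\<close>.  Its kernel \<open>K\<close> is
  \<open>V\<^sub>2\<close> over \<open>U\<^sub>1\<close> and \<open>V\<^sub>0\<close> over \<open>U\<^sub>2\<close>, hence locally free, and \<open>V\<^sub>0 \<supseteq> K \<supseteq> V\<^sub>2\<close> are the same two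
  transforms in the other order (\<open>elementary_transforms_commute\<close>).

  A hierarchical filtration also prescribes determinants.  From
  \<open>det V\<^sub>1 = det V\<^sub>2 \<otimes> \<O>(D\<^sub>2)\<close> one has to deduce \<open>det V\<^sub>0 = det K \<otimes> \<O>(D\<^sub>2)\<close>, and similarly for \<open>D\<^sub>1\<close>.
  Over \<open>U\<^sub>1\<close> the two statements are literally the same, since \<open>V\<^sub>0 = V\<^sub>1\<close> and \<open>K = V\<^sub>2\<close> there.  Over \<open>U\<^sub>2\<close>
  both \<open>det V\<^sub>1 = det V\<^sub>2\<close> and \<open>det V\<^sub>0 = det K\<close>, so that the given isomorphism amounts to a
  trivialization of \<open>\<O>(D\<^sub>2)\<close>, which serves for the second pair as well as for the first.  The two
  local isomorphisms agree on the overlap and glue (\<open>det_twist_exchange\<close>).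

  Two devices keep this gluing elementary.  An isomorphism \<open>A = B \<otimes> L\<close> of invertible sheaves is
  recorded as a bilinear pairing of \<open>B\<close> and \<open>L\<close> into \<open>A\<close> that takes local generators to a local
  generator, so that tensor products have to be sheafified only at the two ends of the argument.
  The determinant, a double dual of a sheafified exterior power, is replaced by the double dual of
  the exterior power presheaf: dualizing does not see the sheafification, and now bundles with the
  same sections over the open subsets of \<open>U\<close> have equal, and not only isomorphic, determinants over
  \<open>U\<close> (\<open>det_model\<close>).  Determinants of vector bundles are invertible because an alternating form on a
  free module of rank \<open>n\<close> is its value on the basis times the determinant.

  With the interchange of neighbours available, the filtration is sorted like a list.  Moving the
  divisors of one collection to the front lowers the sum of their positions at every interchange,
  and a permutation is reached by removing one descent at a time, which interchanges only pairs that
  the permutation inverts.  Interchanges never touch the last stage, so that the normalization and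
  the length of the filtration, and with them the attained depth, are preserved.
\<close>

section \<open>Presheaves and gluing\<close>

lemma presheaf_res_closed:
  assumes "is_presheaf T C r" "openin T U" "openin T V" "V \<subseteq> U" "s \<in> C U"
  shows "r U V s \<in> C V"
  using assms unfolding is_presheaf_def Pi_iff by simp

lemma presheaf_res_id:
  assumes "is_presheaf T C r" "openin T U" "s \<in> C U"
  shows "r U U s = s"
  using assms unfolding is_presheaf_def Pi_iff by simp

lemma presheaf_res_res:
  assumes "is_presheaf T C r" "openin T U" "openin T V" "openin T W" "W \<subseteq> V" "V \<subseteq> U" "s \<in> C U"
  shows "r V W (r U V s) = r U W s"
  using assms unfolding is_presheaf_def Pi_iff by simp

lemma sheaf_presheaf: "is_sheaf T C r ==> is_presheaf T C r"
  unfolding is_sheaf_def by simp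

lemma sheaf_eqI:
  assumes sh: "is_sheaf T C r" and U: "openin T U" and s: "s \<in> C U" and t: "t \<in> C U"
    and loc: "\<And>x. x \<in> U ==> \<exists>V. openin T V \<and> x \<in> V \<and> V \<subseteq> U \<and> r U V s = r U V t"
  shows "s = t"
proof -
  let ?C = "{V. openin T V \<and> V \<subseteq> U \<and> r U V s = r U V t}"
  have un: "\<Union>?C = U" using loc by blast
  have op: "\<forall>V\<in>?C. openin T V" by blast
  note g = sh[unfolded is_sheaf_def, THEN conjunct2, THEN spec[of _ ?C], THEN mp, OF op,
      THEN conjunct1, unfolded un, THEN bspec, OF s, THEN bspec, OF t, THEN mp]
  show ?thesis by (rule g) simp
qed

text \<open>Sections are often described locally by a predicate \<open>Q\<close>; this turns such a description
  into a section, without choosing a cover.\<close>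

lemma sheaf_glue_described:
  assumes sh: "is_sheaf T C r" and U: "openin T U"
    and ex: "\<And>x. x \<in> U ==> \<exists>V c. openin T V \<and> x \<in> V \<and> V \<subseteq> U \<and> c \<in> C V \<and> Q V c"
    and uniq: "\<And>V W c d. openin T V ==> openin T W ==> V \<subseteq> U ==> W \<subseteq> U ==> c \<in> C V ==> d \<in> C W
      ==> Q V c ==> Q W d ==> r V (V \<inter> W) c = r W (V \<inter> W) d"
  shows "\<exists>!s. s \<in> C U \<and> (\<forall>V c. openin T V \<and> V \<subseteq> U \<and> c \<in> C V \<and> Q V c --> r U V s = c)"
proof -
  note pre = sheaf_presheaf[OF sh]
  let ?C = "{V. openin T V \<and> V \<subseteq> U \<and> (\<exists>c\<in>C V. Q V c)}"
  define f where "f V = (SOME c. c \<in> C V \<and> Q V c)" for V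
  have f: "f V \<in> C V \<and> Q V (f V)" if "V \<in> ?C" for V
    unfolding f_def by (rule someI_ex) (use that in blast)
  have un: "\<Union>?C = U" using ex by blast
  have op: "\<forall>V\<in>?C. openin T V" by blast
  have "\<exists>s\<in>C (\<Union>?C). \<forall>V\<in>?C. r (\<Union>?C) V s = f V"
  proof -
    have "\<forall>V\<in>?C. f V \<in> C V" using f by blast
    moreover have "\<forall>V\<in>?C. \<forall>W\<in>?C. r V (V \<inter> W) (f V) = r W (V \<inter> W) (f W)"
    proof (intro ballI)
      fix V W assume V: "V \<in> ?C" and W: "W \<in> ?C"
      show "r V (V \<inter> W) (f V) = r W (V \<inter> W) (f W)"
        using uniq[of V W "f V" "f W"] V W f[OF V] f[OF W] by blast
    qed
    ultimately show ?thesis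
      by (intro sh[unfolded is_sheaf_def, THEN conjunct2, THEN spec[of _ ?C], THEN mp, OF op,
            THEN conjunct2, THEN spec, THEN mp]) (rule conjI)
  qed
  then obtain s where s: "s \<in> C U" "\<And>V. V \<in> ?C ==> r U V s = f V" unfolding un by blast
  have same: "c = f V" if "openin T V" "V \<subseteq> U" "c \<in> C V" "Q V c" for V c
  proof -
    have "V \<in> ?C" using that by blast
    with f have "r V (V \<inter> V) c = r V (V \<inter> V) (f V)" using uniq[of V V c "f V"] that by blast
    then show ?thesis
      using presheaf_res_id[OF pre that(1)] that(3) f[OF \<open>V \<in> ?C\<close>] by simp
  qed
  show ?thesis
  proof (intro ex1I[of _ s] conjI allI impI)
    show "s \<in> C U" by (rule s)
    show "r U V s = c" if "openin T V \<and> V \<subseteq> U \<and> c \<in> C V \<and> Q V c" for V c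
      using s(2)[of V] same[of V c] that by blast
    show "s' = s" if s': "s' \<in> C U \<and> (\<forall>V c. openin T V \<and> V \<subseteq> U \<and> c \<in> C V \<and> Q V c --> r U V s' = c)" for s'
    proof (rule sheaf_eqI[OF sh U])
      show "s' \<in> C U" "s \<in> C U" using s' s by auto
      fix x assume "x \<in> U"
      then obtain V c where V: "openin T V" "x \<in> V" "V \<subseteq> U" "c \<in> C V" "Q V c" using ex by blast
      then have VC: "V \<in> ?C" by blast
      have "r U V s' = c" using s' V by blast
      also have "c = r U V s" using s(2)[OF VC] same[OF V(1,3,4,5)] by simp
      finally show "\<exists>V. openin T V \<and> x \<in> V \<and> V \<subseteq> U \<and> r U V s' = r U V s"
        using V by blast
    qed
  qed
qed

section \<open>Presheaves of modules\<close>

abbreviation secs :: "('p, 'r, 'm) modsheaf \<Rightarrow> 'p set \<Rightarrow> 'm set" where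
  "secs E U \<equiv> carrier (msec E U)"

text \<open>The operations of a presheaf of modules, without the module axioms: this is all that
  sheafification and homomorphisms into a sheaf of modules need of their source.\<close>

definition linear_presheaf :: "('p, 'r) ringed_space \<Rightarrow> ('p, 'r, 'm) modsheaf \<Rightarrow> bool" where
  "linear_presheaf X P \<longleftrightarrow>
     is_presheaf (tps X) (\<lambda>U. secs P U) (mres P) \<and>
     (\<forall>U. openin (tps X) U --> (\<forall>s\<in>secs P U. \<forall>t\<in>secs P U.
        s \<oplus>\<^bsub>msec P U\<^esub> t \<in> secs P U)) \<and>
     (\<forall>U. openin (tps X) U --> (\<forall>a\<in>carrier (sec X U). \<forall>s\<in>secs P U.
        a \<odot>\<^bsub>msec P U\<^esub> s \<in> secs P U)) \<and>
     (\<forall>U V. openin (tps X) U \<and> openin (tps X) V \<and> V \<subseteq> U -->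
        (\<forall>s\<in>secs P U. \<forall>t\<in>secs P U.
           mres P U V (s \<oplus>\<^bsub>msec P U\<^esub> t) = mres P U V s \<oplus>\<^bsub>msec P V\<^esub> mres P U V t)) \<and>
     (\<forall>U V. openin (tps X) U \<and> openin (tps X) V \<and> V \<subseteq> U -->
        (\<forall>a\<in>carrier (sec X U). \<forall>s\<in>secs P U.
           mres P U V (a \<odot>\<^bsub>msec P U\<^esub> s) = res X U V a \<odot>\<^bsub>msec P V\<^esub> mres P U V s))"

locale sheaf_ringed_space =
  fixes X :: "('p, 'r) ringed_space"
  assumes sheaf_of_rings: "sheaf_of_rings X"
begin

abbreviation opn :: "'p set \<Rightarrow> bool" where "opn \<equiv> openin (tps X)"

abbreviation unit_module :: "('p, 'r, 'r) modsheaf" where "unit_module \<equiv> structure_module X"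

abbreviation funs :: "'p set \<Rightarrow> 'r set" where "funs U \<equiv> carrier (sec X U)"

lemma opn_Int: "opn U ==> opn V ==> opn (U \<inter> V)"
  by (rule openin_Int)

lemma opn_topspace: "opn U ==> U \<subseteq> topspace (tps X)"
  by (rule openin_subset)

lemma ring_sheaf: "is_sheaf (tps X) (\<lambda>U. funs U) (res X)"
  using sheaf_of_rings unfolding sheaf_of_rings_def by simp

lemmas ring_presheaf = sheaf_presheaf[OF ring_sheaf]
lemmas res_closed = presheaf_res_closed[OF ring_presheaf]
lemmas res_id = presheaf_res_id[OF ring_presheaf]
lemmas res_res = presheaf_res_res[OF ring_presheaf]

lemma sec_cring: "opn U ==> cring (sec X U)"
  using sheaf_of_rings unfolding sheaf_of_rings_def by simp

lemma res_hom: "opn U ==> opn V ==> V \<subseteq> U ==> res X U V \<in> ring_hom (sec X U) (sec X V)"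
  using sheaf_of_rings unfolding sheaf_of_rings_def by simp

lemma res_add: "opn U ==> opn V ==> V \<subseteq> U ==> a \<in> funs U ==> b \<in> funs U ==>
    res X U V (a \<oplus>\<^bsub>sec X U\<^esub> b) = res X U V a \<oplus>\<^bsub>sec X V\<^esub> res X U V b"
  by (rule ring_hom_add[OF res_hom])

lemma res_mult: "opn U ==> opn V ==> V \<subseteq> U ==> a \<in> funs U ==> b \<in> funs U ==>
    res X U V (a \<otimes>\<^bsub>sec X U\<^esub> b) = res X U V a \<otimes>\<^bsub>sec X V\<^esub> res X U V b"
  by (rule ring_hom_mult[OF res_hom])

lemma res_one: "opn U ==> opn V ==> V \<subseteq> U ==> res X U V \<one>\<^bsub>sec X U\<^esub> = \<one>\<^bsub>sec X V\<^esub>"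
  by (rule ring_hom_one[OF res_hom])

lemma res_zero: "opn U ==> opn V ==> V \<subseteq> U ==> res X U V \<zero>\<^bsub>sec X U\<^esub> = \<zero>\<^bsub>sec X V\<^esub>"
  by (rule ring_hom_zero[OF res_hom]) (auto intro: sec_cring cring.axioms(1))

lemma res_minus: "opn U ==> opn V ==> V \<subseteq> U ==> a \<in> funs U ==>
    res X U V (\<ominus>\<^bsub>sec X U\<^esub> a) = \<ominus>\<^bsub>sec X V\<^esub> res X U V a"
proof -
  assume *: "opn U" "opn V" "V \<subseteq> U" "a \<in> funs U"
  interpret ring_hom_ring "sec X U" "sec X V" "res X U V"
    by (intro ring_hom_ringI2 cring.axioms(1) sec_cring res_hom *)
  show ?thesis using * by simp
qed

lemma linear_presheafD:
  assumes "linear_presheaf X P"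
  shows linear_presheaf_presheaf: "is_presheaf (tps X) (\<lambda>U. secs P U) (mres P)"
    and linear_presheaf_add_closed: "\<And>U s t. opn U ==> s \<in> secs P U ==> t \<in> secs P U ==>
        s \<oplus>\<^bsub>msec P U\<^esub> t \<in> secs P U"
    and linear_presheaf_smult_closed: "\<And>U a s. opn U ==> a \<in> funs U ==> s \<in> secs P U ==>
        a \<odot>\<^bsub>msec P U\<^esub> s \<in> secs P U"
    and linear_presheaf_res_add: "\<And>U V s t. opn U ==> opn V ==> V \<subseteq> U ==> s \<in> secs P U ==> t \<in> secs P U ==>
        mres P U V (s \<oplus>\<^bsub>msec P U\<^esub> t) = mres P U V s \<oplus>\<^bsub>msec P V\<^esub> mres P U V t"
    and linear_presheaf_res_smult: "\<And>U V a s. opn U ==> opn V ==> V \<subseteq> U ==> a \<in> funs U ==> s \<in> secs P U ==>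
        mres P U V (a \<odot>\<^bsub>msec P U\<^esub> s) = res X U V a \<odot>\<^bsub>msec P V\<^esub> mres P U V s"
    and linear_presheaf_res_closed: "\<And>U V s. opn U ==> opn V ==> V \<subseteq> U ==> s \<in> secs P U ==>
        mres P U V s \<in> secs P V"
    and linear_presheaf_res_id: "\<And>U s. opn U ==> s \<in> secs P U ==> mres P U U s = s"
    and linear_presheaf_res_res: "\<And>U V W s. opn U ==> opn V ==> opn W ==> W \<subseteq> V ==> V \<subseteq> U ==> s \<in> secs P U ==>
        mres P V W (mres P U V s) = mres P U W s"
proof -
  show pre: "is_presheaf (tps X) (\<lambda>U. secs P U) (mres P)"
    using assms unfolding linear_presheaf_def by simp
  show "\<And>U V s. opn U ==> opn V ==> V \<subseteq> U ==> s \<in> secs P U ==>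
        mres P U V s \<in> secs P V"
    using presheaf_res_closed[OF pre] by blast
  show "\<And>U s. opn U ==> s \<in> secs P U ==> mres P U U s = s"
    using presheaf_res_id[OF pre] by blast
  show "\<And>U V W s. opn U ==> opn V ==> opn W ==> W \<subseteq> V ==> V \<subseteq> U ==> s \<in> secs P U ==>
        mres P V W (mres P U V s) = mres P U W s"
    using presheaf_res_res[OF pre] by blast
  show "\<And>U s t. opn U ==> s \<in> secs P U ==> t \<in> secs P U ==>
        s \<oplus>\<^bsub>msec P U\<^esub> t \<in> secs P U"
    using assms unfolding linear_presheaf_def by simp
  show "\<And>U a s. opn U ==> a \<in> funs U ==> s \<in> secs P U ==>
        a \<odot>\<^bsub>msec P U\<^esub> s \<in> secs P U"
    using assms unfolding linear_presheaf_def by simp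
  show "\<And>U V s t. opn U ==> opn V ==> V \<subseteq> U ==> s \<in> secs P U ==> t \<in> secs P U ==>
        mres P U V (s \<oplus>\<^bsub>msec P U\<^esub> t) = mres P U V s \<oplus>\<^bsub>msec P V\<^esub> mres P U V t"
    using assms unfolding linear_presheaf_def by simp
  show "\<And>U V a s. opn U ==> opn V ==> V \<subseteq> U ==> a \<in> funs U ==> s \<in> secs P U ==>
        mres P U V (a \<odot>\<^bsub>msec P U\<^esub> s) = res X U V a \<odot>\<^bsub>msec P V\<^esub> mres P U V s"
    using assms unfolding linear_presheaf_def by simp
qed

lemma modules_sheaf:
  "sheaf_of_modules X E ==> is_sheaf (tps X) (\<lambda>U. secs E U) (mres E)"
  unfolding sheaf_of_modules_def by simp

lemma modules_module: "sheaf_of_modules X E ==> opn U ==> module (sec X U) (msec E U)"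
  unfolding sheaf_of_modules_def by simp

lemma modules_linear_presheaf:
  assumes E: "sheaf_of_modules X E"
  shows "linear_presheaf X E"
proof -
  have add: "s \<oplus>\<^bsub>msec E U\<^esub> t \<in> secs E U"
    if "opn U" "s \<in> secs E U" "t \<in> secs E U" for U s t
  proof -
    interpret module "sec X U" "msec E U" by (rule modules_module[OF E that(1)])
    show ?thesis using that by auto
  qed
  have smult: "a \<odot>\<^bsub>msec E U\<^esub> s \<in> secs E U"
    if "opn U" "s \<in> secs E U" "a \<in> funs U" for U s a
  proof -
    interpret module "sec X U" "msec E U" by (rule modules_module[OF E that(1)])
    show ?thesis using that by auto
  qed
  show ?thesis
    using add smult sheaf_presheaf[OF modules_sheaf[OF E]] E[unfolded sheaf_of_modules_def]
    unfolding linear_presheaf_def by simp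
qed

lemmas sheaf_lin = linear_presheafD[OF modules_linear_presheaf]

lemma modules_eqI:
  assumes "sheaf_of_modules X E" "opn U" "s \<in> secs E U" "t \<in> secs E U"
    and "\<And>x. x \<in> U ==> \<exists>V. opn V \<and> x \<in> V \<and> V \<subseteq> U \<and> mres E U V s = mres E U V t"
  shows "s = t"
  by (rule sheaf_eqI[OF modules_sheaf[OF assms(1)] assms(2)]) (use assms in auto)

lemma modules_res_zero:
  assumes E: "sheaf_of_modules X E" and "opn U" "opn V" "V \<subseteq> U"
  shows "mres E U V \<zero>\<^bsub>msec E U\<^esub> = \<zero>\<^bsub>msec E V\<^esub>"
proof -
  interpret U: module "sec X U" "msec E U" by (rule modules_module) fact+
  interpret V: module "sec X V" "msec E V" by (rule modules_module) fact+
  have "mres E U V (\<zero>\<^bsub>sec X U\<^esub> \<odot>\<^bsub>msec E U\<^esub> \<zero>\<^bsub>msec E U\<^esub>)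
      = res X U V \<zero>\<^bsub>sec X U\<^esub> \<odot>\<^bsub>msec E V\<^esub> mres E U V \<zero>\<^bsub>msec E U\<^esub>"
    by (rule sheaf_lin(5)) (use assms in auto)
  then show ?thesis
    using sheaf_lin(6)[OF E assms(2-4), of "\<zero>\<^bsub>msec E U\<^esub>"] res_zero[OF assms(2-4)] by simp
qed

section \<open>Homomorphisms\<close>

lemma sheaf_homI:
  assumes "\<phi> = on_opens X U \<phi>"
    and "\<And>W. opn W ==> W \<subseteq> U ==> \<phi> W \<in> secs E W \<rightarrow>\<^sub>E secs F W"
    and "\<And>W s t. opn W ==> W \<subseteq> U ==> s \<in> secs E W ==> t \<in> secs E W ==>
        \<phi> W (s \<oplus>\<^bsub>msec E W\<^esub> t) = \<phi> W s \<oplus>\<^bsub>msec F W\<^esub> \<phi> W t"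
    and "\<And>W a s. opn W ==> W \<subseteq> U ==> a \<in> funs W ==> s \<in> secs E W ==>
        \<phi> W (a \<odot>\<^bsub>msec E W\<^esub> s) = a \<odot>\<^bsub>msec F W\<^esub> \<phi> W s"
    and "\<And>W W' s. opn W ==> opn W' ==> W' \<subseteq> W ==> W \<subseteq> U ==> s \<in> secs E W ==>
        \<phi> W' (mres E W W' s) = mres F W W' (\<phi> W s)"
  shows "\<phi> \<in> sheaf_hom X U E F"
  using assms unfolding sheaf_hom_def linear_maps_def by simp

lemma sheaf_homD:
  assumes "\<phi> \<in> sheaf_hom X U E F"
  shows sheaf_hom_on_opens: "\<phi> = on_opens X U \<phi>"
    and sheaf_hom_ext: "\<And>W. opn W ==> W \<subseteq> U ==> \<phi> W \<in> secs E W \<rightarrow>\<^sub>E secs F W"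
    and sheaf_hom_add: "\<And>W s t. opn W ==> W \<subseteq> U ==> s \<in> secs E W ==> t \<in> secs E W ==>
        \<phi> W (s \<oplus>\<^bsub>msec E W\<^esub> t) = \<phi> W s \<oplus>\<^bsub>msec F W\<^esub> \<phi> W t"
    and sheaf_hom_smult: "\<And>W a s. opn W ==> W \<subseteq> U ==> a \<in> funs W ==> s \<in> secs E W ==>
        \<phi> W (a \<odot>\<^bsub>msec E W\<^esub> s) = a \<odot>\<^bsub>msec F W\<^esub> \<phi> W s"
    and sheaf_hom_res: "\<And>W W' s. opn W ==> opn W' ==> W' \<subseteq> W ==> W \<subseteq> U ==> s \<in> secs E W ==>
        \<phi> W' (mres E W W' s) = mres F W W' (\<phi> W s)"
    and sheaf_hom_closed: "\<And>W s. opn W ==> W \<subseteq> U ==> s \<in> secs E W ==> \<phi> W s \<in> secs F W"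
proof -
  show *: "\<And>W. opn W ==> W \<subseteq> U ==> \<phi> W \<in> secs E W \<rightarrow>\<^sub>E secs F W"
    using assms unfolding sheaf_hom_def linear_maps_def by simp
  show "\<And>W s. opn W ==> W \<subseteq> U ==> s \<in> secs E W ==> \<phi> W s \<in> secs F W"
    using * by (blast dest: PiE_mem)
  show "\<phi> = on_opens X U \<phi>"
    using assms unfolding sheaf_hom_def by simp
  show "\<And>W s t. opn W ==> W \<subseteq> U ==> s \<in> secs E W ==> t \<in> secs E W ==>
        \<phi> W (s \<oplus>\<^bsub>msec E W\<^esub> t) = \<phi> W s \<oplus>\<^bsub>msec F W\<^esub> \<phi> W t"
    using assms unfolding sheaf_hom_def linear_maps_def by simp
  show "\<And>W a s. opn W ==> W \<subseteq> U ==> a \<in> funs W ==> s \<in> secs E W ==>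
        \<phi> W (a \<odot>\<^bsub>msec E W\<^esub> s) = a \<odot>\<^bsub>msec F W\<^esub> \<phi> W s"
    using assms unfolding sheaf_hom_def linear_maps_def by simp
  show "\<And>W W' s. opn W ==> opn W' ==> W' \<subseteq> W ==> W \<subseteq> U ==> s \<in> secs E W ==>
        \<phi> W' (mres E W W' s) = mres F W W' (\<phi> W s)"
    using assms unfolding sheaf_hom_def by simp
qed

lemma sheaf_hom_eqI:
  assumes "\<phi> \<in> sheaf_hom X U E F" "\<psi> \<in> sheaf_hom X U E F"
    and "\<And>W s. opn W ==> W \<subseteq> U ==> s \<in> secs E W ==> \<phi> W s = \<psi> W s"
  shows "\<phi> = \<psi>"
proof
  fix W
  show "\<phi> W = \<psi> W"
  proof (cases "opn W \<and> W \<subseteq> U")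
    case True
    then show ?thesis
      using PiE_ext[OF sheaf_hom_ext[OF assms(1)] sheaf_hom_ext[OF assms(2)]] assms(3) by blast
  next
    case False
    then show ?thesis
      using sheaf_hom_on_opens[OF assms(1)] sheaf_hom_on_opens[OF assms(2)]
      by (metis on_opens_def)
  qed
qed

text \<open>Making a family of maps undefined off the carriers and off the open subsets of \<open>U\<close>.\<close>

definition on_sections where
  "on_sections U E \<phi> = on_opens X U (\<lambda>W. \<lambda>s\<in>secs E W. \<phi> W s)"

lemma on_sections_apply [simp]:
  "opn W ==> W \<subseteq> U ==> s \<in> secs E W ==> on_sections U E \<phi> W s = \<phi> W s"
  unfolding on_sections_def on_opens_def by simp

lemma on_sections_homI:
  assumes E: "linear_presheaf X E"
    and cl: "\<And>W s. opn W ==> W \<subseteq> U ==> s \<in> secs E W ==> \<phi> W s \<in> secs F W"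
    and add: "\<And>W s t. opn W ==> W \<subseteq> U ==> s \<in> secs E W ==> t \<in> secs E W ==>
        \<phi> W (s \<oplus>\<^bsub>msec E W\<^esub> t) = \<phi> W s \<oplus>\<^bsub>msec F W\<^esub> \<phi> W t"
    and smult: "\<And>W a s. opn W ==> W \<subseteq> U ==> a \<in> funs W ==> s \<in> secs E W ==>
        \<phi> W (a \<odot>\<^bsub>msec E W\<^esub> s) = a \<odot>\<^bsub>msec F W\<^esub> \<phi> W s"
    and re: "\<And>W W' s. opn W ==> opn W' ==> W' \<subseteq> W ==> W \<subseteq> U ==> s \<in> secs E W ==>
        \<phi> W' (mres E W W' s) = mres F W W' (\<phi> W s)"
  shows "on_sections U E \<phi> \<in> sheaf_hom X U E F"
proof (rule sheaf_homI)
  show "on_sections U E \<phi> = on_opens X U (on_sections U E \<phi>)"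
    unfolding on_sections_def on_opens_def by (rule ext) simp
  show "on_sections U E \<phi> W \<in> secs E W \<rightarrow>\<^sub>E secs F W" if "opn W" "W \<subseteq> U" for W
    using that cl unfolding on_sections_def on_opens_def by (auto simp: PiE_def)
qed (use assms linear_presheafD[OF E] in \<open>simp_all add: subset_trans\<close>)

lemma sheaf_hom_on_subset:
  assumes \<phi>: "\<phi> \<in> sheaf_hom X U E F" and V: "V \<subseteq> U"
  shows "on_opens X V \<phi> \<in> sheaf_hom X V E F"
proof (rule sheaf_homI)
  show "on_opens X V \<phi> = on_opens X V (on_opens X V \<phi>)"
    unfolding on_opens_def by (rule ext) simp
qed (use sheaf_homD[OF \<phi>] V in \<open>simp_all add: on_opens_def subset_trans\<close>)

lemma on_opens_apply [simp]: "opn W ==> W \<subseteq> U ==> on_opens X U \<phi> W = \<phi> W"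
  unfolding on_opens_def by simp

lemma sheaf_hom_zero:
  assumes "sheaf_of_modules X E" "sheaf_of_modules X F" "\<phi> \<in> sheaf_hom X U E F" "opn W" "W \<subseteq> U"
  shows "\<phi> W \<zero>\<^bsub>msec E W\<^esub> = \<zero>\<^bsub>msec F W\<^esub>"
proof -
  interpret E: module "sec X W" "msec E W" by (rule modules_module) fact+
  interpret F: module "sec X W" "msec F W" by (rule modules_module) fact+
  have "\<phi> W (\<zero>\<^bsub>sec X W\<^esub> \<odot>\<^bsub>msec E W\<^esub> \<zero>\<^bsub>msec E W\<^esub>) = \<zero>\<^bsub>sec X W\<^esub> \<odot>\<^bsub>msec F W\<^esub> \<phi> W \<zero>\<^bsub>msec E W\<^esub>"
    by (rule sheaf_hom_smult[OF assms(3-5)]) auto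
  then show ?thesis using sheaf_hom_closed[OF assms(3-5), of "\<zero>\<^bsub>msec E W\<^esub>"] by simp
qed

text \<open>Linearity of the inverse is tested after applying the bijective homomorphism.\<close>

lemma isomorphic_on_sym:
  assumes E: "linear_presheaf X E" and iso: "isomorphic_on X U E F"
  shows "isomorphic_on X U F E"
proof -
  obtain \<phi> where \<phi>: "\<phi> \<in> sheaf_hom X U E F"
    and bij: "\<And>W. opn W ==> W \<subseteq> U ==> bij_betw (\<phi> W) (secs E W) (secs F W)"
    using iso unfolding isomorphic_on_def by blast
  define g where "g W = inv_into (secs E W) (\<phi> W)" for W
  have gcl: "g W t \<in> secs E W" and \<phi>g: "\<phi> W (g W t) = t"
    if "opn W" "W \<subseteq> U" "t \<in> secs F W" for W t
    using bij[OF that(1,2)] that(3) unfolding g_def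
    by (metis bij_betw_def inv_into_into, metis bij_betw_inv_into_right)
  have g\<phi>: "g W (\<phi> W s) = s" if "opn W" "W \<subseteq> U" "s \<in> secs E W" for W s
    using bij[OF that(1,2)] that(3) unfolding g_def by (metis bij_betw_inv_into_left)
  note H = sheaf_homD[OF \<phi>]
  note L = linear_presheafD[OF E]
  let ?g = "on_sections U F g"
  have gadd: "g W (s \<oplus>\<^bsub>msec F W\<^esub> t) = g W s \<oplus>\<^bsub>msec E W\<^esub> g W t \<and> s \<oplus>\<^bsub>msec F W\<^esub> t \<in> secs F W"
    if W: "opn W" "W \<subseteq> U" and st: "s \<in> secs F W" "t \<in> secs F W" for W s t
  proof -
    have "\<phi> W (g W s \<oplus>\<^bsub>msec E W\<^esub> g W t) = s \<oplus>\<^bsub>msec F W\<^esub> t"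
      using H(3)[OF W gcl[OF W st(1)] gcl[OF W st(2)]] by (simp add: \<phi>g W st)
    moreover have "g W s \<oplus>\<^bsub>msec E W\<^esub> g W t \<in> secs E W"
      by (intro L gcl W st)
    ultimately show ?thesis by (metis W g\<phi> H(6))
  qed
  have gsm: "g W (a \<odot>\<^bsub>msec F W\<^esub> t) = a \<odot>\<^bsub>msec E W\<^esub> g W t \<and> a \<odot>\<^bsub>msec F W\<^esub> t \<in> secs F W"
    if W: "opn W" "W \<subseteq> U" and st: "a \<in> funs W" "t \<in> secs F W" for W a t
  proof -
    have "\<phi> W (a \<odot>\<^bsub>msec E W\<^esub> g W t) = a \<odot>\<^bsub>msec F W\<^esub> t"
      using H(4)[OF W st(1) gcl[OF W st(2)]] by (simp add: \<phi>g W st)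
    moreover have "a \<odot>\<^bsub>msec E W\<^esub> g W t \<in> secs E W"
      by (intro L gcl W st)
    ultimately show ?thesis by (metis W g\<phi> H(6))
  qed
  have gres: "g W' (mres F W W' t) = mres E W W' (g W t) \<and> mres F W W' t \<in> secs F W'"
    if W: "opn W" "opn W'" "W' \<subseteq> W" "W \<subseteq> U" and t: "t \<in> secs F W" for W W' t
  proof -
    have W'U: "W' \<subseteq> U" using W by blast
    have "\<phi> W' (mres E W W' (g W t)) = mres F W W' t"
      using H(5)[OF W gcl[OF W(1,4) t]] by (simp add: \<phi>g W t)
    moreover have "mres E W W' (g W t) \<in> secs E W'"
      by (intro L gcl W t)
    ultimately show ?thesis by (metis W(2) W'U g\<phi> H(6))
  qed
  have "?g \<in> sheaf_hom X U F E"
  proof (rule sheaf_homI)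
    show "?g = on_opens X U ?g"
      unfolding on_sections_def on_opens_def by (rule ext) simp
    show "?g W \<in> secs F W \<rightarrow>\<^sub>E secs E W" if "opn W" "W \<subseteq> U" for W
      using that gcl unfolding on_sections_def on_opens_def by (auto simp: PiE_def)
  qed (use gadd gsm gres in \<open>simp_all add: subset_trans\<close>)
  moreover have "bij_betw (?g W) (secs F W) (secs E W)" if W: "opn W" "W \<subseteq> U" for W
  proof -
    have "bij_betw (g W) (secs F W) (secs E W)"
      unfolding g_def by (rule bij_betw_inv_into[OF bij[OF W]])
    then show ?thesis by (rule bij_betw_cong[THEN iffD1, rotated]) (simp add: W)
  qed
  ultimately show ?thesis unfolding isomorphic_on_def by blast
qed

section \<open>Sheaves of homomorphisms\<close>

lemma hom_sheaf_carrier [simp]: "secs (hom_sheaf X P F) U = sheaf_hom X U P F"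
  by (simp add: hom_sheaf_def mk_module_def)

lemma hom_sheaf_res [simp]: "mres (hom_sheaf X P F) U V \<phi> = on_opens X V \<phi>"
  by (simp add: hom_sheaf_def)

lemma hom_sheaf_add: "\<phi> \<oplus>\<^bsub>msec (hom_sheaf X P F) U\<^esub> \<psi> = on_sections U P (\<lambda>W s. \<phi> W s \<oplus>\<^bsub>msec F W\<^esub> \<psi> W s)"
  by (simp add: hom_sheaf_def mk_module_def on_sections_def)

lemma hom_sheaf_smult: "a \<odot>\<^bsub>msec (hom_sheaf X P F) U\<^esub> \<phi> = on_sections U P (\<lambda>W s. res X U W a \<odot>\<^bsub>msec F W\<^esub> \<phi> W s)"
  by (simp add: hom_sheaf_def mk_module_def on_sections_def)

lemma hom_sheaf_zero: "\<zero>\<^bsub>msec (hom_sheaf X P F) U\<^esub> = on_sections U P (\<lambda>W s. \<zero>\<^bsub>msec F W\<^esub>)"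
  by (simp add: hom_sheaf_def mk_module_def on_sections_def)

lemma hom_sheaf_add_closed:
  assumes P: "linear_presheaf X P" and F: "sheaf_of_modules X F"
    and \<phi>: "\<phi> \<in> sheaf_hom X U P F" and \<psi>: "\<psi> \<in> sheaf_hom X U P F"
  shows "\<phi> \<oplus>\<^bsub>msec (hom_sheaf X P F) U\<^esub> \<psi> \<in> sheaf_hom X U P F"
  unfolding hom_sheaf_add
proof (rule on_sections_homI[OF P])
  fix W s assume W: "opn W" "W \<subseteq> U" and s: "s \<in> secs P W"
  interpret F: module "sec X W" "msec F W" by (rule modules_module[OF F W(1)])
  show "\<phi> W s \<oplus>\<^bsub>msec F W\<^esub> \<psi> W s \<in> secs F W"
    using sheaf_hom_closed[OF \<phi> W s] sheaf_hom_closed[OF \<psi> W s] by simp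
  show "\<phi> W (s \<oplus>\<^bsub>msec P W\<^esub> t) \<oplus>\<^bsub>msec F W\<^esub> \<psi> W (s \<oplus>\<^bsub>msec P W\<^esub> t)
      = \<phi> W s \<oplus>\<^bsub>msec F W\<^esub> \<psi> W s \<oplus>\<^bsub>msec F W\<^esub> (\<phi> W t \<oplus>\<^bsub>msec F W\<^esub> \<psi> W t)" if "t \<in> secs P W" for t
    using sheaf_hom_closed[OF \<phi> W] sheaf_hom_closed[OF \<psi> W] s that
    by (simp add: sheaf_hom_add[OF \<phi> W] sheaf_hom_add[OF \<psi> W] F.add.m_ac)
  show "\<phi> W (a \<odot>\<^bsub>msec P W\<^esub> s) \<oplus>\<^bsub>msec F W\<^esub> \<psi> W (a \<odot>\<^bsub>msec P W\<^esub> s) = a \<odot>\<^bsub>msec F W\<^esub> (\<phi> W s \<oplus>\<^bsub>msec F W\<^esub> \<psi> W s)"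
    if "a \<in> funs W" for a
    using sheaf_hom_closed[OF \<phi> W] sheaf_hom_closed[OF \<psi> W] s that
    by (simp add: sheaf_hom_smult[OF \<phi> W] sheaf_hom_smult[OF \<psi> W] F.smult_r_distr)
  show "\<phi> W' (mres P W W' s) \<oplus>\<^bsub>msec F W'\<^esub> \<psi> W' (mres P W W' s) = mres F W W' (\<phi> W s \<oplus>\<^bsub>msec F W\<^esub> \<psi> W s)"
    if "opn W'" "W' \<subseteq> W" for W'
    using sheaf_hom_closed[OF \<phi> W s] sheaf_hom_closed[OF \<psi> W s] W s that
    by (simp add: sheaf_hom_res[OF \<phi>] sheaf_hom_res[OF \<psi>] sheaf_lin(4)[OF F])
qed

lemma hom_sheaf_smult_closed:
  assumes P: "linear_presheaf X P" and F: "sheaf_of_modules X F" and U: "opn U"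
    and c: "c \<in> funs U" and \<phi>: "\<phi> \<in> sheaf_hom X U P F"
  shows "c \<odot>\<^bsub>msec (hom_sheaf X P F) U\<^esub> \<phi> \<in> sheaf_hom X U P F"
  unfolding hom_sheaf_smult
proof (rule on_sections_homI[OF P])
  fix W s assume W: "opn W" "W \<subseteq> U" and s: "s \<in> secs P W"
  interpret F: module "sec X W" "msec F W" by (rule modules_module[OF F W(1)])
  have cW: "res X U W c \<in> funs W" by (rule res_closed[OF U W c])
  show "res X U W c \<odot>\<^bsub>msec F W\<^esub> \<phi> W s \<in> secs F W"
    using sheaf_hom_closed[OF \<phi> W s] cW by simp
  show "res X U W c \<odot>\<^bsub>msec F W\<^esub> \<phi> W (s \<oplus>\<^bsub>msec P W\<^esub> t)
      = res X U W c \<odot>\<^bsub>msec F W\<^esub> \<phi> W s \<oplus>\<^bsub>msec F W\<^esub> res X U W c \<odot>\<^bsub>msec F W\<^esub> \<phi> W t"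
    if "t \<in> secs P W" for t
    using sheaf_hom_closed[OF \<phi> W] s that cW
    by (simp add: sheaf_hom_add[OF \<phi> W] F.smult_r_distr)
  show "res X U W c \<odot>\<^bsub>msec F W\<^esub> \<phi> W (a \<odot>\<^bsub>msec P W\<^esub> s) = a \<odot>\<^bsub>msec F W\<^esub> (res X U W c \<odot>\<^bsub>msec F W\<^esub> \<phi> W s)"
    if "a \<in> funs W" for a
    using sheaf_hom_closed[OF \<phi> W] s that cW
    by (simp add: sheaf_hom_smult[OF \<phi> W] F.smult_assoc1[symmetric] F.R.m_comm)
  show "res X U W' c \<odot>\<^bsub>msec F W'\<^esub> \<phi> W' (mres P W W' s) = mres F W W' (res X U W c \<odot>\<^bsub>msec F W\<^esub> \<phi> W s)"
    if "opn W'" "W' \<subseteq> W" for W'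
    using sheaf_hom_closed[OF \<phi> W s] W s that c cW U
    by (simp add: sheaf_hom_res[OF \<phi>] sheaf_lin(5)[OF F] res_res)
qed

lemma hom_sheaf_module:
  assumes P: "linear_presheaf X P" and F: "sheaf_of_modules X F" and U: "opn U"
  shows "module (sec X U) (msec (hom_sheaf X P F) U)"
proof -
  let ?H = "msec (hom_sheaf X P F) U"
  note add_closed = hom_sheaf_add_closed[OF P F]
  note smult_closed = hom_sheaf_smult_closed[OF P F U]
  interpret R: cring "sec X U" by (rule sec_cring[OF U])
  have ap: "(\<phi> \<oplus>\<^bsub>?H\<^esub> \<psi>) W s = \<phi> W s \<oplus>\<^bsub>msec F W\<^esub> \<psi> W s"
    if "opn W" "W \<subseteq> U" "s \<in> secs P W" for \<phi> \<psi> W s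
    using that by (simp add: hom_sheaf_add)
  have sp: "(a \<odot>\<^bsub>?H\<^esub> \<phi>) W s = res X U W a \<odot>\<^bsub>msec F W\<^esub> \<phi> W s"
    if "opn W" "W \<subseteq> U" "s \<in> secs P W" for \<phi> a W s
    using that by (simp add: hom_sheaf_smult)
  have zp: "\<zero>\<^bsub>?H\<^esub> W s = \<zero>\<^bsub>msec F W\<^esub>"
    if "opn W" "W \<subseteq> U" "s \<in> secs P W" for W s
    using that by (simp add: hom_sheaf_zero)
  have zero_closed: "\<zero>\<^bsub>?H\<^esub> \<in> sheaf_hom X U P F"
    unfolding hom_sheaf_zero
  proof (rule on_sections_homI[OF P])
    fix W s assume W: "opn W" "W \<subseteq> U"
    interpret F: module "sec X W" "msec F W" by (rule modules_module[OF F W(1)])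
    show "\<zero>\<^bsub>msec F W\<^esub> \<in> secs F W" "\<zero>\<^bsub>msec F W\<^esub> = \<zero>\<^bsub>msec F W\<^esub> \<oplus>\<^bsub>msec F W\<^esub> \<zero>\<^bsub>msec F W\<^esub>" by simp_all
    show "\<zero>\<^bsub>msec F W\<^esub> = a \<odot>\<^bsub>msec F W\<^esub> \<zero>\<^bsub>msec F W\<^esub>" if "a \<in> funs W" for a using that by simp
    show "\<zero>\<^bsub>msec F W'\<^esub> = mres F W W' \<zero>\<^bsub>msec F W\<^esub>" if "opn W'" "W' \<subseteq> W" for W'
      using modules_res_zero[OF F W(1) that] by simp
  qed
  show ?thesis
  proof (rule moduleI)
    show "cring (sec X U)" by (rule R.is_cring)
    show "abelian_group ?H"
    proof (rule abelian_groupI)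
      fix \<phi> \<psi> \<chi> assume "\<phi> \<in> carrier ?H" "\<psi> \<in> carrier ?H" "\<chi> \<in> carrier ?H"
      then have c: "\<phi> \<in> sheaf_hom X U P F" "\<psi> \<in> sheaf_hom X U P F" "\<chi> \<in> sheaf_hom X U P F" by simp_all
      show "\<phi> \<oplus>\<^bsub>?H\<^esub> \<psi> \<in> carrier ?H" using add_closed c by simp
      show "\<phi> \<oplus>\<^bsub>?H\<^esub> \<psi> \<oplus>\<^bsub>?H\<^esub> \<chi> = \<phi> \<oplus>\<^bsub>?H\<^esub> (\<psi> \<oplus>\<^bsub>?H\<^esub> \<chi>)"
      proof (rule sheaf_hom_eqI[OF add_closed add_closed])
        fix W s assume W: "opn W" "W \<subseteq> U" and s: "s \<in> secs P W"
        interpret F: module "sec X W" "msec F W" by (rule modules_module[OF F W(1)])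
        show "(\<phi> \<oplus>\<^bsub>?H\<^esub> \<psi> \<oplus>\<^bsub>?H\<^esub> \<chi>) W s = (\<phi> \<oplus>\<^bsub>?H\<^esub> (\<psi> \<oplus>\<^bsub>?H\<^esub> \<chi>)) W s"
          using sheaf_hom_closed[OF c(1) W s] sheaf_hom_closed[OF c(2) W s] sheaf_hom_closed[OF c(3) W s]
          by (simp add: ap W s F.a_assoc)
      qed (use c add_closed in auto)
      show "\<phi> \<oplus>\<^bsub>?H\<^esub> \<psi> = \<psi> \<oplus>\<^bsub>?H\<^esub> \<phi>"
      proof (rule sheaf_hom_eqI[OF add_closed add_closed])
        fix W s assume W: "opn W" "W \<subseteq> U" and s: "s \<in> secs P W"
        interpret F: module "sec X W" "msec F W" by (rule modules_module[OF F W(1)])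
        show "(\<phi> \<oplus>\<^bsub>?H\<^esub> \<psi>) W s = (\<psi> \<oplus>\<^bsub>?H\<^esub> \<phi>) W s"
          using sheaf_hom_closed[OF c(1) W s] sheaf_hom_closed[OF c(2) W s]
          by (simp add: ap W s F.a_comm)
      qed (use c in auto)
      show "\<zero>\<^bsub>?H\<^esub> \<oplus>\<^bsub>?H\<^esub> \<phi> = \<phi>"
      proof (rule sheaf_hom_eqI[OF add_closed])
        fix W s assume W: "opn W" "W \<subseteq> U" and s: "s \<in> secs P W"
        interpret F: module "sec X W" "msec F W" by (rule modules_module[OF F W(1)])
        show "(\<zero>\<^bsub>?H\<^esub> \<oplus>\<^bsub>?H\<^esub> \<phi>) W s = \<phi> W s"
          using sheaf_hom_closed[OF c(1) W s] by (simp add: ap zp W s)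
      qed (use c zero_closed in auto)
      have neg: "(\<ominus>\<^bsub>sec X U\<^esub> \<one>\<^bsub>sec X U\<^esub>) \<odot>\<^bsub>?H\<^esub> \<phi> \<in> sheaf_hom X U P F"
        by (rule smult_closed[OF _ c(1)]) simp
      have "(\<ominus>\<^bsub>sec X U\<^esub> \<one>\<^bsub>sec X U\<^esub>) \<odot>\<^bsub>?H\<^esub> \<phi> \<oplus>\<^bsub>?H\<^esub> \<phi> = \<zero>\<^bsub>?H\<^esub>"
      proof (rule sheaf_hom_eqI[OF add_closed[OF neg c(1)] zero_closed])
        fix W s assume W: "opn W" "W \<subseteq> U" and s: "s \<in> secs P W"
        interpret F: module "sec X W" "msec F W" by (rule modules_module[OF F W(1)])
        show "((\<ominus>\<^bsub>sec X U\<^esub> \<one>\<^bsub>sec X U\<^esub>) \<odot>\<^bsub>?H\<^esub> \<phi> \<oplus>\<^bsub>?H\<^esub> \<phi>) W s = \<zero>\<^bsub>?H\<^esub> W s"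
          using sheaf_hom_closed[OF c(1) W s]
          by (simp add: ap zp sp W s res_minus[OF U W] res_one[OF U W] F.smult_l_minus F.M.l_neg)
      qed
      then show "\<exists>\<psi>\<in>carrier ?H. \<psi> \<oplus>\<^bsub>?H\<^esub> \<phi> = \<zero>\<^bsub>?H\<^esub>" using neg by auto
    qed (use zero_closed in simp)
    fix a b \<phi> \<psi> assume a: "a \<in> funs U" and b: "b \<in> funs U"
      and "\<phi> \<in> carrier ?H" and "\<psi> \<in> carrier ?H"
    then have c: "\<phi> \<in> sheaf_hom X U P F" "\<psi> \<in> sheaf_hom X U P F" by simp_all
    show "a \<odot>\<^bsub>?H\<^esub> \<phi> \<in> carrier ?H" using smult_closed a c by simp
    show "(a \<oplus>\<^bsub>sec X U\<^esub> b) \<odot>\<^bsub>?H\<^esub> \<phi> = a \<odot>\<^bsub>?H\<^esub> \<phi> \<oplus>\<^bsub>?H\<^esub> b \<odot>\<^bsub>?H\<^esub> \<phi>"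
    proof (rule sheaf_hom_eqI[OF smult_closed add_closed[OF smult_closed smult_closed]])
      fix W s assume W: "opn W" "W \<subseteq> U" and s: "s \<in> secs P W"
      interpret F: module "sec X W" "msec F W" by (rule modules_module[OF F W(1)])
      show "((a \<oplus>\<^bsub>sec X U\<^esub> b) \<odot>\<^bsub>?H\<^esub> \<phi>) W s = (a \<odot>\<^bsub>?H\<^esub> \<phi> \<oplus>\<^bsub>?H\<^esub> b \<odot>\<^bsub>?H\<^esub> \<phi>) W s"
        using sheaf_hom_closed[OF c(1) W s] res_closed[OF U W a] res_closed[OF U W b]
        by (simp add: ap sp W s res_add[OF U W a b] F.smult_l_distr)
    qed (use a b c in auto)
    show "a \<odot>\<^bsub>?H\<^esub> (\<phi> \<oplus>\<^bsub>?H\<^esub> \<psi>) = a \<odot>\<^bsub>?H\<^esub> \<phi> \<oplus>\<^bsub>?H\<^esub> a \<odot>\<^bsub>?H\<^esub> \<psi>"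
    proof (rule sheaf_hom_eqI[OF smult_closed[OF _ add_closed] add_closed[OF smult_closed smult_closed]])
      fix W s assume W: "opn W" "W \<subseteq> U" and s: "s \<in> secs P W"
      interpret F: module "sec X W" "msec F W" by (rule modules_module[OF F W(1)])
      show "(a \<odot>\<^bsub>?H\<^esub> (\<phi> \<oplus>\<^bsub>?H\<^esub> \<psi>)) W s = (a \<odot>\<^bsub>?H\<^esub> \<phi> \<oplus>\<^bsub>?H\<^esub> a \<odot>\<^bsub>?H\<^esub> \<psi>) W s"
        using sheaf_hom_closed[OF c(1) W s] sheaf_hom_closed[OF c(2) W s] res_closed[OF U W a]
        by (simp add: ap sp W s F.smult_r_distr)
    qed (use a c in auto)
    show "(a \<otimes>\<^bsub>sec X U\<^esub> b) \<odot>\<^bsub>?H\<^esub> \<phi> = a \<odot>\<^bsub>?H\<^esub> (b \<odot>\<^bsub>?H\<^esub> \<phi>)"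
    proof (rule sheaf_hom_eqI[OF smult_closed smult_closed[OF _ smult_closed]])
      fix W s assume W: "opn W" "W \<subseteq> U" and s: "s \<in> secs P W"
      interpret F: module "sec X W" "msec F W" by (rule modules_module[OF F W(1)])
      show "((a \<otimes>\<^bsub>sec X U\<^esub> b) \<odot>\<^bsub>?H\<^esub> \<phi>) W s = (a \<odot>\<^bsub>?H\<^esub> (b \<odot>\<^bsub>?H\<^esub> \<phi>)) W s"
        using sheaf_hom_closed[OF c(1) W s] res_closed[OF U W a] res_closed[OF U W b]
        by (simp add: sp W s res_mult[OF U W a b] F.smult_assoc1)
    qed (use a b c in auto)
  next
    fix \<phi> assume "\<phi> \<in> carrier ?H"
    then have c: "\<phi> \<in> sheaf_hom X U P F" by simp
    show "\<one>\<^bsub>sec X U\<^esub> \<odot>\<^bsub>?H\<^esub> \<phi> = \<phi>"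
    proof (rule sheaf_hom_eqI[OF smult_closed])
      fix W s assume W: "opn W" "W \<subseteq> U" and s: "s \<in> secs P W"
      interpret F: module "sec X W" "msec F W" by (rule modules_module[OF F W(1)])
      show "(\<one>\<^bsub>sec X U\<^esub> \<odot>\<^bsub>?H\<^esub> \<phi>) W s = \<phi> W s"
        using sheaf_hom_closed[OF c W s] by (simp add: sp W s res_one[OF U W])
    qed (use c in auto)
  qed
qed

text \<open>The value of a glued homomorphism on a section \<open>s\<close> is glued in the target from its values on the
  restrictions of \<open>s\<close>.\<close>

lemma hom_sheaf_is_sheaf:
  assumes P: "linear_presheaf X P" and F: "sheaf_of_modules X F"
  shows "is_sheaf (tps X) (\<lambda>U. sheaf_hom X U P F) (\<lambda>U V. on_opens X V)"
  unfolding is_sheaf_def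
proof (intro conjI allI impI)
  note L = linear_presheafD[OF P]
  show "is_presheaf (tps X) (\<lambda>U. sheaf_hom X U P F) (\<lambda>U V. on_opens X V)"
    unfolding is_presheaf_def
  proof (intro conjI allI impI ballI)
    show "on_opens X V \<in> sheaf_hom X U P F \<rightarrow> sheaf_hom X V P F" if "opn U \<and> opn V \<and> V \<subseteq> U" for U V
      using that sheaf_hom_on_subset by blast
    show "on_opens X U \<phi> = \<phi>" if "\<phi> \<in> sheaf_hom X U P F" for U \<phi>
      using sheaf_hom_on_opens[OF that] by simp
    show "on_opens X W (on_opens X V \<phi>) = on_opens X W \<phi>" if "opn U \<and> opn V \<and> opn W \<and> W \<subseteq> V \<and> V \<subseteq> U" for U V W \<phi>
      using that by (auto simp: on_opens_def fun_eq_iff)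
  qed
  fix \<U> assume "\<forall>V\<in>\<U>. opn V"
  then have op: "\<And>V. V \<in> \<U> ==> opn V" by blast
  show "\<forall>\<phi>\<in>sheaf_hom X (\<Union>\<U>) P F. \<forall>\<psi>\<in>sheaf_hom X (\<Union>\<U>) P F.
      (\<forall>V\<in>\<U>. on_opens X V \<phi> = on_opens X V \<psi>) --> \<phi> = \<psi>"
  proof (intro ballI impI)
    fix \<phi> \<psi> assume \<phi>: "\<phi> \<in> sheaf_hom X (\<Union>\<U>) P F" and \<psi>: "\<psi> \<in> sheaf_hom X (\<Union>\<U>) P F"
      and eq: "\<forall>V\<in>\<U>. on_opens X V \<phi> = on_opens X V \<psi>"
    show "\<phi> = \<psi>"
    proof (rule sheaf_hom_eqI[OF \<phi> \<psi>])
      fix W s assume W: "opn W" "W \<subseteq> \<Union>\<U>" and s: "s \<in> secs P W"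
      show "\<phi> W s = \<psi> W s"
      proof (rule modules_eqI[OF F W(1)])
        show "\<phi> W s \<in> secs F W" by (rule sheaf_hom_closed[OF \<phi> W s])
        show "\<psi> W s \<in> secs F W" by (rule sheaf_hom_closed[OF \<psi> W s])
        fix x assume "x \<in> W"
        then obtain V where V: "V \<in> \<U>" "x \<in> V" using W by blast
        have o: "opn (W \<inter> V)" using W op[OF V(1)] by blast
        have "\<phi> (W \<inter> V) = on_opens X V \<phi> (W \<inter> V)" using o by simp
        also have "\<dots> = on_opens X V \<psi> (W \<inter> V)" using eq V by simp
        also have "\<dots> = \<psi> (W \<inter> V)" using o by simp
        finally have "mres F W (W \<inter> V) (\<phi> W s) = mres F W (W \<inter> V) (\<psi> W s)"
          using sheaf_hom_res[OF \<phi> W(1) o _ W(2) s] sheaf_hom_res[OF \<psi> W(1) o _ W(2) s] by simp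
        then show "\<exists>V. opn V \<and> x \<in> V \<and> V \<subseteq> W \<and> mres F W V (\<phi> W s) = mres F W V (\<psi> W s)"
          using o V \<open>x \<in> W\<close> by (intro exI[of _ "W \<inter> V"]) auto
      qed
    qed
  qed
  fix f assume "(\<forall>V\<in>\<U>. f V \<in> sheaf_hom X V P F) \<and>
      (\<forall>V\<in>\<U>. \<forall>W\<in>\<U>. on_opens X (V \<inter> W) (f V) = on_opens X (V \<inter> W) (f W))"
  then have f: "\<And>V. V \<in> \<U> ==> f V \<in> sheaf_hom X V P F"
    and agree: "\<And>V W. V \<in> \<U> ==> W \<in> \<U> ==> on_opens X (V \<inter> W) (f V) = on_opens X (V \<inter> W) (f W)" by blast+
  have agree': "f V W = f V' W" if "V \<in> \<U>" "V' \<in> \<U>" "opn W" "W \<subseteq> V" "W \<subseteq> V'" for V V' W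
    using agree[OF that(1,2)] that(3-5) by (metis Int_greatest on_opens_apply)
  define \<phi> where "\<phi> W s = (THE c. c \<in> secs F W \<and> (\<forall>V' d. opn V' \<and> V' \<subseteq> W \<and> d \<in> secs F V' \<and>
      (\<exists>V\<in>\<U>. V' \<subseteq> V \<and> d = f V V' (mres P W V' s)) --> mres F W V' c = d))" for W s
  have \<phi>: "\<phi> W s \<in> secs F W" "\<And>V V'. V \<in> \<U> ==> opn V' ==> V' \<subseteq> W ==> V' \<subseteq> V ==> mres F W V' (\<phi> W s) = f V V' (mres P W V' s)"
    if W: "opn W" "W \<subseteq> \<Union>\<U>" and s: "s \<in> secs P W" for W s
  proof -
    have "\<exists>!c. c \<in> secs F W \<and> (\<forall>V' d. opn V' \<and> V' \<subseteq> W \<and> d \<in> secs F V' \<and>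
      (\<exists>V\<in>\<U>. V' \<subseteq> V \<and> d = f V V' (mres P W V' s)) --> mres F W V' c = d)"
    proof (rule sheaf_glue_described[OF modules_sheaf[OF F] W(1)])
      fix x assume "x \<in> W"
      then obtain V where V: "V \<in> \<U>" "x \<in> V" using W by blast
      have o: "opn (W \<inter> V)" using W op[OF V(1)] by blast
      have "f V (W \<inter> V) (mres P W (W \<inter> V) s) \<in> secs F (W \<inter> V)"
        by (intro sheaf_hom_closed[OF f[OF V(1)] o] L(6) W s o) auto
      with o V \<open>x \<in> W\<close> show "\<exists>V' c. opn V' \<and> x \<in> V' \<and> V' \<subseteq> W \<and> c \<in> secs F V' \<and>
          (\<exists>V\<in>\<U>. V' \<subseteq> V \<and> c = f V V' (mres P W V' s))"
        by (intro exI[of _ "W \<inter> V"] exI[of _ "f V (W \<inter> V) (mres P W (W \<inter> V) s)"]) auto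
    next
      fix V1 V2 c d
      assume o: "opn V1" "opn V2" and sub: "V1 \<subseteq> W" "V2 \<subseteq> W"
        and "\<exists>V\<in>\<U>. V1 \<subseteq> V \<and> c = f V V1 (mres P W V1 s)" and "\<exists>V\<in>\<U>. V2 \<subseteq> V \<and> d = f V V2 (mres P W V2 s)"
      then obtain U1 U2 where U: "U1 \<in> \<U>" "U2 \<in> \<U>" "V1 \<subseteq> U1" "V2 \<subseteq> U2"
        and c: "c = f U1 V1 (mres P W V1 s)" and d: "d = f U2 V2 (mres P W V2 s)" by blast
      have oo: "opn (V1 \<inter> V2)" using o by blast
      have "mres F V1 (V1 \<inter> V2) c = f U1 (V1 \<inter> V2) (mres P W (V1 \<inter> V2) s)"
        unfolding c using sheaf_hom_res[OF f[OF U(1)] o(1) oo _ U(3) L(6)[OF W(1) o(1) sub(1) s]]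
          L(8)[OF W(1) o(1) oo _ sub(1) s] by simp
      also have "\<dots> = f U2 (V1 \<inter> V2) (mres P W (V1 \<inter> V2) s)"
        using agree'[OF U(1,2) oo] U by (simp add: le_infI1 le_infI2)
      also have "\<dots> = mres F V2 (V1 \<inter> V2) d"
        unfolding d using sheaf_hom_res[OF f[OF U(2)] o(2) oo _ U(4) L(6)[OF W(1) o(2) sub(2) s]]
          L(8)[OF W(1) o(2) oo _ sub(2) s] by simp
      finally show "mres F V1 (V1 \<inter> V2) c = mres F V2 (V1 \<inter> V2) d" .
    qed
    from theI'[OF this, folded \<phi>_def] have t: "\<phi> W s \<in> secs F W"
      "\<And>V' d. opn V' \<and> V' \<subseteq> W \<and> d \<in> secs F V' \<and>
      (\<exists>V\<in>\<U>. V' \<subseteq> V \<and> d = f V V' (mres P W V' s)) ==> mres F W V' (\<phi> W s) = d" by blast+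
    show "\<phi> W s \<in> secs F W" by (rule t)
    show "mres F W V' (\<phi> W s) = f V V' (mres P W V' s)" if "V \<in> \<U>" "opn V'" "V' \<subseteq> W" "V' \<subseteq> V" for V V'
      by (rule t(2)) (use that W s L(6) sheaf_hom_closed[OF f[OF that(1)] that(2) that(4)] in blast)
  qed
  have eqI: "c = \<phi> W s" if W: "opn W" "W \<subseteq> \<Union>\<U>" and s: "s \<in> secs P W" and c: "c \<in> secs F W"
    and loc: "\<And>V V'. V \<in> \<U> ==> opn V' ==> V' \<subseteq> W ==> V' \<subseteq> V ==> mres F W V' c = f V V' (mres P W V' s)" for W s c
  proof (rule modules_eqI[OF F W(1) c \<phi>(1)[OF W s]])
    fix x assume "x \<in> W"
    then obtain V where V: "V \<in> \<U>" "x \<in> V" using W by blast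
    have o: "opn (W \<inter> V)" using W op[OF V(1)] by blast
    show "\<exists>V. opn V \<and> x \<in> V \<and> V \<subseteq> W \<and> mres F W V c = mres F W V (\<phi> W s)"
      using o V \<open>x \<in> W\<close> loc[OF V(1) o] \<phi>(2)[OF W s V(1) o] by (intro exI[of _ "W \<inter> V"]) auto
  qed
  show "\<exists>\<phi>\<in>sheaf_hom X (\<Union>\<U>) P F. \<forall>V\<in>\<U>. on_opens X V \<phi> = f V"
  proof (intro bexI ballI)
    show hom: "on_sections (\<Union>\<U>) P \<phi> \<in> sheaf_hom X (\<Union>\<U>) P F"
    proof (rule on_sections_homI[OF P])
      fix W s assume W: "opn W" "W \<subseteq> \<Union>\<U>" and s: "s \<in> secs P W"
      interpret F: module "sec X W" "msec F W" by (rule modules_module[OF F W(1)])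
      show "\<phi> W s \<in> secs F W" by (rule \<phi>(1)[OF W s])
      show "\<phi> W (s \<oplus>\<^bsub>msec P W\<^esub> t) = \<phi> W s \<oplus>\<^bsub>msec F W\<^esub> \<phi> W t" if t: "t \<in> secs P W" for t
      proof (rule eqI[symmetric, OF W L(2)[OF W(1) s t]])
        show "\<phi> W s \<oplus>\<^bsub>msec F W\<^esub> \<phi> W t \<in> secs F W" using \<phi>(1)[OF W s] \<phi>(1)[OF W t] by simp
        fix V V' assume V: "V \<in> \<U>" "opn V'" "V' \<subseteq> W" "V' \<subseteq> V"
        show "mres F W V' (\<phi> W s \<oplus>\<^bsub>msec F W\<^esub> \<phi> W t) = f V V' (mres P W V' (s \<oplus>\<^bsub>msec P W\<^esub> t))"
          using sheaf_lin(4)[OF F W(1) V(2,3) \<phi>(1)[OF W s] \<phi>(1)[OF W t]] \<phi>(2)[OF W s V] \<phi>(2)[OF W t V]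
            L(4)[OF W(1) V(2,3) s t] sheaf_hom_add[OF f[OF V(1)] V(2,4) L(6)[OF W(1) V(2,3) s] L(6)[OF W(1) V(2,3) t]]
          by simp
      qed
      show "\<phi> W (a \<odot>\<^bsub>msec P W\<^esub> s) = a \<odot>\<^bsub>msec F W\<^esub> \<phi> W s" if a: "a \<in> funs W" for a
      proof (rule eqI[symmetric, OF W L(3)[OF W(1) a s]])
        show "a \<odot>\<^bsub>msec F W\<^esub> \<phi> W s \<in> secs F W" using \<phi>(1)[OF W s] a by simp
        fix V V' assume V: "V \<in> \<U>" "opn V'" "V' \<subseteq> W" "V' \<subseteq> V"
        show "mres F W V' (a \<odot>\<^bsub>msec F W\<^esub> \<phi> W s) = f V V' (mres P W V' (a \<odot>\<^bsub>msec P W\<^esub> s))"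
          using sheaf_lin(5)[OF F W(1) V(2,3) a \<phi>(1)[OF W s]] \<phi>(2)[OF W s V]
            L(5)[OF W(1) V(2,3) a s] sheaf_hom_smult[OF f[OF V(1)] V(2,4) res_closed[OF W(1) V(2,3) a] L(6)[OF W(1) V(2,3) s]]
          by simp
      qed
      show "\<phi> W' (mres P W W' s) = mres F W W' (\<phi> W s)" if W': "opn W'" "W' \<subseteq> W" for W'
      proof (rule eqI[symmetric, OF W'(1) _ L(6)[OF W(1) W' s]])
        show "W' \<subseteq> \<Union>\<U>" using W W' by blast
        show "mres F W W' (\<phi> W s) \<in> secs F W'" by (rule sheaf_lin(6)[OF F W(1) W' \<phi>(1)[OF W s]])
        fix V V' assume V: "V \<in> \<U>" "opn V'" "V' \<subseteq> W'" "V' \<subseteq> V"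
        show "mres F W' V' (mres F W W' (\<phi> W s)) = f V V' (mres P W' V' (mres P W W' s))"
          using sheaf_lin(8)[OF F W(1) W'(1) V(2,3) W'(2) \<phi>(1)[OF W s]] \<phi>(2)[OF W s V(1,2) _ V(4)]
            L(8)[OF W(1) W'(1) V(2,3) W'(2) s] V W' by auto
      qed
    qed
    fix V assume V: "V \<in> \<U>"
    have VU: "V \<subseteq> \<Union>\<U>" using V by blast
    show "on_opens X V (on_sections (\<Union>\<U>) P \<phi>) = f V"
    proof (rule sheaf_hom_eqI[OF sheaf_hom_on_subset[OF hom VU] f[OF V]])
      fix W s assume W: "opn W" "W \<subseteq> V" and s: "s \<in> secs P W"
      have WU: "W \<subseteq> \<Union>\<U>" using W V by blast
      have "mres F W W (\<phi> W s) = f V W (mres P W W s)"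
        by (rule \<phi>(2)[OF W(1) WU s V W(1) _ W(2)]) simp
      then show "on_opens X V (on_sections (\<Union>\<U>) P \<phi>) W s = f V W s"
        using W s WU sheaf_lin(7)[OF F W(1) \<phi>(1)[OF W(1) WU s]] L(7)[OF W(1) s] by simp
    qed
  qed
qed

lemma hom_sheaf_sheaf_of_modules:
  assumes P: "linear_presheaf X P" and F: "sheaf_of_modules X F"
  shows "sheaf_of_modules X (hom_sheaf X P F)"
  unfolding sheaf_of_modules_def
proof (intro conjI allI impI ballI)
  show "is_sheaf (tps X) (\<lambda>U. secs (hom_sheaf X P F) U) (mres (hom_sheaf X P F))"
    using hom_sheaf_is_sheaf[OF P F] by (simp add: hom_sheaf_def mk_module_def)
  show "module (sec X U) (msec (hom_sheaf X P F) U)" if "opn U" for U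
    by (rule hom_sheaf_module[OF P F that])
  fix U V assume "opn U \<and> opn V \<and> V \<subseteq> U"
  then have UV: "opn U" "opn V" "V \<subseteq> U" by auto
  fix \<phi> assume "\<phi> \<in> secs (hom_sheaf X P F) U"
  then have \<phi>: "\<phi> \<in> sheaf_hom X U P F" by simp
  show "mres (hom_sheaf X P F) U V (\<phi> \<oplus>\<^bsub>msec (hom_sheaf X P F) U\<^esub> \<psi>) =
      mres (hom_sheaf X P F) U V \<phi> \<oplus>\<^bsub>msec (hom_sheaf X P F) V\<^esub> mres (hom_sheaf X P F) U V \<psi>" for \<psi>
    unfolding hom_sheaf_res hom_sheaf_add on_sections_def using UV
    by (auto simp: on_opens_def fun_eq_iff)
  show "mres (hom_sheaf X P F) U V (a \<odot>\<^bsub>msec (hom_sheaf X P F) U\<^esub> \<phi>) =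
      res X U V a \<odot>\<^bsub>msec (hom_sheaf X P F) V\<^esub> mres (hom_sheaf X P F) U V \<phi>" if "a \<in> funs U" for a
    unfolding hom_sheaf_res hom_sheaf_smult on_sections_def using UV that
    by (auto simp: on_opens_def fun_eq_iff res_res)
qed

lemma unit_module_simps [simp]:
  "secs unit_module U = funs U"
  "\<zero>\<^bsub>msec unit_module U\<^esub> = \<zero>\<^bsub>sec X U\<^esub>"
  "add (msec unit_module U) = add (sec X U)"
  "a \<odot>\<^bsub>msec unit_module U\<^esub> b = a \<otimes>\<^bsub>sec X U\<^esub> b"
  "mres unit_module = res X"
  by (simp_all add: structure_module_def mk_module_def)

lemma unit_module_modules: "sheaf_of_modules X unit_module"
  unfolding sheaf_of_modules_def
proof (intro conjI allI impI ballI)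
  show "is_sheaf (tps X) (\<lambda>U. secs unit_module U) (mres unit_module)"
    using ring_sheaf by simp
  show "module (sec X U) (msec unit_module U)" if "opn U" for U
  proof -
    interpret cring "sec X U" by (rule sec_cring[OF that])
    show ?thesis
    proof (rule moduleI)
      show "abelian_group (msec unit_module U)"
        by (rule abelian_groupI) (auto simp: a_ac)
    qed (simp_all add: is_cring l_distr r_distr m_assoc)
  qed
qed (simp_all add: res_add res_mult)

lemma dual_sheaf_modules: "linear_presheaf X P ==> sheaf_of_modules X (dual_sheaf X P)"
  unfolding dual_sheaf_def by (rule hom_sheaf_sheaf_of_modules[OF _ unit_module_modules])

lemma dual_sheaf_isomorphic:
  fixes E :: "('p, 'r, 'e) modsheaf" and F :: "('p, 'r, 'f) modsheaf"
  assumes E: "linear_presheaf X E" and F: "linear_presheaf X F"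
    and iso: "isomorphic X E F"
  shows "isomorphic X (dual_sheaf X F) (dual_sheaf X E)"
proof -
  let ?T = "topspace (tps X)"
  obtain \<Phi> where \<Phi>: "\<Phi> \<in> homs X E F"
    and bij: "\<And>W. opn W ==> W \<subseteq> ?T ==> bij_betw (\<Phi> W) (secs E W) (secs F W)"
    using iso unfolding isomorphic_on_def by blast
  define pull where "pull U \<xi> = on_sections U E (\<lambda>W s. \<xi> W (\<Phi> W s))" for U and \<xi> :: "'p set \<Rightarrow> 'f \<Rightarrow> 'r"
  have pull_hom: "pull U \<xi> \<in> sheaf_hom X U E unit_module" if U: "opn U" and \<xi>: "\<xi> \<in> sheaf_hom X U F unit_module" for U \<xi>
    unfolding pull_def
    by (rule on_sections_homI[OF E])
      (use sheaf_homD[OF \<Phi>] sheaf_homD[OF \<xi>] opn_topspace in \<open>simp_all add: subset_trans\<close>)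
  have pull_inj: "inj_on (pull U) (sheaf_hom X U F unit_module)" if U: "opn U" for U
  proof (rule inj_onI)
    fix \<xi> \<eta> assume \<xi>: "\<xi> \<in> sheaf_hom X U F unit_module" and \<eta>: "\<eta> \<in> sheaf_hom X U F unit_module" and eq: "pull U \<xi> = pull U \<eta>"
    show "\<xi> = \<eta>"
    proof (rule sheaf_hom_eqI[OF \<xi> \<eta>])
      fix W t assume W: "opn W" "W \<subseteq> U" and t: "t \<in> secs F W"
      then obtain s where s: "s \<in> secs E W" "t = \<Phi> W s"
        using bij[OF W(1) opn_topspace[OF W(1)]] unfolding bij_betw_def by blast
      have "pull U \<xi> W s = pull U \<eta> W s" by (simp add: eq)
      then show "\<xi> W t = \<eta> W t" using W s by (simp add: pull_def)
    qed
  qed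
  have pull_surj: "\<exists>\<xi>\<in>sheaf_hom X U F unit_module. pull U \<xi> = \<chi>" if U: "opn U" and \<chi>: "\<chi> \<in> sheaf_hom X U E unit_module" for U \<chi>
  proof -
    define \<xi> where "\<xi> = on_sections U F (\<lambda>W t. \<chi> W (inv_into (secs E W) (\<Phi> W) t))"
    have inv: "\<exists>s. s \<in> secs E W \<and> t = \<Phi> W s \<and> inv_into (secs E W) (\<Phi> W) t = s"
      if "opn W" "t \<in> secs F W" for W t
      using bij[OF that(1) opn_topspace[OF that(1)]] that(2)
      by (metis bij_betw_inv_into_right bij_betw_def inv_into_into)
    have inv': "inv_into (secs E W) (\<Phi> W) (\<Phi> W s) = s" if "opn W" "s \<in> secs E W" for W s
      by (rule bij_betw_inv_into_left[OF bij[OF that(1) opn_topspace[OF that(1)]] that(2)])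
    note L = linear_presheafD[OF E]
    have "\<xi> \<in> sheaf_hom X U F unit_module"
      unfolding \<xi>_def
    proof (rule on_sections_homI[OF F])
      fix W t assume W: "opn W" "W \<subseteq> U" and t: "t \<in> secs F W"
      note WT = W(1) opn_topspace[OF W(1)]
      obtain s where s: "s \<in> secs E W" "t = \<Phi> W s" using inv[OF W(1) t] by blast
      show "\<chi> W (inv_into (secs E W) (\<Phi> W) t) \<in> secs unit_module W"
        using sheaf_hom_closed[OF \<chi> W s(1)] s inv'[OF W(1) s(1)] by simp
      show "\<chi> W (inv_into (secs E W) (\<Phi> W) (t \<oplus>\<^bsub>msec F W\<^esub> t'))
          = \<chi> W (inv_into (secs E W) (\<Phi> W) t) \<oplus>\<^bsub>msec unit_module W\<^esub> \<chi> W (inv_into (secs E W) (\<Phi> W) t')"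
        if t': "t' \<in> secs F W" for t'
      proof -
        obtain s' where s': "s' \<in> secs E W" "t' = \<Phi> W s'" using inv[OF W(1) t'] by blast
        have "t \<oplus>\<^bsub>msec F W\<^esub> t' = \<Phi> W (s \<oplus>\<^bsub>msec E W\<^esub> s')"
          using sheaf_hom_add[OF \<Phi> WT s(1) s'(1)] s s' by simp
        then show ?thesis
          using sheaf_hom_add[OF \<chi> W s(1) s'(1)] inv'[OF W(1) s(1)] inv'[OF W(1) s'(1)]
            inv'[OF W(1) L(2)[OF W(1) s(1) s'(1)]] s(2) s'(2) by simp
      qed
      show "\<chi> W (inv_into (secs E W) (\<Phi> W) (a \<odot>\<^bsub>msec F W\<^esub> t))
          = a \<odot>\<^bsub>msec unit_module W\<^esub> \<chi> W (inv_into (secs E W) (\<Phi> W) t)"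
        if a: "a \<in> funs W" for a
        using sheaf_hom_smult[OF \<Phi> WT a s(1)] sheaf_hom_smult[OF \<chi> W a s(1)] inv'[OF W(1) s(1)]
            inv'[OF W(1) L(3)[OF W(1) a s(1)]] s(2) by simp
      show "\<chi> W' (inv_into (secs E W') (\<Phi> W') (mres F W W' t))
          = mres unit_module W W' (\<chi> W (inv_into (secs E W) (\<Phi> W) t))"
        if W': "opn W'" "W' \<subseteq> W" for W'
        using sheaf_hom_res[OF \<Phi> W(1) W' WT(2) s(1)] sheaf_hom_res[OF \<chi> W(1) W' W(2) s(1)]
            inv'[OF W(1) s(1)] inv'[OF W'(1) L(6)[OF W(1) W' s(1)]] s(2) by simp
    qed
    moreover have "pull U \<xi> = \<chi>"
      by (rule sheaf_hom_eqI[OF pull_hom[OF U calculation] \<chi>])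
        (use inv' sheaf_hom_closed[OF \<Phi> _ opn_topspace] in \<open>simp add: pull_def \<xi>_def\<close>)
    ultimately show ?thesis by blast
  qed
  have "on_sections ?T (dual_sheaf X F) pull \<in> homs X (dual_sheaf X F) (dual_sheaf X E)"
  proof (rule on_sections_homI[OF modules_linear_presheaf[OF dual_sheaf_modules[OF F]]], unfold dual_sheaf_def)
    fix W \<xi> assume W: "opn W" and "\<xi> \<in> secs (hom_sheaf X F unit_module) W"
    then have \<xi>: "\<xi> \<in> sheaf_hom X W F unit_module" by simp
    have cl: "\<Phi> W' s \<in> secs F W'" if "opn W'" "s \<in> secs E W'" for W' s
      by (rule sheaf_hom_closed[OF \<Phi> that(1) opn_topspace[OF that(1)] that(2)])
    show "pull W \<xi> \<in> secs (hom_sheaf X E unit_module) W" using pull_hom[OF W \<xi>] by simp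
    show "pull W (\<xi> \<oplus>\<^bsub>msec (hom_sheaf X F unit_module) W\<^esub> \<eta>) = pull W \<xi> \<oplus>\<^bsub>msec (hom_sheaf X E unit_module) W\<^esub> pull W \<eta>" for \<eta>
      unfolding hom_sheaf_add pull_def on_sections_def using cl
      by (auto simp: on_opens_def fun_eq_iff)
    show "pull W (a \<odot>\<^bsub>msec (hom_sheaf X F unit_module) W\<^esub> \<xi>) = a \<odot>\<^bsub>msec (hom_sheaf X E unit_module) W\<^esub> pull W \<xi>" for a
      unfolding hom_sheaf_smult pull_def on_sections_def using cl
      by (auto simp: on_opens_def fun_eq_iff)
    show "pull W' (mres (hom_sheaf X F unit_module) W W' \<xi>) = mres (hom_sheaf X E unit_module) W W' (pull W \<xi>)"
      if "opn W'" "W' \<subseteq> W" for W'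
      unfolding hom_sheaf_res pull_def on_sections_def using cl that
      by (auto simp: on_opens_def fun_eq_iff)
  qed
  moreover have "bij_betw (on_sections ?T (dual_sheaf X F) pull W) (secs (dual_sheaf X F) W) (secs (dual_sheaf X E) W)"
    if W: "opn W" "W \<subseteq> ?T" for W
  proof -
    have "bij_betw (pull W) (secs (dual_sheaf X F) W) (secs (dual_sheaf X E) W)"
      unfolding bij_betw_def dual_sheaf_def using pull_inj[OF W(1)] pull_hom[OF W(1)] pull_surj[OF W(1)] by (auto simp: image_iff)
    then show ?thesis by (rule bij_betw_cong[THEN iffD1, rotated]) (simp add: W)
  qed
  ultimately show ?thesis unfolding isomorphic_on_def by blast
qed

section \<open>Sheafification\<close>

context
  fixes P :: "('p, 'r, 'm) modsheaf"
  assumes P: "linear_presheaf X P"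
begin

private lemmas L = linear_presheafD[OF P]

text \<open>Germs are equivalence classes, so that the operations of the sheafification, unions over
  representatives, can be computed on any representative.\<close>

lemma mem_mgerm_iff:
  "(V, t) \<in> mgerm X P x U s \<longleftrightarrow> opn V \<and> x \<in> V \<and> t \<in> secs P V \<and>
     (\<exists>W. opn W \<and> x \<in> W \<and> W \<subseteq> U \<and> W \<subseteq> V \<and> mres P U W s = mres P V W t)"
  unfolding mgerm_def germ_of_def by auto

lemma mgerm_self: "opn U ==> x \<in> U ==> s \<in> secs P U ==> (U, s) \<in> mgerm X P x U s"
  unfolding mem_mgerm_iff by blast

lemma mgerm_subset:
  assumes U: "opn U" "s \<in> secs P U" and V: "opn V" "t \<in> secs P V"
    and W: "opn W" "x \<in> W" "W \<subseteq> U" "W \<subseteq> V" and eq: "mres P U W s = mres P V W t"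
  shows "mgerm X P x U s \<subseteq> mgerm X P x V t"
proof (rule subrelI)
  fix Y r assume "(Y, r) \<in> mgerm X P x U s"
  then obtain Z where Y: "opn Y" "x \<in> Y" "r \<in> secs P Y"
    and Z: "opn Z" "x \<in> Z" "Z \<subseteq> U" "Z \<subseteq> Y" "mres P U Z s = mres P Y Z r"
    unfolding mem_mgerm_iff by blast
  have o: "opn (W \<inter> Z)" using W Z by blast
  have "mres P V (W \<inter> Z) t = mres P W (W \<inter> Z) (mres P V W t)"
    using L(8)[OF V(1) W(1) o _ W(4) V(2)] by simp
  also have "\<dots> = mres P U (W \<inter> Z) s"
    using L(8)[OF U(1) W(1) o _ W(3) U(2)] by (simp add: eq[symmetric])
  also have "\<dots> = mres P Z (W \<inter> Z) (mres P U Z s)"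
    using L(8)[OF U(1) Z(1) o _ Z(3) U(2)] by simp
  also have "\<dots> = mres P Y (W \<inter> Z) r"
    using L(8)[OF Y(1) Z(1) o _ Z(4) Y(3)] by (simp add: Z(5))
  finally show "(Y, r) \<in> mgerm X P x V t"
    unfolding mem_mgerm_iff using Y o W Z by (intro conjI exI[of _ "W \<inter> Z"]) auto
qed

lemma mgerm_eqI:
  assumes "opn U" "s \<in> secs P U" and "opn V" "t \<in> secs P V"
    and "opn W" "x \<in> W" "W \<subseteq> U" "W \<subseteq> V" and "mres P U W s = mres P V W t"
  shows "mgerm X P x U s = mgerm X P x V t"
  using mgerm_subset[OF assms] mgerm_subset[OF assms(3,4,1,2,5,6,8,7) assms(9)[symmetric]] by blast

lemma mgerm_eqD:
  assumes U: "opn U" "x \<in> U" "s \<in> secs P U" and eq: "mgerm X P x U s = mgerm X P x V t"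
  shows "\<exists>W. opn W \<and> x \<in> W \<and> W \<subseteq> U \<and> W \<subseteq> V \<and> mres P U W s = mres P V W t"
proof -
  have "(U, s) \<in> mgerm X P x V t" using mgerm_self[OF U] eq by simp
  then show ?thesis unfolding mem_mgerm_iff by metis
qed

lemma mgerm_res:
  assumes U: "opn U" "s \<in> secs P U" and V: "opn V" "V \<subseteq> U" "x \<in> V"
  shows "mgerm X P x V (mres P U V s) = mgerm X P x U s"
  by (rule mgerm_eqI[OF V(1) L(6)[OF U(1) V(1,2) U(2)] U V(1,3)])
    (use V U L(8)[OF U(1) V(1) V(1) _ V(2) U(2)] in auto)

lemma mgerm_add:
  assumes U: "opn U" "x \<in> U" and s: "s \<in> secs P U" and t: "t \<in> secs P U"
  shows "(\<Union>(V, a)\<in>mgerm X P x U s. \<Union>(W, b)\<in>mgerm X P x U t.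
      mgerm X P x (V \<inter> W) (mres P V (V \<inter> W) a \<oplus>\<^bsub>msec P (V \<inter> W)\<^esub> mres P W (V \<inter> W) b))
    = mgerm X P x U (s \<oplus>\<^bsub>msec P U\<^esub> t)"
proof -
  have eq: "mgerm X P x (V \<inter> W) (mres P V (V \<inter> W) a \<oplus>\<^bsub>msec P (V \<inter> W)\<^esub> mres P W (V \<inter> W) b)
      = mgerm X P x U (s \<oplus>\<^bsub>msec P U\<^esub> t)"
    if a: "(V, a) \<in> mgerm X P x U s" and b: "(W, b) \<in> mgerm X P x U t" for V a W b
  proof -
    obtain A where V: "opn V" "x \<in> V" "a \<in> secs P V"
      and A: "opn A" "x \<in> A" "A \<subseteq> U" "A \<subseteq> V" "mres P U A s = mres P V A a"
      using a unfolding mem_mgerm_iff by blast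
    obtain B where W: "opn W" "x \<in> W" "b \<in> secs P W"
      and B: "opn B" "x \<in> B" "B \<subseteq> U" "B \<subseteq> W" "mres P U B t = mres P W B b"
      using b unfolding mem_mgerm_iff by blast
    let ?C = "A \<inter> B"
    have C: "opn ?C" "?C \<subseteq> V \<inter> W" "?C \<subseteq> U" using A B by blast+
    have VW: "opn (V \<inter> W)" using V W by blast
    have "mres P V ?C a = mres P A ?C (mres P V A a)"
      using L(8)[OF V(1) A(1) C(1) _ A(4) V(3)] by simp
    also have "\<dots> = mres P U ?C s"
      using L(8)[OF U(1) A(1) C(1) _ A(3) s] by (simp add: A(5)[symmetric])
    finally have 1: "mres P V ?C a = mres P U ?C s" .
    have "mres P W ?C b = mres P B ?C (mres P W B b)"
      using L(8)[OF W(1) B(1) C(1) _ B(4) W(3)] by simp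
    also have "\<dots> = mres P U ?C t"
      using L(8)[OF U(1) B(1) C(1) _ B(3) t] by (simp add: B(5)[symmetric])
    finally have 2: "mres P W ?C b = mres P U ?C t" .
    have ra: "mres P V (V \<inter> W) a \<in> secs P (V \<inter> W)" using L(6)[OF V(1) VW _ V(3)] by simp
    have rb: "mres P W (V \<inter> W) b \<in> secs P (V \<inter> W)" using L(6)[OF W(1) VW _ W(3)] by simp
    show ?thesis
    proof (rule mgerm_eqI[OF VW L(2)[OF VW ra rb] U(1) L(2)[OF U(1) s t] C(1)])
      show "x \<in> ?C" "?C \<subseteq> V \<inter> W" "?C \<subseteq> U" using A B C by auto
      show "mres P (V \<inter> W) ?C (mres P V (V \<inter> W) a \<oplus>\<^bsub>msec P (V \<inter> W)\<^esub> mres P W (V \<inter> W) b) = mres P U ?C (s \<oplus>\<^bsub>msec P U\<^esub> t)"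
        using L(4)[OF VW C(1,2) ra rb] L(4)[OF U(1) C(1,3) s t] L(8)[OF V(1) VW C(1,2) _ V(3)] L(8)[OF W(1) VW C(1,2) _ W(3)] 1 2
        by simp
    qed
  qed
  have ns: "(U, s) \<in> mgerm X P x U s" and nt: "(U, t) \<in> mgerm X P x U t"
    by (rule mgerm_self[OF U], fact)+
  show ?thesis
  proof (intro subset_antisym subsetI)
    fix z assume "z \<in> mgerm X P x U (s \<oplus>\<^bsub>msec P U\<^esub> t)"
    then have "z \<in> mgerm X P x (U \<inter> U) (mres P U (U \<inter> U) s \<oplus>\<^bsub>msec P (U \<inter> U)\<^esub> mres P U (U \<inter> U) t)"
      unfolding eq[OF ns nt] .
    then show "z \<in> (\<Union>(V, a)\<in>mgerm X P x U s. \<Union>(W, b)\<in>mgerm X P x U t.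
      mgerm X P x (V \<inter> W) (mres P V (V \<inter> W) a \<oplus>\<^bsub>msec P (V \<inter> W)\<^esub> mres P W (V \<inter> W) b))"
      using ns nt by blast
  qed (use eq in auto)
qed

lemma mgerm_smult:
  assumes U: "opn U" and V: "opn V" "V \<subseteq> U" "x \<in> V" and c: "c \<in> funs U" and s: "s \<in> secs P V"
  shows "(\<Union>(W, a)\<in>mgerm X P x V s. mgerm X P x (U \<inter> W) (res X U (U \<inter> W) c \<odot>\<^bsub>msec P (U \<inter> W)\<^esub> mres P W (U \<inter> W) a))
    = mgerm X P x V (res X U V c \<odot>\<^bsub>msec P V\<^esub> s)"
proof -
  have eq: "mgerm X P x (U \<inter> W) (res X U (U \<inter> W) c \<odot>\<^bsub>msec P (U \<inter> W)\<^esub> mres P W (U \<inter> W) a)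
      = mgerm X P x V (res X U V c \<odot>\<^bsub>msec P V\<^esub> s)"
    if a: "(W, a) \<in> mgerm X P x V s" for W a
  proof -
    obtain A where W: "opn W" "x \<in> W" "a \<in> secs P W"
      and A: "opn A" "x \<in> A" "A \<subseteq> V" "A \<subseteq> W" "mres P V A s = mres P W A a"
      using a unfolding mem_mgerm_iff by blast
    have UW: "opn (U \<inter> W)" using U W by blast
    have AUW: "A \<subseteq> U \<inter> W" using A V by blast
    have ra: "mres P W (U \<inter> W) a \<in> secs P (U \<inter> W)" using L(6)[OF W(1) UW _ W(3)] by simp
    have rc: "res X U (U \<inter> W) c \<in> funs (U \<inter> W)" using res_closed[OF U UW _ c] by simp
    have rc': "res X U V c \<in> funs V" using res_closed[OF U V(1,2) c] by simp
    show ?thesis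
    proof (rule mgerm_eqI[OF UW L(3)[OF UW rc ra] V(1) L(3)[OF V(1) rc' s] A(1,2) AUW A(3)])
      show "mres P (U \<inter> W) A (res X U (U \<inter> W) c \<odot>\<^bsub>msec P (U \<inter> W)\<^esub> mres P W (U \<inter> W) a)
          = mres P V A (res X U V c \<odot>\<^bsub>msec P V\<^esub> s)"
        using L(5)[OF UW A(1) AUW rc ra] L(5)[OF V(1) A(1,3) rc' s] L(8)[OF W(1) UW A(1) AUW _ W(3)] A(5)
          res_res[OF U UW A(1) AUW _ c] res_res[OF U V(1) A(1) A(3) V(2) c]
        by simp
    qed
  qed
  have ns: "(V, s) \<in> mgerm X P x V s" by (rule mgerm_self[OF V(1,3) s])
  show ?thesis
  proof (intro subset_antisym subsetI)
    fix z assume "z \<in> mgerm X P x V (res X U V c \<odot>\<^bsub>msec P V\<^esub> s)"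
    then have "z \<in> mgerm X P x (U \<inter> V) (res X U (U \<inter> V) c \<odot>\<^bsub>msec P (U \<inter> V)\<^esub> mres P V (U \<inter> V) s)"
      unfolding eq[OF ns] .
    then show "z \<in> (\<Union>(W, a)\<in>mgerm X P x V s. mgerm X P x (U \<inter> W) (res X U (U \<inter> W) c \<odot>\<^bsub>msec P (U \<inter> W)\<^esub> mres P W (U \<inter> W) a))"
      using ns by blast
  qed (use eq in auto)
qed

lemma sheafify_carrier_iff:
  "s \<in> secs (sheafify X P) U \<longleftrightarrow> s \<in> extensional U \<and>
     (\<forall>x\<in>U. \<exists>V t. opn V \<and> x \<in> V \<and> V \<subseteq> U \<and> t \<in> secs P V \<and> (\<forall>y\<in>V. s y = mgerm X P y V t))"
  by (simp add: sheafify_def mk_module_def)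

lemma sheafify_res [simp]: "mres (sheafify X P) U V s = restrict s V"
  by (simp add: sheafify_def)

lemma sheafify_add_germ:
  assumes "opn V" "V \<subseteq> U" "y \<in> V" "a \<in> secs P V" "b \<in> secs P V"
    and "s y = mgerm X P y V a" "t y = mgerm X P y V b"
  shows "(s \<oplus>\<^bsub>msec (sheafify X P) U\<^esub> t) y = mgerm X P y V (a \<oplus>\<^bsub>msec P V\<^esub> b)"
  unfolding mgerm_add[OF assms(1,3,4,5), symmetric] using assms
  by (auto simp: sheafify_def mk_module_def)

lemma sheafify_smult_germ:
  assumes "opn U" "opn V" "V \<subseteq> U" "y \<in> V" "c \<in> funs U" "a \<in> secs P V"
    and "s y = mgerm X P y V a"
  shows "(c \<odot>\<^bsub>msec (sheafify X P) U\<^esub> s) y = mgerm X P y V (res X U V c \<odot>\<^bsub>msec P V\<^esub> a)"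
  unfolding mgerm_smult[OF assms(1-6), symmetric] using assms
  by (auto simp: sheafify_def mk_module_def)

lemma sheafify_add_ext: "s \<oplus>\<^bsub>msec (sheafify X P) U\<^esub> t \<in> extensional U"
  by (simp add: sheafify_def mk_module_def)

lemma sheafify_smult_ext: "c \<odot>\<^bsub>msec (sheafify X P) U\<^esub> t \<in> extensional U"
  by (simp add: sheafify_def mk_module_def)

lemma sheafify_local:
  assumes "s \<in> secs (sheafify X P) U" "x \<in> U"
  obtains V a where "opn V" "x \<in> V" "V \<subseteq> U" "a \<in> secs P V" "\<And>y. y \<in> V ==> s y = mgerm X P y V a"
  using assms unfolding sheafify_carrier_iff by metis

lemma sheafify_local2:
  assumes s: "s \<in> secs (sheafify X P) U" and t: "t \<in> secs (sheafify X P) U" and x: "x \<in> U"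
  obtains V a b where "opn V" "x \<in> V" "V \<subseteq> U" "a \<in> secs P V" "b \<in> secs P V"
    "\<And>y. y \<in> V ==> s y = mgerm X P y V a" "\<And>y. y \<in> V ==> t y = mgerm X P y V b"
proof -
  obtain V a where V: "opn V" "x \<in> V" "V \<subseteq> U" "a \<in> secs P V" "\<And>y. y \<in> V ==> s y = mgerm X P y V a"
    by (rule sheafify_local[OF s x]) blast
  obtain W b where W: "opn W" "x \<in> W" "W \<subseteq> U" "b \<in> secs P W" "\<And>y. y \<in> W ==> t y = mgerm X P y W b"
    by (rule sheafify_local[OF t x]) blast
  have o: "opn (V \<inter> W)" using V W by blast
  show thesis
  proof (rule that[OF o])
    show "mres P V (V \<inter> W) a \<in> secs P (V \<inter> W)" using L(6)[OF V(1) o _ V(4)] by simp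
    show "mres P W (V \<inter> W) b \<in> secs P (V \<inter> W)" using L(6)[OF W(1) o _ W(4)] by simp
    show "s y = mgerm X P y (V \<inter> W) (mres P V (V \<inter> W) a)" if "y \<in> V \<inter> W" for y
      using that V mgerm_res[OF V(1,4) o] by simp
    show "t y = mgerm X P y (V \<inter> W) (mres P W (V \<inter> W) b)" if "y \<in> V \<inter> W" for y
      using that W mgerm_res[OF W(1,4) o] by simp
  qed (use V W in auto)
qed

lemma sheafify_linear_presheaf: "linear_presheaf X (sheafify X P)"
  unfolding linear_presheaf_def
proof (intro conjI allI impI ballI)
  let ?S = "sheafify X P"
  show "is_presheaf (tps X) (\<lambda>U. secs ?S U) (mres ?S)"
    unfolding is_presheaf_def
  proof (intro conjI allI impI ballI)
    fix U V assume UV: "opn U \<and> opn V \<and> V \<subseteq> U"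
    show "mres ?S U V \<in> secs ?S U \<rightarrow> secs ?S V"
    proof
      fix s assume s: "s \<in> secs ?S U"
      show "mres ?S U V s \<in> secs ?S V"
        unfolding sheafify_carrier_iff
      proof (intro conjI ballI)
        fix x assume x: "x \<in> V"
        then have "x \<in> U" using UV by blast
        then obtain W a where W: "opn W" "x \<in> W" "W \<subseteq> U" "a \<in> secs P W" "\<And>y. y \<in> W ==> s y = mgerm X P y W a"
          by (rule sheafify_local[OF s]) blast
        have o: "opn (V \<inter> W)" using W UV by blast
        have "mres P W (V \<inter> W) a \<in> secs P (V \<inter> W)" using L(6)[OF W(1) o _ W(4)] by simp
        moreover have "mres ?S U V s y = mgerm X P y (V \<inter> W) (mres P W (V \<inter> W) a)" if "y \<in> V \<inter> W" for y
          using that W mgerm_res[OF W(1,4) o] by simp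
        ultimately show "\<exists>Va t. opn Va \<and> x \<in> Va \<and> Va \<subseteq> V \<and> t \<in> secs P Va \<and> (\<forall>y\<in>Va. mres ?S U V s y = mgerm X P y Va t)"
          using o x W(2) by blast
      qed simp
    qed
  next
    fix U s assume "s \<in> secs ?S U"
    then show "mres ?S U U s = s" unfolding sheafify_carrier_iff by (simp add: extensional_restrict)
  next
    fix U V W s assume "opn U \<and> opn V \<and> opn W \<and> W \<subseteq> V \<and> V \<subseteq> U"
    then show "mres ?S V W (mres ?S U V s) = mres ?S U W s" by (auto simp: restrict_def fun_eq_iff)
  qed
  fix U assume U: "opn U"
  fix s assume s: "s \<in> secs ?S U"
  show "s \<oplus>\<^bsub>msec ?S U\<^esub> t \<in> secs ?S U" if t: "t \<in> secs ?S U" for t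
    unfolding sheafify_carrier_iff
  proof (intro conjI ballI sheafify_add_ext)
    fix x assume "x \<in> U"
    then obtain V a b where V: "opn V" "x \<in> V" "V \<subseteq> U" "a \<in> secs P V" "b \<in> secs P V"
      and st: "\<And>y. y \<in> V ==> s y = mgerm X P y V a" "\<And>y. y \<in> V ==> t y = mgerm X P y V b"
      by (rule sheafify_local2[OF s t]) blast
    show "\<exists>V ta. opn V \<and> x \<in> V \<and> V \<subseteq> U \<and> ta \<in> secs P V \<and> (\<forall>y\<in>V. (s \<oplus>\<^bsub>msec ?S U\<^esub> t) y = mgerm X P y V ta)"
    proof (intro exI conjI ballI)
      show "(s \<oplus>\<^bsub>msec ?S U\<^esub> t) y = mgerm X P y V (a \<oplus>\<^bsub>msec P V\<^esub> b)" if "y \<in> V" for y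
        by (rule sheafify_add_germ[where s=s and t=t, OF V(1,3) that V(4,5) st[OF that]])
    qed (use V L(2)[OF V(1,4,5)] in auto)
  qed
  show "c \<odot>\<^bsub>msec ?S U\<^esub> s' \<in> secs ?S U" if c: "c \<in> funs U" and s': "s' \<in> secs ?S U" for c s'
    unfolding sheafify_carrier_iff
  proof (intro conjI ballI sheafify_smult_ext)
    fix x assume "x \<in> U"
    then obtain V a where V: "opn V" "x \<in> V" "V \<subseteq> U" "a \<in> secs P V" "\<And>y. y \<in> V ==> s' y = mgerm X P y V a"
      by (rule sheafify_local[OF s']) blast
    show "\<exists>V ta. opn V \<and> x \<in> V \<and> V \<subseteq> U \<and> ta \<in> secs P V \<and> (\<forall>y\<in>V. (c \<odot>\<^bsub>msec ?S U\<^esub> s') y = mgerm X P y V ta)"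
    proof (intro exI conjI ballI)
      show "(c \<odot>\<^bsub>msec ?S U\<^esub> s') y = mgerm X P y V (res X U V c \<odot>\<^bsub>msec P V\<^esub> a)" if "y \<in> V" for y
        by (rule sheafify_smult_germ[where s=s', OF U V(1,3) that c V(4) V(5)[OF that]])
    qed (use V L(3)[OF V(1) res_closed[OF U V(1,3) c] V(4)] in auto)
  qed
next
  let ?S = "sheafify X P"
  fix U V s assume "opn U \<and> opn V \<and> V \<subseteq> U" and s: "s \<in> secs ?S U"
  then have U: "opn U" and V: "opn V" "V \<subseteq> U" by auto
  show "mres ?S U V (s \<oplus>\<^bsub>msec ?S U\<^esub> t) = mres ?S U V s \<oplus>\<^bsub>msec ?S V\<^esub> mres ?S U V t" if t: "t \<in> secs ?S U" for t
  proof (rule extensionalityI[of _ V])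
    fix x assume x: "x \<in> V"
    then have "x \<in> U" using V by blast
    then obtain W a b where W: "opn W" "x \<in> W" "W \<subseteq> U" "a \<in> secs P W" "b \<in> secs P W"
      and st: "\<And>y. y \<in> W ==> s y = mgerm X P y W a" "\<And>y. y \<in> W ==> t y = mgerm X P y W b"
      by (rule sheafify_local2[OF s t]) blast
    let ?W = "V \<inter> W"
    have o: "opn ?W" "x \<in> ?W" "?W \<subseteq> V" "?W \<subseteq> W" using W V x by auto
    have a: "mres P W ?W a \<in> secs P ?W" and b: "mres P W ?W b \<in> secs P ?W"
      using L(6)[OF W(1) o(1,4)] W by auto
    have oU: "?W \<subseteq> U" using W by blast
    have "(s \<oplus>\<^bsub>msec ?S U\<^esub> t) x = mgerm X P x ?W (mres P W ?W a \<oplus>\<^bsub>msec P ?W\<^esub> mres P W ?W b)"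
      by (rule sheafify_add_germ[OF o(1) oU o(2) a b]) (use W(2) st mgerm_res[OF W(1,4) o(1,4,2)] mgerm_res[OF W(1,5) o(1,4,2)] in auto)
    moreover have "(mres ?S U V s \<oplus>\<^bsub>msec ?S V\<^esub> mres ?S U V t) x = mgerm X P x ?W (mres P W ?W a \<oplus>\<^bsub>msec P ?W\<^esub> mres P W ?W b)"
      by (rule sheafify_add_germ[OF o(1,3,2) a b]) (use x W(2) st mgerm_res[OF W(1,4) o(1,4,2)] mgerm_res[OF W(1,5) o(1,4,2)] in auto)
    ultimately show "mres ?S U V (s \<oplus>\<^bsub>msec ?S U\<^esub> t) x = (mres ?S U V s \<oplus>\<^bsub>msec ?S V\<^esub> mres ?S U V t) x"
      using x by simp
  qed (simp_all add: sheafify_add_ext)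
next
  let ?S = "sheafify X P"
  fix U V c s assume "opn U \<and> opn V \<and> V \<subseteq> U" and c: "c \<in> funs U" and s: "s \<in> secs ?S U"
  then have U: "opn U" and V: "opn V" "V \<subseteq> U" by auto
  show "mres ?S U V (c \<odot>\<^bsub>msec ?S U\<^esub> s) = res X U V c \<odot>\<^bsub>msec ?S V\<^esub> mres ?S U V s"
  proof (rule extensionalityI[of _ V])
    fix x assume x: "x \<in> V"
    then have "x \<in> U" using V by blast
    then obtain W a where W: "opn W" "x \<in> W" "W \<subseteq> U" "a \<in> secs P W"
      and st: "\<And>y. y \<in> W ==> s y = mgerm X P y W a"
      by (rule sheafify_local[OF s]) blast
    let ?W = "V \<inter> W"
    have o: "opn ?W" "x \<in> ?W" "?W \<subseteq> V" "?W \<subseteq> W" using W V x by auto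
    have a: "mres P W ?W a \<in> secs P ?W"
      using L(6)[OF W(1) o(1,4)] W by auto
    have oU: "?W \<subseteq> U" using W by blast
    have "(c \<odot>\<^bsub>msec ?S U\<^esub> s) x = mgerm X P x ?W (res X U ?W c \<odot>\<^bsub>msec P ?W\<^esub> mres P W ?W a)"
      by (rule sheafify_smult_germ[OF U o(1) oU o(2) c a]) (use W(2) st mgerm_res[OF W(1,4) o(1,4,2)] in auto)
    moreover have "(res X U V c \<odot>\<^bsub>msec ?S V\<^esub> mres ?S U V s) x = mgerm X P x ?W (res X V ?W (res X U V c) \<odot>\<^bsub>msec P ?W\<^esub> mres P W ?W a)"
      by (rule sheafify_smult_germ[OF V(1) o(1,3,2) res_closed[OF U V c] a]) (use x W(2) st mgerm_res[OF W(1,4) o(1,4,2)] in auto)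
    ultimately show "mres ?S U V (c \<odot>\<^bsub>msec ?S U\<^esub> s) x = (res X U V c \<odot>\<^bsub>msec ?S V\<^esub> mres ?S U V s) x"
      using x res_res[OF U V(1) o(1,3) V(2) c] by simp
  qed (simp_all add: sheafify_smult_ext)
qed

text \<open>The section of the sheafification given by a section of the presheaf.\<close>

definition sheafify_unit where "sheafify_unit W t = (\<lambda>x\<in>W. mgerm X P x W t)"

lemma sheafify_unit_closed:
  "opn W ==> t \<in> secs P W ==> sheafify_unit W t \<in> secs (sheafify X P) W"
  unfolding sheafify_carrier_iff sheafify_unit_def by (auto intro!: exI[of _ W])

lemma sheafify_unit_add:
  assumes "opn W" "s \<in> secs P W" "t \<in> secs P W"
  shows "sheafify_unit W (s \<oplus>\<^bsub>msec P W\<^esub> t) = sheafify_unit W s \<oplus>\<^bsub>msec (sheafify X P) W\<^esub> sheafify_unit W t"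
  by (rule extensionalityI[of _ W])
    (use assms in \<open>auto simp: sheafify_unit_def sheafify_add_ext sheafify_add_germ[OF assms(1) subset_refl _ assms(2,3)]\<close>)

lemma sheafify_unit_smult:
  assumes "opn W" "c \<in> funs W" "t \<in> secs P W"
  shows "sheafify_unit W (c \<odot>\<^bsub>msec P W\<^esub> t) = c \<odot>\<^bsub>msec (sheafify X P) W\<^esub> sheafify_unit W t"
  by (rule extensionalityI[of _ W])
    (use assms in \<open>auto simp: sheafify_unit_def sheafify_smult_ext res_id sheafify_smult_germ[OF assms(1,1) subset_refl _ assms(2,3)]\<close>)

lemma sheafify_unit_res:
  assumes "opn W" "opn V" "V \<subseteq> W" "t \<in> secs P W"
  shows "sheafify_unit V (mres P W V t) = mres (sheafify X P) W V (sheafify_unit W t)"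
  by (rule extensionalityI[of _ V]) (use assms mgerm_res[OF assms(1,4,2,3)] in \<open>auto simp: sheafify_unit_def\<close>)

lemma sheafify_local_unit:
  assumes "s \<in> secs (sheafify X P) U" "x \<in> U"
  obtains V a where "opn V" "x \<in> V" "V \<subseteq> U" "a \<in> secs P V" "mres (sheafify X P) U V s = sheafify_unit V a"
proof -
  obtain V a where V: "opn V" "x \<in> V" "V \<subseteq> U" "a \<in> secs P V" "\<And>y. y \<in> V ==> s y = mgerm X P y V a"
    by (rule sheafify_local[OF assms]) blast
  show thesis
    by (rule that[OF V(1-4)]) (use V(5) in \<open>auto simp: sheafify_unit_def fun_eq_iff\<close>)
qed

lemma sheafify_hom_unique:
  assumes F: "sheaf_of_modules X F" and \<phi>: "\<phi> \<in> sheaf_hom X U (sheafify X P) F" and \<psi>: "\<psi> \<in> sheaf_hom X U (sheafify X P) F"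
    and eq: "\<And>W t. opn W ==> W \<subseteq> U ==> t \<in> secs P W ==> \<phi> W (sheafify_unit W t) = \<psi> W (sheafify_unit W t)"
  shows "\<phi> = \<psi>"
proof (rule sheaf_hom_eqI[OF \<phi> \<psi>])
  fix W s assume W: "opn W" "W \<subseteq> U" and s: "s \<in> secs (sheafify X P) W"
  show "\<phi> W s = \<psi> W s"
  proof (rule modules_eqI[OF F W(1) sheaf_hom_closed[OF \<phi> W s] sheaf_hom_closed[OF \<psi> W s]])
    fix x assume "x \<in> W"
    then obtain V a where V: "opn V" "x \<in> V" "V \<subseteq> W" "a \<in> secs P V"
      and e: "mres (sheafify X P) W V s = sheafify_unit V a"
      by (rule sheafify_local_unit[OF s])
    have "\<phi> V (sheafify_unit V a) = \<psi> V (sheafify_unit V a)"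
      using eq V W by blast
    then have "mres F W V (\<phi> W s) = mres F W V (\<psi> W s)"
      using sheaf_hom_res[OF \<phi> W(1) V(1,3) W(2) s] sheaf_hom_res[OF \<psi> W(1) V(1,3) W(2) s] unfolding e by simp
    then show "\<exists>V. opn V \<and> x \<in> V \<and> V \<subseteq> W \<and> mres F W V (\<phi> W s) = mres F W V (\<psi> W s)"
      using V by blast
  qed
qed

text \<open>Locally a section of the sheafification is a section of \<open>P\<close>, so a homomorphism on \<open>P\<close>
  determines compatible local values, and these glue because the target is a sheaf.\<close>

lemma sheafify_hom_extend:
  assumes F: "sheaf_of_modules X F" and \<psi>: "\<psi> \<in> sheaf_hom X U P F"
  shows "\<exists>\<phi>\<in>sheaf_hom X U (sheafify X P) F.
    \<forall>W t. opn W \<and> W \<subseteq> U \<and> t \<in> secs P W --> \<phi> W (sheafify_unit W t) = \<psi> W t"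
proof -
  let ?S = "sheafify X P"
  define \<phi> where "\<phi> W s = (THE c. c \<in> secs F W \<and> (\<forall>V d. opn V \<and> V \<subseteq> W \<and> d \<in> secs F V \<and>
      (\<exists>t\<in>secs P V. (\<forall>y\<in>V. s y = mgerm X P y V t) \<and> d = \<psi> V t) --> mres F W V c = d))" for W s
  have \<phi>: "\<phi> W s \<in> secs F W"
      "\<And>V t. opn V ==> V \<subseteq> W ==> t \<in> secs P V ==> (\<And>y. y \<in> V ==> s y = mgerm X P y V t) ==> mres F W V (\<phi> W s) = \<psi> V t"
    if W: "opn W" "W \<subseteq> U" and s: "s \<in> secs ?S W" for W s
  proof -
    have "\<exists>!c. c \<in> secs F W \<and> (\<forall>V d. opn V \<and> V \<subseteq> W \<and> d \<in> secs F V \<and>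
      (\<exists>t\<in>secs P V. (\<forall>y\<in>V. s y = mgerm X P y V t) \<and> d = \<psi> V t) --> mres F W V c = d)"
    proof (rule sheaf_glue_described[OF modules_sheaf[OF F] W(1)])
      fix x assume "x \<in> W"
      then obtain V a where V: "opn V" "x \<in> V" "V \<subseteq> W" "a \<in> secs P V" "\<And>y. y \<in> V ==> s y = mgerm X P y V a"
        by (rule sheafify_local[OF s]) blast
      have "\<psi> V a \<in> secs F V" using sheaf_hom_closed[OF \<psi> V(1) _ V(4)] V W by blast
      then show "\<exists>V c. opn V \<and> x \<in> V \<and> V \<subseteq> W \<and> c \<in> secs F V \<and>
         (\<exists>t\<in>secs P V. (\<forall>y\<in>V. s y = mgerm X P y V t) \<and> c = \<psi> V t)"
        using V by blast
    next
      fix V1 V2 c d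
      assume o: "opn V1" "opn V2" and sub: "V1 \<subseteq> W" "V2 \<subseteq> W"
        and "\<exists>t\<in>secs P V1. (\<forall>y\<in>V1. s y = mgerm X P y V1 t) \<and> c = \<psi> V1 t"
        and "\<exists>t\<in>secs P V2. (\<forall>y\<in>V2. s y = mgerm X P y V2 t) \<and> d = \<psi> V2 t"
      then obtain a b where a: "a \<in> secs P V1" "\<And>y. y \<in> V1 ==> s y = mgerm X P y V1 a" "c = \<psi> V1 a"
        and b: "b \<in> secs P V2" "\<And>y. y \<in> V2 ==> s y = mgerm X P y V2 b" "d = \<psi> V2 b" by blast
      have sU: "V1 \<subseteq> U" "V2 \<subseteq> U" using sub W by auto
      let ?V = "V1 \<inter> V2"
      have oV: "opn ?V" using o by blast
      have cc: "c \<in> secs F V1" "d \<in> secs F V2"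
        using sheaf_hom_closed[OF \<psi> o(1) sU(1) a(1)] sheaf_hom_closed[OF \<psi> o(2) sU(2) b(1)] a b by auto
      show "mres F V1 ?V c = mres F V2 ?V d"
      proof (rule modules_eqI[OF F oV])
        show "mres F V1 ?V c \<in> secs F ?V" "mres F V2 ?V d \<in> secs F ?V"
          using sheaf_lin(6)[OF F o(1) oV _ cc(1)] sheaf_lin(6)[OF F o(2) oV _ cc(2)] by auto
        fix x assume x: "x \<in> ?V"
        then have x1: "x \<in> V1" and germ_eq: "mgerm X P x V1 a = mgerm X P x V2 b" using a(2)[of x] b(2)[of x] by auto
        obtain Z where Z: "opn Z" "x \<in> Z" "Z \<subseteq> V1" "Z \<subseteq> V2" "mres P V1 Z a = mres P V2 Z b"
          using mgerm_eqD[OF o(1) x1 a(1) germ_eq] by (elim exE conjE)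
        have "mres F V1 Z c = mres F V2 Z d"
          using sheaf_hom_res[OF \<psi> o(1) Z(1,3) sU(1) a(1)] sheaf_hom_res[OF \<psi> o(2) Z(1,4) sU(2) b(1)] Z(5) a(3) b(3) by simp
        moreover have "Z \<subseteq> ?V" using Z by blast
        ultimately show "\<exists>V. opn V \<and> x \<in> V \<and> V \<subseteq> ?V \<and> mres F ?V V (mres F V1 ?V c) = mres F ?V V (mres F V2 ?V d)"
          using Z sheaf_lin(8)[OF F o(1) oV Z(1) _ _ cc(1)] sheaf_lin(8)[OF F o(2) oV Z(1) _ _ cc(2)]
          by (intro exI[of _ Z]) auto
      qed
    qed
    from theI'[OF this, folded \<phi>_def] have t: "\<phi> W s \<in> secs F W"
      "\<And>V d. opn V \<and> V \<subseteq> W \<and> d \<in> secs F V \<and>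
      (\<exists>t\<in>secs P V. (\<forall>y\<in>V. s y = mgerm X P y V t) \<and> d = \<psi> V t) ==> mres F W V (\<phi> W s) = d" by blast+
    show "\<phi> W s \<in> secs F W" by (rule t)
    fix V t assume V: "opn V" "V \<subseteq> W" "t \<in> secs P V" "\<And>y. y \<in> V ==> s y = mgerm X P y V t"
    have "\<psi> V t \<in> secs F V" using sheaf_hom_closed[OF \<psi> V(1) _ V(3)] V W by blast
    then show "mres F W V (\<phi> W s) = \<psi> V t" by (intro t(2)) (use V in blast)
  qed
  have hom: "on_sections U ?S \<phi> \<in> sheaf_hom X U ?S F"
  proof (rule on_sections_homI[OF sheafify_linear_presheaf])
    fix W s assume W: "opn W" "W \<subseteq> U" and s: "s \<in> secs ?S W"
    interpret F: module "sec X W" "msec F W" by (rule modules_module[OF F W(1)])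
    note LS = linear_presheafD[OF sheafify_linear_presheaf]
    show cl: "\<phi> W s \<in> secs F W" by (rule \<phi>(1)[OF W s])
    show "\<phi> W (s \<oplus>\<^bsub>msec ?S W\<^esub> t) = \<phi> W s \<oplus>\<^bsub>msec F W\<^esub> \<phi> W t" if t: "t \<in> secs ?S W" for t
    proof (rule modules_eqI[OF F W(1)])
      note st = LS(2)[OF W(1) s t]
      show "\<phi> W (s \<oplus>\<^bsub>msec ?S W\<^esub> t) \<in> secs F W" by (rule \<phi>(1)[OF W st])
      show "\<phi> W s \<oplus>\<^bsub>msec F W\<^esub> \<phi> W t \<in> secs F W" using \<phi>(1)[OF W s] \<phi>(1)[OF W t] by simp
      fix x assume "x \<in> W"
      then obtain V a b where V: "opn V" "x \<in> V" "V \<subseteq> W" "a \<in> secs P V" "b \<in> secs P V"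
        and e: "\<And>y. y \<in> V ==> s y = mgerm X P y V a" "\<And>y. y \<in> V ==> t y = mgerm X P y V b"
        by (rule sheafify_local2[OF s t]) blast
      have VU: "V \<subseteq> U" using V W by blast
      have "mres F W V (\<phi> W (s \<oplus>\<^bsub>msec ?S W\<^esub> t)) = \<psi> V (a \<oplus>\<^bsub>msec P V\<^esub> b)"
      proof (rule \<phi>(2)[OF W st V(1,3) L(2)[OF V(1,4,5)]])
        show "(s \<oplus>\<^bsub>msec ?S W\<^esub> t) y = mgerm X P y V (a \<oplus>\<^bsub>msec P V\<^esub> b)" if "y \<in> V" for y
          by (rule sheafify_add_germ[where s=s and t=t, OF V(1,3) that V(4,5) e[OF that]])
      qed
      also have "\<dots> = mres F W V (\<phi> W s) \<oplus>\<^bsub>msec F V\<^esub> mres F W V (\<phi> W t)"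
        using sheaf_hom_add[OF \<psi> V(1) VU V(4,5)] \<phi>(2)[OF W s V(1,3,4) e(1)] \<phi>(2)[OF W t V(1,3,5) e(2)] by simp
      also have "\<dots> = mres F W V (\<phi> W s \<oplus>\<^bsub>msec F W\<^esub> \<phi> W t)"
        by (rule sheaf_lin(4)[OF F W(1) V(1,3) \<phi>(1)[OF W s] \<phi>(1)[OF W t], symmetric])
      finally show "\<exists>V. opn V \<and> x \<in> V \<and> V \<subseteq> W \<and> mres F W V (\<phi> W (s \<oplus>\<^bsub>msec ?S W\<^esub> t)) = mres F W V (\<phi> W s \<oplus>\<^bsub>msec F W\<^esub> \<phi> W t)"
        using V by blast
    qed
    show "\<phi> W (c \<odot>\<^bsub>msec ?S W\<^esub> s) = c \<odot>\<^bsub>msec F W\<^esub> \<phi> W s" if c: "c \<in> funs W" for c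
    proof (rule modules_eqI[OF F W(1)])
      note st = LS(3)[OF W(1) c s]
      show "\<phi> W (c \<odot>\<^bsub>msec ?S W\<^esub> s) \<in> secs F W" by (rule \<phi>(1)[OF W st])
      show "c \<odot>\<^bsub>msec F W\<^esub> \<phi> W s \<in> secs F W" using cl c by simp
      fix x assume "x \<in> W"
      then obtain V a where V: "opn V" "x \<in> V" "V \<subseteq> W" "a \<in> secs P V"
        and e: "\<And>y. y \<in> V ==> s y = mgerm X P y V a"
        by (rule sheafify_local[OF s]) blast
      have VU: "V \<subseteq> U" using V W by blast
      note cV = res_closed[OF W(1) V(1,3) c]
      have "mres F W V (\<phi> W (c \<odot>\<^bsub>msec ?S W\<^esub> s)) = \<psi> V (res X W V c \<odot>\<^bsub>msec P V\<^esub> a)"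
      proof (rule \<phi>(2)[OF W st V(1,3) L(3)[OF V(1) cV V(4)]])
        show "(c \<odot>\<^bsub>msec ?S W\<^esub> s) y = mgerm X P y V (res X W V c \<odot>\<^bsub>msec P V\<^esub> a)" if "y \<in> V" for y
          by (rule sheafify_smult_germ[where s=s, OF W(1) V(1,3) that c V(4) e[OF that]])
      qed
      also have "\<dots> = mres F W V (c \<odot>\<^bsub>msec F W\<^esub> \<phi> W s)"
        using sheaf_hom_smult[OF \<psi> V(1) VU cV V(4)] \<phi>(2)[OF W s V(1,3,4) e] sheaf_lin(5)[OF F W(1) V(1,3) c cl] by simp
      finally show "\<exists>V. opn V \<and> x \<in> V \<and> V \<subseteq> W \<and> mres F W V (\<phi> W (c \<odot>\<^bsub>msec ?S W\<^esub> s)) = mres F W V (c \<odot>\<^bsub>msec F W\<^esub> \<phi> W s)"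
        using V by blast
    qed
    show "\<phi> W' (mres ?S W W' s) = mres F W W' (\<phi> W s)" if W': "opn W'" "W' \<subseteq> W" for W'
    proof (rule modules_eqI[OF F W'(1)])
      have W'U: "W' \<subseteq> U" using W W' by blast
      note st = LS(6)[OF W(1) W' s]
      show "\<phi> W' (mres ?S W W' s) \<in> secs F W'" by (rule \<phi>(1)[OF W'(1) W'U st])
      show "mres F W W' (\<phi> W s) \<in> secs F W'" by (rule sheaf_lin(6)[OF F W(1) W' cl])
      fix x assume "x \<in> W'"
      then obtain V a where V: "opn V" "x \<in> V" "V \<subseteq> W'" "a \<in> secs P V"
        and e: "\<And>y. y \<in> V ==> mres ?S W W' s y = mgerm X P y V a"
        by (rule sheafify_local[OF st]) blast
      have VW: "V \<subseteq> W" using V W' by blast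
      have e': "s y = mgerm X P y V a" if "y \<in> V" for y using e[OF that] that V by auto
      have "mres F W' V (\<phi> W' (mres ?S W W' s)) = \<psi> V a"
        by (rule \<phi>(2)[OF W'(1) W'U st V(1,3,4) e])
      also have "\<dots> = mres F W V (\<phi> W s)"
        by (rule \<phi>(2)[OF W s V(1) VW V(4) e', symmetric])
      also have "\<dots> = mres F W' V (mres F W W' (\<phi> W s))"
        by (rule sheaf_lin(8)[OF F W(1) W'(1) V(1,3) W'(2) cl, symmetric])
      finally show "\<exists>V. opn V \<and> x \<in> V \<and> V \<subseteq> W' \<and> mres F W' V (\<phi> W' (mres ?S W W' s)) = mres F W' V (mres F W W' (\<phi> W s))"
        using V by blast
    qed
  qed
  moreover have "on_sections U ?S \<phi> W (sheafify_unit W t) = \<psi> W t" if W: "opn W" "W \<subseteq> U" and t: "t \<in> secs P W" for W t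
  proof -
    note cl = sheafify_unit_closed[OF W(1) t]
    have "mres F W W (\<phi> W (sheafify_unit W t)) = \<psi> W t"
      by (rule \<phi>(2)[OF W cl W(1) subset_refl t]) (simp add: sheafify_unit_def)
    then show ?thesis using sheaf_lin(7)[OF F W(1) \<phi>(1)[OF W cl]] W cl by simp
  qed
  ultimately show ?thesis by blast
qed

text \<open>Homomorphisms into a sheaf factor uniquely through the sheafification, in particular those into
  the structure sheaf.\<close>

lemma dual_sheafify: "isomorphic X (dual_sheaf X (sheafify X P)) (dual_sheaf X P)"
proof -
  let ?S = "sheafify X P" and ?T = "topspace (tps X)"
  define pull where "pull U \<xi> = on_sections U P (\<lambda>W s. \<xi> W (sheafify_unit W s))" for U and \<xi> :: "'p set \<Rightarrow> ('p \<Rightarrow> ('p set \<times> 'm) set) \<Rightarrow> 'r"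
  have pull_hom: "pull U \<xi> \<in> sheaf_hom X U P unit_module" if U: "opn U" and \<xi>: "\<xi> \<in> sheaf_hom X U ?S unit_module" for U \<xi>
    unfolding pull_def
  proof (rule on_sections_homI[OF P])
    fix W s assume W: "opn W" "W \<subseteq> U" and s: "s \<in> secs P W"
    note us = sheafify_unit_closed[OF W(1) s]
    show "\<xi> W (sheafify_unit W s) \<in> secs unit_module W" by (rule sheaf_hom_closed[OF \<xi> W us])
    show "\<xi> W (sheafify_unit W (s \<oplus>\<^bsub>msec P W\<^esub> t)) = \<xi> W (sheafify_unit W s) \<oplus>\<^bsub>msec unit_module W\<^esub> \<xi> W (sheafify_unit W t)"
      if t: "t \<in> secs P W" for t
      unfolding sheafify_unit_add[OF W(1) s t] by (rule sheaf_hom_add[OF \<xi> W us sheafify_unit_closed[OF W(1) t]])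
    show "\<xi> W (sheafify_unit W (a \<odot>\<^bsub>msec P W\<^esub> s)) = a \<odot>\<^bsub>msec unit_module W\<^esub> \<xi> W (sheafify_unit W s)"
      if a: "a \<in> funs W" for a
      unfolding sheafify_unit_smult[OF W(1) a s] by (rule sheaf_hom_smult[OF \<xi> W a us])
    show "\<xi> W' (sheafify_unit W' (mres P W W' s)) = mres unit_module W W' (\<xi> W (sheafify_unit W s))"
      if W': "opn W'" "W' \<subseteq> W" for W'
      unfolding sheafify_unit_res[OF W(1) W' s] by (rule sheaf_hom_res[OF \<xi> W(1) W' W(2) us])
  qed
  have pull_inj: "inj_on (pull U) (sheaf_hom X U ?S unit_module)" for U
  proof (rule inj_onI)
    fix \<xi> \<eta> assume \<xi>: "\<xi> \<in> sheaf_hom X U ?S unit_module" and \<eta>: "\<eta> \<in> sheaf_hom X U ?S unit_module" and eq: "pull U \<xi> = pull U \<eta>"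
    show "\<xi> = \<eta>"
    proof (rule sheafify_hom_unique[OF unit_module_modules \<xi> \<eta>])
      fix W t assume W: "opn W" "W \<subseteq> U" and t: "t \<in> secs P W"
      have "pull U \<xi> W t = pull U \<eta> W t" by (simp add: eq)
      then show "\<xi> W (sheafify_unit W t) = \<eta> W (sheafify_unit W t)" using W t by (simp add: pull_def)
    qed
  qed
  have pull_surj: "\<exists>\<xi>\<in>sheaf_hom X U ?S unit_module. pull U \<xi> = \<chi>" if U: "opn U" and \<chi>: "\<chi> \<in> sheaf_hom X U P unit_module" for U \<chi>
  proof -
    obtain \<xi> where \<xi>: "\<xi> \<in> sheaf_hom X U ?S unit_module" "\<And>W t. opn W ==> W \<subseteq> U ==> t \<in> secs P W ==> \<xi> W (sheafify_unit W t) = \<chi> W t"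
      using sheafify_hom_extend[OF unit_module_modules \<chi>] by blast
    have "pull U \<xi> = \<chi>"
      by (rule sheaf_hom_eqI[OF pull_hom[OF U \<xi>(1)] \<chi>]) (simp add: pull_def \<xi>(2))
    then show ?thesis using \<xi> by blast
  qed
  have "on_sections ?T (dual_sheaf X ?S) pull \<in> homs X (dual_sheaf X ?S) (dual_sheaf X P)"
  proof (rule on_sections_homI[OF modules_linear_presheaf[OF dual_sheaf_modules[OF sheafify_linear_presheaf]]], unfold dual_sheaf_def)
    fix W \<xi> assume W: "opn W" and "\<xi> \<in> secs (hom_sheaf X ?S unit_module) W"
    then have \<xi>: "\<xi> \<in> sheaf_hom X W ?S unit_module" by simp
    show "pull W \<xi> \<in> secs (hom_sheaf X P unit_module) W" using pull_hom[OF W \<xi>] by simp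
    show "pull W (\<xi> \<oplus>\<^bsub>msec (hom_sheaf X ?S unit_module) W\<^esub> \<eta>) = pull W \<xi> \<oplus>\<^bsub>msec (hom_sheaf X P unit_module) W\<^esub> pull W \<eta>" for \<eta>
      unfolding hom_sheaf_add pull_def on_sections_def using sheafify_unit_closed
      by (auto simp: on_opens_def fun_eq_iff)
    show "pull W (a \<odot>\<^bsub>msec (hom_sheaf X ?S unit_module) W\<^esub> \<xi>) = a \<odot>\<^bsub>msec (hom_sheaf X P unit_module) W\<^esub> pull W \<xi>" for a
      unfolding hom_sheaf_smult pull_def on_sections_def using sheafify_unit_closed
      by (auto simp: on_opens_def fun_eq_iff)
    show "pull W' (mres (hom_sheaf X ?S unit_module) W W' \<xi>) = mres (hom_sheaf X P unit_module) W W' (pull W \<xi>)"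
      if "opn W'" "W' \<subseteq> W" for W'
      unfolding hom_sheaf_res pull_def on_sections_def using sheafify_unit_closed that
      by (auto simp: on_opens_def fun_eq_iff)
  qed
  moreover have "bij_betw (on_sections ?T (dual_sheaf X ?S) pull W) (secs (dual_sheaf X ?S) W) (secs (dual_sheaf X P) W)"
    if W: "opn W" "W \<subseteq> ?T" for W
  proof -
    have "bij_betw (pull W) (secs (dual_sheaf X ?S) W) (secs (dual_sheaf X P) W)"
      unfolding bij_betw_def dual_sheaf_def hom_sheaf_carrier
    proof (intro conjI pull_inj subset_antisym subsetI)
      show "\<chi> \<in> sheaf_hom X W P unit_module" if "\<chi> \<in> pull W ` sheaf_hom X W ?S unit_module" for \<chi>
        using that pull_hom[OF W(1)] by blast
      show "\<chi> \<in> pull W ` sheaf_hom X W ?S unit_module" if "\<chi> \<in> sheaf_hom X W P unit_module" for \<chi>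
        using pull_surj[OF W(1) that] by blast
    qed
    then show ?thesis by (rule bij_betw_cong[THEN iffD1, rotated]) (simp add: W)
  qed
  ultimately show ?thesis unfolding isomorphic_on_def by blast
qed

text \<open>A homomorphism that is bijective near every point is bijective on germs; a section of the target
  is lifted near each point, and the lifts have the same germs on overlaps.\<close>

lemma sheafify_isomorphic:
  assumes F: "sheaf_of_modules X F" and \<theta>: "\<theta> \<in> homs X P F"
    and loc: "\<And>x. x \<in> topspace (tps X) ==> \<exists>U. opn U \<and> x \<in> U \<and>
      (\<forall>W. opn W \<and> W \<subseteq> U --> bij_betw (\<theta> W) (secs P W) (secs F W))"
  shows "isomorphic X (sheafify X P) F"
proof -
  let ?S = "sheafify X P" and ?T = "topspace (tps X)"
  obtain \<phi> where \<phi>: "\<phi> \<in> homs X ?S F"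
    and \<phi>_unit': "\<forall>W t. opn W \<and> W \<subseteq> ?T \<and> t \<in> secs P W --> \<phi> W (sheafify_unit W t) = \<theta> W t"
    using sheafify_hom_extend[OF F \<theta>] by blast
  have \<phi>_unit: "\<phi> W (sheafify_unit W t) = \<theta> W t" if "opn W" "t \<in> secs P W" for W t
    using \<phi>_unit' that opn_topspace[OF that(1)] by simp
  from loc have "\<forall>x\<in>?T. \<exists>U. opn U \<and> x \<in> U \<and>
      (\<forall>W. opn W \<and> W \<subseteq> U --> bij_betw (\<theta> W) (secs P W) (secs F W))"
    by (rule ballI)
  from bchoice[OF this] obtain N where N': "\<forall>x\<in>?T. opn (N x) \<and> x \<in> N x \<and>
      (\<forall>W. opn W \<and> W \<subseteq> N x --> bij_betw (\<theta> W) (secs P W) (secs F W))"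
    by (rule exE)
  then have N: "\<And>x. x \<in> ?T ==> opn (N x)" "\<And>x. x \<in> ?T ==> x \<in> N x" by auto
  have bij: "\<And>x W. x \<in> ?T ==> opn W ==> W \<subseteq> N x ==> bij_betw (\<theta> W) (secs P W) (secs F W)"
    using N' by auto
  have "bij_betw (\<phi> U) (secs ?S U) (secs F U)" if U: "opn U" "U \<subseteq> ?T" for U
    unfolding bij_betw_def
  proof (intro conjI inj_onI subset_antisym subsetI)
    fix s t assume s: "s \<in> secs ?S U" and t: "t \<in> secs ?S U" and eq: "\<phi> U s = \<phi> U t"
    show "s = t"
    proof (rule extensionalityI[of _ U])
      show "s \<in> extensional U" "t \<in> extensional U" using s t unfolding sheafify_carrier_iff by auto
      fix x assume x: "x \<in> U"
      then have xT: "x \<in> ?T" using U by blast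
      obtain V a b where V: "opn V" "x \<in> V" "V \<subseteq> U" "a \<in> secs P V" "b \<in> secs P V"
        and e: "\<And>y. y \<in> V ==> s y = mgerm X P y V a" "\<And>y. y \<in> V ==> t y = mgerm X P y V b"
        by (rule sheafify_local2[OF s t x]) blast
      let ?W = "V \<inter> N x"
      have W: "opn ?W" "?W \<subseteq> V" "x \<in> ?W" "?W \<subseteq> U" "?W \<subseteq> N x" using V N[OF xT] by auto
      have a: "mres P V ?W a \<in> secs P ?W" and b: "mres P V ?W b \<in> secs P ?W"
        using L(6)[OF V(1) W(1,2)] V by auto
      have "mres ?S U ?W s = sheafify_unit ?W (mres P V ?W a)" "mres ?S U ?W t = sheafify_unit ?W (mres P V ?W b)"
        using e mgerm_res[OF V(1,4) W(1,2)] mgerm_res[OF V(1,5) W(1,2)] by (auto simp: sheafify_unit_def fun_eq_iff)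
      then have "\<theta> ?W (mres P V ?W a) = mres F U ?W (\<phi> U s)" "\<theta> ?W (mres P V ?W b) = mres F U ?W (\<phi> U t)"
        using sheaf_hom_res[OF \<phi> U(1) W(1,4) U(2) s] sheaf_hom_res[OF \<phi> U(1) W(1,4) U(2) t] \<phi>_unit[OF W(1) a] \<phi>_unit[OF W(1) b] by auto
      then have "\<theta> ?W (mres P V ?W a) = \<theta> ?W (mres P V ?W b)" using eq by simp
      then have "mres P V ?W a = mres P V ?W b"
        using bij[OF xT W(1,5)] a b unfolding bij_betw_def inj_on_def by blast
      then show "s x = t x"
        using e[OF V(2)] mgerm_res[OF V(1,4) W(1,2,3)] mgerm_res[OF V(1,5) W(1,2,3)] by simp
    qed
  next
    fix f assume "f \<in> \<phi> U ` secs ?S U"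
    then show "f \<in> secs F U" using sheaf_hom_closed[OF \<phi> U] by blast
  next
    fix f assume f: "f \<in> secs F U"
    define W where "W x = U \<inter> N x" for x
    have W: "opn (W x)" "x \<in> W x" "W x \<subseteq> U" "W x \<subseteq> N x" "x \<in> ?T" if "x \<in> U" for x
      using that U N[of x] unfolding W_def by auto
    have "\<exists>t. t \<in> secs P (W x) \<and> \<theta> (W x) t = mres F U (W x) f" if x: "x \<in> U" for x
    proof -
      have "mres F U (W x) f \<in> secs F (W x)" by (rule sheaf_lin(6)[OF F U(1) W(1,3)[OF x] f])
      then show ?thesis using bij[OF W(5,1,4)[OF x]] unfolding bij_betw_def by (metis imageE)
    qed
    then obtain g where g: "\<And>x. x \<in> U ==> g x \<in> secs P (W x)" "\<And>x. x \<in> U ==> \<theta> (W x) (g x) = mres F U (W x) f"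
      by metis
    define s where "s = (\<lambda>x\<in>U. mgerm X P x (W x) (g x))"
    have loc: "s y = mgerm X P y (W x) (g x)" if x: "x \<in> U" and y: "y \<in> W x" for x y
    proof -
      have yU: "y \<in> U" using W(3)[OF x] y by blast
      let ?Z = "W x \<inter> W y"
      have Z: "opn ?Z" "?Z \<subseteq> W x" "?Z \<subseteq> W y" "?Z \<subseteq> N x" "?Z \<subseteq> U" "y \<in> ?Z" using W[OF x] W[OF yU] y by auto
      have WT: "W x \<subseteq> ?T" "W y \<subseteq> ?T" using W[OF x] W[OF yU] U by auto
      have "\<theta> ?Z (mres P (W x) ?Z (g x)) = mres F (W x) ?Z (mres F U (W x) f)"
        using sheaf_hom_res[OF \<theta> W(1)[OF x] Z(1,2) WT(1) g(1)[OF x]] g(2)[OF x] by simp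
      also have "\<dots> = mres F (W y) ?Z (mres F U (W y) f)"
        using sheaf_lin(8)[OF F U(1) W(1)[OF x] Z(1,2) W(3)[OF x] f] sheaf_lin(8)[OF F U(1) W(1)[OF yU] Z(1,3) W(3)[OF yU] f] by simp
      also have "\<dots> = \<theta> ?Z (mres P (W y) ?Z (g y))"
        using sheaf_hom_res[OF \<theta> W(1)[OF yU] Z(1,3) WT(2) g(1)[OF yU]] g(2)[OF yU] by simp
      finally have "mres P (W x) ?Z (g x) = mres P (W y) ?Z (g y)"
        using bij[OF W(5)[OF x] Z(1,4)] L(6)[OF W(1)[OF x] Z(1,2) g(1)[OF x]] L(6)[OF W(1)[OF yU] Z(1,3) g(1)[OF yU]]
        unfolding bij_betw_def inj_on_def by blast
      then have "mgerm X P y (W x) (g x) = mgerm X P y (W y) (g y)"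
        by (rule mgerm_eqI[OF W(1)[OF x] g(1)[OF x] W(1)[OF yU] g(1)[OF yU] Z(1,6,2,3)])
      then show ?thesis using yU by (simp add: s_def)
    qed
    have s: "s \<in> secs ?S U"
      unfolding sheafify_carrier_iff
    proof (intro conjI ballI)
      show "s \<in> extensional U" by (simp add: s_def)
      fix x assume x: "x \<in> U"
      show "\<exists>V t. opn V \<and> x \<in> V \<and> V \<subseteq> U \<and> t \<in> secs P V \<and> (\<forall>y\<in>V. s y = mgerm X P y V t)"
        using W[OF x] g(1)[OF x] loc[OF x] by blast
    qed
    have "\<phi> U s = f"
    proof (rule modules_eqI[OF F U(1) sheaf_hom_closed[OF \<phi> U s] f])
      fix x assume x: "x \<in> U"
      have "mres ?S U (W x) s = sheafify_unit (W x) (g x)"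
        using loc[OF x] by (auto simp: sheafify_unit_def fun_eq_iff)
      then have "mres F U (W x) (\<phi> U s) = mres F U (W x) f"
        using sheaf_hom_res[OF \<phi> U(1) W(1,3)[OF x] U(2) s] \<phi>_unit[OF W(1)[OF x] g(1)[OF x]] g(2)[OF x] by simp
      then show "\<exists>V. opn V \<and> x \<in> V \<and> V \<subseteq> U \<and> mres F U V (\<phi> U s) = mres F U V f" using W[OF x] by blast
    qed
    then show "f \<in> \<phi> U ` secs ?S U" using s by blast
  qed
  then show ?thesis unfolding isomorphic_on_def using \<phi> by blast
qed

end

end

section \<open>Free modules and quotients\<close>

lemma free_module_simps [simp]:
  "carrier (free_module R I) = {f. (\<forall>i. f i \<in> carrier R) \<and> finite {i. f i \<noteq> \<zero>\<^bsub>R\<^esub>} \<and> (\<forall>i. i \<notin> I --> f i = \<zero>\<^bsub>R\<^esub>)}"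
  "\<zero>\<^bsub>free_module R I\<^esub> = (\<lambda>i. \<zero>\<^bsub>R\<^esub>)"
  "f \<oplus>\<^bsub>free_module R I\<^esub> g = (\<lambda>i. f i \<oplus>\<^bsub>R\<^esub> g i)"
  "a \<odot>\<^bsub>free_module R I\<^esub> f = (\<lambda>i. a \<otimes>\<^bsub>R\<^esub> f i)"
  by (simp_all add: free_module_def mk_module_def)

lemma free_module_module:
  assumes "cring R"
  shows "module R (free_module R I)"
proof -
  interpret cring R by fact
  have supp: "finite {i. f i \<oplus>\<^bsub>R\<^esub> g i \<noteq> \<zero>\<^bsub>R\<^esub>}"
    if "finite {i. f i \<noteq> \<zero>\<^bsub>R\<^esub>}" "finite {i. g i \<noteq> \<zero>\<^bsub>R\<^esub>}" for f g :: "'b \<Rightarrow> 'a"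
    by (rule finite_subset[OF _ finite_UnI[OF that]]) auto
  have supp_smult: "finite {i. a \<otimes>\<^bsub>R\<^esub> f i \<noteq> \<zero>\<^bsub>R\<^esub>}"
    if "finite {i. f i \<noteq> \<zero>\<^bsub>R\<^esub>}" "a \<in> carrier R" for f :: "'b \<Rightarrow> 'a" and a
    by (rule finite_subset[OF _ that(1)]) (use that in auto)
  show ?thesis
  proof (rule moduleI)
    show "abelian_group (free_module R I)"
    proof (rule abelian_groupI)
      fix f g h assume f: "f \<in> carrier (free_module R I)" and g: "g \<in> carrier (free_module R I)" and h: "h \<in> carrier (free_module R I)"
      show "f \<oplus>\<^bsub>free_module R I\<^esub> g \<in> carrier (free_module R I)" using f g supp by auto
      show "f \<oplus>\<^bsub>free_module R I\<^esub> g = g \<oplus>\<^bsub>free_module R I\<^esub> f" using f g by (auto simp: a_comm)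
      show "f \<oplus>\<^bsub>free_module R I\<^esub> g \<oplus>\<^bsub>free_module R I\<^esub> h = f \<oplus>\<^bsub>free_module R I\<^esub> (g \<oplus>\<^bsub>free_module R I\<^esub> h)"
        using f g h by (auto simp: a_assoc)
      show "\<zero>\<^bsub>free_module R I\<^esub> \<oplus>\<^bsub>free_module R I\<^esub> f = f" using f by auto
      have "(\<lambda>i. \<ominus>\<^bsub>R\<^esub> f i) \<in> carrier (free_module R I)"
        using f by (auto intro: rev_finite_subset)
      moreover have "(\<lambda>i. \<ominus>\<^bsub>R\<^esub> f i) \<oplus>\<^bsub>free_module R I\<^esub> f = \<zero>\<^bsub>free_module R I\<^esub>"
        using f by (auto simp: l_neg)
      ultimately show "\<exists>g\<in>carrier (free_module R I). g \<oplus>\<^bsub>free_module R I\<^esub> f = \<zero>\<^bsub>free_module R I\<^esub>" by blast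
    qed simp
  qed (use is_cring supp_smult in \<open>auto simp: l_distr r_distr m_assoc\<close>)
qed

lemma basis_vector_closed:
  assumes "cring R" "i \<in> I"
  shows "basis_vector R i \<in> carrier (free_module R I)"
proof -
  interpret cring R by fact
  have "finite {j. basis_vector R i j \<noteq> \<zero>\<^bsub>R\<^esub>}"
    by (rule finite_subset[of _ "{i}"]) (auto simp: basis_vector_def)
  then show ?thesis using assms by (auto simp: basis_vector_def)
qed

text \<open>Induction on the support, adding one multiple of a basis vector at a time.\<close>

lemma free_module_induct [consumes 2, case_names base step]:
  assumes R: "cring R" and f: "f \<in> carrier (free_module R I)"
    and base: "P \<zero>\<^bsub>free_module R I\<^esub>"
    and step: "\<And>f a i. f \<in> carrier (free_module R I) ==> a \<in> carrier R ==> i \<in> I ==> P f ==>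
      P (f \<oplus>\<^bsub>free_module R I\<^esub> (a \<odot>\<^bsub>free_module R I\<^esub> basis_vector R i))"
  shows "P f"
proof -
  interpret cring R by fact
  have "finite {i. f i \<noteq> \<zero>\<^bsub>R\<^esub>}" using f by simp
  then show "P f" using f
  proof (induction "{i. f i \<noteq> \<zero>\<^bsub>R\<^esub>}" arbitrary: f rule: finite_induct)
    case empty
    then have "f = \<zero>\<^bsub>free_module R I\<^esub>" by auto
    with base show ?case by (simp only:)
  next
    case (insert i F)
    let ?g = "f(i := \<zero>\<^bsub>R\<^esub>)"
    have F: "F = {j. ?g j \<noteq> \<zero>\<^bsub>R\<^esub>}" using insert(2,4) by auto
    have "finite {j. ?g j \<noteq> \<zero>\<^bsub>R\<^esub>}" using insert(1) F by simp
    then have g: "?g \<in> carrier (free_module R I)" using insert.prems by auto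
    have i: "i \<in> I" using insert(4) insert.prems by auto
    have "P (?g \<oplus>\<^bsub>free_module R I\<^esub> (f i \<odot>\<^bsub>free_module R I\<^esub> basis_vector R i))"
      using step[OF g _ i insert(3)[OF F g]] insert.prems by auto
    moreover have "?g \<oplus>\<^bsub>free_module R I\<^esub> (f i \<odot>\<^bsub>free_module R I\<^esub> basis_vector R i) = f"
      using insert.prems by (auto simp: fun_eq_iff basis_vector_def)
    ultimately show ?case by simp
  qed
qed

text \<open>The linear map with prescribed values \<open>h\<close> on the basis.\<close>

definition free_lift :: "'r ring \<Rightarrow> ('r, 'n) module \<Rightarrow> ('i \<Rightarrow> 'n) \<Rightarrow> ('i \<Rightarrow> 'r) \<Rightarrow> 'n" where
  "free_lift R N h f = finsum N (\<lambda>i. f i \<odot>\<^bsub>N\<^esub> h i) {i. f i \<noteq> \<zero>\<^bsub>R\<^esub>}"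

context
  fixes R :: "'r ring" (structure) and M :: "('r, 'm) module"
  assumes module_M: "module R M"
begin

interpretation module R M by (rule module_M)

context
  fixes I :: "'i set" and h :: "'i \<Rightarrow> 'm"
  assumes h: "h \<in> I \<rightarrow> carrier M"
begin

lemma free_lift_finite:
  assumes f: "f \<in> carrier (free_module R I)" and A: "finite A" "{i. f i \<noteq> \<zero>} \<subseteq> A" "A \<subseteq> I"
  shows "free_lift R M h f = finsum M (\<lambda>i. f i \<odot>\<^bsub>M\<^esub> h i) A"
  unfolding free_lift_def
  by (rule M.add.finprod_mono_neutral_cong_left) (use A f h in \<open>auto simp: Pi_iff subset_iff\<close>)

lemma free_supp: "f \<in> carrier (free_module R I) ==> finite {i. f i \<noteq> \<zero>} \<and> {i. f i \<noteq> \<zero>} \<subseteq> I"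
  by auto

lemma free_lift_closed:
  assumes f: "f \<in> carrier (free_module R I)"
  shows "free_lift R M h f \<in> carrier M"
  unfolding free_lift_def by (rule M.finsum_closed) (use f h in \<open>auto simp: Pi_iff\<close>)

lemma free_lift_add:
  assumes f: "f \<in> carrier (free_module R I)" and g: "g \<in> carrier (free_module R I)"
  shows "free_lift R M h (f \<oplus>\<^bsub>free_module R I\<^esub> g) = free_lift R M h f \<oplus>\<^bsub>M\<^esub> free_lift R M h g"
proof -
  interpret F: module R "free_module R I" by (rule free_module_module[OF R.is_cring])
  let ?A = "{i. f i \<noteq> \<zero>} \<union> {i. g i \<noteq> \<zero>}"
  have A: "finite ?A" "?A \<subseteq> I" using free_supp[OF f] free_supp[OF g] by auto
  have fg: "f \<oplus>\<^bsub>free_module R I\<^esub> g \<in> carrier (free_module R I)" using F.M.a_closed[OF f g] .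
  have sub: "{i. (f \<oplus>\<^bsub>free_module R I\<^esub> g) i \<noteq> \<zero>} \<subseteq> ?A" using f g by auto
  have hA: "h i \<in> carrier M" if "i \<in> ?A" for i using that A h by auto
  have "free_lift R M h (f \<oplus>\<^bsub>free_module R I\<^esub> g) = finsum M (\<lambda>i. (f i \<oplus> g i) \<odot>\<^bsub>M\<^esub> h i) ?A"
    unfolding free_lift_finite[OF fg A(1) sub A(2)] by simp
  also have "\<dots> = finsum M (\<lambda>i. f i \<odot>\<^bsub>M\<^esub> h i \<oplus>\<^bsub>M\<^esub> g i \<odot>\<^bsub>M\<^esub> h i) ?A"
    by (rule M.finsum_cong') (use f g hA in \<open>auto simp: smult_l_distr\<close>)
  also have "\<dots> = finsum M (\<lambda>i. f i \<odot>\<^bsub>M\<^esub> h i) ?A \<oplus>\<^bsub>M\<^esub> finsum M (\<lambda>i. g i \<odot>\<^bsub>M\<^esub> h i) ?A"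
    by (rule M.finsum_addf) (use f g hA in auto)
  finally show ?thesis
    using free_lift_finite[OF f A(1) _ A(2)] free_lift_finite[OF g A(1) _ A(2)] by simp
qed

lemma free_lift_smult:
  assumes a: "a \<in> carrier R" and f: "f \<in> carrier (free_module R I)"
  shows "free_lift R M h (a \<odot>\<^bsub>free_module R I\<^esub> f) = a \<odot>\<^bsub>M\<^esub> free_lift R M h f"
proof -
  interpret F: module R "free_module R I" by (rule free_module_module[OF R.is_cring])
  let ?A = "{i. f i \<noteq> \<zero>}"
  have A: "finite ?A" "?A \<subseteq> I" using free_supp[OF f] by auto
  have af: "a \<odot>\<^bsub>free_module R I\<^esub> f \<in> carrier (free_module R I)" using F.smult_closed[OF a f] .
  have sub: "{i. (a \<odot>\<^bsub>free_module R I\<^esub> f) i \<noteq> \<zero>} \<subseteq> ?A" using f a by auto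
  have hA: "h i \<in> carrier M" if "i \<in> ?A" for i using that A h by auto
  have "free_lift R M h (a \<odot>\<^bsub>free_module R I\<^esub> f) = finsum M (\<lambda>i. (a \<otimes> f i) \<odot>\<^bsub>M\<^esub> h i) ?A"
    unfolding free_lift_finite[OF af A(1) sub A(2)] by simp
  also have "\<dots> = finsum M (\<lambda>i. a \<odot>\<^bsub>M\<^esub> (f i \<odot>\<^bsub>M\<^esub> h i)) ?A"
    by (rule M.finsum_cong') (use a f hA in \<open>auto simp: smult_assoc1\<close>)
  also have "\<dots> = a \<odot>\<^bsub>M\<^esub> finsum M (\<lambda>i. f i \<odot>\<^bsub>M\<^esub> h i) ?A"
    by (rule finsum_smult_ldistr[symmetric]) (use a f hA A in auto)
  finally show ?thesis by (simp add: free_lift_def)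
qed

lemma free_lift_basis:
  assumes i: "i \<in> I"
  shows "free_lift R M h (basis_vector R i) = h i"
proof -
  have hi: "h i \<in> carrier M" using h i by auto
  have "free_lift R M h (basis_vector R i) = finsum M (\<lambda>j. basis_vector R i j \<odot>\<^bsub>M\<^esub> h j) {i}"
    by (rule free_lift_finite[OF basis_vector_closed[OF R.is_cring i]]) (use i in \<open>auto simp: basis_vector_def\<close>)
  then show ?thesis using hi by (simp add: basis_vector_def)
qed

lemma free_lift_zero: "free_lift R M h \<zero>\<^bsub>free_module R I\<^esub> = \<zero>\<^bsub>M\<^esub>"
  by (simp add: free_lift_def)

end

subsection \<open>Quotients\<close>

context
  fixes N assumes N: "submodule N R M"
begin

lemma submodule_abelian_subgroup: "abelian_subgroup N M"
  by (intro abelian_subgroupI3 additive_subgroupI M.abelian_group_axioms submodule.axioms(1)[OF N])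

interpretation N: abelian_subgroup N M by (rule submodule_abelian_subgroup)

lemma coset_eqI:
  assumes x: "x \<in> carrier M" and n: "n \<in> N"
  shows "a_r_coset M N (n \<oplus>\<^bsub>M\<^esub> x) = a_r_coset M N x"
proof -
  have "n \<in> carrier M" using n N.a_subset by blast
  then show ?thesis
    using M.a_coset_add_assoc[of N n x] M.a_coset_join2[OF _ N.a_subgroup n] x N.a_subset by simp
qed

lemma coset_eq_iff:
  assumes x: "x \<in> carrier M" and y: "y \<in> carrier M"
  shows "a_r_coset M N x = a_r_coset M N y \<longleftrightarrow> x \<ominus>\<^bsub>M\<^esub> y \<in> N"
proof
  assume "a_r_coset M N x = a_r_coset M N y"
  then have "x \<in> a_r_coset M N y" using N.a_rcos_self[OF x] by simp
  then obtain n where n: "n \<in> N" "x = n \<oplus>\<^bsub>M\<^esub> y" unfolding a_r_coset_def' by blast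
  then show "x \<ominus>\<^bsub>M\<^esub> y \<in> N" using y N.a_Hcarr[OF n(1)] by (simp add: M.minus_eq M.a_assoc M.r_neg)
next
  assume d: "x \<ominus>\<^bsub>M\<^esub> y \<in> N"
  have "x \<ominus>\<^bsub>M\<^esub> y \<oplus>\<^bsub>M\<^esub> y = x" using x y by (simp add: M.minus_eq M.a_assoc M.l_neg)
  with coset_eqI[OF y d] show "a_r_coset M N x = a_r_coset M N y" by simp
qed

lemma quotient_carrier: "carrier (quotient_module M N) = {a_r_coset M N x | x. x \<in> carrier M}"
  by (auto simp: quotient_module_def mk_module_def A_RCOSETS_def')

lemma quotient_add:
  "x \<in> carrier M ==> y \<in> carrier M ==>
    a_r_coset M N x \<oplus>\<^bsub>quotient_module M N\<^esub> a_r_coset M N y = a_r_coset M N (x \<oplus>\<^bsub>M\<^esub> y)"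
  by (simp add: quotient_module_def mk_module_def N.a_rcos_sum)

end

lemma submodule_Inter:
  assumes "S \<noteq> {}" and "\<And>N. N \<in> S ==> submodule N R M"
  shows "submodule (\<Inter>S) R M"
proof (rule submoduleI)
  note E = submoduleE[OF assms(2)]
  show "\<Inter>S \<subseteq> carrier M" using assms(1) E(1) by blast
  show "\<zero>\<^bsub>M\<^esub> \<in> \<Inter>S"
  proof
    fix N assume "N \<in> S"
    then interpret N: abelian_subgroup N M by (intro submodule_abelian_subgroup assms)
    show "\<zero>\<^bsub>M\<^esub> \<in> N" by simp
  qed
  show "\<ominus>\<^bsub>M\<^esub> x \<in> \<Inter>S" if "x \<in> \<Inter>S" for x
    by (rule InterI) (use that E(3) in blast)
  show "x \<oplus>\<^bsub>M\<^esub> y \<in> \<Inter>S" if "x \<in> \<Inter>S" "y \<in> \<Inter>S" for x y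
  proof (rule InterI)
    fix N assume N: "N \<in> S"
    interpret N: abelian_subgroup N M by (rule submodule_abelian_subgroup[OF assms(2)[OF N]])
    show "x \<oplus>\<^bsub>M\<^esub> y \<in> N" using that N by auto
  qed
  show "a \<odot>\<^bsub>M\<^esub> x \<in> \<Inter>S" if "a \<in> carrier R" "x \<in> \<Inter>S" for a x
    by (rule InterI) (use that submodule.smult_closed[OF assms(2)] in blast)
qed

lemma span_submodule:
  assumes "S \<subseteq> carrier M"
  shows "submodule (span_module R M S) R M"
  unfolding span_module_def
  by (rule submodule_Inter) (use assms carrier_is_submodule in auto)

lemma span_incl: "S \<subseteq> span_module R M S"
  unfolding span_module_def by blast

lemma span_least: "submodule N R M ==> S \<subseteq> N ==> span_module R M S \<subseteq> N"
  unfolding span_module_def by blast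

end

lemma Union_image_coset:
  fixes R :: "'r ring" and R' :: "'s ring" and M :: "('r, 'm) module" and M' :: "('s, 'n) module"
  assumes R: "module R M" and N: "submodule N R M" and R': "module R' M'" and N': "submodule N' R' M'"
    and g: "\<And>y. y \<in> carrier M ==> g y \<in> carrier M'"
    and add: "\<And>y z. y \<in> carrier M ==> z \<in> carrier M ==> g (y \<oplus>\<^bsub>M\<^esub> z) = g y \<oplus>\<^bsub>M'\<^esub> g z"
    and NN': "\<And>n. n \<in> N ==> g n \<in> N'" and x: "x \<in> carrier M"
  shows "(\<Union>y\<in>a_r_coset M N x. a_r_coset M' N' (g y)) = a_r_coset M' N' (g x)"
proof -
  interpret N: abelian_subgroup N M by (rule submodule_abelian_subgroup[OF R N])
  have "a_r_coset M' N' (g y) = a_r_coset M' N' (g x)" if y: "y \<in> a_r_coset M N x" for y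
  proof -
    obtain n where n: "n \<in> N" "y = n \<oplus>\<^bsub>M\<^esub> x" using y unfolding a_r_coset_def' by blast
    then show ?thesis
      using coset_eqI[OF R' N' g[OF x] NN'[OF n(1)]] add[OF N.a_Hcarr[OF n(1)] x] by simp
  qed
  moreover have "a_r_coset M N x \<noteq> {}" using N.a_rcos_self[OF x] by blast
  ultimately show ?thesis by (intro SUP_eq_const)
qed

lemma quotient_smult:
  fixes R :: "'r ring" and M :: "('r, 'm) module"
  assumes M: "module R M" and N: "submodule N R M" and "a \<in> carrier R" "x \<in> carrier M"
  shows "a \<odot>\<^bsub>quotient_module M N\<^esub> a_r_coset M N x = a_r_coset M N (a \<odot>\<^bsub>M\<^esub> x)"
proof -
  interpret module R M by (rule M)
  have "(\<Union>y\<in>a_r_coset M N x. a_r_coset M N (a \<odot>\<^bsub>M\<^esub> y)) = a_r_coset M N (a \<odot>\<^bsub>M\<^esub> x)"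
    by (rule Union_image_coset[OF M N M N])
      (use assms submodule.smult_closed[OF N] in \<open>auto simp: smult_r_distr\<close>)
  then show ?thesis by (simp add: quotient_module_def mk_module_def)
qed

text \<open>The elements that \<open>g\<close> maps into \<open>N'\<close> form a submodule containing the generators.\<close>

lemma span_image_subset:
  fixes R :: "'r ring" and R' :: "'s ring" and M :: "('r, 'm) module" and M' :: "('s, 'n) module"
  assumes M: "module R M" and M': "module R' M'" and \<sigma>: "\<And>a. a \<in> carrier R ==> \<sigma> a \<in> carrier R'"
    and S: "S \<subseteq> carrier M" and N': "submodule N' R' M'"
    and g: "\<And>x. x \<in> carrier M ==> g x \<in> carrier M'"
    and add: "\<And>x y. x \<in> carrier M ==> y \<in> carrier M ==> g (x \<oplus>\<^bsub>M\<^esub> y) = g x \<oplus>\<^bsub>M'\<^esub> g y"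
    and smult: "\<And>a x. a \<in> carrier R ==> x \<in> carrier M ==> g (a \<odot>\<^bsub>M\<^esub> x) = \<sigma> a \<odot>\<^bsub>M'\<^esub> g x"
    and gen: "\<And>x. x \<in> S ==> g x \<in> N'" and x: "x \<in> span_module R M S"
  shows "g x \<in> N'"
proof -
  interpret M: module R M by fact
  interpret M': module R' M' by fact
  interpret N': abelian_subgroup N' M' by (rule submodule_abelian_subgroup[OF M' N'])
  have "g (\<zero>\<^bsub>M\<^esub> \<oplus>\<^bsub>M\<^esub> \<zero>\<^bsub>M\<^esub>) = g \<zero>\<^bsub>M\<^esub> \<oplus>\<^bsub>M'\<^esub> g \<zero>\<^bsub>M\<^esub>" by (rule add) simp_all
  then have "g \<zero>\<^bsub>M\<^esub> = g \<zero>\<^bsub>M\<^esub> \<oplus>\<^bsub>M'\<^esub> g \<zero>\<^bsub>M\<^esub>" by (simp only: M.M.l_zero[OF M.M.zero_closed])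
  then have zero: "g \<zero>\<^bsub>M\<^esub> = \<zero>\<^bsub>M'\<^esub>"
    by (rule M'.M.add.r_cancel_one'[OF g g, THEN iffD1, OF M.M.zero_closed M.M.zero_closed])
  have "submodule {y \<in> carrier M. g y \<in> N'} R M"
  proof (rule M.submoduleI)
    show "\<ominus>\<^bsub>M\<^esub> a \<in> {y \<in> carrier M. g y \<in> N'}" if "a \<in> {y \<in> carrier M. g y \<in> N'}" for a
    proof -
      have a: "a \<in> carrier M" "g a \<in> N'" using that by auto
      have "g (\<ominus>\<^bsub>M\<^esub> a \<oplus>\<^bsub>M\<^esub> a) = g (\<ominus>\<^bsub>M\<^esub> a) \<oplus>\<^bsub>M'\<^esub> g a" by (rule add) (use a in simp_all)
      then have "g (\<ominus>\<^bsub>M\<^esub> a) \<oplus>\<^bsub>M'\<^esub> g a = \<zero>\<^bsub>M'\<^esub>" by (simp only: M.M.l_neg[OF a(1)] zero)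
      then have "\<ominus>\<^bsub>M'\<^esub> g a = g (\<ominus>\<^bsub>M\<^esub> a)"
        by (rule M'.M.minus_equality[OF _ g[OF a(1)] g]) (use a in simp)
      moreover have "\<ominus>\<^bsub>M'\<^esub> g a \<in> N'" using N'.a_inv_closed[OF a(2)] .
      ultimately show ?thesis using a by simp
    qed
    show "{y \<in> carrier M. g y \<in> N'} \<subseteq> carrier M" by blast
    show "\<zero>\<^bsub>M\<^esub> \<in> {y \<in> carrier M. g y \<in> N'}" using zero by simp
    show "a \<oplus>\<^bsub>M\<^esub> b \<in> {y \<in> carrier M. g y \<in> N'}"
      if "a \<in> {y \<in> carrier M. g y \<in> N'}" "b \<in> {y \<in> carrier M. g y \<in> N'}" for a b
      using that add[of a b] by simp
    show "a \<odot>\<^bsub>M\<^esub> y \<in> {y \<in> carrier M. g y \<in> N'}"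
      if "a \<in> carrier R" "y \<in> {y \<in> carrier M. g y \<in> N'}" for a y
      using that smult[of a y] submodule.smult_closed[OF N' \<sigma>[of a], of "g y"] by simp
  qed
  then have "span_module R M S \<subseteq> {y \<in> carrier M. g y \<in> N'}"
    by (rule span_least[OF M]) (use S gen in auto)
  then show ?thesis using x by blast
qed

subsection \<open>Functoriality of free modules\<close>

context
  fixes R R' :: "'r ring" and \<sigma> :: "'r \<Rightarrow> 'r" and \<rho> :: "'i \<Rightarrow> 'i" and I I' :: "'i set"
  assumes R: "cring R" and R': "cring R'" and \<sigma>: "\<sigma> \<in> ring_hom R R'" and \<rho>: "\<And>i. i \<in> I ==> \<rho> i \<in> I'"
begin

interpretation R: cring R by (rule R)
interpretation R': cring R' by (rule R')
interpretation F: module R "free_module R I" by (rule free_module_module[OF R])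
interpretation F': module R' "free_module R' I'" by (rule free_module_module[OF R'])

private lemma \<sigma>_simps [simp]:
  "a \<in> carrier R ==> \<sigma> a \<in> carrier R'"
  "a \<in> carrier R ==> b \<in> carrier R ==> \<sigma> (a \<oplus>\<^bsub>R\<^esub> b) = \<sigma> a \<oplus>\<^bsub>R'\<^esub> \<sigma> b"
  "a \<in> carrier R ==> b \<in> carrier R ==> \<sigma> (a \<otimes>\<^bsub>R\<^esub> b) = \<sigma> a \<otimes>\<^bsub>R'\<^esub> \<sigma> b"
  "\<sigma> \<one>\<^bsub>R\<^esub> = \<one>\<^bsub>R'\<^esub>"
  using \<sigma> by (auto simp: ring_hom_def)

private lemma \<sigma>_zero [simp]: "\<sigma> \<zero>\<^bsub>R\<^esub> = \<zero>\<^bsub>R'\<^esub>"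
  by (rule ring_hom_zero[OF \<sigma> R.ring_axioms R'.ring_axioms])

lemma free_map_finite:
  assumes f: "f \<in> carrier (free_module R I)" and A: "finite A" "{i. f i \<noteq> \<zero>\<^bsub>R\<^esub>} \<subseteq> A"
  shows "free_map R R' \<sigma> \<rho> f j = finsum R' (\<lambda>i. \<sigma> (f i)) {i \<in> A. \<rho> i = j}"
  unfolding free_map_def
  by (rule R'.add.finprod_mono_neutral_cong_left) (use A f in auto)

lemma free_map_closed:
  assumes f: "f \<in> carrier (free_module R I)"
  shows "free_map R R' \<sigma> \<rho> f \<in> carrier (free_module R' I')"
proof -
  have "free_map R R' \<sigma> \<rho> f j \<in> carrier R'" for j
    unfolding free_map_def by (rule R'.finsum_closed) (use f in auto)
  moreover have z: "free_map R R' \<sigma> \<rho> f j = \<zero>\<^bsub>R'\<^esub>" if "j \<notin> \<rho> ` {i. f i \<noteq> \<zero>\<^bsub>R\<^esub>}" for j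
  proof -
    have "{i. f i \<noteq> \<zero>\<^bsub>R\<^esub> \<and> \<rho> i = j} = {}" using that by auto
    then show ?thesis unfolding free_map_def by (simp only: R'.finsum_empty)
  qed
  moreover have "finite {j. free_map R R' \<sigma> \<rho> f j \<noteq> \<zero>\<^bsub>R'\<^esub>}"
    by (rule finite_subset[of _ "\<rho> ` {i. f i \<noteq> \<zero>\<^bsub>R\<^esub>}"]) (use f z in auto)
  moreover have "free_map R R' \<sigma> \<rho> f j = \<zero>\<^bsub>R'\<^esub>" if "j \<notin> I'" for j
    by (rule z) (use \<rho> that f in auto)
  ultimately show ?thesis by simp
qed

lemma free_map_add:
  assumes f: "f \<in> carrier (free_module R I)" and g: "g \<in> carrier (free_module R I)"
  shows "free_map R R' \<sigma> \<rho> (f \<oplus>\<^bsub>free_module R I\<^esub> g)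
    = free_map R R' \<sigma> \<rho> f \<oplus>\<^bsub>free_module R' I'\<^esub> free_map R R' \<sigma> \<rho> g"
proof -
  let ?A = "{i. f i \<noteq> \<zero>\<^bsub>R\<^esub>} \<union> {i. g i \<noteq> \<zero>\<^bsub>R\<^esub>}"
  have A: "finite ?A" using f g by simp
  have sub: "{i. (f \<oplus>\<^bsub>free_module R I\<^esub> g) i \<noteq> \<zero>\<^bsub>R\<^esub>} \<subseteq> ?A" using f g by auto
  have fg: "f \<oplus>\<^bsub>free_module R I\<^esub> g \<in> carrier (free_module R I)" using F.M.a_closed[OF f g] .
  have "free_map R R' \<sigma> \<rho> (f \<oplus>\<^bsub>free_module R I\<^esub> g) j = free_map R R' \<sigma> \<rho> f j \<oplus>\<^bsub>R'\<^esub> free_map R R' \<sigma> \<rho> g j" for j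
  proof -
    have "free_map R R' \<sigma> \<rho> (f \<oplus>\<^bsub>free_module R I\<^esub> g) j = finsum R' (\<lambda>i. \<sigma> (f i \<oplus>\<^bsub>R\<^esub> g i)) {i \<in> ?A. \<rho> i = j}"
      unfolding free_map_finite[OF fg A sub] by simp
    also have "\<dots> = finsum R' (\<lambda>i. \<sigma> (f i) \<oplus>\<^bsub>R'\<^esub> \<sigma> (g i)) {i \<in> ?A. \<rho> i = j}"
      by (rule R'.finsum_cong') (use f g in auto)
    also have "\<dots> = finsum R' (\<lambda>i. \<sigma> (f i)) {i \<in> ?A. \<rho> i = j} \<oplus>\<^bsub>R'\<^esub> finsum R' (\<lambda>i. \<sigma> (g i)) {i \<in> ?A. \<rho> i = j}"
      by (rule R'.finsum_addf) (use f g in auto)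
    finally show ?thesis using free_map_finite[OF f A Un_upper1] free_map_finite[OF g A Un_upper2] by simp
  qed
  then show ?thesis by auto
qed

lemma free_map_smult:
  assumes a: "a \<in> carrier R" and f: "f \<in> carrier (free_module R I)"
  shows "free_map R R' \<sigma> \<rho> (a \<odot>\<^bsub>free_module R I\<^esub> f) = \<sigma> a \<odot>\<^bsub>free_module R' I'\<^esub> free_map R R' \<sigma> \<rho> f"
proof -
  let ?A = "{i. f i \<noteq> \<zero>\<^bsub>R\<^esub>}"
  have A: "finite ?A" using f by simp
  have sub: "{i. (a \<odot>\<^bsub>free_module R I\<^esub> f) i \<noteq> \<zero>\<^bsub>R\<^esub>} \<subseteq> ?A" using f a by auto
  have af: "a \<odot>\<^bsub>free_module R I\<^esub> f \<in> carrier (free_module R I)" using F.smult_closed[OF a f] .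
  have "free_map R R' \<sigma> \<rho> (a \<odot>\<^bsub>free_module R I\<^esub> f) j = \<sigma> a \<otimes>\<^bsub>R'\<^esub> free_map R R' \<sigma> \<rho> f j" for j
  proof -
    have "free_map R R' \<sigma> \<rho> (a \<odot>\<^bsub>free_module R I\<^esub> f) j = finsum R' (\<lambda>i. \<sigma> (a \<otimes>\<^bsub>R\<^esub> f i)) {i \<in> ?A. \<rho> i = j}"
      unfolding free_map_finite[OF af A sub] by simp
    also have "\<dots> = finsum R' (\<lambda>i. \<sigma> a \<otimes>\<^bsub>R'\<^esub> \<sigma> (f i)) {i \<in> ?A. \<rho> i = j}"
      by (rule R'.finsum_cong') (use f a in auto)
    also have "\<dots> = \<sigma> a \<otimes>\<^bsub>R'\<^esub> finsum R' (\<lambda>i. \<sigma> (f i)) {i \<in> ?A. \<rho> i = j}"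
      by (rule R'.finsum_rdistr[symmetric]) (use f a A in auto)
    finally show ?thesis using free_map_finite[OF f A subset_refl] by simp
  qed
  then show ?thesis by auto
qed

lemma free_map_basis:
  assumes i: "i \<in> I"
  shows "free_map R R' \<sigma> \<rho> (basis_vector R i) = basis_vector R' (\<rho> i)"
proof
  fix j
  have "free_map R R' \<sigma> \<rho> (basis_vector R i) j = finsum R' (\<lambda>k. \<sigma> (basis_vector R i k)) {k \<in> {i}. \<rho> k = j}"
    by (rule free_map_finite[OF basis_vector_closed[OF R i]]) (auto simp: basis_vector_def)
  also have "\<dots> = basis_vector R' (\<rho> i) j"
  proof (cases "\<rho> i = j")
    case True
    then have "{k \<in> {i}. \<rho> k = j} = {i}" by auto
    then show ?thesis using True by (simp add: basis_vector_def)
  next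
    case False
    then have "{k \<in> {i}. \<rho> k = j} = {}" by auto
    then have "finsum R' (\<lambda>k. \<sigma> (basis_vector R i k)) {k \<in> {i}. \<rho> k = j} = \<zero>\<^bsub>R'\<^esub>"
      by (simp only: R'.finsum_empty)
    then show ?thesis using False by (simp add: basis_vector_def)
  qed
  finally show "free_map R R' \<sigma> \<rho> (basis_vector R i) j = basis_vector R' (\<rho> i) j" .
qed

lemma free_map_zero: "free_map R R' \<sigma> \<rho> \<zero>\<^bsub>free_module R I\<^esub> = \<zero>\<^bsub>free_module R' I'\<^esub>"
  by (simp add: free_map_def)

lemma free_map_step:
  assumes f: "f \<in> carrier (free_module R I)" and a: "a \<in> carrier R" and i: "i \<in> I"
  shows "free_map R R' \<sigma> \<rho> (f \<oplus>\<^bsub>free_module R I\<^esub> (a \<odot>\<^bsub>free_module R I\<^esub> basis_vector R i))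
    = free_map R R' \<sigma> \<rho> f \<oplus>\<^bsub>free_module R' I'\<^esub> (\<sigma> a \<odot>\<^bsub>free_module R' I'\<^esub> basis_vector R' (\<rho> i))"
  unfolding free_map_add[OF f F.smult_closed[OF a basis_vector_closed[OF R i]]]
    free_map_smult[OF a basis_vector_closed[OF R i]] free_map_basis[OF i] ..

end

lemma additive_minus:
  assumes "abelian_group M" "abelian_group M'"
    and g: "\<And>x. x \<in> carrier M ==> g x \<in> carrier M'"
    and add: "\<And>x y. x \<in> carrier M ==> y \<in> carrier M ==> g (x \<oplus>\<^bsub>M\<^esub> y) = g x \<oplus>\<^bsub>M'\<^esub> g y"
    and x: "x \<in> carrier M" and y: "y \<in> carrier M"
  shows "g (x \<ominus>\<^bsub>M\<^esub> y) = g x \<ominus>\<^bsub>M'\<^esub> g y"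
proof -
  interpret M: abelian_group M by fact
  interpret M': abelian_group M' by fact
  have d: "x \<ominus>\<^bsub>M\<^esub> y \<in> carrier M" using x y by simp
  have "g (x \<ominus>\<^bsub>M\<^esub> y \<oplus>\<^bsub>M\<^esub> y) = g (x \<ominus>\<^bsub>M\<^esub> y) \<oplus>\<^bsub>M'\<^esub> g y" by (rule add[OF d y])
  moreover have "x \<ominus>\<^bsub>M\<^esub> y \<oplus>\<^bsub>M\<^esub> y = x" using x y by (simp add: M.minus_eq M.a_assoc M.l_neg)
  ultimately have e: "g x = g (x \<ominus>\<^bsub>M\<^esub> y) \<oplus>\<^bsub>M'\<^esub> g y" by simp
  show ?thesis unfolding e using g[OF d] g[OF y] by (simp add: M'.minus_eq M'.a_assoc M'.r_neg)
qed

context sheaf_ringed_space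
begin

section \<open>Presheaves given by generators and relations\<close>

text \<open>The common form of exterior powers and tensor products before sheafification: \<open>I U\<close> are
  the generators over \<open>U\<close>, \<open>\<rho>\<close> restricts them, and \<open>N U\<close> is the module of relations.\<close>

definition presented_presheaf ::
  "('p set \<Rightarrow> 'i set) \<Rightarrow> ('p set \<Rightarrow> 'p set \<Rightarrow> 'i \<Rightarrow> 'i) \<Rightarrow> ('p set \<Rightarrow> ('i \<Rightarrow> 'r) set) \<Rightarrow> ('p, 'r, ('i \<Rightarrow> 'r) set) modsheaf" where
  "presented_presheaf I \<rho> N =
     \<lparr> msec = (\<lambda>U. quotient_module (free_module (sec X U) (I U)) (N U)),
       mres = (\<lambda>U V A. \<Union>f\<in>A. a_r_coset (free_module (sec X V) (I V)) (N V)
          (free_map (sec X U) (sec X V) (res X U V) (\<rho> U V) f)) \<rparr>"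

end

locale generator_presheaf = sheaf_ringed_space X
  for X :: "('p, 'r) ringed_space" +
  fixes I :: "'p set \<Rightarrow> 'i set" and \<rho> :: "'p set \<Rightarrow> 'p set \<Rightarrow> 'i \<Rightarrow> 'i"
  assumes \<rho>_closed: "\<And>U V i. opn U ==> opn V ==> V \<subseteq> U ==> i \<in> I U ==> \<rho> U V i \<in> I V"
    and \<rho>_id: "\<And>U i. opn U ==> i \<in> I U ==> \<rho> U U i = i"
    and \<rho>_comp: "\<And>U V W i. opn U ==> opn V ==> opn W ==> W \<subseteq> V ==> V \<subseteq> U ==> i \<in> I U ==> \<rho> V W (\<rho> U V i) = \<rho> U W i"
begin

abbreviation "Fr U \<equiv> free_module (sec X U) (I U)"
abbreviation "fm U V \<equiv> free_map (sec X U) (sec X V) (res X U V) (\<rho> U V)"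
lemma Fr_module: "opn U ==> module (sec X U) (Fr U)"
  by (rule free_module_module[OF sec_cring])

lemma Fr_add_closed: "opn U ==> f \<in> carrier (Fr U) ==> g \<in> carrier (Fr U) ==> f \<oplus>\<^bsub>Fr U\<^esub> g \<in> carrier (Fr U)"
  using Fr_module abelian_group.axioms(1) abelian_monoid.a_closed module.axioms(2) by metis

lemma Fr_smult_closed: "opn U ==> a \<in> funs U ==> f \<in> carrier (Fr U) ==> a \<odot>\<^bsub>Fr U\<^esub> f \<in> carrier (Fr U)"
  by (rule module.smult_closed[OF Fr_module])

lemma basis_closed: "opn U ==> i \<in> I U ==> basis_vector (sec X U) i \<in> carrier (Fr U)"
  by (rule basis_vector_closed[OF sec_cring])

lemma fm_closed: "opn U ==> opn V ==> V \<subseteq> U ==> f \<in> carrier (Fr U) ==> fm U V f \<in> carrier (Fr V)"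
  by (rule free_map_closed) (assumption | rule sec_cring res_hom \<rho>_closed)+

lemma fm_add: "opn U ==> opn V ==> V \<subseteq> U ==> f \<in> carrier (Fr U) ==> g \<in> carrier (Fr U) ==>
    fm U V (f \<oplus>\<^bsub>Fr U\<^esub> g) = fm U V f \<oplus>\<^bsub>Fr V\<^esub> fm U V g"
  by (rule free_map_add) (assumption | rule sec_cring res_hom \<rho>_closed)+

lemma fm_smult: "opn U ==> opn V ==> V \<subseteq> U ==> a \<in> funs U ==> f \<in> carrier (Fr U) ==>
    fm U V (a \<odot>\<^bsub>Fr U\<^esub> f) = res X U V a \<odot>\<^bsub>Fr V\<^esub> fm U V f"
  by (rule free_map_smult) (assumption | rule sec_cring res_hom \<rho>_closed)+

lemma fm_basis: "opn U ==> opn V ==> V \<subseteq> U ==> i \<in> I U ==>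
    fm U V (basis_vector (sec X U) i) = basis_vector (sec X V) (\<rho> U V i)"
  by (rule free_map_basis[where I = "I U" and I' = "I V"]) (assumption | rule sec_cring res_hom \<rho>_closed)+

lemma fm_zero: "opn U ==> opn V ==> V \<subseteq> U ==> fm U V \<zero>\<^bsub>Fr U\<^esub> = \<zero>\<^bsub>Fr V\<^esub>"
  by (rule free_map_zero) (assumption | rule sec_cring res_hom \<rho>_closed)+

lemma fm_step: "opn U ==> opn V ==> V \<subseteq> U ==> f \<in> carrier (Fr U) ==> a \<in> funs U ==> i \<in> I U ==>
    fm U V (f \<oplus>\<^bsub>Fr U\<^esub> (a \<odot>\<^bsub>Fr U\<^esub> basis_vector (sec X U) i)) =
    fm U V f \<oplus>\<^bsub>Fr V\<^esub> (res X U V a \<odot>\<^bsub>Fr V\<^esub> basis_vector (sec X V) (\<rho> U V i))"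
  by (rule free_map_step) (assumption | rule sec_cring res_hom \<rho>_closed)+

lemma fm_id: "opn U ==> f \<in> carrier (Fr U) ==> fm U U f = f"
proof -
  assume U: "opn U" and f: "f \<in> carrier (Fr U)"
  note UU = U U subset_refl
  from sec_cring[OF U] f show ?thesis
  proof (induction rule: free_module_induct)
    case base
    then show ?case by (rule fm_zero[OF UU])
  next
    case (step f a i)
    then show ?case using fm_step[OF UU step(1,2,3)] \<rho>_id[OF U step(3)] res_id[OF U step(2)] by simp
  qed
qed

lemma fm_comp:
  assumes U: "opn U" and V: "opn V" and W: "opn W" and WV: "W \<subseteq> V" and VU: "V \<subseteq> U" and f: "f \<in> carrier (Fr U)"
  shows "fm V W (fm U V f) = fm U W f"
proof -
  have WU: "W \<subseteq> U" using WV VU by blast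
  from sec_cring[OF U] f show ?thesis
  proof (induction rule: free_module_induct)
    case base
    show ?case by (simp only: fm_zero[OF U V VU] fm_zero[OF V W WV] fm_zero[OF U W WU])
  next
    case (step f a i)
    have a: "res X U V a \<in> funs V" by (rule res_closed[OF U V VU step(2)])
    have i: "\<rho> U V i \<in> I V" by (rule \<rho>_closed[OF U V VU step(3)])
    show ?case
      unfolding fm_step[OF U V VU step(1,2,3)] fm_step[OF U W WU step(1,2,3)] fm_step[OF V W WV fm_closed[OF U V VU step(1)] a i]
      by (simp only: step(4) \<rho>_comp[OF U V W WV VU step(3)] res_res[OF U V W WV VU step(2)])
  qed
qed

lemma fm_sum_relation:
  assumes UV: "opn U" "opn V" "V \<subseteq> U" and ijk: "i \<in> I U" "j \<in> I U" "k \<in> I U"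
  shows "fm U V (basis_vector (sec X U) i \<ominus>\<^bsub>Fr U\<^esub> (basis_vector (sec X U) j \<oplus>\<^bsub>Fr U\<^esub> basis_vector (sec X U) k))
    = basis_vector (sec X V) (\<rho> U V i) \<ominus>\<^bsub>Fr V\<^esub> (basis_vector (sec X V) (\<rho> U V j) \<oplus>\<^bsub>Fr V\<^esub> basis_vector (sec X V) (\<rho> U V k))"
proof -
  interpret FU: module "sec X U" "Fr U" by (rule Fr_module[OF UV(1)])
  interpret FV: module "sec X V" "Fr V" by (rule Fr_module[OF UV(2)])
  note b = basis_closed[OF UV(1) ijk(1)] basis_closed[OF UV(1) ijk(2)] basis_closed[OF UV(1) ijk(3)]
  have "fm U V (basis_vector (sec X U) i \<ominus>\<^bsub>Fr U\<^esub> (basis_vector (sec X U) j \<oplus>\<^bsub>Fr U\<^esub> basis_vector (sec X U) k))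
    = fm U V (basis_vector (sec X U) i) \<ominus>\<^bsub>Fr V\<^esub> fm U V (basis_vector (sec X U) j \<oplus>\<^bsub>Fr U\<^esub> basis_vector (sec X U) k)"
    by (rule additive_minus[OF FU.M.abelian_group_axioms FV.M.abelian_group_axioms fm_closed[OF UV] fm_add[OF UV] b(1) Fr_add_closed[OF UV(1) b(2,3)]])
  then show ?thesis
    by (simp only: fm_add[OF UV b(2,3)] fm_basis[OF UV ijk(1)] fm_basis[OF UV ijk(2)] fm_basis[OF UV ijk(3)])
qed

lemma fm_smult_relation:
  assumes UV: "opn U" "opn V" "V \<subseteq> U" and ij: "i \<in> I U" "j \<in> I U" and a: "a \<in> funs U"
  shows "fm U V (basis_vector (sec X U) i \<ominus>\<^bsub>Fr U\<^esub> (a \<odot>\<^bsub>Fr U\<^esub> basis_vector (sec X U) j))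
    = basis_vector (sec X V) (\<rho> U V i) \<ominus>\<^bsub>Fr V\<^esub> (res X U V a \<odot>\<^bsub>Fr V\<^esub> basis_vector (sec X V) (\<rho> U V j))"
proof -
  interpret FU: module "sec X U" "Fr U" by (rule Fr_module[OF UV(1)])
  interpret FV: module "sec X V" "Fr V" by (rule Fr_module[OF UV(2)])
  note b = basis_closed[OF UV(1) ij(1)] basis_closed[OF UV(1) ij(2)]
  have "fm U V (basis_vector (sec X U) i \<ominus>\<^bsub>Fr U\<^esub> (a \<odot>\<^bsub>Fr U\<^esub> basis_vector (sec X U) j))
    = fm U V (basis_vector (sec X U) i) \<ominus>\<^bsub>Fr V\<^esub> fm U V (a \<odot>\<^bsub>Fr U\<^esub> basis_vector (sec X U) j)"
    by (rule additive_minus[OF FU.M.abelian_group_axioms FV.M.abelian_group_axioms fm_closed[OF UV] fm_add[OF UV] b(1) Fr_smult_closed[OF UV(1) a b(2)]])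
  then show ?thesis
    by (simp only: fm_smult[OF UV a b(2)] fm_basis[OF UV ij(1)] fm_basis[OF UV ij(2)])
qed

end

locale presentation = generator_presheaf X I \<rho>
  for X :: "('p, 'r) ringed_space" and I :: "'p set \<Rightarrow> 'i set" and \<rho> :: "'p set \<Rightarrow> 'p set \<Rightarrow> 'i \<Rightarrow> 'i" +
  fixes Rel :: "'p set \<Rightarrow> ('i \<Rightarrow> 'r) set"
  assumes Rel_closed: "\<And>U. opn U ==> Rel U \<subseteq> carrier (free_module (sec X U) (I U))"
    and Rel_res: "\<And>U V r. opn U ==> opn V ==> V \<subseteq> U ==> r \<in> Rel U ==>
      free_map (sec X U) (sec X V) (res X U V) (\<rho> U V) r \<in> Rel V"
begin

definition "N U = span_module (sec X U) (Fr U) (Rel U)"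
definition "cls U f = a_r_coset (Fr U) (N U) f"
definition "gen U i = cls U (basis_vector (sec X U) i)"
definition "P = presented_presheaf I \<rho> N"

lemma N_submodule: "opn U ==> submodule (N U) (sec X U) (Fr U)"
  unfolding N_def by (rule span_submodule[OF Fr_module Rel_closed])

lemma Rel_N: "opn U ==> Rel U \<subseteq> N U"
  unfolding N_def by (rule span_incl[OF Fr_module])

lemma fm_N:
  assumes UV: "opn U" "opn V" "V \<subseteq> U" and f: "f \<in> N U"
  shows "fm U V f \<in> N V"
proof (rule span_image_subset[where \<sigma> = "res X U V" and g = "fm U V", OF Fr_module[OF UV(1)] Fr_module[OF UV(2)] _ Rel_closed[OF UV(1)] N_submodule[OF UV(2)]])
  show "res X U V a \<in> funs V" if "a \<in> funs U" for a by (rule res_closed[OF UV that])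
  show "fm U V x \<in> N V" if "x \<in> Rel U" for x using Rel_res[OF UV that] Rel_N[OF UV(2)] by blast
  show "f \<in> span_module (sec X U) (Fr U) (Rel U)" using f unfolding N_def .
qed (rule fm_closed[OF UV] fm_add[OF UV] fm_smult[OF UV]; assumption)+

lemma P_carrier: "opn U ==> secs P U = {cls U f | f. f \<in> carrier (Fr U)}"
  unfolding P_def presented_presheaf_def cls_def by (simp only: modsheaf.simps quotient_carrier[OF Fr_module N_submodule])

lemma cls_closed: "opn U ==> f \<in> carrier (Fr U) ==> cls U f \<in> secs P U"
  using P_carrier by blast

lemma P_cases:
  assumes "opn U" "A \<in> secs P U"
  obtains f where "f \<in> carrier (Fr U)" "A = cls U f"
  using assms P_carrier by blast

lemma cls_eq_iff: "opn U ==> f \<in> carrier (Fr U) ==> g \<in> carrier (Fr U) ==> cls U f = cls U g \<longleftrightarrow> f \<ominus>\<^bsub>Fr U\<^esub> g \<in> N U"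
  unfolding cls_def by (rule coset_eq_iff[OF Fr_module N_submodule])

lemma cls_add: "opn U ==> f \<in> carrier (Fr U) ==> g \<in> carrier (Fr U) ==> cls U f \<oplus>\<^bsub>msec P U\<^esub> cls U g = cls U (f \<oplus>\<^bsub>Fr U\<^esub> g)"
  unfolding cls_def P_def presented_presheaf_def modsheaf.simps by (rule quotient_add[OF Fr_module N_submodule])

lemma cls_smult: "opn U ==> a \<in> funs U ==> f \<in> carrier (Fr U) ==> a \<odot>\<^bsub>msec P U\<^esub> cls U f = cls U (a \<odot>\<^bsub>Fr U\<^esub> f)"
  unfolding cls_def P_def presented_presheaf_def modsheaf.simps by (rule quotient_smult[OF Fr_module N_submodule])

lemma cls_res:
  assumes UV: "opn U" "opn V" "V \<subseteq> U" and f: "f \<in> carrier (Fr U)"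
  shows "mres P U V (cls U f) = cls V (fm U V f)"
  unfolding cls_def P_def presented_presheaf_def modsheaf.simps
  by (rule Union_image_coset[OF Fr_module[OF UV(1)] N_submodule[OF UV(1)] Fr_module[OF UV(2)] N_submodule[OF UV(2)]
        fm_closed[OF UV] fm_add[OF UV] fm_N[OF UV] f])

lemma gen_closed: "opn U ==> i \<in> I U ==> gen U i \<in> secs P U"
  unfolding gen_def by (rule cls_closed[OF _ basis_closed])

lemma gen_res: "opn U ==> opn V ==> V \<subseteq> U ==> i \<in> I U ==> mres P U V (gen U i) = gen V (\<rho> U V i)"
  unfolding gen_def by (simp only: cls_res basis_closed fm_basis)

lemma presented_linear_presheaf: "linear_presheaf X P"
  unfolding linear_presheaf_def
proof (intro conjI allI impI ballI)
  show "is_presheaf (tps X) (\<lambda>U. secs P U) (mres P)"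
    unfolding is_presheaf_def
  proof (intro conjI allI impI ballI)
    fix U V assume "opn U \<and> opn V \<and> V \<subseteq> U"
    then have UV: "opn U" "opn V" "V \<subseteq> U" by auto
    show "mres P U V \<in> secs P U \<rightarrow> secs P V"
    proof
      fix A assume "A \<in> secs P U"
      then obtain f where f: "f \<in> carrier (Fr U)" "A = cls U f" by (rule P_cases[OF UV(1)])
      show "mres P U V A \<in> secs P V"
        unfolding f(2) cls_res[OF UV f(1)] by (rule cls_closed[OF UV(2) fm_closed[OF UV f(1)]])
    qed
  next
    fix U A assume U: "opn U" and "A \<in> secs P U"
    then obtain f where f: "f \<in> carrier (Fr U)" "A = cls U f" by (rule P_cases)
    show "mres P U U A = A" unfolding f(2) cls_res[OF U U subset_refl f(1)] fm_id[OF U f(1)] ..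
  next
    fix U V W A assume "opn U \<and> opn V \<and> opn W \<and> W \<subseteq> V \<and> V \<subseteq> U" and A: "A \<in> secs P U"
    then have *: "opn U" "opn V" "opn W" "W \<subseteq> V" "V \<subseteq> U" "W \<subseteq> U" by auto
    obtain f where f: "f \<in> carrier (Fr U)" "A = cls U f" by (rule P_cases[OF *(1) A])
    show "mres P V W (mres P U V A) = mres P U W A"
      unfolding f(2) cls_res[OF *(1,2,5) f(1)] cls_res[OF *(1,3,6) f(1)] cls_res[OF *(2,3,4) fm_closed[OF *(1,2,5) f(1)]]
        fm_comp[OF *(1-5) f(1)] ..
  qed
  fix U assume U: "opn U"
  fix A B assume "A \<in> secs P U" "B \<in> secs P U"
  then obtain f g where fg: "f \<in> carrier (Fr U)" "A = cls U f" "g \<in> carrier (Fr U)" "B = cls U g"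
    by (elim P_cases[OF U])
  show "A \<oplus>\<^bsub>msec P U\<^esub> B \<in> secs P U"
    unfolding fg(2,4) cls_add[OF U fg(1,3)] by (rule cls_closed[OF U Fr_add_closed[OF U fg(1,3)]])
next
  fix U a A assume U: "opn U" and a: "a \<in> funs U" and "A \<in> secs P U"
  then obtain f where f: "f \<in> carrier (Fr U)" "A = cls U f" by (elim P_cases[OF U])
  show "a \<odot>\<^bsub>msec P U\<^esub> A \<in> secs P U"
    unfolding f(2) cls_smult[OF U a f(1)] by (rule cls_closed[OF U Fr_smult_closed[OF U a f(1)]])
next
  fix U V A B assume "opn U \<and> opn V \<and> V \<subseteq> U" and AB: "A \<in> secs P U" "B \<in> secs P U"
  then have UV: "opn U" "opn V" "V \<subseteq> U" by auto
  obtain f g where fg: "f \<in> carrier (Fr U)" "A = cls U f" "g \<in> carrier (Fr U)" "B = cls U g"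
    using AB by (elim P_cases[OF UV(1)])
  show "mres P U V (A \<oplus>\<^bsub>msec P U\<^esub> B) = mres P U V A \<oplus>\<^bsub>msec P V\<^esub> mres P U V B"
    unfolding fg(2,4) cls_add[OF UV(1) fg(1,3)] cls_res[OF UV fg(1)] cls_res[OF UV fg(3)]
      cls_res[OF UV Fr_add_closed[OF UV(1) fg(1,3)]] cls_add[OF UV(2) fm_closed[OF UV fg(1)] fm_closed[OF UV fg(3)]]
      fm_add[OF UV fg(1,3)] ..
next
  fix U V a A assume "opn U \<and> opn V \<and> V \<subseteq> U" and a: "a \<in> funs U" and A: "A \<in> secs P U"
  then have UV: "opn U" "opn V" "V \<subseteq> U" by auto
  obtain f where f: "f \<in> carrier (Fr U)" "A = cls U f" by (rule P_cases[OF UV(1) A])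
  show "mres P U V (a \<odot>\<^bsub>msec P U\<^esub> A) = res X U V a \<odot>\<^bsub>msec P V\<^esub> mres P U V A"
    unfolding f(2) cls_smult[OF UV(1) a f(1)] cls_res[OF UV f(1)]
      cls_res[OF UV Fr_smult_closed[OF UV(1) a f(1)]] cls_smult[OF UV(2) res_closed[OF UV a] fm_closed[OF UV f(1)]]
      fm_smult[OF UV a f(1)] ..
qed

text \<open>Every section is a linear combination of generators, and both sides are linear.\<close>

lemma presented_hom_eqI:
  assumes F: "sheaf_of_modules X F" and \<phi>: "\<phi> \<in> sheaf_hom X U P F" and \<psi>: "\<psi> \<in> sheaf_hom X U P F"
    and eq: "\<And>W i. opn W ==> W \<subseteq> U ==> i \<in> I W ==> \<phi> W (gen W i) = \<psi> W (gen W i)"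
  shows "\<phi> = \<psi>"
proof (rule sheaf_hom_eqI[OF \<phi> \<psi>])
  fix W A assume W: "opn W" "W \<subseteq> U" and "A \<in> secs P W"
  then obtain f where f: "f \<in> carrier (Fr W)" and A: "A = cls W f" by (elim P_cases)
  interpret Fr: module "sec X W" "Fr W" by (rule Fr_module[OF W(1)])
  interpret F: module "sec X W" "msec F W" by (rule modules_module[OF F W(1)])
  from sec_cring[OF W(1)] f have "\<phi> W (cls W f) = \<psi> W (cls W f)"
  proof (induction rule: free_module_induct)
    case base
    let ?z = "\<zero>\<^bsub>Fr W\<^esub>"
    have z: "cls W ?z = \<zero>\<^bsub>sec X W\<^esub> \<odot>\<^bsub>msec P W\<^esub> cls W ?z"
      by (simp only: cls_smult[OF W(1) Fr.R.zero_closed Fr.M.zero_closed] Fr.smult_r_null[OF Fr.R.zero_closed])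
    note c = cls_closed[OF W(1) Fr.M.zero_closed]
    show ?case
      by (subst z, subst (2) z, simp only: sheaf_hom_smult[OF \<phi> W Fr.R.zero_closed c] sheaf_hom_smult[OF \<psi> W Fr.R.zero_closed c]
          F.smult_l_null[OF sheaf_hom_closed[OF \<phi> W c]] F.smult_l_null[OF sheaf_hom_closed[OF \<psi> W c]])
  next
    case (step f a i)
    note b = basis_closed[OF W(1) step(3)]
    have "cls W (f \<oplus>\<^bsub>Fr W\<^esub> (a \<odot>\<^bsub>Fr W\<^esub> basis_vector (sec X W) i)) = cls W f \<oplus>\<^bsub>msec P W\<^esub> (a \<odot>\<^bsub>msec P W\<^esub> gen W i)"
      unfolding gen_def by (simp only: cls_smult[OF W(1) step(2) b] cls_add[OF W(1) step(1) Fr_smult_closed[OF W(1) step(2) b]])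
    moreover have "a \<odot>\<^bsub>msec P W\<^esub> gen W i \<in> secs P W"
      by (rule linear_presheaf_smult_closed[OF presented_linear_presheaf W(1) step(2) gen_closed[OF W(1) step(3)]])
    ultimately show ?case
      by (simp only: sheaf_hom_add[OF \<phi> W cls_closed[OF W(1) step(1)]] sheaf_hom_add[OF \<psi> W cls_closed[OF W(1) step(1)]]
          sheaf_hom_smult[OF \<phi> W step(2) gen_closed[OF W(1) step(3)]] sheaf_hom_smult[OF \<psi> W step(2) gen_closed[OF W(1) step(3)]]
          step(4) eq[OF W step(3)])
  qed
  then show "\<phi> W A = \<psi> W A" unfolding A .
qed

text \<open>The linear extension of \<open>h\<close> vanishes on the relations, hence on their span, and is therefore
  constant on cosets.\<close>

lemma presented_hom_exists:
  assumes F: "sheaf_of_modules X F"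
    and h: "\<And>W i. opn W ==> W \<subseteq> U ==> i \<in> I W ==> h W i \<in> secs F W"
    and h_res: "\<And>W V i. opn W ==> opn V ==> V \<subseteq> W ==> W \<subseteq> U ==> i \<in> I W ==> h V (\<rho> W V i) = mres F W V (h W i)"
    and h_rel: "\<And>W r. opn W ==> W \<subseteq> U ==> r \<in> Rel W ==> free_lift (sec X W) (msec F W) (h W) r = \<zero>\<^bsub>msec F W\<^esub>"
  shows "\<exists>\<theta>\<in>sheaf_hom X U P F. \<forall>W. opn W \<and> W \<subseteq> U -->
    (\<forall>f\<in>carrier (Fr W). \<theta> W (cls W f) = free_lift (sec X W) (msec F W) (h W) f) \<and>
    (\<forall>i\<in>I W. \<theta> W (gen W i) = h W i)"
proof -
  define l where "l W = free_lift (sec X W) (msec F W) (h W)" for W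
  define \<theta> where "\<theta> W A = the_elem (l W ` A)" for W A
  have l_closed: "l W f \<in> secs F W"
    and l_add: "g \<in> carrier (Fr W) ==> l W (f \<oplus>\<^bsub>Fr W\<^esub> g) = l W f \<oplus>\<^bsub>msec F W\<^esub> l W g"
    and l_smult: "a \<in> funs W ==> l W (a \<odot>\<^bsub>Fr W\<^esub> f) = a \<odot>\<^bsub>msec F W\<^esub> l W f"
    and l_basis: "i \<in> I W ==> l W (basis_vector (sec X W) i) = h W i"
    and l_zero: "l W \<zero>\<^bsub>Fr W\<^esub> = \<zero>\<^bsub>msec F W\<^esub>"
    if W: "opn W" "W \<subseteq> U" and f: "f \<in> carrier (Fr W)" for W f g a i
  proof -
    have hW: "h W \<in> I W \<rightarrow> secs F W" using h[OF W] by blast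
    note m = modules_module[OF F W(1)]
    show "l W f \<in> secs F W" unfolding l_def by (rule free_lift_closed[OF m hW f])
    show "l W (f \<oplus>\<^bsub>Fr W\<^esub> g) = l W f \<oplus>\<^bsub>msec F W\<^esub> l W g" if "g \<in> carrier (Fr W)"
      unfolding l_def by (rule free_lift_add[OF m hW f that])
    show "l W (a \<odot>\<^bsub>Fr W\<^esub> f) = a \<odot>\<^bsub>msec F W\<^esub> l W f" if "a \<in> funs W"
      unfolding l_def by (rule free_lift_smult[OF m hW that f])
    show "l W (basis_vector (sec X W) i) = h W i" if "i \<in> I W"
      unfolding l_def by (rule free_lift_basis[OF m hW that])
    show "l W \<zero>\<^bsub>Fr W\<^esub> = \<zero>\<^bsub>msec F W\<^esub>" unfolding l_def by (rule free_lift_zero[OF m hW])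
  qed
  have l_N: "l W f = \<zero>\<^bsub>msec F W\<^esub>" if W: "opn W" "W \<subseteq> U" and f: "f \<in> N W" for W f
  proof -
    interpret F: module "sec X W" "msec F W" by (rule modules_module[OF F W(1)])
    have z: "submodule {\<zero>\<^bsub>msec F W\<^esub>} (sec X W) (msec F W)" by (rule F.submoduleI) auto
    have "l W f \<in> {\<zero>\<^bsub>msec F W\<^esub>}"
    proof (rule span_image_subset[OF Fr_module[OF W(1)] F.module_axioms _ Rel_closed[OF W(1)] z, where \<sigma> = "\<lambda>a. a"])
      show "f \<in> span_module (sec X W) (Fr W) (Rel W)" using f unfolding N_def .
      show "l W r \<in> {\<zero>\<^bsub>msec F W\<^esub>}" if "r \<in> Rel W" for r using h_rel[OF W that] unfolding l_def by simp
    qed (assumption | (rule l_closed[OF W] l_add[OF W] l_smult[OF W]; assumption))+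
    then show ?thesis by simp
  qed
  have \<theta>: "\<theta> W (cls W f) = l W f" if W: "opn W" "W \<subseteq> U" and f: "f \<in> carrier (Fr W)" for W f
  proof -
    interpret Fr: module "sec X W" "Fr W" by (rule Fr_module[OF W(1)])
    interpret F: module "sec X W" "msec F W" by (rule modules_module[OF F W(1)])
    interpret NN: abelian_subgroup "N W" "Fr W" by (rule submodule_abelian_subgroup[OF Fr.module_axioms N_submodule[OF W(1)]])
    have "l W g = l W f" if g: "g \<in> cls W f" for g
    proof -
      obtain n where n: "n \<in> N W" "g = n \<oplus>\<^bsub>Fr W\<^esub> f" using g unfolding cls_def a_r_coset_def' by blast
      have "l W g = l W n \<oplus>\<^bsub>msec F W\<^esub> l W f"
        unfolding n(2) by (rule l_add[OF W NN.a_Hcarr[OF n(1)] f])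
      then show ?thesis using l_N[OF W n(1)] l_closed[OF W f] by simp
    qed
    moreover have "f \<in> cls W f" unfolding cls_def by (rule NN.a_rcos_self[OF f])
    ultimately have "l W ` cls W f = {l W f}" by blast
    then show ?thesis unfolding \<theta>_def by simp
  qed
  have l_res: "l V (fm W V f) = mres F W V (l W f)" if WV: "opn W" "opn V" "V \<subseteq> W" "W \<subseteq> U" and f: "f \<in> carrier (Fr W)" for W V f
    using sec_cring[OF WV(1)] f
  proof (induction rule: free_module_induct)
    have VU: "V \<subseteq> U" using WV by blast
    {
      case base
      have "\<zero>\<^bsub>Fr W\<^esub> \<in> carrier (Fr W)" "\<zero>\<^bsub>Fr V\<^esub> \<in> carrier (Fr V)"
        using Fr_module[OF WV(1)] Fr_module[OF WV(2)] by (meson abelian_group.axioms(1) abelian_monoid.zero_closed module.axioms(2))+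
      then show ?case
        by (simp only: fm_zero[OF WV(1-3)] l_zero[OF WV(1,4)] l_zero[OF WV(2) VU] modules_res_zero[OF F WV(1-3)])
    next
      case (step f a i)
      note bW = basis_closed[OF WV(1) step(3)]
      note rcl = \<rho>_closed[OF WV(1-3) step(3)]
      note bV = basis_closed[OF WV(2) rcl]
      note ra = res_closed[OF WV(1-3) step(2)]
      interpret F: module "sec X W" "msec F W" by (rule modules_module[OF F WV(1)])
      have hW: "h W i \<in> secs F W" by (rule h[OF WV(1,4) step(3)])
      have ah: "a \<odot>\<^bsub>msec F W\<^esub> h W i \<in> secs F W" using step(2) hW by simp
      show ?case
        unfolding fm_step[OF WV(1-3) step(1-3)] l_add[OF WV(2) VU fm_closed[OF WV(1-3) step(1)] Fr_smult_closed[OF WV(2) ra bV]]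
          l_smult[OF WV(2) VU bV ra] l_basis[OF WV(2) VU bV rcl] l_add[OF WV(1,4) step(1) Fr_smult_closed[OF WV(1) step(2) bW]]
          l_smult[OF WV(1,4) bW step(2)] l_basis[OF WV(1,4) bW step(3)] step(4) h_res[OF WV step(3)]
          sheaf_lin(4)[OF F WV(1-3) l_closed[OF WV(1,4) step(1)] ah] sheaf_lin(5)[OF F WV(1-3) step(2) hW] ..
    }
  qed
  have hom: "on_sections U P \<theta> \<in> sheaf_hom X U P F"
  proof (rule on_sections_homI[OF presented_linear_presheaf])
    fix W A assume W: "opn W" "W \<subseteq> U" and A: "A \<in> secs P W"
    obtain f where f: "f \<in> carrier (Fr W)" "A = cls W f" by (rule P_cases[OF W(1) A])
    show "\<theta> W A \<in> secs F W" unfolding f(2) \<theta>[OF W f(1)] by (rule l_closed[OF W f(1)])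
    show "\<theta> W (A \<oplus>\<^bsub>msec P W\<^esub> B) = \<theta> W A \<oplus>\<^bsub>msec F W\<^esub> \<theta> W B" if B: "B \<in> secs P W" for B
    proof -
      obtain g where g: "g \<in> carrier (Fr W)" "B = cls W g" by (rule P_cases[OF W(1) B])
      show ?thesis
        unfolding f(2) g(2) cls_add[OF W(1) f(1) g(1)] \<theta>[OF W f(1)] \<theta>[OF W g(1)] \<theta>[OF W Fr_add_closed[OF W(1) f(1) g(1)]]
        by (rule l_add[OF W f(1) g(1)])
    qed
    show "\<theta> W (a \<odot>\<^bsub>msec P W\<^esub> A) = a \<odot>\<^bsub>msec F W\<^esub> \<theta> W A" if a: "a \<in> funs W" for a
      unfolding f(2) cls_smult[OF W(1) a f(1)] \<theta>[OF W f(1)] \<theta>[OF W Fr_smult_closed[OF W(1) a f(1)]]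
      by (rule l_smult[OF W f(1) a])
    show "\<theta> V (mres P W V A) = mres F W V (\<theta> W A)" if V: "opn V" "V \<subseteq> W" for V
    proof -
      have VU: "V \<subseteq> U" using V W by blast
      show ?thesis
        unfolding f(2) cls_res[OF W(1) V f(1)] \<theta>[OF W f(1)] \<theta>[OF V(1) VU fm_closed[OF W(1) V f(1)]]
        by (rule l_res[OF W(1) V W(2) f(1)])
    qed
  qed
  show ?thesis
  proof (rule bexI[OF _ hom], intro allI impI conjI ballI)
    fix W assume "opn W \<and> W \<subseteq> U"
    then have W: "opn W" "W \<subseteq> U" by auto
    show *: "on_sections U P \<theta> W (cls W f) = free_lift (sec X W) (msec F W) (h W) f" if "f \<in> carrier (Fr W)" for f
      using \<theta>[OF W that] cls_closed[OF W(1) that] W unfolding l_def by (simp only: on_sections_apply)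
    show "on_sections U P \<theta> W (gen W i) = h W i" if "i \<in> I W" for i
      unfolding gen_def *[OF basis_closed[OF W(1) that]] using l_basis[OF W basis_closed[OF W(1) that] that] unfolding l_def .
  qed
qed

text \<open>Turning an additive relation among generators into an equation in the presheaf, and back.\<close>

lemma gen_sumI:
  assumes U: "opn U" and ijk: "i \<in> I U" "j \<in> I U" "k \<in> I U"
    and rel: "basis_vector (sec X U) i \<ominus>\<^bsub>Fr U\<^esub> (basis_vector (sec X U) j \<oplus>\<^bsub>Fr U\<^esub> basis_vector (sec X U) k) \<in> N U"
  shows "gen U i = gen U j \<oplus>\<^bsub>msec P U\<^esub> gen U k"
  unfolding gen_def cls_add[OF U basis_closed[OF U ijk(2)] basis_closed[OF U ijk(3)]]
    cls_eq_iff[OF U basis_closed[OF U ijk(1)] Fr_add_closed[OF U basis_closed[OF U ijk(2)] basis_closed[OF U ijk(3)]]]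
  by (rule rel)

lemma gen_smultI:
  assumes U: "opn U" and ij: "i \<in> I U" "j \<in> I U" and a: "a \<in> funs U"
    and rel: "basis_vector (sec X U) i \<ominus>\<^bsub>Fr U\<^esub> (a \<odot>\<^bsub>Fr U\<^esub> basis_vector (sec X U) j) \<in> N U"
  shows "gen U i = a \<odot>\<^bsub>msec P U\<^esub> gen U j"
  unfolding gen_def cls_smult[OF U a basis_closed[OF U ij(2)]]
    cls_eq_iff[OF U basis_closed[OF U ij(1)] Fr_smult_closed[OF U a basis_closed[OF U ij(2)]]]
  by (rule rel)

lemma free_lift_sum_relation:
  assumes U: "opn U" and F: "sheaf_of_modules X F" and h: "h \<in> I U \<rightarrow> secs F U" and ijk: "i \<in> I U" "j \<in> I U" "k \<in> I U"
    and eq: "h i = h j \<oplus>\<^bsub>msec F U\<^esub> h k"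
  shows "free_lift (sec X U) (msec F U) h (basis_vector (sec X U) i \<ominus>\<^bsub>Fr U\<^esub> (basis_vector (sec X U) j \<oplus>\<^bsub>Fr U\<^esub> basis_vector (sec X U) k)) = \<zero>\<^bsub>msec F U\<^esub>"
proof -
  interpret Fr: module "sec X U" "Fr U" by (rule Fr_module[OF U])
  interpret F: module "sec X U" "msec F U" by (rule modules_module[OF F U])
  note m = F.module_axioms
  note b = basis_closed[OF U ijk(1)] basis_closed[OF U ijk(2)] basis_closed[OF U ijk(3)]
  have hc: "h i \<in> secs F U" using h ijk by blast
  have "free_lift (sec X U) (msec F U) h (basis_vector (sec X U) i \<ominus>\<^bsub>Fr U\<^esub> (basis_vector (sec X U) j \<oplus>\<^bsub>Fr U\<^esub> basis_vector (sec X U) k))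
    = free_lift (sec X U) (msec F U) h (basis_vector (sec X U) i) \<ominus>\<^bsub>msec F U\<^esub>
      free_lift (sec X U) (msec F U) h (basis_vector (sec X U) j \<oplus>\<^bsub>Fr U\<^esub> basis_vector (sec X U) k)"
    by (rule additive_minus[OF Fr.M.abelian_group_axioms F.M.abelian_group_axioms free_lift_closed[OF m h] free_lift_add[OF m h] b(1) Fr_add_closed[OF U b(2,3)]])
  also have "\<dots> = h i \<ominus>\<^bsub>msec F U\<^esub> h i"
    by (simp only: free_lift_add[OF m h b(2,3)] free_lift_basis[OF m h ijk(1)] free_lift_basis[OF m h ijk(2)] free_lift_basis[OF m h ijk(3)] eq[symmetric])
  also have "\<dots> = \<zero>\<^bsub>msec F U\<^esub>" using hc by (simp add: F.M.minus_eq F.M.r_neg)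
  finally show ?thesis .
qed

lemma free_lift_smult_relation:
  assumes U: "opn U" and F: "sheaf_of_modules X F" and h: "h \<in> I U \<rightarrow> secs F U" and ij: "i \<in> I U" "j \<in> I U" and a: "a \<in> funs U"
    and eq: "h i = a \<odot>\<^bsub>msec F U\<^esub> h j"
  shows "free_lift (sec X U) (msec F U) h (basis_vector (sec X U) i \<ominus>\<^bsub>Fr U\<^esub> (a \<odot>\<^bsub>Fr U\<^esub> basis_vector (sec X U) j)) = \<zero>\<^bsub>msec F U\<^esub>"
proof -
  interpret Fr: module "sec X U" "Fr U" by (rule Fr_module[OF U])
  interpret F: module "sec X U" "msec F U" by (rule modules_module[OF F U])
  note m = F.module_axioms
  note b = basis_closed[OF U ij(1)] basis_closed[OF U ij(2)]
  have hc: "h i \<in> secs F U" using h ij by blast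
  have "free_lift (sec X U) (msec F U) h (basis_vector (sec X U) i \<ominus>\<^bsub>Fr U\<^esub> (a \<odot>\<^bsub>Fr U\<^esub> basis_vector (sec X U) j))
    = free_lift (sec X U) (msec F U) h (basis_vector (sec X U) i) \<ominus>\<^bsub>msec F U\<^esub>
      free_lift (sec X U) (msec F U) h (a \<odot>\<^bsub>Fr U\<^esub> basis_vector (sec X U) j)"
    by (rule additive_minus[OF Fr.M.abelian_group_axioms F.M.abelian_group_axioms free_lift_closed[OF m h] free_lift_add[OF m h] b(1) Fr_smult_closed[OF U a b(2)]])
  also have "\<dots> = h i \<ominus>\<^bsub>msec F U\<^esub> h i"
    by (simp only: free_lift_smult[OF m h a b(2)] free_lift_basis[OF m h ij(1)] free_lift_basis[OF m h ij(2)] eq[symmetric])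
  also have "\<dots> = \<zero>\<^bsub>msec F U\<^esub>" using hc by (simp add: F.M.minus_eq F.M.r_neg)
  finally show ?thesis .
qed

end

section \<open>Determinants and alternating forms\<close>

text \<open>A module with a basis \<open>b\<close> indexed by \<open>{..<n}\<close>, given by its coordinate functions \<open>c\<close>.\<close>

locale module_with_basis =
  fixes R :: "'r ring" and M :: "('r, 'm) module" and n :: nat
    and b :: "nat \<Rightarrow> 'm" and c :: "'m \<Rightarrow> nat \<Rightarrow> 'r"
  assumes module_M: "module R M"
    and basis_closed: "\<And>i. i < n ==> b i \<in> carrier M"
    and coord_closed: "\<And>x i. x \<in> carrier M ==> i < n ==> c x i \<in> carrier R"
    and coord_add: "\<And>x y i. x \<in> carrier M ==> y \<in> carrier M ==> i < n ==> c (x \<oplus>\<^bsub>M\<^esub> y) i = c x i \<oplus>\<^bsub>R\<^esub> c y i"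
    and coord_smult: "\<And>a x i. a \<in> carrier R ==> x \<in> carrier M ==> i < n ==> c (a \<odot>\<^bsub>M\<^esub> x) i = a \<otimes>\<^bsub>R\<^esub> c x i"
    and coord_basis: "\<And>i j. i < n ==> j < n ==> c (b i) j = (if i = j then \<one>\<^bsub>R\<^esub> else \<zero>\<^bsub>R\<^esub>)"
    and coord_expand: "\<And>x. x \<in> carrier M ==> x = finsum M (\<lambda>j. c x j \<odot>\<^bsub>M\<^esub> b j) {..<n}"
begin

interpretation module R M by (rule module_M)

abbreviation vecs :: "(nat \<Rightarrow> 'm) set" where "vecs \<equiv> {..<n} \<rightarrow>\<^sub>E carrier M"

definition signed :: "(nat \<Rightarrow> nat) \<Rightarrow> 'r \<Rightarrow> 'r" where
  "signed p a = (if evenperm p then a else \<ominus>\<^bsub>R\<^esub> a)"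

definition leibniz :: "(nat \<Rightarrow> 'm) \<Rightarrow> (nat \<Rightarrow> nat) \<Rightarrow> 'r" where
  "leibniz v p = (\<Otimes>\<^bsub>R\<^esub>i\<in>{..<n}. c (v i) (p i))"

definition determinant :: "(nat \<Rightarrow> 'm) \<Rightarrow> 'r" where
  "determinant v = (\<Oplus>\<^bsub>R\<^esub>p\<in>{p. p permutes {..<n}}. signed p (leibniz v p))"

lemma perm_less: "p permutes {..<n} ==> i < n ==> p i < n"
  using permutes_in_image[of p "{..<n}" i] by simp

lemma vecs_closed: "v \<in> vecs ==> i < n ==> v i \<in> carrier M"
  by auto

lemma vecs_upd: "v \<in> vecs ==> i < n ==> x \<in> carrier M ==> v(i := x) \<in> vecs"
  by (auto simp: PiE_iff extensional_def)

lemma entry_closed: "v \<in> vecs ==> p permutes {..<n} ==> i < n ==> c (v i) (p i) \<in> carrier R"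
  by (rule coord_closed[OF vecs_closed perm_less])

lemma leibniz_closed: "v \<in> vecs ==> p permutes {..<n} ==> leibniz v p \<in> carrier R"
  unfolding leibniz_def by (rule R.finprod_closed) (use entry_closed[of v p] in auto)

lemma signed_closed: "a \<in> carrier R ==> signed p a \<in> carrier R"
  by (simp add: signed_def)

lemma determinant_closed: "v \<in> vecs ==> determinant v \<in> carrier R"
  unfolding determinant_def by (rule R.finsum_closed) (auto intro!: signed_closed leibniz_closed)

lemma leibniz_upd:
  assumes v: "v \<in> vecs" and p: "p permutes {..<n}" and i: "i < n" and x: "x \<in> carrier M"
  shows "leibniz (v(i := x)) p = c x (p i) \<otimes>\<^bsub>R\<^esub> (\<Otimes>\<^bsub>R\<^esub>k\<in>{..<n} - {i}. c (v k) (p k))"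
proof -
  have s: "{..<n} = insert i ({..<n} - {i})" using i by auto
  have cl: "c ((v(i := x)) k) (p k) \<in> carrier R" if "k < n" for k
    by (rule entry_closed[OF vecs_upd[OF v i x] p that])
  have "leibniz (v(i := x)) p = (\<Otimes>\<^bsub>R\<^esub>k\<in>insert i ({..<n} - {i}). c ((v(i := x)) k) (p k))"
    unfolding leibniz_def s[symmetric] ..
  also have "\<dots> = c ((v(i := x)) i) (p i) \<otimes>\<^bsub>R\<^esub> (\<Otimes>\<^bsub>R\<^esub>k\<in>{..<n} - {i}. c ((v(i := x)) k) (p k))"
    by (rule R.finprod_insert)
      (use cl cl[OF i] i in auto)
  also have "(\<Otimes>\<^bsub>R\<^esub>k\<in>{..<n} - {i}. c ((v(i := x)) k) (p k)) = (\<Otimes>\<^bsub>R\<^esub>k\<in>{..<n} - {i}. c (v k) (p k))"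
    by (rule R.finprod_cong') (use entry_closed[OF v p] in auto)
  finally show ?thesis unfolding fun_upd_same .
qed

lemma leibniz_rest_closed:
  "v \<in> vecs ==> p permutes {..<n} ==> (\<Otimes>\<^bsub>R\<^esub>k\<in>{..<n} - {i}. c (v k) (p k)) \<in> carrier R"
  by (rule R.finprod_closed) (use entry_closed[of v p] in auto)

lemma determinant_add:
  assumes v: "v \<in> vecs" and i: "i < n" and x: "x \<in> carrier M" and y: "y \<in> carrier M"
  shows "determinant (v(i := x \<oplus>\<^bsub>M\<^esub> y)) = determinant (v(i := x)) \<oplus>\<^bsub>R\<^esub> determinant (v(i := y))"
proof -
  have "determinant (v(i := x \<oplus>\<^bsub>M\<^esub> y))
      = (\<Oplus>\<^bsub>R\<^esub>p\<in>{p. p permutes {..<n}}. signed p (leibniz (v(i := x)) p) \<oplus>\<^bsub>R\<^esub> signed p (leibniz (v(i := y)) p))"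
    unfolding determinant_def
  proof (rule R.finsum_cong'[OF refl])
    fix p assume "p \<in> {p. p permutes {..<n}}"
    then have p: "p permutes {..<n}" by simp
    note cl = coord_closed[OF x perm_less[OF p i]] coord_closed[OF y perm_less[OF p i]] leibniz_rest_closed[OF v p, of i]
    have "leibniz (v(i := x \<oplus>\<^bsub>M\<^esub> y)) p = leibniz (v(i := x)) p \<oplus>\<^bsub>R\<^esub> leibniz (v(i := y)) p"
      using cl by (simp add: leibniz_upd[OF v p i] x y coord_add[OF x y perm_less[OF p i]] R.l_distr)
    then show "signed p (leibniz (v(i := x \<oplus>\<^bsub>M\<^esub> y)) p) = signed p (leibniz (v(i := x)) p) \<oplus>\<^bsub>R\<^esub> signed p (leibniz (v(i := y)) p)"
      using leibniz_closed[OF vecs_upd[OF v i x] p] leibniz_closed[OF vecs_upd[OF v i y] p]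
      by (simp add: signed_def R.minus_add)
  qed (use leibniz_closed[OF vecs_upd[OF v i x]] leibniz_closed[OF vecs_upd[OF v i y]] in \<open>auto intro!: signed_closed\<close>)
  also have "\<dots> = determinant (v(i := x)) \<oplus>\<^bsub>R\<^esub> determinant (v(i := y))"
    unfolding determinant_def
    by (rule R.finsum_addf) (use leibniz_closed[OF vecs_upd[OF v i x]] leibniz_closed[OF vecs_upd[OF v i y]] in \<open>auto intro!: signed_closed\<close>)
  finally show ?thesis .
qed

lemma determinant_smult:
  assumes v: "v \<in> vecs" and i: "i < n" and x: "x \<in> carrier M" and a: "a \<in> carrier R"
  shows "determinant (v(i := a \<odot>\<^bsub>M\<^esub> x)) = a \<otimes>\<^bsub>R\<^esub> determinant (v(i := x))"
proof -
  have fin: "finite {p. p permutes {..<n}}" by (rule finite_permutations) simp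
  have "determinant (v(i := a \<odot>\<^bsub>M\<^esub> x)) = (\<Oplus>\<^bsub>R\<^esub>p\<in>{p. p permutes {..<n}}. a \<otimes>\<^bsub>R\<^esub> signed p (leibniz (v(i := x)) p))"
    unfolding determinant_def
  proof (rule R.finsum_cong'[OF refl])
    fix p assume "p \<in> {p. p permutes {..<n}}"
    then have p: "p permutes {..<n}" by simp
    note cl = coord_closed[OF x perm_less[OF p i]] leibniz_rest_closed[OF v p, of i]
    have "leibniz (v(i := a \<odot>\<^bsub>M\<^esub> x)) p = a \<otimes>\<^bsub>R\<^esub> leibniz (v(i := x)) p"
      using cl a by (simp add: leibniz_upd[OF v p i] x coord_smult[OF a x perm_less[OF p i]] R.m_assoc)
    then show "signed p (leibniz (v(i := a \<odot>\<^bsub>M\<^esub> x)) p) = a \<otimes>\<^bsub>R\<^esub> signed p (leibniz (v(i := x)) p)"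
      using leibniz_closed[OF vecs_upd[OF v i x] p] a by (simp add: signed_def R.r_minus)
  qed (use leibniz_closed[OF vecs_upd[OF v i x]] a in \<open>auto intro!: signed_closed\<close>)
  also have "\<dots> = a \<otimes>\<^bsub>R\<^esub> determinant (v(i := x))"
    unfolding determinant_def
    by (rule R.finsum_rdistr[symmetric]) (use leibniz_closed[OF vecs_upd[OF v i x]] a fin in \<open>auto intro!: signed_closed\<close>)
  finally show ?thesis .
qed

text \<open>The permutations are paired off by composition with the transposition of \<open>i\<close> and \<open>j\<close>; the two
  terms of a pair have opposite signs.\<close>

lemma determinant_alternating:
  assumes v: "v \<in> vecs" and i: "i < n" and j: "j < n" and ij: "i \<noteq> j" and eq: "v i = v j"
  shows "determinant v = \<zero>\<^bsub>R\<^esub>"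
proof -
  let ?t = "Transposition.transpose i j"
  let ?E = "{p. p permutes {..<n} \<and> evenperm p}" and ?O = "{p. p permutes {..<n} \<and> \<not> evenperm p}"
  have t: "?t permutes {..<n}" by (rule permutes_swap_id) (use i j in auto)
  have tt: "?t \<circ> ?t = id" by simp
  have fin: "finite {p. p permutes {..<n}}" by (rule finite_permutations) simp
  have perm: "permutation p" if "p permutes {..<n}" for p using that permutation_permutes by blast
  have flip: "evenperm (p \<circ> ?t) \<longleftrightarrow> \<not> evenperm p" if "p permutes {..<n}" for p
    using evenperm_comp[OF perm[OF that] perm[OF t]] evenperm_swap[of i j] ij by simp
  have pt: "p \<circ> ?t permutes {..<n}" if "p permutes {..<n}" for p
    by (rule permutes_compose[OF t that])
  have same: "leibniz v (p \<circ> ?t) = leibniz v p" if p: "p permutes {..<n}" for p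
  proof -
    have "leibniz v p = (\<Otimes>\<^bsub>R\<^esub>k\<in>?t ` {..<n}. c (v k) (p k))"
      unfolding leibniz_def using permutes_image[OF t] by simp
    also have "\<dots> = (\<Otimes>\<^bsub>R\<^esub>k\<in>{..<n}. c (v (?t k)) (p (?t k)))"
      by (rule R.finprod_reindex) (use permutes_image[OF t] entry_closed[OF v p] permutes_inj_on[OF t] in auto)
    also have "\<dots> = leibniz v (p \<circ> ?t)"
      unfolding leibniz_def
    proof (rule R.finprod_cong'[OF refl])
      show "(\<lambda>k. c (v k) ((p \<circ> ?t) k)) \<in> {..<n} \<rightarrow> carrier R" using entry_closed[OF v pt[OF p]] by auto
      show "c (v (?t k)) (p (?t k)) = c (v k) ((p \<circ> ?t) k)" for k
        using eq by (cases "k = i"; cases "k = j") (auto simp: Transposition.transpose_def)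
    qed
    finally show ?thesis by simp
  qed
  have lc: "leibniz v p \<in> carrier R" if "p permutes {..<n}" for p by (rule leibniz_closed[OF v that])
  have O: "?O = (\<lambda>p. p \<circ> ?t) ` ?E"
  proof (intro subset_antisym subsetI)
    fix p assume "p \<in> ?O"
    then have p: "p permutes {..<n}" "\<not> evenperm p" by auto
    have mem: "p \<circ> ?t \<in> ?E" using pt[OF p(1)] flip[OF p(1)] p(2) by simp
    have "p = p \<circ> ?t \<circ> ?t" using tt by (simp add: o_assoc[symmetric])
    then show "p \<in> (\<lambda>p. p \<circ> ?t) ` ?E" using mem by (rule image_eqI)
  qed (use pt flip in auto)
  have inj: "inj_on (\<lambda>p. p \<circ> ?t) ?E"
  proof (rule inj_onI)
    fix p q assume "p \<circ> ?t = q \<circ> ?t"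
    then have "p \<circ> ?t \<circ> ?t = q \<circ> ?t \<circ> ?t" by simp
    then show "p = q" using tt by (simp add: o_assoc[symmetric])
  qed
  have "determinant v = (\<Oplus>\<^bsub>R\<^esub>p\<in>?E \<union> ?O. signed p (leibniz v p))"
    unfolding determinant_def by (rule arg_cong[of _ _ "finsum R _"]) auto
  also have "\<dots> = (\<Oplus>\<^bsub>R\<^esub>p\<in>?E. signed p (leibniz v p)) \<oplus>\<^bsub>R\<^esub> (\<Oplus>\<^bsub>R\<^esub>p\<in>?O. signed p (leibniz v p))"
    by (rule R.finsum_Un_disjoint) (use fin lc in \<open>auto intro!: signed_closed\<close>)
  also have "(\<Oplus>\<^bsub>R\<^esub>p\<in>?O. signed p (leibniz v p)) = (\<Oplus>\<^bsub>R\<^esub>p\<in>?E. signed (p \<circ> ?t) (leibniz v (p \<circ> ?t)))"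
    unfolding O by (rule R.add.finprod_reindex[OF _ inj]) (use lc pt in \<open>auto intro!: signed_closed\<close>)
  also have "\<dots> = (\<Oplus>\<^bsub>R\<^esub>p\<in>?E. \<ominus>\<^bsub>R\<^esub> leibniz v p)"
    by (rule R.finsum_cong') (use lc same flip in \<open>auto simp: signed_def\<close>)
  also have "(\<Oplus>\<^bsub>R\<^esub>p\<in>?E. signed p (leibniz v p)) = (\<Oplus>\<^bsub>R\<^esub>p\<in>?E. leibniz v p)"
    by (rule R.finsum_cong') (use lc in \<open>auto simp: signed_def\<close>)
  also have "(\<Oplus>\<^bsub>R\<^esub>p\<in>?E. leibniz v p) \<oplus>\<^bsub>R\<^esub> (\<Oplus>\<^bsub>R\<^esub>p\<in>?E. \<ominus>\<^bsub>R\<^esub> leibniz v p) = (\<Oplus>\<^bsub>R\<^esub>p\<in>?E. leibniz v p \<oplus>\<^bsub>R\<^esub> \<ominus>\<^bsub>R\<^esub> leibniz v p)"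
    by (rule R.finsum_addf[symmetric]) (use lc in auto)
  also have "\<dots> = (\<Oplus>\<^bsub>R\<^esub>p\<in>?E. \<zero>\<^bsub>R\<^esub>)"
    by (rule R.finsum_cong') (use lc in \<open>auto simp: R.r_neg\<close>)
  finally show ?thesis by (simp add: R.finsum_zero)
qed

lemma determinant_basis: "determinant (\<lambda>i\<in>{..<n}. b i) = \<one>\<^bsub>R\<^esub>"
proof -
  let ?v = "\<lambda>i\<in>{..<n}. b i"
  have v: "?v \<in> vecs" using basis_closed by auto
  have fin: "finite {p. p permutes {..<n}}" by (rule finite_permutations) simp
  have l: "leibniz ?v p = (if p = id then \<one>\<^bsub>R\<^esub> else \<zero>\<^bsub>R\<^esub>)" if p: "p permutes {..<n}" for p
  proof (cases "p = id")
    case True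
    have "leibniz ?v p = (\<Otimes>\<^bsub>R\<^esub>i\<in>{..<n}. \<one>\<^bsub>R\<^esub>)"
      unfolding leibniz_def by (rule R.finprod_cong') (use True coord_basis in auto)
    then show ?thesis using True by simp
  next
    case False
    then obtain i where i: "p i \<noteq> i" by (auto simp: fun_eq_iff)
    then have "i < n" using p by (meson lessThan_iff permutes_not_in)
    have "leibniz ?v p = leibniz (?v(i := b i)) p" using \<open>i < n\<close> by (simp add: fun_upd_idem)
    also have "\<dots> = c (b i) (p i) \<otimes>\<^bsub>R\<^esub> (\<Otimes>\<^bsub>R\<^esub>k\<in>{..<n} - {i}. c (?v k) (p k))"
      by (rule leibniz_upd[OF v p \<open>i < n\<close> basis_closed[OF \<open>i < n\<close>]])
    also have "c (b i) (p i) = \<zero>\<^bsub>R\<^esub>" using coord_basis[OF \<open>i < n\<close> perm_less[OF p \<open>i < n\<close>]] i by simp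
    finally have "leibniz ?v p = \<zero>\<^bsub>R\<^esub>" unfolding R.l_null[OF leibniz_rest_closed[OF v p]] .
    then show ?thesis using False by (simp only: if_False)
  qed
  have "determinant ?v = (\<Oplus>\<^bsub>R\<^esub>p\<in>{p. p permutes {..<n}}. if id = p then \<one>\<^bsub>R\<^esub> else \<zero>\<^bsub>R\<^esub>)"
    unfolding determinant_def by (rule R.finsum_cong') (use l in \<open>auto simp: signed_def\<close>)
  also have "\<dots> = \<one>\<^bsub>R\<^esub>"
    using R.add.finprod_singleton[of id "{p. p permutes {..<n}}" "\<lambda>_. \<one>\<^bsub>R\<^esub>"] fin permutes_id by simp
  finally show ?thesis .
qed

text \<open>Expanding every argument in the basis, an alternating multilinear form is a combination of
  its values on rearrangements of the basis, hence zero if it vanishes on the basis itself.\<close>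

lemma alternating_form_eq_zero:
  assumes cl: "\<And>v. v \<in> vecs ==> \<alpha> v \<in> carrier R"
    and add: "\<And>v i x y. v \<in> vecs ==> i < n ==> x \<in> carrier M ==> y \<in> carrier M ==>
      \<alpha> (v(i := x \<oplus>\<^bsub>M\<^esub> y)) = \<alpha> (v(i := x)) \<oplus>\<^bsub>R\<^esub> \<alpha> (v(i := y))"
    and smult: "\<And>v i a x. v \<in> vecs ==> i < n ==> a \<in> carrier R ==> x \<in> carrier M ==>
      \<alpha> (v(i := a \<odot>\<^bsub>M\<^esub> x)) = a \<otimes>\<^bsub>R\<^esub> \<alpha> (v(i := x))"
    and alt: "\<And>v i j. v \<in> vecs ==> i < n ==> j < n ==> i \<noteq> j ==> v i = v j ==> \<alpha> v = \<zero>\<^bsub>R\<^esub>"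
    and basis: "\<alpha> (\<lambda>i\<in>{..<n}. b i) = \<zero>\<^bsub>R\<^esub>"
    and v: "v \<in> vecs"
  shows "\<alpha> v = \<zero>\<^bsub>R\<^esub>"
proof -
  (* Expand the form at the sum of the two entries, placed in both slots. *)
  have swap_zero: "\<alpha> (v(i := v j, j := v i)) = \<zero>\<^bsub>R\<^esub>"
    if v: "v \<in> vecs" and ij: "i < n" "j < n" "i \<noteq> j" and z: "\<alpha> v = \<zero>\<^bsub>R\<^esub>" for v i j
  proof -
    let ?x = "v i" and ?y = "v j"
    have x: "?x \<in> carrier M" and y: "?y \<in> carrier M" using vecs_closed[OF v] ij by auto
    have V: "v(i := s, j := t) \<in> vecs" if "s \<in> carrier M" "t \<in> carrier M" for s t
      by (intro vecs_upd v ij that)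
    have e1: "\<alpha> (v(i := s, j := t \<oplus>\<^bsub>M\<^esub> t')) = \<alpha> (v(i := s, j := t)) \<oplus>\<^bsub>R\<^esub> \<alpha> (v(i := s, j := t'))"
      if "s \<in> carrier M" "t \<in> carrier M" "t' \<in> carrier M" for s t t'
      by (rule add[OF vecs_upd[OF v ij(1) that(1)] ij(2) that(2,3)])
    have tw: "v(i := s, j := t) = v(j := t, i := s)" for s t using ij by (simp add: fun_upd_twist)
    have e2: "\<alpha> (v(i := s \<oplus>\<^bsub>M\<^esub> s', j := t)) = \<alpha> (v(i := s, j := t)) \<oplus>\<^bsub>R\<^esub> \<alpha> (v(i := s', j := t))"
      if "s \<in> carrier M" "s' \<in> carrier M" "t \<in> carrier M" for s s' t
      unfolding tw by (rule add[OF vecs_upd[OF v ij(2) that(3)] ij(1) that(1,2)])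
    have diag: "\<alpha> (v(i := s, j := s)) = \<zero>\<^bsub>R\<^esub>" if "s \<in> carrier M" for s
      by (rule alt[OF V[OF that that] ij]) (use ij in simp)
    have xy: "?x \<oplus>\<^bsub>M\<^esub> ?y \<in> carrier M" using x y by simp
    have "\<zero>\<^bsub>R\<^esub> = \<alpha> (v(i := ?x \<oplus>\<^bsub>M\<^esub> ?y, j := ?x \<oplus>\<^bsub>M\<^esub> ?y))" using diag[OF xy] by simp
    also have "\<dots> = (\<alpha> (v(i := ?x, j := ?x)) \<oplus>\<^bsub>R\<^esub> \<alpha> (v(i := ?y, j := ?x))) \<oplus>\<^bsub>R\<^esub> (\<alpha> (v(i := ?x, j := ?y)) \<oplus>\<^bsub>R\<^esub> \<alpha> (v(i := ?y, j := ?y)))"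
      by (simp only: e1[OF xy x y] e2[OF x y x] e2[OF x y y])
    also have "v(i := ?x, j := ?y) = v" by (simp add: fun_eq_iff)
    finally have "\<zero>\<^bsub>R\<^esub> = (\<zero>\<^bsub>R\<^esub> \<oplus>\<^bsub>R\<^esub> \<alpha> (v(i := ?y, j := ?x))) \<oplus>\<^bsub>R\<^esub> (\<zero>\<^bsub>R\<^esub> \<oplus>\<^bsub>R\<^esub> \<zero>\<^bsub>R\<^esub>)"
      unfolding diag[OF x] diag[OF y] z .
    then show ?thesis using cl[OF V[OF y x]] by (simp del: fun_upd_apply)
  qed
  have zero_slot: "\<alpha> (v(i := \<zero>\<^bsub>M\<^esub>)) = \<zero>\<^bsub>R\<^esub>" if v: "v \<in> vecs" and i: "i < n" for v i
  proof -
    have "\<alpha> (v(i := \<zero>\<^bsub>R\<^esub> \<odot>\<^bsub>M\<^esub> \<zero>\<^bsub>M\<^esub>)) = \<zero>\<^bsub>R\<^esub> \<otimes>\<^bsub>R\<^esub> \<alpha> (v(i := \<zero>\<^bsub>M\<^esub>))"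
      by (rule smult[OF v i]) auto
    then show ?thesis
      by (simp only: smult_l_null[OF M.zero_closed] R.l_null[OF cl[OF vecs_upd[OF v i M.zero_closed]]])
  qed
  have sum_slot: "\<alpha> (v(i := finsum M g A)) = \<zero>\<^bsub>R\<^esub>"
    if v: "v \<in> vecs" and i: "i < n" and A: "finite A" and g: "\<And>k. k \<in> A ==> g k \<in> carrier M"
      and z: "\<And>k. k \<in> A ==> \<alpha> (v(i := g k)) = \<zero>\<^bsub>R\<^esub>" for v i A and g :: "nat \<Rightarrow> 'm"
    using A g z
  proof (induction A)
    case empty
    show ?case unfolding M.finsum_empty by (rule zero_slot[OF v i])
  next
    case (insert k A)
    have gA: "g \<in> A \<rightarrow> carrier M" and gk: "g k \<in> carrier M" using insert.prems by auto
    have "finsum M g (insert k A) = g k \<oplus>\<^bsub>M\<^esub> finsum M g A"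
      by (rule M.finsum_insert[OF insert.hyps gA gk])
    then have "\<alpha> (v(i := finsum M g (insert k A))) = \<alpha> (v(i := g k)) \<oplus>\<^bsub>R\<^esub> \<alpha> (v(i := finsum M g A))"
      by (simp only: add[OF v i gk M.finsum_closed[OF gA]])
    also have "\<alpha> (v(i := g k)) = \<zero>\<^bsub>R\<^esub>" by (rule insert.prems(2)) simp
    also have "\<alpha> (v(i := finsum M g A)) = \<zero>\<^bsub>R\<^esub>" by (rule insert.IH) (use insert.prems in auto)
    finally show ?case by (simp only: R.l_zero[OF R.zero_closed])
  qed
  have perm: "\<alpha> (\<lambda>i\<in>{..<n}. b (p i)) = \<zero>\<^bsub>R\<^esub>" if p: "p permutes {..<n}" for p
    using finite_lessThan p
  proof (induction rule: permutes_rev_induct)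
    case id
    show ?case unfolding id_apply by (rule basis)
  next
    case (swap i j p)
    let ?w = "\<lambda>i\<in>{..<n}. b (p i)"
    have w: "?w \<in> vecs" using basis_closed perm_less[OF swap(4)] by auto
    have eq: "(\<lambda>k\<in>{..<n}. b ((p \<circ> Transposition.transpose i j) k)) = ?w(i := ?w j, j := ?w i)"
      using swap(1,2,3) by (auto simp: fun_eq_iff Transposition.transpose_def)
    show ?case unfolding eq by (rule swap_zero[OF w _ _ swap(3,5)]) (use swap(1,2) in auto)
  qed
  have on_basis: "\<alpha> v = \<zero>\<^bsub>R\<^esub>" if v: "v \<in> vecs" and bas: "\<And>i. i < n ==> \<exists>j<n. v i = b j" for v
  proof -
    obtain f where f: "\<And>i. i < n ==> f i < n \<and> v i = b (f i)" using bas by metis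
    show ?thesis
    proof (cases "inj_on f {..<n}")
      case True
      define p where "p i = (if i < n then f i else i)" for i
      have "p permutes {..<n}"
      proof (rule bij_imp_permutes)
        have "inj_on p {..<n}" using True by (auto simp: p_def inj_on_def)
        moreover have "p ` {..<n} \<subseteq> {..<n}" using f by (auto simp: p_def)
        ultimately show "bij_betw p {..<n} {..<n}"
          unfolding bij_betw_def using endo_inj_surj[of "{..<n}" p] by blast
      qed (simp add: p_def)
      then have "\<alpha> (\<lambda>i\<in>{..<n}. b (p i)) = \<zero>\<^bsub>R\<^esub>" by (rule perm)
      moreover have "(\<lambda>i\<in>{..<n}. b (p i)) = v"
        by (rule extensionalityI[of _ "{..<n}"]) (use v f in \<open>auto simp: p_def PiE_iff\<close>)
      ultimately show ?thesis by simp
    next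
      case False
      then obtain i j where "i < n" "j < n" "i \<noteq> j" "f i = f j" unfolding inj_on_def by auto
      then show ?thesis using alt[OF v, of i j] f by metis
    qed
  qed
  have "\<forall>v\<in>vecs. (\<forall>i<n. k \<le> i --> (\<exists>j<n. v i = b j)) --> \<alpha> v = \<zero>\<^bsub>R\<^esub>" if "k \<le> n" for k
    using that
  proof (induction k)
    case 0
    then show ?case using on_basis by auto
  next
    case (Suc k)
    show ?case
    proof (intro ballI impI)
      fix v assume v: "v \<in> vecs" and bas: "\<forall>i<n. Suc k \<le> i --> (\<exists>j<n. v i = b j)"
      have k: "k < n" using Suc.prems by simp
      note vk = vecs_closed[OF v k]
      have "\<alpha> (v(k := finsum M (\<lambda>j. c (v k) j \<odot>\<^bsub>M\<^esub> b j) {..<n})) = \<zero>\<^bsub>R\<^esub>"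
      proof (rule sum_slot[OF v k])
        fix j assume "j \<in> {..<n}"
        then have j: "j < n" by simp
        show "c (v k) j \<odot>\<^bsub>M\<^esub> b j \<in> carrier M" using coord_closed[OF vk j] basis_closed[OF j] by simp
        have w: "v(k := b j) \<in> vecs" by (rule vecs_upd[OF v k basis_closed[OF j]])
        have "\<forall>i<n. k \<le> i --> (\<exists>j'<n. (v(k := b j)) i = b j')"
        proof (intro allI impI)
          fix i assume i: "i < n" "k \<le> i"
          show "\<exists>j'<n. (v(k := b j)) i = b j'"
            using bas i j by (cases "i = k") auto
        qed
        then have "\<alpha> (v(k := b j)) = \<zero>\<^bsub>R\<^esub>" using Suc.IH Suc.prems w by auto
        then show "\<alpha> (v(k := c (v k) j \<odot>\<^bsub>M\<^esub> b j)) = \<zero>\<^bsub>R\<^esub>"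
          unfolding smult[OF v k coord_closed[OF vk j] basis_closed[OF j]]
          by (simp only: R.r_null[OF coord_closed[OF vk j]])
      qed simp
      then show "\<alpha> v = \<zero>\<^bsub>R\<^esub>" unfolding coord_expand[OF vk, symmetric] fun_upd_triv .
    qed
  qed
  from this[of n] v show ?thesis by simp
qed

end

context sheaf_ringed_space
begin

section \<open>Invertible sheaves\<close>

text \<open>Multiplication by \<open>g\<close> identifies the restriction of the structure sheaf to \<open>U\<close> with that of \<open>E\<close>.\<close>

definition generates :: "'p set \<Rightarrow> ('p, 'r, 'm) modsheaf \<Rightarrow> 'm \<Rightarrow> bool" where
  "generates U E g \<longleftrightarrow> opn U \<and> g \<in> secs E U \<and>
     (\<forall>W. opn W \<and> W \<subseteq> U -->
        bij_betw (\<lambda>a. a \<odot>\<^bsub>msec E W\<^esub> mres E U W g) (funs W) (secs E W))"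

definition line_sheaf :: "('p, 'r, 'm) modsheaf \<Rightarrow> bool" where
  "line_sheaf E \<longleftrightarrow> sheaf_of_modules X E \<and>
     (\<forall>x\<in>topspace (tps X). \<exists>U g. x \<in> U \<and> generates U E g)"

lemma generatesD:
  assumes "generates U E g"
  shows "opn U" and "g \<in> secs E U"
    and "\<And>W. opn W ==> W \<subseteq> U ==>
        bij_betw (\<lambda>a. a \<odot>\<^bsub>msec E W\<^esub> mres E U W g) (funs W) (secs E W)"
  using assms unfolding generates_def by simp_all

lemma generates_cancel:
  assumes g: "generates U E g" and W: "opn W" "W \<subseteq> U" and a: "a \<in> funs W" and b: "b \<in> funs W"
    and eq: "a \<odot>\<^bsub>msec E W\<^esub> mres E U W g = b \<odot>\<^bsub>msec E W\<^esub> mres E U W g"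
  shows "a = b"
  by (rule inj_onD[OF bij_betw_imp_inj_on[OF generatesD(3)[OF g W]] eq a b])

lemma generates_coeff:
  assumes g: "generates U E g" and W: "opn W" "W \<subseteq> U" and s: "s \<in> secs E W"
  obtains a where "a \<in> funs W" "s = a \<odot>\<^bsub>msec E W\<^esub> mres E U W g"
proof -
  have "s \<in> (\<lambda>a. a \<odot>\<^bsub>msec E W\<^esub> mres E U W g) ` funs W"
    using bij_betw_imp_surj_on[OF generatesD(3)[OF g W]] s by simp
  then show thesis using that by blast
qed

lemma generates_res:
  assumes E: "linear_presheaf X E" and g: "generates U E g" and V: "opn V" "V \<subseteq> U"
  shows "generates V E (mres E U V g)"
  unfolding generates_def
proof (intro conjI allI impI)
  note gD = generatesD[OF g]
  show "opn V" by (rule V)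
  show "mres E U V g \<in> secs E V" by (rule linear_presheaf_res_closed[OF E gD(1) V gD(2)])
  fix W assume "opn W \<and> W \<subseteq> V"
  then have W: "opn W" "W \<subseteq> V" "W \<subseteq> U" using V by auto
  show "bij_betw (\<lambda>a. a \<odot>\<^bsub>msec E W\<^esub> mres E V W (mres E U V g)) (funs W) (secs E W)"
    unfolding linear_presheaf_res_res[OF E gD(1) V(1) W(1,2) V(2) gD(2)] by (rule gD(3)[OF W(1,3)])
qed

lemma generates_cancel_self:
  assumes E: "linear_presheaf X E" and g: "generates U E g" and a: "a \<in> funs U" and b: "b \<in> funs U"
    and eq: "a \<odot>\<^bsub>msec E U\<^esub> g = b \<odot>\<^bsub>msec E U\<^esub> g"
  shows "a = b"
  by (rule generates_cancel[OF g generatesD(1)[OF g] subset_refl a b])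
    (simp only: linear_presheaf_res_id[OF E generatesD(1,2)[OF g]] eq)

lemma generates_coeff_self:
  assumes E: "linear_presheaf X E" and g: "generates U E g" and s: "s \<in> secs E U"
  obtains a where "a \<in> funs U" "s = a \<odot>\<^bsub>msec E U\<^esub> g"
  using generates_coeff[OF g generatesD(1)[OF g] subset_refl s]
  unfolding linear_presheaf_res_id[OF E generatesD(1,2)[OF g]] by blast

lemma generates_unit_multiple:
  assumes E: "sheaf_of_modules X E" and g: "generates U E g"
    and r: "r \<in> funs U" and s: "s \<in> funs U" and sr: "s \<otimes>\<^bsub>sec X U\<^esub> r = \<one>\<^bsub>sec X U\<^esub>"
  shows "generates U E (r \<odot>\<^bsub>msec E U\<^esub> g)"
  unfolding generates_def
proof (intro conjI allI impI)
  note gD = generatesD[OF g]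
  show "opn U" by (rule gD)
  show "r \<odot>\<^bsub>msec E U\<^esub> g \<in> secs E U" by (rule sheaf_lin(3)[OF E gD(1) r gD(2)])
  fix W assume "opn W \<and> W \<subseteq> U"
  then have W: "opn W" "W \<subseteq> U" by auto
  interpret M: module "sec X W" "msec E W" by (rule modules_module[OF E W(1)])
  let ?r = "res X U W r" and ?s = "res X U W s" and ?g = "mres E U W g"
  have cl: "?r \<in> funs W" "?s \<in> funs W" "?g \<in> secs E W"
    by (intro res_closed gD(1) W r s sheaf_lin(6)[OF E] gD(2))+
  have sr': "?s \<otimes>\<^bsub>sec X W\<^esub> ?r = \<one>\<^bsub>sec X W\<^esub>"
    using res_mult[OF gD(1) W s r] sr res_one[OF gD(1) W] by simp
  have eq: "a \<odot>\<^bsub>msec E W\<^esub> mres E U W (r \<odot>\<^bsub>msec E U\<^esub> g) = (a \<otimes>\<^bsub>sec X W\<^esub> ?r) \<odot>\<^bsub>msec E W\<^esub> ?g"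
    if "a \<in> funs W" for a
    using sheaf_lin(5)[OF E gD(1) W r gD(2)] M.smult_assoc1[OF that cl(1,3)] by simp
  have inv: "a \<otimes>\<^bsub>sec X W\<^esub> ?s \<otimes>\<^bsub>sec X W\<^esub> ?r = a" "a \<otimes>\<^bsub>sec X W\<^esub> ?r \<otimes>\<^bsub>sec X W\<^esub> ?s = a" if "a \<in> funs W" for a
    using that cl sr' by (simp_all add: M.R.m_assoc M.R.m_comm[of ?r ?s])
  have "bij_betw (\<lambda>a. a \<otimes>\<^bsub>sec X W\<^esub> ?r) (funs W) (funs W)"
    by (rule bij_betw_byWitness[where f' = "\<lambda>a. a \<otimes>\<^bsub>sec X W\<^esub> ?s"]) (use inv cl in auto)
  from bij_betw_trans[OF this gD(3)[OF W]]
  show "bij_betw (\<lambda>a. a \<odot>\<^bsub>msec E W\<^esub> mres E U W (r \<odot>\<^bsub>msec E U\<^esub> g)) (funs W) (secs E W)"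
    by (rule bij_betw_cong[THEN iffD1, rotated]) (simp add: eq)
qed

text \<open>The generator is a multiple of its multiple, and coefficients are unique.\<close>

lemma generates_coeff_unit:
  assumes E: "sheaf_of_modules X E" and g: "generates U E g" and r: "r \<in> funs U"
    and rg: "generates U E (r \<odot>\<^bsub>msec E U\<^esub> g)"
  obtains s where "s \<in> funs U" "s \<otimes>\<^bsub>sec X U\<^esub> r = \<one>\<^bsub>sec X U\<^esub>"
proof -
  note gD = generatesD[OF g] and L = modules_linear_presheaf[OF E]
  interpret M: module "sec X U" "msec E U" by (rule modules_module[OF E gD(1)])
  obtain s where s: "s \<in> funs U" "g = s \<odot>\<^bsub>msec E U\<^esub> (r \<odot>\<^bsub>msec E U\<^esub> g)"
    by (rule generates_coeff_self[OF L rg gD(2)])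
  have "(s \<otimes>\<^bsub>sec X U\<^esub> r) \<odot>\<^bsub>msec E U\<^esub> g = \<one>\<^bsub>sec X U\<^esub> \<odot>\<^bsub>msec E U\<^esub> g"
    using M.smult_assoc1[OF s(1) r gD(2)] s(2) gD(2) by simp
  then have "s \<otimes>\<^bsub>sec X U\<^esub> r = \<one>\<^bsub>sec X U\<^esub>"
    by (rule generates_cancel_self[OF L g, rotated 2]) (use s r in auto)
  with s(1) show thesis by (rule that)
qed

lemma line_sheafD:
  assumes "line_sheaf E"
  shows line_sheaf_modules: "sheaf_of_modules X E"
    and line_sheaf_linear: "linear_presheaf X E"
  using assms modules_linear_presheaf unfolding line_sheaf_def by blast+

lemma line_sheaf_generator:
  assumes E: "line_sheaf E" and V: "opn V" "x \<in> V"
  obtains U g where "x \<in> U" "U \<subseteq> V" "generates U E g"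
proof -
  have "x \<in> topspace (tps X)" using V opn_topspace by blast
  then obtain U g where U: "x \<in> U" "generates U E g" using E unfolding line_sheaf_def by blast
  have "generates (U \<inter> V) E (mres E U (U \<inter> V) g)"
    by (rule generates_res[OF line_sheaf_linear[OF E] U(2)]) (use generatesD(1)[OF U(2)] V in auto)
  then show thesis using U V by (intro that[of "U \<inter> V"]) auto
qed

subsection \<open>Duals of invertible sheaves\<close>

definition coord :: "'p set \<Rightarrow> ('p, 'r, 'm) modsheaf \<Rightarrow> 'm \<Rightarrow> 'p set \<Rightarrow> 'm \<Rightarrow> 'r" where
  "coord U E g W s = (THE a. a \<in> funs W \<and> s = a \<odot>\<^bsub>msec E W\<^esub> mres E U W g)"

lemma coord_eqI:
  assumes g: "generates U E g" and W: "opn W" "W \<subseteq> U" and a: "a \<in> funs W"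
    and s: "s = a \<odot>\<^bsub>msec E W\<^esub> mres E U W g"
  shows "coord U E g W s = a"
  unfolding coord_def
proof (rule the_equality)
  show "a \<in> funs W \<and> s = a \<odot>\<^bsub>msec E W\<^esub> mres E U W g" using a s by blast
  show "b = a" if "b \<in> funs W \<and> s = b \<odot>\<^bsub>msec E W\<^esub> mres E U W g" for b
    by (rule generates_cancel[OF g W _ a]) (use that s in auto)
qed

lemma coord_props:
  assumes g: "generates U E g" and W: "opn W" "W \<subseteq> U" and s: "s \<in> secs E W"
  shows coord_closed: "coord U E g W s \<in> funs W"
    and coord_smult_generator: "coord U E g W s \<odot>\<^bsub>msec E W\<^esub> mres E U W g = s"
proof -
  obtain a where a: "a \<in> funs W" "s = a \<odot>\<^bsub>msec E W\<^esub> mres E U W g"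
    by (rule generates_coeff[OF g W s])
  show "coord U E g W s \<in> funs W" "coord U E g W s \<odot>\<^bsub>msec E W\<^esub> mres E U W g = s"
    unfolding coord_eqI[OF g W a] using a by auto
qed

lemma coord_hom:
  assumes E: "sheaf_of_modules X E" and g: "generates U E g"
  shows "on_sections U E (coord U E g) \<in> sheaf_hom X U E unit_module"
proof (rule on_sections_homI[OF modules_linear_presheaf[OF E]])
  note gD = generatesD[OF g]
  fix W s assume W: "opn W" "W \<subseteq> U" and s: "s \<in> secs E W"
  interpret M: module "sec X W" "msec E W" by (rule modules_module[OF E W(1)])
  let ?c = "coord U E g W" and ?g = "mres E U W g"
  have gc: "?g \<in> secs E W" by (rule sheaf_lin(6)[OF E gD(1) W gD(2)])
  note c = coord_props[OF g W]
  show "?c s \<in> secs unit_module W" using c(1)[OF s] by simp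
  show "?c (s \<oplus>\<^bsub>msec E W\<^esub> t) = ?c s \<oplus>\<^bsub>msec unit_module W\<^esub> ?c t" if t: "t \<in> secs E W" for t
  proof -
    have "?c (s \<oplus>\<^bsub>msec E W\<^esub> t) = ?c s \<oplus>\<^bsub>sec X W\<^esub> ?c t"
    proof (rule coord_eqI[OF g W])
      show "?c s \<oplus>\<^bsub>sec X W\<^esub> ?c t \<in> funs W" using c(1)[OF s] c(1)[OF t] by simp
      show "s \<oplus>\<^bsub>msec E W\<^esub> t = (?c s \<oplus>\<^bsub>sec X W\<^esub> ?c t) \<odot>\<^bsub>msec E W\<^esub> ?g"
        using M.smult_l_distr[OF c(1)[OF s] c(1)[OF t] gc] c(2)[OF s] c(2)[OF t] by simp
    qed
    then show ?thesis by simp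
  qed
  show "?c (a \<odot>\<^bsub>msec E W\<^esub> s) = a \<odot>\<^bsub>msec unit_module W\<^esub> ?c s" if a: "a \<in> funs W" for a
  proof -
    have "?c (a \<odot>\<^bsub>msec E W\<^esub> s) = a \<otimes>\<^bsub>sec X W\<^esub> ?c s"
    proof (rule coord_eqI[OF g W])
      show "a \<otimes>\<^bsub>sec X W\<^esub> ?c s \<in> funs W" using c(1)[OF s] a by simp
      show "a \<odot>\<^bsub>msec E W\<^esub> s = (a \<otimes>\<^bsub>sec X W\<^esub> ?c s) \<odot>\<^bsub>msec E W\<^esub> ?g"
        using M.smult_assoc1[OF a c(1)[OF s] gc] c(2)[OF s] by simp
    qed
    then show ?thesis by simp
  qed
  show "coord U E g V (mres E W V s) = mres unit_module W V (?c s)" if V: "opn V" "V \<subseteq> W" for V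
  proof -
    have VU: "V \<subseteq> U" using V W by blast
    have "coord U E g V (mres E W V s) = res X W V (?c s)"
    proof (rule coord_eqI[OF g V(1) VU res_closed[OF W(1) V c(1)[OF s]]])
      have "mres E W V s = mres E W V (?c s \<odot>\<^bsub>msec E W\<^esub> ?g)" using c(2)[OF s] by simp
      also have "\<dots> = res X W V (?c s) \<odot>\<^bsub>msec E V\<^esub> mres E W V ?g"
        by (rule sheaf_lin(5)[OF E W(1) V c(1)[OF s] gc])
      also have "mres E W V ?g = mres E U V g" by (rule sheaf_lin(8)[OF E gD(1) W(1) V W(2) gD(2)])
      finally show "mres E W V s = res X W V (?c s) \<odot>\<^bsub>msec E V\<^esub> mres E U V g" .
    qed
    then show ?thesis by simp
  qed
qed

text \<open>The coefficient of a homomorphism with respect to \<open>\<delta>\<close> is read off as its value on \<open>w\<close>.\<close>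

lemma dual_generatesI:
  assumes P: "linear_presheaf X P" and U: "opn U" and \<delta>: "\<delta> \<in> sheaf_hom X U P unit_module"
    and w: "w \<in> secs P U" and \<delta>w: "\<delta> U w = \<one>\<^bsub>sec X U\<^esub>"
    and det: "\<And>W \<psi>. opn W ==> W \<subseteq> U ==> \<psi> \<in> sheaf_hom X W P unit_module ==>
      \<psi> = \<psi> W (mres P U W w) \<odot>\<^bsub>msec (dual_sheaf X P) W\<^esub> on_opens X W \<delta>"
  shows "generates U (dual_sheaf X P) \<delta>"
  unfolding generates_def
proof (intro conjI allI impI)
  show "opn U" by (rule U)
  show "\<delta> \<in> secs (dual_sheaf X P) U" using \<delta> unfolding dual_sheaf_def by simp
  fix W assume "opn W \<and> W \<subseteq> U"
  then have W: "opn W" "W \<subseteq> U" by auto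
  interpret R: cring "sec X W" by (rule sec_cring[OF W(1)])
  note wW = linear_presheaf_res_closed[OF P U W w]
  have mult: "a \<odot>\<^bsub>msec (dual_sheaf X P) W\<^esub> on_opens X W \<delta> \<in> sheaf_hom X W P unit_module" if "a \<in> funs W" for a
    using hom_sheaf_smult_closed[OF P unit_module_modules W(1) that sheaf_hom_on_subset[OF \<delta> W(2)]]
    unfolding dual_sheaf_def .
  have val: "(a \<odot>\<^bsub>msec (dual_sheaf X P) W\<^esub> on_opens X W \<delta>) W (mres P U W w) = a" if a: "a \<in> funs W" for a
  proof -
    have "\<delta> W (mres P U W w) = \<one>\<^bsub>sec X W\<^esub>"
      using sheaf_hom_res[OF \<delta> U W subset_refl w] \<delta>w res_one[OF U W] by simp
    then show ?thesis using W wW a unfolding dual_sheaf_def hom_sheaf_smult by (simp add: res_id)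
  qed
  show "bij_betw (\<lambda>a. a \<odot>\<^bsub>msec (dual_sheaf X P) W\<^esub> mres (dual_sheaf X P) U W \<delta>) (funs W) (secs (dual_sheaf X P) W)"
  proof (rule bij_betw_byWitness[where f' = "\<lambda>\<psi>. \<psi> W (mres P U W w)"])
    have r: "mres (dual_sheaf X P) U W \<delta> = on_opens X W \<delta>" unfolding dual_sheaf_def by simp
    have c: "secs (dual_sheaf X P) W = sheaf_hom X W P unit_module" unfolding dual_sheaf_def by simp
    show "\<forall>a\<in>funs W. (a \<odot>\<^bsub>msec (dual_sheaf X P) W\<^esub> mres (dual_sheaf X P) U W \<delta>) W (mres P U W w) = a"
      unfolding r using val by blast
    show "\<forall>\<psi>\<in>secs (dual_sheaf X P) W. \<psi> W (mres P U W w) \<odot>\<^bsub>msec (dual_sheaf X P) W\<^esub> mres (dual_sheaf X P) U W \<delta> = \<psi>"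
      unfolding r c using det[OF W] by simp
    show "(\<lambda>a. a \<odot>\<^bsub>msec (dual_sheaf X P) W\<^esub> mres (dual_sheaf X P) U W \<delta>) ` funs W \<subseteq> secs (dual_sheaf X P) W"
      unfolding r c using mult by blast
    show "(\<lambda>\<psi>. \<psi> W (mres P U W w)) ` secs (dual_sheaf X P) W \<subseteq> funs W"
      unfolding c using sheaf_hom_closed[OF _ W(1) subset_refl wW, of _ unit_module] by auto
  qed
qed

text \<open>The coordinate with respect to a generator of \<open>E\<close> generates the dual.\<close>

lemma dual_line_sheaf:
  assumes E: "line_sheaf E"
  shows "line_sheaf (dual_sheaf X E)"
  unfolding line_sheaf_def
proof (intro conjI ballI)
  note M = line_sheaf_modules[OF E] and L = line_sheaf_linear[OF E]
  show "sheaf_of_modules X (dual_sheaf X E)" by (rule dual_sheaf_modules[OF L])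
  fix x assume "x \<in> topspace (tps X)"
  then obtain U g where U: "x \<in> U" and g: "generates U E g" using E unfolding line_sheaf_def by blast
  note gD = generatesD[OF g]
  interpret MU: module "sec X U" "msec E U" by (rule modules_module[OF M gD(1)])
  let ?c = "on_sections U E (coord U E g)"
  have "generates U (dual_sheaf X E) ?c"
  proof (rule dual_generatesI[OF L gD(1) coord_hom[OF M g] gD(2)])
    have "coord U E g U g = \<one>\<^bsub>sec X U\<^esub>"
      by (rule coord_eqI[OF g gD(1) subset_refl]) (use gD(2) linear_presheaf_res_id[OF L gD(1,2)] in simp_all)
    then show "?c U g = \<one>\<^bsub>sec X U\<^esub>" using gD by simp
    fix W \<psi> assume W: "opn W" "W \<subseteq> U" and \<psi>: "\<psi> \<in> sheaf_hom X W E unit_module"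
    interpret R: cring "sec X W" by (rule sec_cring[OF W(1)])
    let ?g = "mres E U W g"
    have gW: "?g \<in> secs E W" by (rule linear_presheaf_res_closed[OF L gD(1) W gD(2)])
    have v: "\<psi> W ?g \<in> funs W" using sheaf_hom_closed[OF \<psi> W(1) subset_refl gW] by simp
    show "\<psi> = \<psi> W ?g \<odot>\<^bsub>msec (dual_sheaf X E) W\<^esub> on_opens X W ?c"
    proof (rule sheaf_hom_eqI[OF \<psi>])
      show "\<psi> W ?g \<odot>\<^bsub>msec (dual_sheaf X E) W\<^esub> on_opens X W ?c \<in> sheaf_hom X W E unit_module"
        using hom_sheaf_smult_closed[OF L unit_module_modules W(1) v sheaf_hom_on_subset[OF coord_hom[OF M g] W(2)]]
        unfolding dual_sheaf_def .
      fix V s assume V: "opn V" "V \<subseteq> W" and s: "s \<in> secs E V"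
      interpret RV: cring "sec X V" by (rule sec_cring[OF V(1)])
      have VU: "V \<subseteq> U" using V W by blast
      note c = coord_props[OF g V(1) VU s]
      have gV: "mres E U V g \<in> secs E V" by (rule linear_presheaf_res_closed[OF L gD(1) V(1) VU gD(2)])
      have "\<psi> V s = \<psi> V (coord U E g V s \<odot>\<^bsub>msec E V\<^esub> mres E U V g)" using c(2) by simp
      also have "\<dots> = coord U E g V s \<otimes>\<^bsub>sec X V\<^esub> \<psi> V (mres E U V g)"
        using sheaf_hom_smult[OF \<psi> V c(1) gV] by simp
      also have "\<psi> V (mres E U V g) = res X W V (\<psi> W ?g)"
        using sheaf_hom_res[OF \<psi> W(1) V subset_refl gW] linear_presheaf_res_res[OF L gD(1) W(1) V W(2) gD(2)] by simp
      finally have "\<psi> V s = res X W V (\<psi> W ?g) \<otimes>\<^bsub>sec X V\<^esub> coord U E g V s"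
        using c(1) res_closed[OF W(1) V v] by (simp add: RV.m_comm)
      then show "\<psi> V s = (\<psi> W ?g \<odot>\<^bsub>msec (dual_sheaf X E) W\<^esub> on_opens X W ?c) V s"
        using V VU s unfolding dual_sheaf_def hom_sheaf_smult by simp
    qed
  qed
  with U show "\<exists>U \<delta>. x \<in> U \<and> generates U (dual_sheaf X E) \<delta>" by blast
qed

lemma isomorphic_line_sheaf:
  assumes E: "line_sheaf E" and F: "sheaf_of_modules X F" and iso: "isomorphic X E F"
  shows "line_sheaf F"
  unfolding line_sheaf_def
proof (intro conjI ballI F)
  note L = line_sheaf_linear[OF E]
  obtain \<phi> where \<phi>: "\<phi> \<in> homs X E F"
    and bij: "\<And>W. opn W ==> W \<subseteq> topspace (tps X) ==> bij_betw (\<phi> W) (secs E W) (secs F W)"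
    using iso unfolding isomorphic_on_def by blast
  fix x assume "x \<in> topspace (tps X)"
  then obtain U g where U: "x \<in> U" and g: "generates U E g" using E unfolding line_sheaf_def by blast
  note gD = generatesD[OF g]
  have "generates U F (\<phi> U g)"
    unfolding generates_def
  proof (intro conjI allI impI gD(1))
    show "\<phi> U g \<in> secs F U" by (rule sheaf_hom_closed[OF \<phi> gD(1) opn_topspace[OF gD(1)] gD(2)])
    fix W assume "opn W \<and> W \<subseteq> U"
    then have W: "opn W" "W \<subseteq> U" by auto
    have eq: "a \<odot>\<^bsub>msec F W\<^esub> mres F U W (\<phi> U g) = \<phi> W (a \<odot>\<^bsub>msec E W\<^esub> mres E U W g)" if "a \<in> funs W" for a
      using sheaf_hom_res[OF \<phi> gD(1) W opn_topspace[OF gD(1)] gD(2)]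
        sheaf_hom_smult[OF \<phi> W(1) opn_topspace[OF W(1)] that linear_presheaf_res_closed[OF L gD(1) W gD(2)]] by simp
    from bij_betw_trans[OF gD(3)[OF W] bij[OF W(1) opn_topspace[OF W(1)]]]
    show "bij_betw (\<lambda>a. a \<odot>\<^bsub>msec F W\<^esub> mres F U W (\<phi> U g)) (funs W) (secs F W)"
      by (rule bij_betw_cong[THEN iffD1, rotated]) (simp add: eq)
  qed
  with U show "\<exists>U g. x \<in> U \<and> generates U F g" by blast
qed

lemma free_sheaf_simps:
  "secs (free_sheaf X n) U = {..<n} \<rightarrow>\<^sub>E funs U"
  "v \<oplus>\<^bsub>msec (free_sheaf X n) U\<^esub> w = (\<lambda>i\<in>{..<n}. v i \<oplus>\<^bsub>sec X U\<^esub> w i)"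
  "a \<odot>\<^bsub>msec (free_sheaf X n) U\<^esub> v = (\<lambda>i\<in>{..<n}. a \<otimes>\<^bsub>sec X U\<^esub> v i)"
  "mres (free_sheaf X n) U V v = (\<lambda>i\<in>{..<n}. res X U V (v i))"
  by (simp_all add: free_sheaf_def mk_module_def)

lemma vector_bundle_line_sheaf:
  assumes E: "vector_bundle X 1 E"
  shows "line_sheaf E"
  unfolding line_sheaf_def
proof (intro conjI ballI)
  show M: "sheaf_of_modules X E" using E unfolding vector_bundle_def by simp
  fix x assume "x \<in> topspace (tps X)"
  then obtain U where U: "opn U" "x \<in> U" and iso: "isomorphic_on X U (free_sheaf X 1) E"
    using E unfolding vector_bundle_def by blast
  obtain \<phi> where \<phi>: "\<phi> \<in> sheaf_hom X U (free_sheaf X 1) E"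
    and bij: "\<And>W. opn W ==> W \<subseteq> U ==> bij_betw (\<phi> W) (secs (free_sheaf X 1) W) (secs E W)"
    using iso unfolding isomorphic_on_def by blast
  define e where "e W = (\<lambda>i\<in>{..<1::nat}. \<one>\<^bsub>sec X W\<^esub>)" for W
  have e: "e W \<in> secs (free_sheaf X 1) W" if "opn W" for W
  proof -
    interpret cring "sec X W" by (rule sec_cring[OF that])
    show ?thesis unfolding free_sheaf_simps e_def by auto
  qed
  have "generates U E (\<phi> U (e U))"
    unfolding generates_def
  proof (intro conjI allI impI U(1))
    show "\<phi> U (e U) \<in> secs E U" by (rule sheaf_hom_closed[OF \<phi> U(1) subset_refl e[OF U(1)]])
    fix W assume "opn W \<and> W \<subseteq> U"
    then have W: "opn W" "W \<subseteq> U" by auto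
    interpret cring "sec X W" by (rule sec_cring[OF W(1)])
    have re: "mres (free_sheaf X 1) U W (e U) = e W"
      unfolding free_sheaf_simps e_def by (auto simp: fun_eq_iff res_one[OF U(1) W])
    have eq: "a \<odot>\<^bsub>msec E W\<^esub> mres E U W (\<phi> U (e U)) = \<phi> W (\<lambda>i\<in>{..<1}. a)" if a: "a \<in> funs W" for a
    proof -
      have "a \<odot>\<^bsub>msec (free_sheaf X 1) W\<^esub> e W = (\<lambda>i\<in>{..<1}. a)"
        unfolding free_sheaf_simps e_def using a by (auto simp: fun_eq_iff)
      then show ?thesis
        using sheaf_hom_res[OF \<phi> U(1) W subset_refl e[OF U(1)]] re sheaf_hom_smult[OF \<phi> W a e[OF W(1)]] by simp
    qed
    have "bij_betw (\<lambda>a. \<lambda>i\<in>{..<1::nat}. a) (funs W) (secs (free_sheaf X 1) W)"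
      by (rule bij_betw_byWitness[where f' = "\<lambda>v. v 0"])
        (auto simp: free_sheaf_simps fun_eq_iff PiE_iff extensional_def split: if_splits)
    from bij_betw_trans[OF this bij[OF W]]
    show "bij_betw (\<lambda>a. a \<odot>\<^bsub>msec E W\<^esub> mres E U W (\<phi> U (e U))) (funs W) (secs E W)"
      by (rule bij_betw_cong[THEN iffD1, rotated]) (simp add: eq)
  qed
  with U show "\<exists>U g. x \<in> U \<and> generates U E g" by blast
qed

subsection \<open>Locality\<close>

text \<open>Equality on the nose: what is built from the sections over the open subsets of \<open>U\<close> inherits it.\<close>

definition agree_on :: "'p set \<Rightarrow> ('p, 'r, 'm) modsheaf \<Rightarrow> ('p, 'r, 'm) modsheaf \<Rightarrow> bool" where
  "agree_on U E F \<longleftrightarrow> (\<forall>W. opn W \<and> W \<subseteq> U --> msec E W = msec F W) \<and>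
     (\<forall>W V. opn W \<and> opn V \<and> V \<subseteq> W \<and> W \<subseteq> U --> mres E W V = mres F W V)"

lemma agree_onD:
  assumes "agree_on U E F"
  shows "\<And>W. opn W ==> W \<subseteq> U ==> msec E W = msec F W"
    and "\<And>W V. opn W ==> opn V ==> V \<subseteq> W ==> W \<subseteq> U ==> mres E W V = mres F W V"
  using assms unfolding agree_on_def by simp_all

lemma agree_on_sym: "agree_on U E F ==> agree_on U F E"
  unfolding agree_on_def by simp

lemma agree_on_sheaf_hom:
  assumes ag: "agree_on U E F" and W: "W \<subseteq> U"
  shows "sheaf_hom X W E G \<subseteq> sheaf_hom X W F G"
proof
  fix \<phi> assume \<phi>: "\<phi> \<in> sheaf_hom X W E G"
  have eq: "msec E V = msec F V" if "opn V" "V \<subseteq> W" for V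
    by (rule agree_onD(1)[OF ag that(1)]) (use that W in blast)
  show "\<phi> \<in> sheaf_hom X W F G"
  proof (rule sheaf_homI[OF sheaf_hom_on_opens[OF \<phi>]])
    fix V assume V: "opn V" "V \<subseteq> W"
    note e = eq[OF V]
    show "\<phi> V \<in> secs F V \<rightarrow>\<^sub>E secs G V"
      using sheaf_hom_ext[OF \<phi> V] unfolding e .
    show "\<phi> V (s \<oplus>\<^bsub>msec F V\<^esub> t) = \<phi> V s \<oplus>\<^bsub>msec G V\<^esub> \<phi> V t" if "s \<in> secs F V" "t \<in> secs F V" for s t
      using sheaf_hom_add[OF \<phi> V, unfolded e, OF that] .
    show "\<phi> V (a \<odot>\<^bsub>msec F V\<^esub> s) = a \<odot>\<^bsub>msec G V\<^esub> \<phi> V s" if "a \<in> funs V" "s \<in> secs F V" for s a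
      using sheaf_hom_smult[OF \<phi> V, unfolded e, OF that] .
    show "\<phi> V' (mres F V V' s) = mres G V V' (\<phi> V s)" if "opn V'" "V' \<subseteq> V" "s \<in> secs F V" for V' s
    proof -
      have "mres E V V' = mres F V V'" by (rule agree_onD(2)[OF ag V(1) that(1,2)]) (use V W in blast)
      then show ?thesis using sheaf_hom_res[OF \<phi> V(1) that(1,2) V(2), unfolded e, OF that(3)] by simp
    qed
  qed
qed

lemma agree_on_dual:
  assumes ag: "agree_on U E F"
  shows "agree_on U (dual_sheaf X E) (dual_sheaf X F)"
  unfolding agree_on_def
proof (intro conjI allI impI)
  fix W assume "opn W \<and> W \<subseteq> U"
  then have W: "opn W" "W \<subseteq> U" by auto
  have h: "sheaf_hom X W E unit_module = sheaf_hom X W F unit_module"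
    using agree_on_sheaf_hom[OF ag W(2)] agree_on_sheaf_hom[OF agree_on_sym[OF ag] W(2)] by (rule subset_antisym)
  have c: "secs E V = secs F V" if "opn V" "V \<subseteq> W" for V
    using agree_onD(1)[OF ag that(1)] that W by (metis subset_trans)
  have o: "on_opens X W (\<lambda>V. \<lambda>s\<in>secs E V. f V s) = on_opens X W (\<lambda>V. \<lambda>s\<in>secs F V. f V s)"
    for f :: "'p set \<Rightarrow> 'a \<Rightarrow> 'r"
    unfolding on_opens_def using c by (auto simp: fun_eq_iff)
  show "msec (dual_sheaf X E) W = msec (dual_sheaf X F) W"
    unfolding dual_sheaf_def hom_sheaf_def by (simp only: modsheaf.simps h o)
next
  fix W V
  show "mres (dual_sheaf X E) W V = mres (dual_sheaf X F) W V"
    unfolding dual_sheaf_def hom_sheaf_def by simp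
qed

end

section \<open>Exterior powers and determinants\<close>

lemma ext_relations_cases:
  assumes "r \<in> ext_relations R n M"
  obtains (add) v i x y where "v \<in> {..<n} \<rightarrow>\<^sub>E carrier M" "i < n" "x \<in> carrier M" "y \<in> carrier M"
      "r = basis_vector R (v(i := x \<oplus>\<^bsub>M\<^esub> y)) \<ominus>\<^bsub>free_module R ({..<n} \<rightarrow>\<^sub>E carrier M)\<^esub>
        (basis_vector R (v(i := x)) \<oplus>\<^bsub>free_module R ({..<n} \<rightarrow>\<^sub>E carrier M)\<^esub> basis_vector R (v(i := y)))"
  | (smult) v i a x where "v \<in> {..<n} \<rightarrow>\<^sub>E carrier M" "i < n" "a \<in> carrier R" "x \<in> carrier M"
      "r = basis_vector R (v(i := a \<odot>\<^bsub>M\<^esub> x)) \<ominus>\<^bsub>free_module R ({..<n} \<rightarrow>\<^sub>E carrier M)\<^esub>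
        (a \<odot>\<^bsub>free_module R ({..<n} \<rightarrow>\<^sub>E carrier M)\<^esub> basis_vector R (v(i := x)))"
  | (alt) v i j where "v \<in> {..<n} \<rightarrow>\<^sub>E carrier M" "i < n" "j < n" "i \<noteq> j" "v i = v j" "r = basis_vector R v"
  using assms unfolding ext_relations_def Let_def Un_iff mem_Collect_eq
  by (elim disjE exE conjE) blast+

lemma ext_relations_add:
  "v \<in> {..<n} \<rightarrow>\<^sub>E carrier M ==> i < n ==> x \<in> carrier M ==> y \<in> carrier M ==>
    basis_vector R (v(i := x \<oplus>\<^bsub>M\<^esub> y)) \<ominus>\<^bsub>free_module R ({..<n} \<rightarrow>\<^sub>E carrier M)\<^esub>
      (basis_vector R (v(i := x)) \<oplus>\<^bsub>free_module R ({..<n} \<rightarrow>\<^sub>E carrier M)\<^esub> basis_vector R (v(i := y)))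
    \<in> ext_relations R n M"
  unfolding ext_relations_def Let_def by blast

lemma ext_relations_smult:
  "v \<in> {..<n} \<rightarrow>\<^sub>E carrier M ==> i < n ==> a \<in> carrier R ==> x \<in> carrier M ==>
    basis_vector R (v(i := a \<odot>\<^bsub>M\<^esub> x)) \<ominus>\<^bsub>free_module R ({..<n} \<rightarrow>\<^sub>E carrier M)\<^esub>
      (a \<odot>\<^bsub>free_module R ({..<n} \<rightarrow>\<^sub>E carrier M)\<^esub> basis_vector R (v(i := x)))
    \<in> ext_relations R n M"
  unfolding ext_relations_def Let_def by blast

lemma ext_relations_alt:
  "v \<in> {..<n} \<rightarrow>\<^sub>E carrier M ==> i < n ==> j < n ==> i \<noteq> j ==> v i = v j ==> basis_vector R v \<in> ext_relations R n M"
  unfolding ext_relations_def Let_def by blast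

lemma PiE_upd: "v \<in> {..<n::nat} \<rightarrow>\<^sub>E A ==> i < n ==> x \<in> A ==> v(i := x) \<in> {..<n} \<rightarrow>\<^sub>E A"
  by (auto simp: PiE_iff extensional_def)

context sheaf_ringed_space
begin

abbreviation ext_gens :: "nat \<Rightarrow> ('p, 'r, 'm) modsheaf \<Rightarrow> 'p set \<Rightarrow> (nat \<Rightarrow> 'm) set" where
  "ext_gens n E \<equiv> \<lambda>U. {..<n} \<rightarrow>\<^sub>E secs E U"

abbreviation ext_res :: "nat \<Rightarrow> ('p, 'r, 'm) modsheaf \<Rightarrow> 'p set \<Rightarrow> 'p set \<Rightarrow> (nat \<Rightarrow> 'm) \<Rightarrow> nat \<Rightarrow> 'm" where
  "ext_res n E \<equiv> \<lambda>U V v. \<lambda>i\<in>{..<n}. mres E U V (v i)"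

abbreviation ext_rel :: "nat \<Rightarrow> ('p, 'r, 'm) modsheaf \<Rightarrow> 'p set \<Rightarrow> ((nat \<Rightarrow> 'm) \<Rightarrow> 'r) set" where
  "ext_rel n E \<equiv> \<lambda>U. ext_relations (sec X U) n (msec E U)"

lemma ext_res_upd: "i < n ==> ext_res n E U V (v(i := x)) = (ext_res n E U V v)(i := mres E U V x)"
  by (auto simp: fun_eq_iff)

lemma ext_presentation:
  assumes E: "linear_presheaf X E"
  shows "presentation X (ext_gens n E) (ext_res n E) (ext_rel n E)"
proof -
  note L = linear_presheafD[OF E]
  have rc: "ext_res n E U V v \<in> ext_gens n E V" if "opn U" "opn V" "V \<subseteq> U" "v \<in> ext_gens n E U" for U V v
    using that(4) by (auto intro!: L(6)[OF that(1,2,3)])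
  interpret G: generator_presheaf X "ext_gens n E" "ext_res n E"
  proof
    show "ext_res n E U V v \<in> ext_gens n E V" if "opn U" "opn V" "V \<subseteq> U" "v \<in> ext_gens n E U" for U V v
      by (rule rc[OF that])
    show "ext_res n E U U v = v" if "opn U" "v \<in> ext_gens n E U" for U v
      by (rule extensionalityI[of _ "{..<n}"]) (use that L(7) in \<open>auto simp: PiE_iff\<close>)
    show "ext_res n E V W (ext_res n E U V v) = ext_res n E U W v"
      if "opn U" "opn V" "opn W" "W \<subseteq> V" "V \<subseteq> U" "v \<in> ext_gens n E U" for U V W v
      by (rule extensionalityI[of _ "{..<n}"]) (use that L(8) in \<open>auto simp: PiE_iff\<close>)
  qed
  show ?thesis
  proof
    fix U assume U: "opn U"
    note b = G.basis_closed[OF U]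
    interpret Fr: module "sec X U" "G.Fr U" by (rule G.Fr_module[OF U])
    show "ext_rel n E U \<subseteq> carrier (G.Fr U)"
    proof
      fix r assume "r \<in> ext_rel n E U"
      then show "r \<in> carrier (G.Fr U)"
      proof (cases rule: ext_relations_cases)
        case (add v i x y)
        note c = b[OF PiE_upd[OF add(1,2) L(2)[OF U add(3,4)]]] b[OF PiE_upd[OF add(1,2,3)]] b[OF PiE_upd[OF add(1,2,4)]]
        show ?thesis unfolding add(5) by (rule Fr.M.minus_closed[OF c(1) G.Fr_add_closed[OF U c(2,3)]])
      next
        case (smult v i a x)
        note c = b[OF PiE_upd[OF smult(1,2) L(3)[OF U smult(3,4)]]] b[OF PiE_upd[OF smult(1,2,4)]]
        show ?thesis unfolding smult(5) by (rule Fr.M.minus_closed[OF c(1) G.Fr_smult_closed[OF U smult(3) c(2)]])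
      next
        case (alt v i j)
        show ?thesis unfolding alt(6) by (rule b[OF alt(1)])
      qed
    qed
  next
    fix U V r assume UV: "opn U" "opn V" "V \<subseteq> U" and "r \<in> ext_rel n E U"
    from this(4) show "G.fm U V r \<in> ext_rel n E V"
    proof (cases rule: ext_relations_cases)
      case (add v i x y)
      note c = PiE_upd[OF add(1,2) L(2)[OF UV(1) add(3,4)]] PiE_upd[OF add(1,2,3)] PiE_upd[OF add(1,2,4)]
      show ?thesis
        unfolding add(5) G.fm_sum_relation[OF UV c] ext_res_upd[OF add(2)] L(4)[OF UV add(3,4)]
        by (rule ext_relations_add[OF rc[OF UV add(1)] add(2) L(6)[OF UV add(3)] L(6)[OF UV add(4)]])
    next
      case (smult v i a x)
      note c = PiE_upd[OF smult(1,2) L(3)[OF UV(1) smult(3,4)]] PiE_upd[OF smult(1,2,4)]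
      show ?thesis
        unfolding smult(5) G.fm_smult_relation[OF UV c smult(3)] ext_res_upd[OF smult(2)] L(5)[OF UV smult(3,4)]
        by (rule ext_relations_smult[OF rc[OF UV smult(1)] smult(2) res_closed[OF UV smult(3)] L(6)[OF UV smult(4)]])
    next
      case (alt v i j)
      show ?thesis
        unfolding alt(6) G.fm_basis[OF UV alt(1)]
        by (rule ext_relations_alt[OF rc[OF UV alt(1)] alt(2,3,4)]) (use alt in simp)
    qed
  qed
qed

text \<open>The exterior power before sheafification.  Its value over \<open>U\<close> depends on nothing but the
  sections of \<open>E\<close> over \<open>U\<close>.\<close>

definition ext_presheaf :: "nat \<Rightarrow> ('p, 'r, 'm) modsheaf \<Rightarrow> ('p, 'r, ((nat \<Rightarrow> 'm) \<Rightarrow> 'r) set) modsheaf" where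
  "ext_presheaf n E = presented_presheaf (ext_gens n E) (ext_res n E) (\<lambda>U. ext_submodule (sec X U) n (msec E U))"

lemma ext_presheaf_presentation:
  assumes E: "linear_presheaf X E"
  shows "ext_presheaf n E = presentation.P X (ext_gens n E) (ext_res n E) (ext_rel n E)"
proof -
  interpret presentation X "ext_gens n E" "ext_res n E" "ext_rel n E" by (rule ext_presentation[OF E])
  show ?thesis unfolding ext_presheaf_def P_def N_def ext_submodule_def ..
qed

lemma ext_power_sheaf_eq: "ext_power_sheaf X n E = sheafify X (ext_presheaf n E)"
  unfolding ext_power_sheaf_def ext_presheaf_def presented_presheaf_def ext_power_module_def ..

lemma ext_presheaf_linear: "linear_presheaf X E ==> linear_presheaf X (ext_presheaf n E)"
  unfolding ext_presheaf_presentation by (rule presentation.presented_linear_presheaf[OF ext_presentation])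

lemma ext_presheaf_agree:
  assumes ag: "agree_on U E F"
  shows "agree_on U (ext_presheaf n E) (ext_presheaf n F)"
  unfolding agree_on_def
proof (intro conjI allI impI)
  show "msec (ext_presheaf n E) W = msec (ext_presheaf n F) W" if "opn W \<and> W \<subseteq> U" for W
    using agree_onD(1)[OF ag] that unfolding ext_presheaf_def presented_presheaf_def by simp
  show "mres (ext_presheaf n E) W V = mres (ext_presheaf n F) W V" if WV: "opn W \<and> opn V \<and> V \<subseteq> W \<and> W \<subseteq> U" for W V
  proof -
    have "V \<subseteq> U" using WV by blast
    then have "msec E V = msec F V" "mres E W V = mres F W V"
      using agree_onD[OF ag] WV by auto
    then show ?thesis unfolding ext_presheaf_def presented_presheaf_def by simp
  qed
qed

text \<open>A trivialization of \<open>E\<close> over \<open>U\<close> gives compatible bases over the open subsets of \<open>U\<close>.\<close>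

context
  fixes E :: "('p, 'r, 'm) modsheaf" and n :: nat and U :: "'p set" and \<phi>
  assumes E: "sheaf_of_modules X E" and U: "opn U"
    and \<phi>: "\<phi> \<in> sheaf_hom X U (free_sheaf X n) E"
    and bij: "\<And>W. opn W ==> W \<subseteq> U ==> bij_betw (\<phi> W) (secs (free_sheaf X n) W) (secs E W)"
begin

private lemmas bun_lin = sheaf_lin[OF E]

private definition std :: "'p set \<Rightarrow> nat \<Rightarrow> nat \<Rightarrow> 'r" where
  "std W i = (\<lambda>j\<in>{..<n}. if i = j then \<one>\<^bsub>sec X W\<^esub> else \<zero>\<^bsub>sec X W\<^esub>)"

private definition bas :: "'p set \<Rightarrow> nat \<Rightarrow> 'm" where "bas W i = \<phi> W (std W i)"

private definition crd :: "'p set \<Rightarrow> 'm \<Rightarrow> nat \<Rightarrow> 'r" where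
  "crd W = inv_into (secs (free_sheaf X n) W) (\<phi> W)"

private lemma std_closed: "opn W ==> std W i \<in> secs (free_sheaf X n) W"
proof -
  assume "opn W"
  then interpret cring "sec X W" by (rule sec_cring)
  show ?thesis unfolding std_def free_sheaf_simps by auto
qed

private lemma crd_phi: "opn W ==> W \<subseteq> U ==> v \<in> secs (free_sheaf X n) W ==> crd W (\<phi> W v) = v"
  unfolding crd_def by (rule bij_betw_inv_into_left[OF bij])

private lemma phi_crd: "opn W ==> W \<subseteq> U ==> x \<in> secs E W ==> \<phi> W (crd W x) = x"
  unfolding crd_def by (rule bij_betw_inv_into_right[OF bij])

private lemma crd_closed: "opn W ==> W \<subseteq> U ==> x \<in> secs E W ==> crd W x \<in> secs (free_sheaf X n) W"
  unfolding crd_def by (rule inv_into_into) (use bij in \<open>simp add: bij_betw_def\<close>)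

private lemma crd_entry: "opn W ==> W \<subseteq> U ==> x \<in> secs E W ==> i < n ==> crd W x i \<in> funs W"
  using crd_closed unfolding free_sheaf_simps by auto

private lemma crd_res:
  assumes W: "opn W" "W \<subseteq> U" and V: "opn V" "V \<subseteq> W" and x: "x \<in> secs E W" and i: "i < n"
  shows "crd V (mres E W V x) i = res X W V (crd W x i)"
proof -
  let ?v = "mres (free_sheaf X n) W V (crd W x)"
  have VU: "V \<subseteq> U" using V W by blast
  note cx = crd_closed[OF W x]
  have "?v \<in> secs (free_sheaf X n) V"
    using cx res_closed[OF W(1) V] unfolding free_sheaf_simps by auto
  moreover have "\<phi> V ?v = mres E W V x"
    using sheaf_hom_res[OF \<phi> W(1) V W(2) cx] phi_crd[OF W x] by simp
  ultimately have "crd V (mres E W V x) = ?v" using crd_phi[OF V(1) VU] by metis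
  then show ?thesis using i unfolding free_sheaf_simps by simp
qed

private lemma with_basis:
  assumes W: "opn W" "W \<subseteq> U"
  shows "module_with_basis (sec X W) (msec E W) n (bas W) (crd W)"
proof -
  interpret M: module "sec X W" "msec E W" by (rule modules_module[OF E W(1)])
  let ?F = "msec (free_sheaf X n) W"
  have Fadd: "v \<oplus>\<^bsub>?F\<^esub> w \<in> carrier ?F" if "v \<in> carrier ?F" "w \<in> carrier ?F" for v w
    using that unfolding free_sheaf_simps by auto
  have Fsm: "a \<odot>\<^bsub>?F\<^esub> v \<in> carrier ?F" if "a \<in> funs W" "v \<in> carrier ?F" for a v
    using that unfolding free_sheaf_simps by auto
  have expand: "\<phi> W (\<lambda>i\<in>{..<n}. if i < m then v i else \<zero>\<^bsub>sec X W\<^esub>) = finsum (msec E W) (\<lambda>j. v j \<odot>\<^bsub>msec E W\<^esub> bas W j) {..<m}"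
    if m: "m \<le> n" and v: "v \<in> carrier ?F" for m v
    using m
  proof (induction m)
    case 0
    let ?z = "\<lambda>i\<in>{..<n}. \<zero>\<^bsub>sec X W\<^esub>"
    have z: "?z \<in> carrier ?F" unfolding free_sheaf_simps by auto
    have "?z = \<zero>\<^bsub>sec X W\<^esub> \<odot>\<^bsub>?F\<^esub> ?z" unfolding free_sheaf_simps by (auto simp: fun_eq_iff)
    then have "\<phi> W ?z = \<zero>\<^bsub>sec X W\<^esub> \<odot>\<^bsub>msec E W\<^esub> \<phi> W ?z"
      using sheaf_hom_smult[OF \<phi> W M.R.zero_closed z] by simp
    also have "\<dots> = \<zero>\<^bsub>msec E W\<^esub>" by (rule M.smult_l_null[OF sheaf_hom_closed[OF \<phi> W z]])
    finally show ?case by (simp only: not_less0 if_False lessThan_0 M.M.finsum_empty)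
  next
    case (Suc m)
    then have mn: "m < n" by simp
    let ?t = "\<lambda>k. \<lambda>i\<in>{..<n}. if i < k then v i else \<zero>\<^bsub>sec X W\<^esub>"
    have vi: "v i \<in> funs W" if "i < n" for i using v that unfolding free_sheaf_simps by auto
    have t: "?t m \<in> carrier ?F" unfolding free_sheaf_simps using vi by auto
    note s = Fsm[OF vi[OF mn] std_closed[OF W(1), of m]]
    have bm: "bas W j \<in> secs E W" for j unfolding bas_def by (rule sheaf_hom_closed[OF \<phi> W std_closed[OF W(1)]])
    have "?t (Suc m) = ?t m \<oplus>\<^bsub>?F\<^esub> (v m \<odot>\<^bsub>?F\<^esub> std W m)"
      unfolding free_sheaf_simps std_def using vi mn by (auto simp: fun_eq_iff less_Suc_eq)
    then have "\<phi> W (?t (Suc m)) = \<phi> W (?t m) \<oplus>\<^bsub>msec E W\<^esub> v m \<odot>\<^bsub>msec E W\<^esub> bas W m"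
      unfolding bas_def using sheaf_hom_add[OF \<phi> W t s] sheaf_hom_smult[OF \<phi> W vi[OF mn] std_closed[OF W(1)]] by simp
    also have "\<phi> W (?t m) = finsum (msec E W) (\<lambda>j. v j \<odot>\<^bsub>msec E W\<^esub> bas W j) {..<m}"
      by (rule Suc.IH) (use mn in simp)
    also have "finsum (msec E W) (\<lambda>j. v j \<odot>\<^bsub>msec E W\<^esub> bas W j) {..<m} \<oplus>\<^bsub>msec E W\<^esub> v m \<odot>\<^bsub>msec E W\<^esub> bas W m
        = finsum (msec E W) (\<lambda>j. v j \<odot>\<^bsub>msec E W\<^esub> bas W j) (insert m {..<m})"
      using M.M.finsum_insert[of "{..<m}" m "\<lambda>j. v j \<odot>\<^bsub>msec E W\<^esub> bas W j"] bm vi mn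
        M.M.finsum_closed[of "\<lambda>j. v j \<odot>\<^bsub>msec E W\<^esub> bas W j" "{..<m}"]
      by (simp add: M.M.a_comm Pi_iff)
    also have "insert m {..<m} = {..<Suc m}" by auto
    finally show ?case .
  qed
  show ?thesis
  proof (rule module_with_basis.intro)
    show "module (sec X W) (msec E W)" by (rule M.module_axioms)
    show "bas W i \<in> secs E W" for i
      unfolding bas_def by (rule sheaf_hom_closed[OF \<phi> W std_closed[OF W(1)]])
    show "crd W x i \<in> funs W" if "x \<in> secs E W" "i < n" for x i
      by (rule crd_entry[OF W that])
    show "crd W (x \<oplus>\<^bsub>msec E W\<^esub> y) i = crd W x i \<oplus>\<^bsub>sec X W\<^esub> crd W y i"
      if x: "x \<in> secs E W" and y: "y \<in> secs E W" and i: "i < n" for x y i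
    proof -
      note cx = crd_closed[OF W x] and cy = crd_closed[OF W y]
      have "\<phi> W (crd W x \<oplus>\<^bsub>?F\<^esub> crd W y) = x \<oplus>\<^bsub>msec E W\<^esub> y"
        using sheaf_hom_add[OF \<phi> W cx cy] phi_crd[OF W x] phi_crd[OF W y] by simp
      then have "crd W (x \<oplus>\<^bsub>msec E W\<^esub> y) = crd W x \<oplus>\<^bsub>?F\<^esub> crd W y" using crd_phi[OF W Fadd[OF cx cy]] by simp
      then show ?thesis using i unfolding free_sheaf_simps by simp
    qed
    show "crd W (a \<odot>\<^bsub>msec E W\<^esub> x) i = a \<otimes>\<^bsub>sec X W\<^esub> crd W x i"
      if a: "a \<in> funs W" and x: "x \<in> secs E W" and i: "i < n" for a x i
    proof -
      note cx = crd_closed[OF W x]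
      have "\<phi> W (a \<odot>\<^bsub>?F\<^esub> crd W x) = a \<odot>\<^bsub>msec E W\<^esub> x"
        using sheaf_hom_smult[OF \<phi> W a cx] phi_crd[OF W x] by simp
      then have "crd W (a \<odot>\<^bsub>msec E W\<^esub> x) = a \<odot>\<^bsub>?F\<^esub> crd W x" using crd_phi[OF W Fsm[OF a cx]] by simp
      then show ?thesis using i unfolding free_sheaf_simps by simp
    qed
    show "crd W (bas W i) j = (if i = j then \<one>\<^bsub>sec X W\<^esub> else \<zero>\<^bsub>sec X W\<^esub>)" if "i < n" "j < n" for i j
      unfolding bas_def crd_phi[OF W std_closed[OF W(1)]] unfolding std_def using that by simp
    show "x = finsum (msec E W) (\<lambda>j. crd W x j \<odot>\<^bsub>msec E W\<^esub> bas W j) {..<n}" if x: "x \<in> secs E W" for x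
    proof -
      note cx = crd_closed[OF W x]
      have "(\<lambda>i\<in>{..<n}. if i < n then crd W x i else \<zero>\<^bsub>sec X W\<^esub>) = crd W x"
        by (rule extensionalityI[of _ "{..<n}"]) (use cx in \<open>auto simp: free_sheaf_simps PiE_iff\<close>)
      then show ?thesis using expand[OF le_refl cx] phi_crd[OF W x] by simp
    qed
  qed
qed

private definition dt :: "'p set \<Rightarrow> (nat \<Rightarrow> 'm) \<Rightarrow> 'r" where
  "dt W = module_with_basis.determinant (sec X W) n (crd W)"

private lemma dt_res:
  assumes W: "opn W" "W \<subseteq> U" and V: "opn V" "V \<subseteq> W" and v: "v \<in> ext_gens n E W"
  shows "dt V (ext_res n E W V v) = res X W V (dt W v)"
proof -
  have VU: "V \<subseteq> U" using V W by blast
  interpret BW: module_with_basis "sec X W" "msec E W" n "bas W" "crd W" by (rule with_basis[OF W])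
  interpret BV: module_with_basis "sec X V" "msec E V" n "bas V" "crd V" by (rule with_basis[OF V(1) VU])
  interpret h: ring_hom_cring "sec X W" "sec X V" "res X W V"
    by (intro ring_hom_cringI ring_hom_ringI2 sec_cring cring.axioms(1) res_hom W V)
  have rv: "ext_res n E W V v \<in> ext_gens n E V" using v by (auto intro!: bun_lin(6)[OF W(1) V])
  have leib: "BV.leibniz (ext_res n E W V v) p = res X W V (BW.leibniz v p)" if p: "p permutes {..<n}" for p
  proof -
    have "res X W V (BW.leibniz v p) = (\<Otimes>\<^bsub>sec X V\<^esub>i\<in>{..<n}. (res X W V \<circ> (\<lambda>i. crd W (v i) (p i))) i)"
      unfolding BW.leibniz_def by (subst h.hom_finprod) (use BW.entry_closed[OF v p] in \<open>auto simp: comp_def\<close>)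
    also have "\<dots> = BV.leibniz (ext_res n E W V v) p"
      unfolding BV.leibniz_def
    proof (rule h.S.finprod_cong'[OF refl])
      show "(\<lambda>i. crd V (ext_res n E W V v i) (p i)) \<in> {..<n} \<rightarrow> funs V"
        using BV.entry_closed[OF rv p] by auto
      show "(res X W V \<circ> (\<lambda>i. crd W (v i) (p i))) i = crd V (ext_res n E W V v i) (p i)" if "i \<in> {..<n}" for i
        using crd_res[OF W V BW.vecs_closed[OF v] BW.perm_less[OF p]] that by simp
    qed
    finally show ?thesis by simp
  qed
  have "res X W V (dt W v) = (\<Oplus>\<^bsub>sec X V\<^esub>p\<in>{p. p permutes {..<n}}. (res X W V \<circ> (\<lambda>p. BW.signed p (BW.leibniz v p))) p)"
    unfolding dt_def BW.determinant_def
    by (subst h.hom_finsum) (use BW.leibniz_closed[OF v] BW.signed_closed in \<open>auto simp: comp_def\<close>)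
  also have "\<dots> = dt V (ext_res n E W V v)"
    unfolding dt_def BV.determinant_def
  proof (rule h.S.finsum_cong'[OF refl])
    show "(\<lambda>p. BV.signed p (BV.leibniz (ext_res n E W V v) p)) \<in> {p. p permutes {..<n}} \<rightarrow> funs V"
      using BV.leibniz_closed[OF rv] BV.signed_closed by auto
    show "(res X W V \<circ> (\<lambda>p. BW.signed p (BW.leibniz v p))) p = BV.signed p (BV.leibniz (ext_res n E W V v) p)"
      if "p \<in> {p. p permutes {..<n}}" for p
      using leib[of p] BW.leibniz_closed[OF v, of p] that res_minus[OF W(1) V] by (simp add: BV.signed_def BW.signed_def)
  qed
  finally show ?thesis by simp
qed

text \<open>The generator is the determinant in the coordinates of the trivialization.  A form \<open>\<psi>\<close> and the
  determinant times the value of \<open>\<psi>\<close> on the wedge of the basis differ by an alternating form that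
  vanishes on the basis.\<close>

lemma dual_ext_presheaf_generates:
  "\<exists>\<delta>. generates U (dual_sheaf X (ext_presheaf n E)) \<delta>"
proof -
  note LE = modules_linear_presheaf[OF E]
  interpret A: presentation X "ext_gens n E" "ext_res n E" "ext_rel n E" by (rule ext_presentation[OF LE])
  define Q where "Q = ext_presheaf n E"
  have Q: "Q = A.P" unfolding Q_def by (rule ext_presheaf_presentation[OF LE])
  have LQ: "linear_presheaf X Q" unfolding Q by (rule A.presented_linear_presheaf)
  have "\<exists>\<theta>\<in>sheaf_hom X U A.P unit_module. \<forall>W. opn W \<and> W \<subseteq> U -->
    (\<forall>f\<in>carrier (A.Fr W). \<theta> W (A.cls W f) = free_lift (sec X W) (msec unit_module W) (dt W) f) \<and>
    (\<forall>v\<in>ext_gens n E W. \<theta> W (A.gen W v) = dt W v)"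
  proof (rule A.presented_hom_exists[OF unit_module_modules])
    fix W v assume W: "opn W" "W \<subseteq> U" and v: "v \<in> ext_gens n E W"
    interpret B: module_with_basis "sec X W" "msec E W" n "bas W" "crd W" by (rule with_basis[OF W])
    show "dt W v \<in> secs unit_module W" unfolding dt_def using B.determinant_closed[OF v] by simp
    show "dt V (ext_res n E W V v) = mres unit_module W V (dt W v)" if "opn V" "V \<subseteq> W" for V
      using dt_res[OF W that v] by simp
  next
    fix W r assume W: "opn W" "W \<subseteq> U" and "r \<in> ext_rel n E W"
    interpret B: module_with_basis "sec X W" "msec E W" n "bas W" "crd W" by (rule with_basis[OF W])
    have h: "dt W \<in> ext_gens n E W \<rightarrow> secs unit_module W" unfolding dt_def using B.determinant_closed by auto
    from \<open>r \<in> ext_rel n E W\<close> show "free_lift (sec X W) (msec unit_module W) (dt W) r = \<zero>\<^bsub>msec unit_module W\<^esub>"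
    proof (cases rule: ext_relations_cases)
      case (add v i x y)
      note c = PiE_upd[OF add(1,2) bun_lin(2)[OF W(1) add(3,4)]] PiE_upd[OF add(1,2,3)] PiE_upd[OF add(1,2,4)]
      show ?thesis
        unfolding add(5) by (rule A.free_lift_sum_relation[OF W(1) unit_module_modules h c])
          (use B.determinant_add[OF add(1-4)] in \<open>simp only: dt_def unit_module_simps\<close>)
    next
      case (smult v i a x)
      note c = PiE_upd[OF smult(1,2) bun_lin(3)[OF W(1) smult(3,4)]] PiE_upd[OF smult(1,2,4)]
      show ?thesis
        unfolding smult(5) by (rule A.free_lift_smult_relation[OF W(1) unit_module_modules h c smult(3)])
          (use B.determinant_smult[OF smult(1,2,4,3)] in \<open>simp only: dt_def unit_module_simps\<close>)
    next
      case (alt v i j)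
      show ?thesis
        unfolding alt(6) free_lift_basis[OF modules_module[OF unit_module_modules W(1)] h alt(1)]
        using B.determinant_alternating[OF alt(1-5)] by (simp only: dt_def unit_module_simps)
    qed
  qed
  then obtain \<delta> where \<delta>: "\<delta> \<in> sheaf_hom X U Q unit_module"
    and \<delta>_all: "\<forall>W. opn W \<and> W \<subseteq> U -->
      (\<forall>f\<in>carrier (A.Fr W). \<delta> W (A.cls W f) = free_lift (sec X W) (msec unit_module W) (dt W) f) \<and>
      (\<forall>v\<in>ext_gens n E W. \<delta> W (A.gen W v) = dt W v)"
    unfolding Q by (elim bexE)
  have \<delta>_gen: "\<delta> W (A.gen W v) = dt W v" if "opn W" "W \<subseteq> U" "v \<in> ext_gens n E W" for W v
    using \<delta>_all that by simp
  define w where "w W = (\<lambda>i\<in>{..<n}. bas W i)" for W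
  have w: "w W \<in> ext_gens n E W" if "opn W" "W \<subseteq> U" for W
    unfolding w_def bas_def using sheaf_hom_closed[OF \<phi> that std_closed[OF that(1)]] by auto
  have w_res: "ext_res n E W V (w W) = w V" if W: "opn W" "W \<subseteq> U" and V: "opn V" "V \<subseteq> W" for W V
  proof -
    have VU: "V \<subseteq> U" using V W by blast
    have "mres E W V (bas W i) = bas V i" for i
    proof -
      have "mres (free_sheaf X n) W V (std W i) = std V i"
        unfolding free_sheaf_simps std_def using res_one[OF W(1) V] res_zero[OF W(1) V] by (auto simp: fun_eq_iff)
      then show ?thesis
        unfolding bas_def using sheaf_hom_res[OF \<phi> W(1) V W(2) std_closed[OF W(1)]] by metis
    qed
    then show ?thesis unfolding w_def by (auto simp: fun_eq_iff)
  qed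
  have "generates U (dual_sheaf X Q) \<delta>"
  proof (rule dual_generatesI[OF LQ U \<delta>])
    show "A.gen U (w U) \<in> secs Q U" unfolding Q by (rule A.gen_closed[OF U w[OF U subset_refl]])
    interpret B: module_with_basis "sec X U" "msec E U" n "bas U" "crd U" by (rule with_basis[OF U subset_refl])
    show "\<delta> U (A.gen U (w U)) = \<one>\<^bsub>sec X U\<^esub>"
      unfolding \<delta>_gen[OF U subset_refl w[OF U subset_refl]] dt_def unfolding w_def by (rule B.determinant_basis)
  next
    fix W \<psi> assume W: "opn W" "W \<subseteq> U" and \<psi>: "\<psi> \<in> sheaf_hom X W Q unit_module"
    interpret R: cring "sec X W" by (rule sec_cring[OF W(1)])
    have rw: "mres Q U W (A.gen U (w U)) = A.gen W (w W)"
      unfolding Q A.gen_res[OF U W w[OF U subset_refl]] w_res[OF U subset_refl W] ..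
    let ?a = "\<psi> W (mres Q U W (A.gen U (w U)))"
    have gW: "A.gen W (w W) \<in> secs Q W" unfolding Q by (rule A.gen_closed[OF W(1) w[OF W]])
    have a: "?a \<in> funs W" unfolding rw using sheaf_hom_closed[OF \<psi> W(1) subset_refl gW] by simp
    show "\<psi> = ?a \<odot>\<^bsub>msec (dual_sheaf X Q) W\<^esub> on_opens X W \<delta>"
    proof (rule A.presented_hom_eqI[OF unit_module_modules, folded Q])
      show "\<psi> \<in> sheaf_hom X W Q unit_module" by (rule \<psi>)
      show "?a \<odot>\<^bsub>msec (dual_sheaf X Q) W\<^esub> on_opens X W \<delta> \<in> sheaf_hom X W Q unit_module"
        using hom_sheaf_smult_closed[OF LQ unit_module_modules W(1) a sheaf_hom_on_subset[OF \<delta> W(2)]] unfolding dual_sheaf_def .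
      fix V v assume V: "opn V" "V \<subseteq> W" and v: "v \<in> ext_gens n E V"
      have VU: "V \<subseteq> U" using V W by blast
      interpret B: module_with_basis "sec X V" "msec E V" n "bas V" "crd V" by (rule with_basis[OF V(1) VU])
      interpret RV: cring "sec X V" by (rule sec_cring[OF V(1)])
      interpret FrV: module "sec X V" "A.Fr V" by (rule A.Fr_module[OF V(1)])
      let ?aV = "res X W V ?a"
      have aV: "?aV \<in> funs V" by (rule res_closed[OF W(1) V a])
      have gen: "A.gen V u \<in> secs Q V" if "u \<in> ext_gens n E V" for u unfolding Q by (rule A.gen_closed[OF V(1) that])
      have pc: "\<psi> V (A.gen V u) \<in> funs V" if "u \<in> ext_gens n E V" for u
        using sheaf_hom_closed[OF \<psi> V gen[OF that]] by simp
      have dc: "dt V u \<in> funs V" if "u \<in> ext_gens n E V" for u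
        unfolding dt_def by (rule B.determinant_closed[OF that])
      define \<alpha> where "\<alpha> u = \<psi> V (A.gen V u) \<ominus>\<^bsub>sec X V\<^esub> ?aV \<otimes>\<^bsub>sec X V\<^esub> dt V u" for u
      have "\<alpha> v = \<zero>\<^bsub>sec X V\<^esub>"
      proof (rule B.alternating_form_eq_zero[OF _ _ _ _ _ v])
        show "\<alpha> u \<in> funs V" if "u \<in> ext_gens n E V" for u
          unfolding \<alpha>_def using pc[OF that] dc[OF that] aV by simp
        show "\<alpha> (u(i := x \<oplus>\<^bsub>msec E V\<^esub> y)) = \<alpha> (u(i := x)) \<oplus>\<^bsub>sec X V\<^esub> \<alpha> (u(i := y))"
          if u: "u \<in> ext_gens n E V" and i: "i < n" and x: "x \<in> secs E V" and y: "y \<in> secs E V" for u i x y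
        proof -
          note c = PiE_upd[OF u i bun_lin(2)[OF V(1) x y]] PiE_upd[OF u i x] PiE_upd[OF u i y]
          have "A.gen V (u(i := x \<oplus>\<^bsub>msec E V\<^esub> y)) = A.gen V (u(i := x)) \<oplus>\<^bsub>msec Q V\<^esub> A.gen V (u(i := y))"
            unfolding Q by (rule A.gen_sumI[OF V(1) c subsetD[OF A.Rel_N[OF V(1)] ext_relations_add[OF u i x y]]])
          then have "\<psi> V (A.gen V (u(i := x \<oplus>\<^bsub>msec E V\<^esub> y))) = \<psi> V (A.gen V (u(i := x))) \<oplus>\<^bsub>sec X V\<^esub> \<psi> V (A.gen V (u(i := y)))"
            using sheaf_hom_add[OF \<psi> V gen[OF c(2)] gen[OF c(3)]] by (simp only: unit_module_simps)
          moreover have "dt V (u(i := x \<oplus>\<^bsub>msec E V\<^esub> y)) = dt V (u(i := x)) \<oplus>\<^bsub>sec X V\<^esub> dt V (u(i := y))"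
            unfolding dt_def by (rule B.determinant_add[OF u i x y])
          ultimately show ?thesis
            unfolding \<alpha>_def using pc[OF c(2)] pc[OF c(3)] dc[OF c(2)] dc[OF c(3)] aV
            by (simp only: RV.minus_eq RV.r_distr RV.minus_add[symmetric] RV.m_closed RV.a_ac RV.a_closed RV.a_inv_closed)
        qed
        show "\<alpha> (u(i := b \<odot>\<^bsub>msec E V\<^esub> x)) = b \<otimes>\<^bsub>sec X V\<^esub> \<alpha> (u(i := x))"
          if u: "u \<in> ext_gens n E V" and i: "i < n" and b: "b \<in> funs V" and x: "x \<in> secs E V" for u i b x
        proof -
          note c = PiE_upd[OF u i bun_lin(3)[OF V(1) b x]] PiE_upd[OF u i x]
          have "A.gen V (u(i := b \<odot>\<^bsub>msec E V\<^esub> x)) = b \<odot>\<^bsub>msec Q V\<^esub> A.gen V (u(i := x))"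
            unfolding Q by (rule A.gen_smultI[OF V(1) c b subsetD[OF A.Rel_N[OF V(1)] ext_relations_smult[OF u i b x]]])
          then have 1: "\<psi> V (A.gen V (u(i := b \<odot>\<^bsub>msec E V\<^esub> x))) = b \<otimes>\<^bsub>sec X V\<^esub> \<psi> V (A.gen V (u(i := x)))"
            using sheaf_hom_smult[OF \<psi> V b gen[OF c(2)]] by (simp only: unit_module_simps)
          have 2: "dt V (u(i := b \<odot>\<^bsub>msec E V\<^esub> x)) = b \<otimes>\<^bsub>sec X V\<^esub> dt V (u(i := x))"
            unfolding dt_def by (rule B.determinant_smult[OF u i x b])
          show ?thesis
            unfolding \<alpha>_def 1 2 using pc[OF c(2)] dc[OF c(2)] aV b
            by (simp only: RV.minus_eq RV.r_distr RV.r_minus RV.m_lcomm RV.m_closed RV.a_inv_closed)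
        qed
        show "\<alpha> u = \<zero>\<^bsub>sec X V\<^esub>"
          if u: "u \<in> ext_gens n E V" and ij: "i < n" "j < n" "i \<noteq> j" "u i = u j" for u i j
        proof -
          let ?z = "\<zero>\<^bsub>A.Fr V\<^esub>"
          note z = FrV.M.zero_closed
          have "basis_vector (sec X V) u \<ominus>\<^bsub>A.Fr V\<^esub> ?z = basis_vector (sec X V) u"
            using A.basis_closed[OF V(1) u] by (simp only: FrV.M.minus_eq FrV.M.minus_equality[OF FrV.M.r_zero[OF z] z z] FrV.M.r_zero)
          then have "A.gen V u = A.cls V ?z"
            unfolding A.gen_def A.cls_eq_iff[OF V(1) A.basis_closed[OF V(1) u] z]
            using subsetD[OF A.Rel_N[OF V(1)] ext_relations_alt[OF u ij]] by simp
          also have "\<dots> = \<zero>\<^bsub>sec X V\<^esub> \<odot>\<^bsub>msec Q V\<^esub> A.cls V ?z"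
            unfolding Q by (simp only: A.cls_smult[OF V(1) RV.zero_closed z] FrV.smult_r_null[OF RV.zero_closed])
          finally have "\<psi> V (A.gen V u) = \<zero>\<^bsub>sec X V\<^esub> \<otimes>\<^bsub>sec X V\<^esub> \<psi> V (A.cls V ?z)"
            using sheaf_hom_smult[OF \<psi> V RV.zero_closed A.cls_closed[OF V(1) z, folded Q]] by (simp only: unit_module_simps)
          also have "\<dots> = \<zero>\<^bsub>sec X V\<^esub>"
            using sheaf_hom_closed[OF \<psi> V A.cls_closed[OF V(1) z, folded Q]] by simp
          finally have 1: "\<psi> V (A.gen V u) = \<zero>\<^bsub>sec X V\<^esub>" .
          have 2: "dt V u = \<zero>\<^bsub>sec X V\<^esub>" unfolding dt_def by (rule B.determinant_alternating[OF u ij])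
          show ?thesis unfolding \<alpha>_def 1 2 using aV by (simp add: RV.minus_eq)
        qed
        have "\<psi> V (A.gen V (w V)) = res X W V (\<psi> W (A.gen W (w W)))"
          using sheaf_hom_res[OF \<psi> W(1) V subset_refl gW] A.gen_res[OF W(1) V w[OF W]] unfolding Q w_res[OF W V] by simp
        then have 1: "\<psi> V (A.gen V (w V)) = ?aV" unfolding rw .
        have 2: "dt V (w V) = \<one>\<^bsub>sec X V\<^esub>" unfolding dt_def w_def by (rule B.determinant_basis)
        have "\<alpha> (w V) = \<zero>\<^bsub>sec X V\<^esub>" unfolding \<alpha>_def 1 2 using aV by (simp add: RV.minus_eq RV.r_neg)
        then show "\<alpha> (\<lambda>i\<in>{..<n}. bas V i) = \<zero>\<^bsub>sec X V\<^esub>" unfolding w_def .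
      qed
      then have "\<psi> V (A.gen V v) = ?aV \<otimes>\<^bsub>sec X V\<^esub> dt V v"
        unfolding \<alpha>_def using pc[OF v] dc[OF v] aV by (simp add: RV.r_right_minus_eq)
      then show "\<psi> V (A.gen V v) = (?a \<odot>\<^bsub>msec (dual_sheaf X Q) W\<^esub> on_opens X W \<delta>) V (A.gen V v)"
        using V VU gen[OF v] \<delta>_gen[OF V(1) VU v] unfolding dual_sheaf_def hom_sheaf_smult by simp
    qed
  qed
  then show ?thesis unfolding Q_def by blast
qed

end

lemma dual_ext_presheaf_line_sheaf:
  assumes E: "vector_bundle X n E"
  shows "line_sheaf (dual_sheaf X (ext_presheaf n E))"
  unfolding line_sheaf_def
proof (intro conjI ballI)
  have M: "sheaf_of_modules X E" using E unfolding vector_bundle_def by simp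
  show "sheaf_of_modules X (dual_sheaf X (ext_presheaf n E))"
    by (rule dual_sheaf_modules[OF ext_presheaf_linear[OF modules_linear_presheaf[OF M]]])
  fix x assume "x \<in> topspace (tps X)"
  then obtain U where U: "opn U" "x \<in> U" and iso: "isomorphic_on X U (free_sheaf X n) E"
    using E unfolding vector_bundle_def by blast
  from iso obtain \<phi> where \<phi>: "\<phi> \<in> sheaf_hom X U (free_sheaf X n) E"
    "\<And>W. opn W ==> W \<subseteq> U ==> bij_betw (\<phi> W) (secs (free_sheaf X n) W) (secs E W)"
    unfolding isomorphic_on_def by blast
  show "\<exists>U g. x \<in> U \<and> generates U (dual_sheaf X (ext_presheaf n E)) g"
    using dual_ext_presheaf_generates[OF M U(1) \<phi>] U(2) by blast
qed

text \<open>A model of the determinant without sheafification, so that it depends locally on \<open>E\<close> on the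
  nose and not only up to isomorphism.\<close>

definition det_model :: "nat \<Rightarrow> ('p, 'r, 'm) modsheaf \<Rightarrow> _" where
  "det_model n E = dual_sheaf X (dual_sheaf X (ext_presheaf n E))"

lemma det_model_line_sheaf: "vector_bundle X n E ==> line_sheaf (det_model n E)"
  unfolding det_model_def by (rule dual_line_sheaf[OF dual_ext_presheaf_line_sheaf])

lemma det_model_agree: "agree_on U E F ==> agree_on U (det_model n E) (det_model n F)"
  unfolding det_model_def by (intro agree_on_dual ext_presheaf_agree)

lemma det_sheaf_modules:
  assumes E: "linear_presheaf X E"
  shows "sheaf_of_modules X (det_sheaf X n E)"
  unfolding det_sheaf_def ext_power_sheaf_eq
  by (intro dual_sheaf_modules modules_linear_presheaf[OF dual_sheaf_modules] sheafify_linear_presheaf ext_presheaf_linear E)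

text \<open>The two sides differ by a sheafification under the inner dual.\<close>

lemma det_model_isomorphic:
  assumes E: "linear_presheaf X E"
  shows "isomorphic X (det_model n E) (det_sheaf X n E)"
  unfolding det_sheaf_def ext_power_sheaf_eq det_model_def
proof (rule dual_sheaf_isomorphic)
  let ?P = "ext_presheaf n E"
  have P: "linear_presheaf X ?P" by (rule ext_presheaf_linear[OF E])
  show "isomorphic X (dual_sheaf X (sheafify X ?P)) (dual_sheaf X ?P)" by (rule dual_sheafify[OF P])
  show "linear_presheaf X (dual_sheaf X (sheafify X ?P))" "linear_presheaf X (dual_sheaf X ?P)"
    by (rule modules_linear_presheaf[OF dual_sheaf_modules], rule sheafify_linear_presheaf P, (rule P)?)+
qed

lemma det_sheaf_line_sheaf:
  assumes E: "vector_bundle X n E"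
  shows "line_sheaf (det_sheaf X n E)"
proof -
  have L: "linear_presheaf X E" by (rule modules_linear_presheaf) (use E in \<open>simp add: vector_bundle_def\<close>)
  show ?thesis
    by (rule isomorphic_line_sheaf[OF det_model_line_sheaf[OF E] det_sheaf_modules[OF L] det_model_isomorphic[OF L]])
qed

end

section \<open>Tensor products and perfect pairings\<close>

lemma tensor_relations_cases:
  assumes "r \<in> tensor_relations R M N"
  obtains (add_left) x x' y where "x \<in> carrier M" "x' \<in> carrier M" "y \<in> carrier N"
      "r = basis_vector R (x \<oplus>\<^bsub>M\<^esub> x', y) \<ominus>\<^bsub>free_module R (carrier M \<times> carrier N)\<^esub>
        (basis_vector R (x, y) \<oplus>\<^bsub>free_module R (carrier M \<times> carrier N)\<^esub> basis_vector R (x', y))"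
  | (add_right) x y y' where "x \<in> carrier M" "y \<in> carrier N" "y' \<in> carrier N"
      "r = basis_vector R (x, y \<oplus>\<^bsub>N\<^esub> y') \<ominus>\<^bsub>free_module R (carrier M \<times> carrier N)\<^esub>
        (basis_vector R (x, y) \<oplus>\<^bsub>free_module R (carrier M \<times> carrier N)\<^esub> basis_vector R (x, y'))"
  | (smult_left) a x y where "a \<in> carrier R" "x \<in> carrier M" "y \<in> carrier N"
      "r = basis_vector R (a \<odot>\<^bsub>M\<^esub> x, y) \<ominus>\<^bsub>free_module R (carrier M \<times> carrier N)\<^esub>
        (a \<odot>\<^bsub>free_module R (carrier M \<times> carrier N)\<^esub> basis_vector R (x, y))"
  | (smult_right) a x y where "a \<in> carrier R" "x \<in> carrier M" "y \<in> carrier N"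
      "r = basis_vector R (x, a \<odot>\<^bsub>N\<^esub> y) \<ominus>\<^bsub>free_module R (carrier M \<times> carrier N)\<^esub>
        (a \<odot>\<^bsub>free_module R (carrier M \<times> carrier N)\<^esub> basis_vector R (x, y))"
  using assms unfolding tensor_relations_def Let_def Un_iff mem_Collect_eq
  by (elim disjE exE conjE) blast+

lemma tensor_relations_intros:
  fixes R :: "'r ring" and M :: "('r, 'm) module" and N :: "('r, 'n) module"
  defines "F \<equiv> free_module R (carrier M \<times> carrier N)"
  assumes x: "x \<in> carrier M" and y: "y \<in> carrier N"
  shows tensor_relations_add_left: "x' \<in> carrier M ==>
      basis_vector R (x \<oplus>\<^bsub>M\<^esub> x', y) \<ominus>\<^bsub>F\<^esub> (basis_vector R (x, y) \<oplus>\<^bsub>F\<^esub> basis_vector R (x', y)) \<in> tensor_relations R M N"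
    and tensor_relations_add_right: "y' \<in> carrier N ==>
      basis_vector R (x, y \<oplus>\<^bsub>N\<^esub> y') \<ominus>\<^bsub>F\<^esub> (basis_vector R (x, y) \<oplus>\<^bsub>F\<^esub> basis_vector R (x, y')) \<in> tensor_relations R M N"
    and tensor_relations_smult_left: "a \<in> carrier R ==>
      basis_vector R (a \<odot>\<^bsub>M\<^esub> x, y) \<ominus>\<^bsub>F\<^esub> (a \<odot>\<^bsub>F\<^esub> basis_vector R (x, y)) \<in> tensor_relations R M N"
    and tensor_relations_smult_right: "a \<in> carrier R ==>
      basis_vector R (x, a \<odot>\<^bsub>N\<^esub> y) \<ominus>\<^bsub>F\<^esub> (a \<odot>\<^bsub>F\<^esub> basis_vector R (x, y)) \<in> tensor_relations R M N"
  using x y unfolding F_def tensor_relations_def Let_def by blast+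

context sheaf_ringed_space
begin

abbreviation tensor_gens :: "('p, 'r, 'm) modsheaf \<Rightarrow> ('p, 'r, 'n) modsheaf \<Rightarrow> 'p set \<Rightarrow> ('m \<times> 'n) set" where
  "tensor_gens B L \<equiv> \<lambda>U. secs B U \<times> secs L U"

abbreviation tensor_res :: "('p, 'r, 'm) modsheaf \<Rightarrow> ('p, 'r, 'n) modsheaf \<Rightarrow> 'p set \<Rightarrow> 'p set \<Rightarrow> 'm \<times> 'n \<Rightarrow> 'm \<times> 'n" where
  "tensor_res B L \<equiv> \<lambda>U V. \<lambda>(x, y). (mres B U V x, mres L U V y)"

abbreviation tensor_rel :: "('p, 'r, 'm) modsheaf \<Rightarrow> ('p, 'r, 'n) modsheaf \<Rightarrow> 'p set \<Rightarrow> ('m \<times> 'n \<Rightarrow> 'r) set" where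
  "tensor_rel B L \<equiv> \<lambda>U. tensor_relations (sec X U) (msec B U) (msec L U)"

lemma tensor_presentation:
  assumes B: "linear_presheaf X B" and L: "linear_presheaf X L"
  shows "presentation X (tensor_gens B L) (tensor_res B L) (tensor_rel B L)"
proof -
  note LB = linear_presheafD[OF B] and LL = linear_presheafD[OF L]
  interpret G: generator_presheaf X "tensor_gens B L" "tensor_res B L"
  proof
    show "tensor_res B L U V i \<in> tensor_gens B L V" if "opn U" "opn V" "V \<subseteq> U" "i \<in> tensor_gens B L U" for U V i
      using that(4) LB(6)[OF that(1-3)] LL(6)[OF that(1-3)] by auto
    show "tensor_res B L U U i = i" if "opn U" "i \<in> tensor_gens B L U" for U i
      using that(2) LB(7)[OF that(1)] LL(7)[OF that(1)] by auto
    show "tensor_res B L V W (tensor_res B L U V i) = tensor_res B L U W i"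
      if "opn U" "opn V" "opn W" "W \<subseteq> V" "V \<subseteq> U" "i \<in> tensor_gens B L U" for U V W i
      using that(6) LB(8)[OF that(1-5)] LL(8)[OF that(1-5)] by auto
  qed
  show ?thesis
  proof
    fix U assume U: "opn U"
    interpret Fr: module "sec X U" "G.Fr U" by (rule G.Fr_module[OF U])
    have b: "basis_vector (sec X U) (x, y) \<in> carrier (G.Fr U)"
      if "x \<in> secs B U" "y \<in> secs L U" for x y
      by (rule G.basis_closed[OF U]) (use that in simp)
    show "tensor_rel B L U \<subseteq> carrier (G.Fr U)"
    proof
      fix r assume "r \<in> tensor_rel B L U"
      then show "r \<in> carrier (G.Fr U)"
      proof (cases rule: tensor_relations_cases)
        case (add_left x x' y)
        show ?thesis unfolding add_left(4)
          by (intro Fr.M.minus_closed G.Fr_add_closed U b LB(2) add_left)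
      next
        case (add_right x y y')
        show ?thesis unfolding add_right(4)
          by (intro Fr.M.minus_closed G.Fr_add_closed U b LL(2) add_right)
      next
        case (smult_left a x y)
        show ?thesis unfolding smult_left(4)
          by (intro Fr.M.minus_closed G.Fr_smult_closed U b LB(3) smult_left)
      next
        case (smult_right a x y)
        show ?thesis unfolding smult_right(4)
          by (intro Fr.M.minus_closed G.Fr_smult_closed U b LL(3) smult_right)
      qed
    qed
  next
    fix U V r assume UV: "opn U" "opn V" "V \<subseteq> U" and "r \<in> tensor_rel B L U"
    note U = UV(1)
    note rB = LB(6)[OF UV] and rL = LL(6)[OF UV]
    have m: "(x, y) \<in> tensor_gens B L U" if "x \<in> secs B U" "y \<in> secs L U" for x y using that by simp
    from \<open>r \<in> tensor_rel B L U\<close> show "G.fm U V r \<in> tensor_rel B L V"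
    proof (cases rule: tensor_relations_cases)
      case (add_left x x' y)
      show ?thesis
        unfolding add_left(4) G.fm_sum_relation[OF UV m[OF LB(2)[OF U add_left(1,2)] add_left(3)] m[OF add_left(1,3)] m[OF add_left(2,3)]]
          prod.case LB(4)[OF UV add_left(1,2)]
        by (rule tensor_relations_add_left[OF rB[OF add_left(1)] rL[OF add_left(3)] rB[OF add_left(2)]])
    next
      case (add_right x y y')
      show ?thesis
        unfolding add_right(4) G.fm_sum_relation[OF UV m[OF add_right(1) LL(2)[OF U add_right(2,3)]] m[OF add_right(1,2)] m[OF add_right(1,3)]]
          prod.case LL(4)[OF UV add_right(2,3)]
        by (rule tensor_relations_add_right[OF rB[OF add_right(1)] rL[OF add_right(2)] rL[OF add_right(3)]])
    next
      case (smult_left a x y)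
      show ?thesis
        unfolding smult_left(4) G.fm_smult_relation[OF UV m[OF LB(3)[OF U smult_left(1,2)] smult_left(3)] m[OF smult_left(2,3)] smult_left(1)]
          prod.case LB(5)[OF UV smult_left(1,2)]
        by (rule tensor_relations_smult_left[OF rB[OF smult_left(2)] rL[OF smult_left(3)] res_closed[OF UV smult_left(1)]])
    next
      case (smult_right a x y)
      show ?thesis
        unfolding smult_right(4) G.fm_smult_relation[OF UV m[OF smult_right(2) LL(3)[OF U smult_right(1,3)]] m[OF smult_right(2,3)] smult_right(1)]
          prod.case LL(5)[OF UV smult_right(1,3)]
        by (rule tensor_relations_smult_right[OF rB[OF smult_right(2)] rL[OF smult_right(3)] res_closed[OF UV smult_right(1)]])
    qed
  qed
qed

lemma tensor_sheaf_eq: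
  assumes B: "linear_presheaf X B" and L: "linear_presheaf X L"
  shows "tensor_sheaf X B L = sheafify X (presentation.P X (tensor_gens B L) (tensor_res B L) (tensor_rel B L))"
proof -
  interpret presentation X "tensor_gens B L" "tensor_res B L" "tensor_rel B L" by (rule tensor_presentation[OF B L])
  show ?thesis
    unfolding tensor_sheaf_def P_def presented_presheaf_def tensor_module_def N_def tensor_submodule_def ..
qed

text \<open>For invertible sheaves an isomorphism of \<open>A\<close> with \<open>B \<otimes> L\<close> is the same as a bilinear pairing
  of \<open>B\<close> and \<open>L\<close> into \<open>A\<close> that carries local generators to a local generator.\<close>

definition perfect_pairing ::
  "('p, 'r, 'm) modsheaf \<Rightarrow> ('p, 'r, 'n) modsheaf \<Rightarrow> ('p, 'r, 'q) modsheaf \<Rightarrow> ('p set \<Rightarrow> 'm \<Rightarrow> 'n \<Rightarrow> 'q) \<Rightarrow> bool" where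
  "perfect_pairing B L A \<beta> \<longleftrightarrow>
     (\<forall>W x y. opn W \<and> x \<in> secs B W \<and> y \<in> secs L W --> \<beta> W x y \<in> secs A W) \<and>
     (\<forall>W x x' y. opn W \<and> x \<in> secs B W \<and> x' \<in> secs B W \<and> y \<in> secs L W -->
        \<beta> W (x \<oplus>\<^bsub>msec B W\<^esub> x') y = \<beta> W x y \<oplus>\<^bsub>msec A W\<^esub> \<beta> W x' y) \<and>
     (\<forall>W x y y'. opn W \<and> x \<in> secs B W \<and> y \<in> secs L W \<and> y' \<in> secs L W -->
        \<beta> W x (y \<oplus>\<^bsub>msec L W\<^esub> y') = \<beta> W x y \<oplus>\<^bsub>msec A W\<^esub> \<beta> W x y') \<and>
     (\<forall>W a x y. opn W \<and> a \<in> funs W \<and> x \<in> secs B W \<and> y \<in> secs L W -->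
        \<beta> W (a \<odot>\<^bsub>msec B W\<^esub> x) y = a \<odot>\<^bsub>msec A W\<^esub> \<beta> W x y) \<and>
     (\<forall>W a x y. opn W \<and> a \<in> funs W \<and> x \<in> secs B W \<and> y \<in> secs L W -->
        \<beta> W x (a \<odot>\<^bsub>msec L W\<^esub> y) = a \<odot>\<^bsub>msec A W\<^esub> \<beta> W x y) \<and>
     (\<forall>W V x y. opn W \<and> opn V \<and> V \<subseteq> W \<and> x \<in> secs B W \<and> y \<in> secs L W -->
        \<beta> V (mres B W V x) (mres L W V y) = mres A W V (\<beta> W x y)) \<and>
     (\<forall>p\<in>topspace (tps X). \<exists>W x y. p \<in> W \<and> generates W B x \<and> generates W L y \<and> generates W A (\<beta> W x y))"

lemma perfect_pairingD:
  assumes "perfect_pairing B L A \<beta>"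
  shows pairing_closed: "\<And>W x y. opn W ==> x \<in> secs B W ==> y \<in> secs L W ==> \<beta> W x y \<in> secs A W"
    and pairing_add_left: "\<And>W x x' y. opn W ==> x \<in> secs B W ==> x' \<in> secs B W ==> y \<in> secs L W ==>
        \<beta> W (x \<oplus>\<^bsub>msec B W\<^esub> x') y = \<beta> W x y \<oplus>\<^bsub>msec A W\<^esub> \<beta> W x' y"
    and pairing_add_right: "\<And>W x y y'. opn W ==> x \<in> secs B W ==> y \<in> secs L W ==> y' \<in> secs L W ==>
        \<beta> W x (y \<oplus>\<^bsub>msec L W\<^esub> y') = \<beta> W x y \<oplus>\<^bsub>msec A W\<^esub> \<beta> W x y'"
    and pairing_smult_left: "\<And>W a x y. opn W ==> a \<in> funs W ==> x \<in> secs B W ==> y \<in> secs L W ==>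
        \<beta> W (a \<odot>\<^bsub>msec B W\<^esub> x) y = a \<odot>\<^bsub>msec A W\<^esub> \<beta> W x y"
    and pairing_smult_right: "\<And>W a x y. opn W ==> a \<in> funs W ==> x \<in> secs B W ==> y \<in> secs L W ==>
        \<beta> W x (a \<odot>\<^bsub>msec L W\<^esub> y) = a \<odot>\<^bsub>msec A W\<^esub> \<beta> W x y"
    and pairing_res: "\<And>W V x y. opn W ==> opn V ==> V \<subseteq> W ==> x \<in> secs B W ==> y \<in> secs L W ==>
        \<beta> V (mres B W V x) (mres L W V y) = mres A W V (\<beta> W x y)"
    and pairing_perfect: "\<And>p. p \<in> topspace (tps X) ==>
        \<exists>W x y. p \<in> W \<and> generates W B x \<and> generates W L y \<and> generates W A (\<beta> W x y)"
  using assms unfolding perfect_pairing_def by simp_all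

lemma perfect_pairingI:
  assumes "\<And>W x y. opn W ==> x \<in> secs B W ==> y \<in> secs L W ==> \<beta> W x y \<in> secs A W"
    and "\<And>W x x' y. opn W ==> x \<in> secs B W ==> x' \<in> secs B W ==> y \<in> secs L W ==>
        \<beta> W (x \<oplus>\<^bsub>msec B W\<^esub> x') y = \<beta> W x y \<oplus>\<^bsub>msec A W\<^esub> \<beta> W x' y"
    and "\<And>W x y y'. opn W ==> x \<in> secs B W ==> y \<in> secs L W ==> y' \<in> secs L W ==>
        \<beta> W x (y \<oplus>\<^bsub>msec L W\<^esub> y') = \<beta> W x y \<oplus>\<^bsub>msec A W\<^esub> \<beta> W x y'"
    and "\<And>W a x y. opn W ==> a \<in> funs W ==> x \<in> secs B W ==> y \<in> secs L W ==>
        \<beta> W (a \<odot>\<^bsub>msec B W\<^esub> x) y = a \<odot>\<^bsub>msec A W\<^esub> \<beta> W x y"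
    and "\<And>W a x y. opn W ==> a \<in> funs W ==> x \<in> secs B W ==> y \<in> secs L W ==>
        \<beta> W x (a \<odot>\<^bsub>msec L W\<^esub> y) = a \<odot>\<^bsub>msec A W\<^esub> \<beta> W x y"
    and "\<And>W V x y. opn W ==> opn V ==> V \<subseteq> W ==> x \<in> secs B W ==> y \<in> secs L W ==>
        \<beta> V (mres B W V x) (mres L W V y) = mres A W V (\<beta> W x y)"
    and "\<And>p. p \<in> topspace (tps X) ==>
        \<exists>W x y. p \<in> W \<and> generates W B x \<and> generates W L y \<and> generates W A (\<beta> W x y)"
  shows "perfect_pairing B L A \<beta>"
  unfolding perfect_pairing_def using assms by simp

lemma generates_reflect:
  assumes E: "linear_presheaf X E" and \<phi>: "\<phi> \<in> homs X E F"
    and bij: "\<And>W. opn W ==> W \<subseteq> topspace (tps X) ==> bij_betw (\<phi> W) (secs E W) (secs F W)"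
    and g: "g \<in> secs E U" and gen: "generates U F (\<phi> U g)"
  shows "generates U E g"
  unfolding generates_def
proof (intro conjI allI impI g)
  note gD = generatesD[OF gen]
  show "opn U" by (rule gD)
  fix W assume "opn W \<and> W \<subseteq> U"
  then have W: "opn W" "W \<subseteq> U" by auto
  have gW: "mres E U W g \<in> secs E W" by (rule linear_presheaf_res_closed[OF E gD(1) W g])
  have eq: "a \<odot>\<^bsub>msec F W\<^esub> mres F U W (\<phi> U g) = (\<phi> W \<circ> (\<lambda>a. a \<odot>\<^bsub>msec E W\<^esub> mres E U W g)) a" if "a \<in> funs W" for a
    using sheaf_hom_res[OF \<phi> gD(1) W opn_topspace[OF gD(1)] g]
      sheaf_hom_smult[OF \<phi> W(1) opn_topspace[OF W(1)] that gW] by simp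
  have sub: "(\<lambda>a. a \<odot>\<^bsub>msec E W\<^esub> mres E U W g) ` funs W \<subseteq> secs E W"
    using linear_presheaf_smult_closed[OF E W(1) _ gW] by blast
  have "bij_betw (\<phi> W \<circ> (\<lambda>a. a \<odot>\<^bsub>msec E W\<^esub> mres E U W g)) (funs W) (secs F W)"
    using gD(3)[OF W] by (rule bij_betw_cong[THEN iffD1, rotated]) (rule eq)
  then show "bij_betw (\<lambda>a. a \<odot>\<^bsub>msec E W\<^esub> mres E U W g) (funs W) (secs E W)"
    using bij_betw_comp_iff2[OF bij[OF W(1) opn_topspace[OF W(1)]] sub] by blast
qed

text \<open>The pairing is the image of \<open>x \<otimes> y\<close> under the isomorphism.  Near a point the sections of the
  tensor product are the multiples of the product of generators of \<open>B\<close> and \<open>L\<close>; so a generator of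
  \<open>A\<close> is a multiple of the image of that product, which forces the image to generate as well.\<close>

lemma isomorphic_tensor_imp_pairing:
  fixes A :: "('p, 'r, 'a) modsheaf" and B :: "('p, 'r, 'b) modsheaf" and L :: "('p, 'r, 'l) modsheaf"
  assumes A: "line_sheaf A" and B: "line_sheaf B" and L: "line_sheaf L"
    and iso: "isomorphic X A (tensor_sheaf X B L)"
  shows "\<exists>\<beta>. perfect_pairing B L A \<beta>"
proof -
  let ?T = "topspace (tps X)"
  note LB = line_sheaf_linear[OF B] and LL = line_sheaf_linear[OF L] and LA = line_sheaf_linear[OF A]
  note MA = line_sheaf_modules[OF A]
  interpret T: presentation X "tensor_gens B L" "tensor_res B L" "tensor_rel B L" by (rule tensor_presentation[OF LB LL])
  define Q where "Q = T.P"
  have LQ: "linear_presheaf X Q" unfolding Q_def by (rule T.presented_linear_presheaf)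
  let ?S = "sheafify X Q" and ?u = "sheafify_unit Q"
  have "isomorphic X ?S A"
    using isomorphic_on_sym[OF LA iso] unfolding tensor_sheaf_eq[OF LB LL] Q_def .
  then obtain \<psi> where \<psi>: "\<psi> \<in> homs X ?S A"
    and bij: "\<And>W. opn W ==> W \<subseteq> ?T ==> bij_betw (\<psi> W) (secs ?S W) (secs A W)"
    unfolding isomorphic_on_def by blast
  define \<chi> where "\<chi> W s = \<psi> W (?u W s)" for W s
  have \<chi>_closed: "\<chi> W s \<in> secs A W"
    and \<chi>_add: "t \<in> secs Q W ==> \<chi> W (s \<oplus>\<^bsub>msec Q W\<^esub> t) = \<chi> W s \<oplus>\<^bsub>msec A W\<^esub> \<chi> W t"
    and \<chi>_smult: "a \<in> funs W ==> \<chi> W (a \<odot>\<^bsub>msec Q W\<^esub> s) = a \<odot>\<^bsub>msec A W\<^esub> \<chi> W s"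
    and \<chi>_res: "opn V ==> V \<subseteq> W ==> \<chi> V (mres Q W V s) = mres A W V (\<chi> W s)"
    if W: "opn W" and s: "s \<in> secs Q W" for W V s t a
  proof -
    note WT = W opn_topspace[OF W]
    note us = sheafify_unit_closed[OF LQ W]
    show "\<chi> W s \<in> secs A W" unfolding \<chi>_def by (rule sheaf_hom_closed[OF \<psi> WT us[OF s]])
    show "\<chi> W (s \<oplus>\<^bsub>msec Q W\<^esub> t) = \<chi> W s \<oplus>\<^bsub>msec A W\<^esub> \<chi> W t" if t: "t \<in> secs Q W"
      unfolding \<chi>_def sheafify_unit_add[OF LQ W s t] by (rule sheaf_hom_add[OF \<psi> WT us[OF s] us[OF t]])
    show "\<chi> W (a \<odot>\<^bsub>msec Q W\<^esub> s) = a \<odot>\<^bsub>msec A W\<^esub> \<chi> W s" if a: "a \<in> funs W"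
      unfolding \<chi>_def sheafify_unit_smult[OF LQ W a s] by (rule sheaf_hom_smult[OF \<psi> WT a us[OF s]])
    show "\<chi> V (mres Q W V s) = mres A W V (\<chi> W s)" if V: "opn V" "V \<subseteq> W"
      unfolding \<chi>_def sheafify_unit_res[OF LQ W V s] by (rule sheaf_hom_res[OF \<psi> W V WT(2) us[OF s]])
  qed
  define \<beta> where "\<beta> W x y = \<chi> W (T.gen W (x, y))" for W x y
  have gen: "T.gen W (x, y) \<in> secs Q W" if "opn W" "x \<in> secs B W" "y \<in> secs L W" for W x y
    unfolding Q_def by (rule T.gen_closed[OF that(1)]) (use that in simp)
  note m = SigmaI
  have b_closed: "\<beta> W x y \<in> secs A W" if "opn W" "x \<in> secs B W" "y \<in> secs L W" for W x y
    unfolding \<beta>_def by (rule \<chi>_closed[OF that(1) gen[OF that]])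
  have b_add_left: "\<beta> W (x \<oplus>\<^bsub>msec B W\<^esub> x') y = \<beta> W x y \<oplus>\<^bsub>msec A W\<^esub> \<beta> W x' y"
    if W: "opn W" and x: "x \<in> secs B W" and x': "x' \<in> secs B W" and y: "y \<in> secs L W" for W x x' y
  proof -
    have "T.gen W (x \<oplus>\<^bsub>msec B W\<^esub> x', y) = T.gen W (x, y) \<oplus>\<^bsub>msec Q W\<^esub> T.gen W (x', y)"
      unfolding Q_def
      by (rule T.gen_sumI[OF W m[OF linear_presheaf_add_closed[OF LB W x x'] y] m[OF x y] m[OF x' y]
            subsetD[OF T.Rel_N[OF W] tensor_relations_add_left[OF x y x']]])
    then show ?thesis unfolding \<beta>_def using \<chi>_add[OF W gen[OF W x y] gen[OF W x' y]] by simp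
  qed
  have b_add_right: "\<beta> W x (y \<oplus>\<^bsub>msec L W\<^esub> y') = \<beta> W x y \<oplus>\<^bsub>msec A W\<^esub> \<beta> W x y'"
    if W: "opn W" and x: "x \<in> secs B W" and y: "y \<in> secs L W" and y': "y' \<in> secs L W" for W x y y'
  proof -
    have "T.gen W (x, y \<oplus>\<^bsub>msec L W\<^esub> y') = T.gen W (x, y) \<oplus>\<^bsub>msec Q W\<^esub> T.gen W (x, y')"
      unfolding Q_def
      by (rule T.gen_sumI[OF W m[OF x linear_presheaf_add_closed[OF LL W y y']] m[OF x y] m[OF x y']
            subsetD[OF T.Rel_N[OF W] tensor_relations_add_right[OF x y y']]])
    then show ?thesis unfolding \<beta>_def using \<chi>_add[OF W gen[OF W x y] gen[OF W x y']] by simp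
  qed
  have b_smult_left: "\<beta> W (a \<odot>\<^bsub>msec B W\<^esub> x) y = a \<odot>\<^bsub>msec A W\<^esub> \<beta> W x y"
    if W: "opn W" and a: "a \<in> funs W" and x: "x \<in> secs B W" and y: "y \<in> secs L W" for W a x y
  proof -
    have "T.gen W (a \<odot>\<^bsub>msec B W\<^esub> x, y) = a \<odot>\<^bsub>msec Q W\<^esub> T.gen W (x, y)"
      unfolding Q_def
      by (rule T.gen_smultI[OF W m[OF linear_presheaf_smult_closed[OF LB W a x] y] m[OF x y] a
            subsetD[OF T.Rel_N[OF W] tensor_relations_smult_left[OF x y a]]])
    then show ?thesis unfolding \<beta>_def using \<chi>_smult[OF W gen[OF W x y] a] by simp
  qed
  have b_smult_right: "\<beta> W x (a \<odot>\<^bsub>msec L W\<^esub> y) = a \<odot>\<^bsub>msec A W\<^esub> \<beta> W x y"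
    if W: "opn W" and a: "a \<in> funs W" and x: "x \<in> secs B W" and y: "y \<in> secs L W" for W a x y
  proof -
    have "T.gen W (x, a \<odot>\<^bsub>msec L W\<^esub> y) = a \<odot>\<^bsub>msec Q W\<^esub> T.gen W (x, y)"
      unfolding Q_def
      by (rule T.gen_smultI[OF W m[OF x linear_presheaf_smult_closed[OF LL W a y]] m[OF x y] a
            subsetD[OF T.Rel_N[OF W] tensor_relations_smult_right[OF x y a]]])
    then show ?thesis unfolding \<beta>_def using \<chi>_smult[OF W gen[OF W x y] a] by simp
  qed
  have b_res: "\<beta> V (mres B W V x) (mres L W V y) = mres A W V (\<beta> W x y)"
    if W: "opn W" and V: "opn V" "V \<subseteq> W" and x: "x \<in> secs B W" and y: "y \<in> secs L W" for W V x y
  proof -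
    have "mres Q W V (T.gen W (x, y)) = T.gen V (mres B W V x, mres L W V y)"
      unfolding Q_def using T.gen_res[OF W V m[OF x y]] by simp
    then show ?thesis unfolding \<beta>_def using \<chi>_res[OF W gen[OF W x y] V] by simp
  qed
  have "perfect_pairing B L A \<beta>"
  proof (rule perfect_pairingI[OF b_closed b_add_left b_add_right b_smult_left b_smult_right b_res])
    fix p assume p: "p \<in> ?T"
    obtain U1 x1 where U1: "p \<in> U1" "generates U1 B x1" using B p unfolding line_sheaf_def by blast
    obtain U2 y1 where U2: "p \<in> U2" "U2 \<subseteq> U1" "generates U2 L y1"
      by (rule line_sheaf_generator[OF L generatesD(1)[OF U1(2)] U1(1)])
    obtain U3 a1 where U3: "p \<in> U3" "U3 \<subseteq> U2" "generates U3 A a1"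
      by (rule line_sheaf_generator[OF A generatesD(1)[OF U2(3)] U2(1)])
    note a1 = generatesD[OF U3(3)]
    obtain t where t: "t \<in> secs ?S U3" "a1 = \<psi> U3 t"
      using bij[OF a1(1) opn_topspace[OF a1(1)]] a1(2) unfolding bij_betw_def by blast
    obtain V s where V: "opn V" "p \<in> V" "V \<subseteq> U3" and s: "s \<in> secs Q V" "mres ?S U3 V t = ?u V s"
      by (rule sheafify_local_unit[OF LQ t(1) U3(1)])
    have VU: "V \<subseteq> U1" "V \<subseteq> U2" using V U2 U3 by auto
    let ?x = "mres B U1 V x1" and ?y = "mres L U2 V y1" and ?a = "mres A U3 V a1"
    have gx: "generates V B ?x" by (rule generates_res[OF LB U1(2) V(1) VU(1)])
    have gy: "generates V L ?y" by (rule generates_res[OF LL U2(3) V(1) VU(2)])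
    have ga: "generates V A ?a" by (rule generates_res[OF LA U3(3) V(1,3)])
    note x = generatesD(2)[OF gx] and y = generatesD(2)[OF gy] and a = generatesD(2)[OF ga]
    interpret MV: module "sec X V" "msec A V" by (rule modules_module[OF MA V(1)])
    note b = b_closed[OF V(1) x y]
    \<comment> \<open>Sections of \<open>Q\<close> are sums of elementary tensors, and these are multiples of \<open>?x \<otimes> ?y\<close>.\<close>
    have mult: "\<exists>c\<in>funs V. \<chi> V (T.cls V f) = c \<odot>\<^bsub>msec A V\<^esub> \<beta> V ?x ?y" if f: "f \<in> carrier (T.Fr V)" for f
      using sec_cring[OF V(1)] f
    proof (induction rule: free_module_induct)
      case base
      interpret Fr: module "sec X V" "T.Fr V" by (rule T.Fr_module[OF V(1)])
      let ?z = "\<zero>\<^bsub>T.Fr V\<^esub>"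
      note z = Fr.M.zero_closed
      note zc = T.cls_closed[OF V(1) z, folded Q_def]
      have "T.cls V ?z = \<zero>\<^bsub>sec X V\<^esub> \<odot>\<^bsub>msec Q V\<^esub> T.cls V ?z"
        unfolding Q_def by (simp only: T.cls_smult[OF V(1) MV.R.zero_closed z] Fr.smult_r_null[OF MV.R.zero_closed])
      then have "\<chi> V (T.cls V ?z) = \<zero>\<^bsub>sec X V\<^esub> \<odot>\<^bsub>msec A V\<^esub> \<chi> V (T.cls V ?z)"
        using \<chi>_smult[OF V(1) zc MV.R.zero_closed] by simp
      also have "\<dots> = \<zero>\<^bsub>sec X V\<^esub> \<odot>\<^bsub>msec A V\<^esub> \<beta> V ?x ?y"
        using \<chi>_closed[OF V(1) zc] b by simp
      finally show ?case using MV.R.zero_closed by blast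
    next
      case (step f r i)
      obtain x' y' where i: "i = (x', y')" and x': "x' \<in> secs B V" and y': "y' \<in> secs L V"
        using step(3) by auto
      obtain c where c: "c \<in> funs V" "\<chi> V (T.cls V f) = c \<odot>\<^bsub>msec A V\<^esub> \<beta> V ?x ?y" using step(4) by blast
      obtain d where d: "d \<in> funs V" "x' = d \<odot>\<^bsub>msec B V\<^esub> ?x" by (rule generates_coeff_self[OF LB gx x'])
      obtain e where e: "e \<in> funs V" "y' = e \<odot>\<^bsub>msec L V\<^esub> ?y" by (rule generates_coeff_self[OF LL gy y'])
      have be: "\<beta> V x' y' = (d \<otimes>\<^bsub>sec X V\<^esub> e) \<odot>\<^bsub>msec A V\<^esub> \<beta> V ?x ?y"
        unfolding d(2) b_smult_left[OF V(1) d(1) x y'] unfolding e(2) b_smult_right[OF V(1) e(1) x y]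
        by (rule MV.smult_assoc1[OF d(1) e(1) b, symmetric])
      note bi = T.basis_closed[OF V(1) step(3)]
      note gi = gen[OF V(1) x' y']
      have "T.cls V (f \<oplus>\<^bsub>T.Fr V\<^esub> (r \<odot>\<^bsub>T.Fr V\<^esub> basis_vector (sec X V) i)) = T.cls V f \<oplus>\<^bsub>msec Q V\<^esub> (r \<odot>\<^bsub>msec Q V\<^esub> T.gen V i)"
        unfolding T.gen_def Q_def
        by (simp only: T.cls_smult[OF V(1) step(2) bi] T.cls_add[OF V(1) step(1) T.Fr_smult_closed[OF V(1) step(2) bi]])
      then have "\<chi> V (T.cls V (f \<oplus>\<^bsub>T.Fr V\<^esub> (r \<odot>\<^bsub>T.Fr V\<^esub> basis_vector (sec X V) i)))
          = \<chi> V (T.cls V f) \<oplus>\<^bsub>msec A V\<^esub> r \<odot>\<^bsub>msec A V\<^esub> \<beta> V x' y'"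
        unfolding \<beta>_def using \<chi>_add[OF V(1) T.cls_closed[OF V(1) step(1), folded Q_def] linear_presheaf_smult_closed[OF LQ V(1) step(2) gi]]
          \<chi>_smult[OF V(1) gi step(2)] i by simp
      also have "\<dots> = (c \<oplus>\<^bsub>sec X V\<^esub> r \<otimes>\<^bsub>sec X V\<^esub> (d \<otimes>\<^bsub>sec X V\<^esub> e)) \<odot>\<^bsub>msec A V\<^esub> \<beta> V ?x ?y"
        unfolding c(2) be using c(1) d(1) e(1) step(2) b by (simp add: MV.smult_l_distr MV.smult_assoc1)
      finally show ?case using c(1) d(1) e(1) step(2) by blast
    qed
    obtain f where f: "f \<in> carrier (T.Fr V)" "s = T.cls V f" by (rule T.P_cases[OF V(1) s(1)[unfolded Q_def]])
    obtain c where c: "c \<in> funs V" "\<chi> V s = c \<odot>\<^bsub>msec A V\<^esub> \<beta> V ?x ?y" using mult[OF f(1)] f(2) by blast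
    have a_eq: "?a = c \<odot>\<^bsub>msec A V\<^esub> \<beta> V ?x ?y"
      using sheaf_hom_res[OF \<psi> a1(1) V(1,3) opn_topspace[OF a1(1)] t(1)] c(2) unfolding t(2) s(2) \<chi>_def by simp
    obtain d where d: "d \<in> funs V" "\<beta> V ?x ?y = d \<odot>\<^bsub>msec A V\<^esub> ?a" by (rule generates_coeff_self[OF LA ga b])
    have "(c \<otimes>\<^bsub>sec X V\<^esub> d) \<odot>\<^bsub>msec A V\<^esub> ?a = \<one>\<^bsub>sec X V\<^esub> \<odot>\<^bsub>msec A V\<^esub> ?a"
      using a_eq d MV.smult_assoc1[OF c(1) d(1) a] a by simp
    then have cd: "c \<otimes>\<^bsub>sec X V\<^esub> d = \<one>\<^bsub>sec X V\<^esub>"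
      by (rule generates_cancel_self[OF LA ga, rotated 2]) (use c d in auto)
    have "generates V A (\<beta> V ?x ?y)"
      unfolding d(2) by (rule generates_unit_multiple[OF MA ga d(1) c(1) cd])
    with gx gy V(2) show "\<exists>W x y. p \<in> W \<and> generates W B x \<and> generates W L y \<and> generates W A (\<beta> W x y)" by blast
  qed
  then show ?thesis by blast
qed

text \<open>Where \<open>x\<close>, \<open>y\<close> and \<open>\<beta> x y\<close> are generators, the homomorphism induced by \<open>\<beta>\<close> on the tensor product
  presheaf matches multiples of \<open>x \<otimes> y\<close> with multiples of \<open>\<beta> x y\<close> and is bijective.\<close>

lemma pairing_imp_isomorphic_tensor:
  fixes A :: "('p, 'r, 'a) modsheaf" and B :: "('p, 'r, 'b) modsheaf" and L :: "('p, 'r, 'l) modsheaf"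
  assumes A: "sheaf_of_modules X A" and B: "sheaf_of_modules X B" and L: "sheaf_of_modules X L"
    and \<beta>: "perfect_pairing B L A \<beta>"
  shows "isomorphic X A (tensor_sheaf X B L)"
proof -
  let ?T = "topspace (tps X)"
  note LA = modules_linear_presheaf[OF A] and LB = modules_linear_presheaf[OF B] and LL = modules_linear_presheaf[OF L]
  note p = perfect_pairingD[OF \<beta>]
  interpret T: presentation X "tensor_gens B L" "tensor_res B L" "tensor_rel B L" by (rule tensor_presentation[OF LB LL])
  define Q where "Q = T.P"
  have LQ: "linear_presheaf X Q" unfolding Q_def by (rule T.presented_linear_presheaf)
  define h where "h W = (\<lambda>(x, y). \<beta> W x y)" for W
  have h: "h W \<in> tensor_gens B L W \<rightarrow> secs A W" if "opn W" for W
    using p(1)[OF that] unfolding h_def by auto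
  note m = SigmaI
  have "\<exists>\<theta>\<in>homs X T.P A. \<forall>W. opn W \<and> W \<subseteq> ?T -->
    (\<forall>f\<in>carrier (T.Fr W). \<theta> W (T.cls W f) = free_lift (sec X W) (msec A W) (h W) f) \<and>
    (\<forall>i\<in>tensor_gens B L W. \<theta> W (T.gen W i) = h W i)"
  proof (rule T.presented_hom_exists[OF A])
    fix W i assume W: "opn W" and i: "i \<in> tensor_gens B L W"
    show "h W i \<in> secs A W" using h[OF W] i by blast
    show "h V (tensor_res B L W V i) = mres A W V (h W i)" if "opn V" "V \<subseteq> W" for V
      using i p(6)[OF W that] unfolding h_def by auto
  next
    fix W r assume W: "opn W" and "r \<in> tensor_rel B L W"
    from this(2) show "free_lift (sec X W) (msec A W) (h W) r = \<zero>\<^bsub>msec A W\<^esub>"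
    proof (cases rule: tensor_relations_cases)
      case (add_left x x' y)
      show ?thesis unfolding add_left(4)
        by (rule T.free_lift_sum_relation[OF W A h[OF W] m[OF linear_presheaf_add_closed[OF LB W add_left(1,2)] add_left(3)]
              m[OF add_left(1,3)] m[OF add_left(2,3)]])
          (simp only: h_def prod.case p(2)[OF W add_left(1-3)])
    next
      case (add_right x y y')
      show ?thesis unfolding add_right(4)
        by (rule T.free_lift_sum_relation[OF W A h[OF W] m[OF add_right(1) linear_presheaf_add_closed[OF LL W add_right(2,3)]]
              m[OF add_right(1,2)] m[OF add_right(1,3)]])
          (simp only: h_def prod.case p(3)[OF W add_right(1-3)])
    next
      case (smult_left a x y)
      show ?thesis unfolding smult_left(4)
        by (rule T.free_lift_smult_relation[OF W A h[OF W] m[OF linear_presheaf_smult_closed[OF LB W smult_left(1,2)] smult_left(3)]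
              m[OF smult_left(2,3)] smult_left(1)])
          (simp only: h_def prod.case p(4)[OF W smult_left(1-3)])
    next
      case (smult_right a x y)
      show ?thesis unfolding smult_right(4)
        by (rule T.free_lift_smult_relation[OF W A h[OF W] m[OF smult_right(2) linear_presheaf_smult_closed[OF LL W smult_right(1,3)]]
              m[OF smult_right(2,3)] smult_right(1)])
          (simp only: h_def prod.case p(5)[OF W smult_right(1-3)])
    qed
  qed
  then obtain \<theta> where \<theta>: "\<theta> \<in> homs X Q A"
    and \<theta>_all: "\<forall>W. opn W \<and> W \<subseteq> ?T -->
      (\<forall>f\<in>carrier (T.Fr W). \<theta> W (T.cls W f) = free_lift (sec X W) (msec A W) (h W) f) \<and>
      (\<forall>i\<in>tensor_gens B L W. \<theta> W (T.gen W i) = h W i)"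
    unfolding Q_def by (elim bexE)
  have \<theta>_gen: "\<theta> W (T.gen W (x, y)) = \<beta> W x y"
    if "opn W" "x \<in> secs B W" "y \<in> secs L W" for W x y
    using \<theta>_all that opn_topspace[OF that(1)] unfolding h_def by simp
  have "isomorphic X (sheafify X Q) A"
  proof (rule sheafify_isomorphic[OF LQ A \<theta>])
    fix q assume "q \<in> ?T"
    then obtain U x y where U: "q \<in> U" and gx: "generates U B x" and gy: "generates U L y" and ga: "generates U A (\<beta> U x y)"
      using p(7) by blast
    note U' = generatesD(1)[OF gx]
    have "bij_betw (\<theta> W) (secs Q W) (secs A W)" if W: "opn W" "W \<subseteq> U" for W
    proof -
      let ?x = "mres B U W x" and ?y = "mres L U W y"
      have WT: "W \<subseteq> ?T" by (rule opn_topspace[OF W(1)])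
      have gx': "generates W B ?x" by (rule generates_res[OF LB gx W])
      have gy': "generates W L ?y" by (rule generates_res[OF LL gy W])
      note cx = generatesD(2)[OF gx'] and cy = generatesD(2)[OF gy']
      have ga': "generates W A (\<beta> W ?x ?y)"
        unfolding p(6)[OF U' W generatesD(2)[OF gx] generatesD(2)[OF gy]] by (rule generates_res[OF LA ga W])
      note ca = generatesD(2)[OF ga']
      interpret Fr: module "sec X W" "T.Fr W" by (rule T.Fr_module[OF W(1)])
      let ?e = "basis_vector (sec X W) (?x, ?y)" and ?g = "T.gen W (?x, ?y)"
      note e = T.basis_closed[OF W(1) m[OF cx cy]]
      have g: "?g \<in> secs Q W" unfolding Q_def by (rule T.gen_closed[OF W(1) m[OF cx cy]])
      \<comment> \<open>Near a point with generators, every section of \<open>Q\<close> is a multiple of one elementary tensor.\<close>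
      have mult: "\<exists>c\<in>funs W. T.cls W f = c \<odot>\<^bsub>msec Q W\<^esub> ?g" if f: "f \<in> carrier (T.Fr W)" for f
        using sec_cring[OF W(1)] f
      proof (induction rule: free_module_induct)
        case base
        have "T.cls W \<zero>\<^bsub>T.Fr W\<^esub> = \<zero>\<^bsub>sec X W\<^esub> \<odot>\<^bsub>msec Q W\<^esub> ?g"
          unfolding T.gen_def Q_def by (simp only: T.cls_smult[OF W(1) Fr.R.zero_closed e] Fr.smult_l_null[OF e])
        then show ?case using Fr.R.zero_closed by blast
      next
        case (step f r i)
        obtain x' y' where i: "i = (x', y')" and x': "x' \<in> secs B W" and y': "y' \<in> secs L W"
          using step(3) by auto
        obtain c where c: "c \<in> funs W" "T.cls W f = c \<odot>\<^bsub>msec Q W\<^esub> ?g" using step(4) by blast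
        obtain a where a: "a \<in> funs W" "x' = a \<odot>\<^bsub>msec B W\<^esub> ?x" by (rule generates_coeff_self[OF LB gx' x'])
        obtain b where b: "b \<in> funs W" "y' = b \<odot>\<^bsub>msec L W\<^esub> ?y" by (rule generates_coeff_self[OF LL gy' y'])
        have "T.gen W (x', y') = a \<odot>\<^bsub>msec Q W\<^esub> T.gen W (?x, y')"
          unfolding a(2) Q_def
          by (rule T.gen_smultI[OF W(1) m[OF linear_presheaf_smult_closed[OF LB W(1) a(1) cx] y'] m[OF cx y'] a(1)
            subsetD[OF T.Rel_N[OF W(1)] tensor_relations_smult_left[OF cx y' a(1)]]])
        also have "T.gen W (?x, y') = b \<odot>\<^bsub>msec Q W\<^esub> ?g"
          unfolding b(2) Q_def
          by (rule T.gen_smultI[OF W(1) m[OF cx linear_presheaf_smult_closed[OF LL W(1) b(1) cy]] m[OF cx cy] b(1)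
            subsetD[OF T.Rel_N[OF W(1)] tensor_relations_smult_right[OF cx cy b(1)]]])
        finally have gi: "T.gen W i = a \<odot>\<^bsub>msec Q W\<^esub> (b \<odot>\<^bsub>msec Q W\<^esub> ?g)" unfolding i .
        note s1 = T.cls_smult[OF W(1), folded Q_def]
        note cl = Fr.smult_closed
        have "T.cls W (f \<oplus>\<^bsub>T.Fr W\<^esub> (r \<odot>\<^bsub>T.Fr W\<^esub> basis_vector (sec X W) i)) = T.cls W f \<oplus>\<^bsub>msec Q W\<^esub> (r \<odot>\<^bsub>msec Q W\<^esub> T.gen W i)"
          unfolding T.gen_def s1[OF step(2) T.basis_closed[OF W(1) step(3)]]
          by (rule T.cls_add[OF W(1) step(1) cl[OF step(2) T.basis_closed[OF W(1) step(3)]], folded Q_def, symmetric])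
        also have "\<dots> = T.cls W (c \<odot>\<^bsub>T.Fr W\<^esub> ?e) \<oplus>\<^bsub>msec Q W\<^esub> T.cls W (r \<odot>\<^bsub>T.Fr W\<^esub> (a \<odot>\<^bsub>T.Fr W\<^esub> (b \<odot>\<^bsub>T.Fr W\<^esub> ?e)))"
          unfolding c(2) gi unfolding T.gen_def s1[OF c(1) e] s1[OF b(1) e] s1[OF a(1) cl[OF b(1) e]] s1[OF step(2) cl[OF a(1) cl[OF b(1) e]]] ..
        also have "\<dots> = T.cls W (c \<odot>\<^bsub>T.Fr W\<^esub> ?e \<oplus>\<^bsub>T.Fr W\<^esub> r \<odot>\<^bsub>T.Fr W\<^esub> (a \<odot>\<^bsub>T.Fr W\<^esub> (b \<odot>\<^bsub>T.Fr W\<^esub> ?e)))"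
          by (rule T.cls_add[OF W(1) cl[OF c(1) e] cl[OF step(2) cl[OF a(1) cl[OF b(1) e]]], folded Q_def])
        also have "c \<odot>\<^bsub>T.Fr W\<^esub> ?e \<oplus>\<^bsub>T.Fr W\<^esub> r \<odot>\<^bsub>T.Fr W\<^esub> (a \<odot>\<^bsub>T.Fr W\<^esub> (b \<odot>\<^bsub>T.Fr W\<^esub> ?e))
            = (c \<oplus>\<^bsub>sec X W\<^esub> r \<otimes>\<^bsub>sec X W\<^esub> (a \<otimes>\<^bsub>sec X W\<^esub> b)) \<odot>\<^bsub>T.Fr W\<^esub> ?e"
          unfolding Fr.smult_l_distr[OF c(1) Fr.R.m_closed[OF step(2) Fr.R.m_closed[OF a(1) b(1)]] e]
            Fr.smult_assoc1[OF step(2) Fr.R.m_closed[OF a(1) b(1)] e] Fr.smult_assoc1[OF a(1) b(1) e] ..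
        finally have "T.cls W (f \<oplus>\<^bsub>T.Fr W\<^esub> (r \<odot>\<^bsub>T.Fr W\<^esub> basis_vector (sec X W) i))
            = (c \<oplus>\<^bsub>sec X W\<^esub> r \<otimes>\<^bsub>sec X W\<^esub> (a \<otimes>\<^bsub>sec X W\<^esub> b)) \<odot>\<^bsub>msec Q W\<^esub> ?g"
          unfolding T.gen_def s1[OF Fr.R.a_closed[OF c(1) Fr.R.m_closed[OF step(2) Fr.R.m_closed[OF a(1) b(1)]]] e] .
        then show ?case by (rule bexI[OF _ Fr.R.a_closed[OF c(1) Fr.R.m_closed[OF step(2) Fr.R.m_closed[OF a(1) b(1)]]]])
      qed
      have all: "\<exists>c\<in>funs W. s = c \<odot>\<^bsub>msec Q W\<^esub> ?g" if s: "s \<in> secs Q W" for s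
      proof -
        obtain f where f: "f \<in> carrier (T.Fr W)" "s = T.cls W f"
          by (rule T.P_cases[OF W(1) s[unfolded Q_def]])
        show ?thesis unfolding f(2) by (rule mult[OF f(1)])
      qed
      have val: "\<theta> W (c \<odot>\<^bsub>msec Q W\<^esub> ?g) = c \<odot>\<^bsub>msec A W\<^esub> \<beta> W ?x ?y" if "c \<in> funs W" for c
        using sheaf_hom_smult[OF \<theta> W(1) WT that g] \<theta>_gen[OF W(1) cx cy] by simp
      show ?thesis
        unfolding bij_betw_def
      proof (rule conjI)
        show "inj_on (\<theta> W) (secs Q W)"
        proof (rule inj_onI)
        fix s t assume st: "s \<in> secs Q W" "t \<in> secs Q W" "\<theta> W s = \<theta> W t"
        obtain c where c: "c \<in> funs W" "s = c \<odot>\<^bsub>msec Q W\<^esub> ?g" using all[OF st(1)] by blast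
        obtain d where d: "d \<in> funs W" "t = d \<odot>\<^bsub>msec Q W\<^esub> ?g" using all[OF st(2)] by blast
        have "c = d"
          by (rule generates_cancel_self[OF LA ga' c(1) d(1)]) (use st(3) val c d in simp)
        then show "s = t" using c d by simp
        qed
      next
        show "\<theta> W ` secs Q W = secs A W"
        proof (intro subset_antisym subsetI)
        fix a assume "a \<in> \<theta> W ` secs Q W"
        then show "a \<in> secs A W" using sheaf_hom_closed[OF \<theta> W(1) WT] by blast
      next
        fix a assume "a \<in> secs A W"
        then obtain c where c: "c \<in> funs W" "a = c \<odot>\<^bsub>msec A W\<^esub> \<beta> W ?x ?y"
          by (rule generates_coeff_self[OF LA ga'])
        then have "a = \<theta> W (c \<odot>\<^bsub>msec Q W\<^esub> ?g)" using val by simp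
        then show "a \<in> \<theta> W ` secs Q W" using linear_presheaf_smult_closed[OF LQ W(1) c(1) g] by blast
        qed
      qed
    qed
    then show "\<exists>U. opn U \<and> q \<in> U \<and> (\<forall>W. opn W \<and> W \<subseteq> U --> bij_betw (\<theta> W) (secs Q W) (secs A W))"
      using U U' by blast
  qed
  from isomorphic_on_sym[OF sheafify_linear_presheaf[OF LQ] this]
  show ?thesis unfolding tensor_sheaf_eq[OF LB LL] Q_def .
qed

lemma perfect_pairing_transport:
  assumes \<beta>: "perfect_pairing B L A \<beta>" and B': "linear_presheaf X B'" and A: "linear_presheaf X A"
    and isoB: "isomorphic X B' B" and isoA: "isomorphic X A A'"
  shows "\<exists>\<beta>'. perfect_pairing B' L A' \<beta>'"
proof -
  let ?T = "topspace (tps X)"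
  note p = perfect_pairingD[OF \<beta>]
  obtain \<gamma> where \<gamma>: "\<gamma> \<in> homs X B' B"
    and bij\<gamma>: "\<And>W. opn W ==> W \<subseteq> ?T ==> bij_betw (\<gamma> W) (secs B' W) (secs B W)"
    using isoB unfolding isomorphic_on_def by blast
  obtain \<alpha> where \<alpha>: "\<alpha> \<in> homs X A A'"
    and bij\<alpha>: "\<And>W. opn W ==> W \<subseteq> ?T ==> bij_betw (\<alpha> W) (secs A W) (secs A' W)"
    using isoA unfolding isomorphic_on_def by blast
  define \<beta>' where "\<beta>' W x y = \<alpha> W (\<beta> W (\<gamma> W x) y)" for W x y
  have gc: "\<gamma> W x \<in> secs B W" if "opn W" "x \<in> secs B' W" for W x
    by (rule sheaf_hom_closed[OF \<gamma> that(1) opn_topspace[OF that(1)] that(2)])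
  have "perfect_pairing B' L A' \<beta>'"
  proof (rule perfect_pairingI)
    fix W x y assume W: "opn W" and x: "x \<in> secs B' W" and y: "y \<in> secs L W"
    note WT = W opn_topspace[OF W]
    note c = p(1)[OF W gc[OF W x] y]
    show "\<beta>' W x y \<in> secs A' W" unfolding \<beta>'_def by (rule sheaf_hom_closed[OF \<alpha> WT c])
    show "\<beta>' W (x \<oplus>\<^bsub>msec B' W\<^esub> x') y = \<beta>' W x y \<oplus>\<^bsub>msec A' W\<^esub> \<beta>' W x' y" if x': "x' \<in> secs B' W" for x'
      unfolding \<beta>'_def sheaf_hom_add[OF \<gamma> WT x x'] p(2)[OF W gc[OF W x] gc[OF W x'] y]
      by (rule sheaf_hom_add[OF \<alpha> WT c p(1)[OF W gc[OF W x'] y]])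
    show "\<beta>' W x (y \<oplus>\<^bsub>msec L W\<^esub> y') = \<beta>' W x y \<oplus>\<^bsub>msec A' W\<^esub> \<beta>' W x y'" if y': "y' \<in> secs L W" for y'
      unfolding \<beta>'_def p(3)[OF W gc[OF W x] y y']
      by (rule sheaf_hom_add[OF \<alpha> WT c p(1)[OF W gc[OF W x] y']])
    show "\<beta>' W (a \<odot>\<^bsub>msec B' W\<^esub> x) y = a \<odot>\<^bsub>msec A' W\<^esub> \<beta>' W x y" if a: "a \<in> funs W" for a
      unfolding \<beta>'_def sheaf_hom_smult[OF \<gamma> WT a x] p(4)[OF W a gc[OF W x] y]
      by (rule sheaf_hom_smult[OF \<alpha> WT a c])
    show "\<beta>' W x (a \<odot>\<^bsub>msec L W\<^esub> y) = a \<odot>\<^bsub>msec A' W\<^esub> \<beta>' W x y" if a: "a \<in> funs W" for a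
      unfolding \<beta>'_def p(5)[OF W a gc[OF W x] y] by (rule sheaf_hom_smult[OF \<alpha> WT a c])
    show "\<beta>' V (mres B' W V x) (mres L W V y) = mres A' W V (\<beta>' W x y)" if V: "opn V" "V \<subseteq> W" for V
      unfolding \<beta>'_def sheaf_hom_res[OF \<gamma> W V WT(2) x] p(6)[OF W V gc[OF W x] y]
      by (rule sheaf_hom_res[OF \<alpha> W V WT(2) c])
  next
    fix q assume "q \<in> ?T"
    then obtain W x y where W: "q \<in> W" and gx: "generates W B x" and gy: "generates W L y" and ga: "generates W A (\<beta> W x y)"
      using p(7) by blast
    note gD = generatesD[OF gx]
    note WT = gD(1) opn_topspace[OF gD(1)]
    obtain x' where x': "x' \<in> secs B' W" "x = \<gamma> W x'" using bij\<gamma>[OF WT] gD(2) unfolding bij_betw_def by blast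
    have "generates W B' x'" by (rule generates_reflect[OF B' \<gamma> bij\<gamma> x'(1)]) (use gx x' in auto)
    moreover have "generates W A' (\<beta>' W x' y)"
      unfolding \<beta>'_def x'(2)[symmetric] generates_def
    proof (intro conjI allI impI gD(1))
      note ac = generatesD(2)[OF ga]
      show "\<alpha> W (\<beta> W x y) \<in> secs A' W" by (rule sheaf_hom_closed[OF \<alpha> WT ac])
      fix V assume "opn V \<and> V \<subseteq> W"
      then have V: "opn V" "V \<subseteq> W" by auto
      have eq: "a \<odot>\<^bsub>msec A' V\<^esub> mres A' W V (\<alpha> W (\<beta> W x y)) = \<alpha> V (a \<odot>\<^bsub>msec A V\<^esub> mres A W V (\<beta> W x y))" if "a \<in> funs V" for a
        using sheaf_hom_res[OF \<alpha> WT(1) V WT(2) ac]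
          sheaf_hom_smult[OF \<alpha> V(1) opn_topspace[OF V(1)] that linear_presheaf_res_closed[OF A WT(1) V ac]] by simp
      from bij_betw_trans[OF generatesD(3)[OF ga V] bij\<alpha>[OF V(1) opn_topspace[OF V(1)]]]
      show "bij_betw (\<lambda>a. a \<odot>\<^bsub>msec A' V\<^esub> mres A' W V (\<alpha> W (\<beta> W x y))) (funs V) (secs A' V)"
        by (rule bij_betw_cong[THEN iffD1, rotated]) (simp add: eq)
    qed
    ultimately show "\<exists>W x y. q \<in> W \<and> generates W B' x \<and> generates W L y \<and> generates W A' (\<beta>' W x y)" using W gy by blast
  qed
  then show ?thesis by blast
qed

section \<open>Exchanging the ends of a pairing\<close>

lemma generates_agree:
  assumes ag: "agree_on U E F" and W: "W \<subseteq> U" and g: "generates W E g"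
  shows "generates W F g"
  unfolding generates_def
proof (intro conjI allI impI)
  note gD = generatesD[OF g]
  show "opn W" by (rule gD)
  show "g \<in> secs F W" using gD(2) agree_onD(1)[OF ag gD(1) W] by simp
  fix V assume "opn V \<and> V \<subseteq> W"
  then have V: "opn V" "V \<subseteq> W" "V \<subseteq> U" using W by auto
  show "bij_betw (\<lambda>a. a \<odot>\<^bsub>msec F V\<^esub> mres F W V g) (funs V) (secs F V)"
    using gD(3)[OF V(1,2)] agree_onD(1)[OF ag V(1,3)] agree_onD(2)[OF ag gD(1) V(1,2) W] by simp
qed

text \<open>A local generator is sent to a multiple of itself, and the local functions so obtained glue
  because coefficients are unique.\<close>

lemma line_sheaf_endomorphism:
  assumes C: "line_sheaf C" and W: "opn W" and \<phi>: "\<phi> \<in> sheaf_hom X W C C"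
  shows "\<exists>r. r \<in> funs W \<and>
    (\<forall>V c. opn V \<and> V \<subseteq> W \<and> c \<in> secs C V --> \<phi> V c = res X W V r \<odot>\<^bsub>msec C V\<^esub> c)"
proof -
  note M = line_sheaf_modules[OF C] and L = line_sheaf_linear[OF C]
  define Q where "Q V r \<longleftrightarrow> (\<forall>Z c. opn Z \<and> Z \<subseteq> V \<and> c \<in> secs C Z --> \<phi> Z c = res X V Z r \<odot>\<^bsub>msec C Z\<^esub> c)" for V r
  have QD: "\<phi> Z c = res X V Z r \<odot>\<^bsub>msec C Z\<^esub> c" if "Q V r" "opn Z" "Z \<subseteq> V" "c \<in> secs C Z" for V r Z c
    using that unfolding Q_def by blast
  have ex: "\<exists>V r. opn V \<and> x \<in> V \<and> V \<subseteq> W \<and> r \<in> funs V \<and> Q V r" if x: "x \<in> W" for x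
  proof -
    obtain V g where V: "x \<in> V" "V \<subseteq> W" "generates V C g" by (rule line_sheaf_generator[OF C W x])
    note gD = generatesD[OF V(3)]
    have "\<phi> V g \<in> secs C V" by (rule sheaf_hom_closed[OF \<phi> gD(1) V(2) gD(2)])
    then obtain r where r: "r \<in> funs V" "\<phi> V g = r \<odot>\<^bsub>msec C V\<^esub> g" by (rule generates_coeff_self[OF L V(3)])
    have "Q V r"
      unfolding Q_def
    proof (intro allI impI)
      fix Z c assume "opn Z \<and> Z \<subseteq> V \<and> c \<in> secs C Z"
      then have Z: "opn Z" "Z \<subseteq> V" "Z \<subseteq> W" and c: "c \<in> secs C Z" using V by auto
      interpret MZ: module "sec X Z" "msec C Z" by (rule modules_module[OF M Z(1)])
      let ?g = "mres C V Z g" and ?r = "res X V Z r"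
      have gZ: "?g \<in> secs C Z" by (rule linear_presheaf_res_closed[OF L gD(1) Z(1,2) gD(2)])
      have rZ: "?r \<in> funs Z" by (rule res_closed[OF gD(1) Z(1,2) r(1)])
      obtain u where u: "u \<in> funs Z" "c = u \<odot>\<^bsub>msec C Z\<^esub> ?g" by (rule generates_coeff[OF V(3) Z(1,2) c])
      have "\<phi> Z c = u \<odot>\<^bsub>msec C Z\<^esub> \<phi> Z ?g" unfolding u(2) by (rule sheaf_hom_smult[OF \<phi> Z(1,3) u(1) gZ])
      also have "\<phi> Z ?g = ?r \<odot>\<^bsub>msec C Z\<^esub> ?g"
        using sheaf_hom_res[OF \<phi> gD(1) Z(1,2) V(2) gD(2)] linear_presheaf_res_smult[OF L gD(1) Z(1,2) r(1) gD(2)] r(2) by simp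
      also have "u \<odot>\<^bsub>msec C Z\<^esub> (?r \<odot>\<^bsub>msec C Z\<^esub> ?g) = ?r \<odot>\<^bsub>msec C Z\<^esub> c"
        unfolding u(2) using u(1) rZ gZ by (simp add: MZ.smult_assoc1[symmetric] MZ.R.m_comm)
      finally show "\<phi> Z c = ?r \<odot>\<^bsub>msec C Z\<^esub> c" .
    qed
    then show ?thesis using gD(1) V r by blast
  qed
  have "\<exists>!r. r \<in> funs W \<and> (\<forall>V c. opn V \<and> V \<subseteq> W \<and> c \<in> funs V \<and> Q V c --> res X W V r = c)"
  proof (rule sheaf_glue_described[OF ring_sheaf W])
    show "\<exists>V r. opn V \<and> x \<in> V \<and> V \<subseteq> W \<and> r \<in> funs V \<and> Q V r" if "x \<in> W" for x by (rule ex[OF that])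
    fix V V' r r' assume V: "opn V" "V \<subseteq> W" and V': "opn V'" "V' \<subseteq> W" and r: "r \<in> funs V" and r': "r' \<in> funs V'"
      and Q: "Q V r" "Q V' r'"
    have o: "opn (V \<inter> V')" using V V' by blast
    show "res X V (V \<inter> V') r = res X V' (V \<inter> V') r'"
    proof (rule sheaf_eqI[OF ring_sheaf o])
      show "res X V (V \<inter> V') r \<in> funs (V \<inter> V')" "res X V' (V \<inter> V') r' \<in> funs (V \<inter> V')"
        using res_closed[OF V(1) o _ r] res_closed[OF V'(1) o _ r'] by auto
      fix x assume "x \<in> V \<inter> V'"
      then obtain Z g where Z: "x \<in> Z" "Z \<subseteq> V \<inter> V'" "generates Z C g" by (rule line_sheaf_generator[OF C o])
      note gD = generatesD[OF Z(3)]
      have ZV: "Z \<subseteq> V" "Z \<subseteq> V'" using Z by auto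
      have "res X V Z r = res X V' Z r'"
        by (rule generates_cancel_self[OF L Z(3) res_closed[OF V(1) gD(1) ZV(1) r] res_closed[OF V'(1) gD(1) ZV(2) r']])
          (simp only: QD[OF Q(1) gD(1) ZV(1) gD(2), symmetric] QD[OF Q(2) gD(1) ZV(2) gD(2), symmetric])
      then show "\<exists>Z. opn Z \<and> x \<in> Z \<and> Z \<subseteq> V \<inter> V' \<and>
          res X (V \<inter> V') Z (res X V (V \<inter> V') r) = res X (V \<inter> V') Z (res X V' (V \<inter> V') r')"
        using gD(1) Z res_res[OF V(1) o gD(1) Z(2) _ r] res_res[OF V'(1) o gD(1) Z(2) _ r'] by auto
    qed
  qed
  then obtain r where r: "r \<in> funs W"
    and r_loc: "\<forall>V c. opn V \<and> V \<subseteq> W \<and> c \<in> funs V \<and> Q V c --> res X W V r = c" by (elim ex1E conjE)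
  have "\<phi> Z c = res X W Z r \<odot>\<^bsub>msec C Z\<^esub> c" if Z: "opn Z" "Z \<subseteq> W" and c: "c \<in> secs C Z" for Z c
  proof -
    interpret MZ: module "sec X Z" "msec C Z" by (rule modules_module[OF M Z(1)])
    note rZ = res_closed[OF W Z r]
    show ?thesis
    proof (rule modules_eqI[OF M Z(1) sheaf_hom_closed[OF \<phi> Z c] MZ.smult_closed[OF rZ c]])
      fix x assume x: "x \<in> Z"
      then have "x \<in> W" using Z by blast
      then obtain V s where V: "opn V" "x \<in> V" "V \<subseteq> W" "s \<in> funs V" "Q V s" using ex by blast
      let ?Y = "Z \<inter> V"
      have Y: "opn ?Y" "x \<in> ?Y" "?Y \<subseteq> Z" "?Y \<subseteq> V" "?Y \<subseteq> W" using V Z x by auto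
      have cY: "mres C Z ?Y c \<in> secs C ?Y" by (rule linear_presheaf_res_closed[OF L Z(1) Y(1,3) c])
      have rV: "res X W V r = s" using r_loc V by blast
      have "mres C Z ?Y (\<phi> Z c) = \<phi> ?Y (mres C Z ?Y c)" by (rule sheaf_hom_res[OF \<phi> Z(1) Y(1,3) Z(2) c, symmetric])
      also have "\<dots> = res X V ?Y s \<odot>\<^bsub>msec C ?Y\<^esub> mres C Z ?Y c" by (rule QD[OF V(5) Y(1,4) cY])
      also have "res X V ?Y s = res X Z ?Y (res X W Z r)"
        unfolding rV[symmetric] res_res[OF W V(1) Y(1,4) V(3) r] res_res[OF W Z(1) Y(1,3) Z(2) r] ..
      also have "\<dots> \<odot>\<^bsub>msec C ?Y\<^esub> mres C Z ?Y c = mres C Z ?Y (res X W Z r \<odot>\<^bsub>msec C Z\<^esub> c)"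
        by (rule linear_presheaf_res_smult[OF L Z(1) Y(1,3) rZ c, symmetric])
      finally show "\<exists>V. opn V \<and> x \<in> V \<and> V \<subseteq> Z \<and> mres C Z V (\<phi> Z c) = mres C Z V (res X W Z r \<odot>\<^bsub>msec C Z\<^esub> c)"
        using Y by blast
    qed
  qed
  then show ?thesis using r by blast
qed

text \<open>Near each point, compare the two coefficients of a generator.\<close>

lemma line_sheaf_scalar_unique:
  assumes C: "line_sheaf C" and W: "opn W" and r: "r \<in> funs W" and s: "s \<in> funs W"
    and eq: "\<And>V c. opn V ==> V \<subseteq> W ==> c \<in> secs C V ==> res X W V r \<odot>\<^bsub>msec C V\<^esub> c = res X W V s \<odot>\<^bsub>msec C V\<^esub> c"
  shows "r = s"
proof (rule sheaf_eqI[OF ring_sheaf W r s])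
  fix x assume "x \<in> W"
  then obtain Z g where Z: "x \<in> Z" "Z \<subseteq> W" "generates Z C g" by (rule line_sheaf_generator[OF C W])
  note gD = generatesD[OF Z(3)]
  have "res X W Z r = res X W Z s"
    by (rule generates_cancel_self[OF line_sheaf_linear[OF C] Z(3) res_closed[OF W gD(1) Z(2) r] res_closed[OF W gD(1) Z(2) s] eq[OF gD(1) Z(2) gD(2)]])
  then show "\<exists>V. opn V \<and> x \<in> V \<and> V \<subseteq> W \<and> res X W V r = res X W V s" using gD(1) Z by blast
qed

text \<open>Suppose \<open>B = C \<otimes> L\<close>, that \<open>A, K\<close> are \<open>B, C\<close> over \<open>U1\<close>, and that \<open>A = K\<close> and \<open>B = C\<close> over
  \<open>U2\<close>.  Over \<open>U2\<close> the pairing of \<open>C\<close> with a section \<open>l\<close> of \<open>L\<close> is an endomorphism of \<open>C\<close>, hence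
  multiplication by a function of \<open>l\<close>, and the same function makes sense on \<open>K\<close>.  Gluing this to
  the given pairing over \<open>U1\<close> gives \<open>A = K \<otimes> L\<close>.\<close>

lemma perfect_pairing_exchange:
  fixes A B C K :: "('p, 'r, 'm) modsheaf" and L :: "('p, 'r, 'l) modsheaf"
  assumes A: "line_sheaf A" and B: "line_sheaf B" and C: "line_sheaf C" and K: "line_sheaf K" and L: "line_sheaf L"
    and U: "opn U1" "opn U2" "topspace (tps X) \<subseteq> U1 \<union> U2"
    and AB: "agree_on U1 A B" and KC: "agree_on U1 K C" and AK: "agree_on U2 A K" and BC: "agree_on U2 B C"
    and \<beta>: "perfect_pairing C L B \<beta>"
  shows "\<exists>\<beta>'. perfect_pairing K L A \<beta>'"
proof -
  note MA = line_sheaf_modules[OF A] and MC = line_sheaf_modules[OF C] and MK = line_sheaf_modules[OF K]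
  note LA = line_sheaf_linear[OF A] and LB = line_sheaf_linear[OF B] and LC = line_sheaf_linear[OF C]
    and LK = line_sheaf_linear[OF K] and LL = line_sheaf_linear[OF L]
  note p = perfect_pairingD[OF \<beta>]
  have scalar: "\<exists>r. r \<in> funs W \<and> (\<forall>V c. opn V \<and> V \<subseteq> W \<and> c \<in> secs C V -->
      \<beta> V c (mres L W V l) = res X W V r \<odot>\<^bsub>msec C V\<^esub> c)"
    if W: "opn W" "W \<subseteq> U2" and l: "l \<in> secs L W" for W l
  proof -
    let ?\<phi> = "on_sections W C (\<lambda>V c. \<beta> V c (mres L W V l))"
    have "?\<phi> \<in> sheaf_hom X W C C"
    proof (rule on_sections_homI[OF LC])
      fix V c assume V: "opn V" "V \<subseteq> W" and c: "c \<in> secs C V"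
      have VU: "V \<subseteq> U2" using V W by blast
      note e = agree_onD(1)[OF BC V(1) VU]
      have lV: "mres L W V l \<in> secs L V" by (rule linear_presheaf_res_closed[OF LL W(1) V l])
      show "\<beta> V c (mres L W V l) \<in> secs C V" using p(1)[OF V(1) c lV] unfolding e .
      show "\<beta> V (c \<oplus>\<^bsub>msec C V\<^esub> d) (mres L W V l) = \<beta> V c (mres L W V l) \<oplus>\<^bsub>msec C V\<^esub> \<beta> V d (mres L W V l)"
        if "d \<in> secs C V" for d
        using p(2)[OF V(1) c that lV] unfolding e .
      show "\<beta> V (a \<odot>\<^bsub>msec C V\<^esub> c) (mres L W V l) = a \<odot>\<^bsub>msec C V\<^esub> \<beta> V c (mres L W V l)" if "a \<in> funs V" for a
        using p(4)[OF V(1) that c lV] unfolding e .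
      show "\<beta> Z (mres C V Z c) (mres L W Z l) = mres C V Z (\<beta> V c (mres L W V l))" if Z: "opn Z" "Z \<subseteq> V" for Z
        using p(6)[OF V(1) Z c lV] linear_presheaf_res_res[OF LL W(1) V(1) Z V(2) l] agree_onD(2)[OF BC V(1) Z VU] by simp
    qed
    from line_sheaf_endomorphism[OF C W(1) this] show ?thesis by (simp cong: conj_cong)
  qed
  (* The function by which a section l of L acts on C over an open subset of U2. *)
  define \<ll> where "\<ll> W l = (SOME r. r \<in> funs W \<and> (\<forall>V c. opn V \<and> V \<subseteq> W \<and> c \<in> secs C V -->
      \<beta> V c (mres L W V l) = res X W V r \<odot>\<^bsub>msec C V\<^esub> c))" for W l
  have \<ll>: "\<ll> W l \<in> funs W"
    "\<And>V c. opn V ==> V \<subseteq> W ==> c \<in> secs C V ==> \<beta> V c (mres L W V l) = res X W V (\<ll> W l) \<odot>\<^bsub>msec C V\<^esub> c"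
    if "opn W" "W \<subseteq> U2" "l \<in> secs L W" for W l
    using someI_ex[OF scalar[OF that], folded \<ll>_def] by simp_all
  have \<ll>_eqI: "\<ll> W l = r"
    if W: "opn W" "W \<subseteq> U2" and l: "l \<in> secs L W" and r: "r \<in> funs W"
      and eq: "\<And>V c. opn V ==> V \<subseteq> W ==> c \<in> secs C V ==> \<beta> V c (mres L W V l) = res X W V r \<odot>\<^bsub>msec C V\<^esub> c" for W l r
    by (rule line_sheaf_scalar_unique[OF C W(1) \<ll>(1)[OF W l] r]) (simp only: \<ll>(2)[OF W l, symmetric] eq)
  have \<ll>_self: "\<beta> W c l = \<ll> W l \<odot>\<^bsub>msec C W\<^esub> c"
    if W: "opn W" "W \<subseteq> U2" and l: "l \<in> secs L W" and c: "c \<in> secs C W" for W l c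
    using \<ll>(2)[OF W l W(1) subset_refl c] linear_presheaf_res_id[OF LL W(1) l] res_id[OF W(1) \<ll>(1)[OF W l]] by simp
  have \<ll>_res: "\<ll> V (mres L W V l) = res X W V (\<ll> W l)"
    if W: "opn W" "W \<subseteq> U2" and l: "l \<in> secs L W" and V: "opn V" "V \<subseteq> W" for W l V
  proof (rule \<ll>_eqI[OF V(1)])
    show "V \<subseteq> U2" using V W by blast
    show "mres L W V l \<in> secs L V" by (rule linear_presheaf_res_closed[OF LL W(1) V l])
    show "res X W V (\<ll> W l) \<in> funs V" by (rule res_closed[OF W(1) V \<ll>(1)[OF W l]])
    show "\<beta> Z c (mres L V Z (mres L W V l)) = res X V Z (res X W V (\<ll> W l)) \<odot>\<^bsub>msec C Z\<^esub> c"
      if Z: "opn Z" "Z \<subseteq> V" and c: "c \<in> secs C Z" for Z c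
      unfolding linear_presheaf_res_res[OF LL W(1) V(1) Z V(2) l] res_res[OF W(1) V(1) Z V(2) \<ll>(1)[OF W l]]
      by (rule \<ll>(2)[OF W l Z(1) _ c]) (use Z V in blast)
  qed
  have \<ll>_add: "\<ll> W (l \<oplus>\<^bsub>msec L W\<^esub> l') = \<ll> W l \<oplus>\<^bsub>sec X W\<^esub> \<ll> W l'"
    if W: "opn W" "W \<subseteq> U2" and l: "l \<in> secs L W" and l': "l' \<in> secs L W" for W l l'
  proof (rule \<ll>_eqI[OF W linear_presheaf_add_closed[OF LL W(1) l l']])
    interpret R: cring "sec X W" by (rule sec_cring[OF W(1)])
    show "\<ll> W l \<oplus>\<^bsub>sec X W\<^esub> \<ll> W l' \<in> funs W" using \<ll>(1)[OF W l] \<ll>(1)[OF W l'] by simp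
    fix V c assume V: "opn V" "V \<subseteq> W" and c: "c \<in> secs C V"
    have VU: "V \<subseteq> U2" using V W by blast
    interpret MV: module "sec X V" "msec C V" by (rule modules_module[OF MC V(1)])
    note r = linear_presheaf_res_closed[OF LL W(1) V l] linear_presheaf_res_closed[OF LL W(1) V l']
    have "\<beta> V c (mres L W V l \<oplus>\<^bsub>msec L V\<^esub> mres L W V l') = \<beta> V c (mres L W V l) \<oplus>\<^bsub>msec C V\<^esub> \<beta> V c (mres L W V l')"
      using p(3)[OF V(1) c r] unfolding agree_onD(1)[OF BC V(1) VU] .
    then show "\<beta> V c (mres L W V (l \<oplus>\<^bsub>msec L W\<^esub> l')) = res X W V (\<ll> W l \<oplus>\<^bsub>sec X W\<^esub> \<ll> W l') \<odot>\<^bsub>msec C V\<^esub> c"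
      unfolding linear_presheaf_res_add[OF LL W(1) V l l'] res_add[OF W(1) V \<ll>(1)[OF W l] \<ll>(1)[OF W l']]
        \<ll>(2)[OF W l V c] \<ll>(2)[OF W l' V c]
      using MV.smult_l_distr[OF res_closed[OF W(1) V \<ll>(1)[OF W l]] res_closed[OF W(1) V \<ll>(1)[OF W l']] c] by simp
  qed
  have \<ll>_smult: "\<ll> W (a \<odot>\<^bsub>msec L W\<^esub> l) = a \<otimes>\<^bsub>sec X W\<^esub> \<ll> W l"
    if W: "opn W" "W \<subseteq> U2" and l: "l \<in> secs L W" and a: "a \<in> funs W" for W l a
  proof (rule \<ll>_eqI[OF W linear_presheaf_smult_closed[OF LL W(1) a l]])
    interpret R: cring "sec X W" by (rule sec_cring[OF W(1)])
    show "a \<otimes>\<^bsub>sec X W\<^esub> \<ll> W l \<in> funs W" using \<ll>(1)[OF W l] a by simp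
    fix V c assume V: "opn V" "V \<subseteq> W" and c: "c \<in> secs C V"
    have VU: "V \<subseteq> U2" using V W by blast
    interpret MV: module "sec X V" "msec C V" by (rule modules_module[OF MC V(1)])
    note aV = res_closed[OF W(1) V a] and r = linear_presheaf_res_closed[OF LL W(1) V l]
    have "\<beta> V c (res X W V a \<odot>\<^bsub>msec L V\<^esub> mres L W V l) = res X W V a \<odot>\<^bsub>msec C V\<^esub> \<beta> V c (mres L W V l)"
      using p(5)[OF V(1) aV c r] unfolding agree_onD(1)[OF BC V(1) VU] .
    then show "\<beta> V c (mres L W V (a \<odot>\<^bsub>msec L W\<^esub> l)) = res X W V (a \<otimes>\<^bsub>sec X W\<^esub> \<ll> W l) \<odot>\<^bsub>msec C V\<^esub> c"
      unfolding linear_presheaf_res_smult[OF LL W(1) V a l] res_mult[OF W(1) V a \<ll>(1)[OF W l]] \<ll>(2)[OF W l V c]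
      using MV.smult_assoc1[OF aV res_closed[OF W(1) V \<ll>(1)[OF W l]] c] by simp
  qed
  define small where "small V \<longleftrightarrow> opn V \<and> (V \<subseteq> U1 \<or> V \<subseteq> U2)" for V
  define b where "b V k l = (if V \<subseteq> U1 then \<beta> V k l else \<ll> V l \<odot>\<^bsub>msec A V\<^esub> k)" for V k l
  have b2: "b V k l = \<ll> V l \<odot>\<^bsub>msec A V\<^esub> k"
    if V: "opn V" "V \<subseteq> U2" and k: "k \<in> secs K V" and l: "l \<in> secs L V" for V k l
  proof (cases "V \<subseteq> U1")
    case True
    have e: "msec C V = msec A V" "msec K V = msec C V"
      using agree_onD(1)[OF KC V(1) True] agree_onD(1)[OF AK V] by auto
    show ?thesis using \<ll>_self[OF V l, of k] k True unfolding b_def e by simp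
  qed (simp add: b_def)
  have b_closed: "b V k l \<in> secs A V"
    and b_add_left: "k' \<in> secs K V ==> b V (k \<oplus>\<^bsub>msec K V\<^esub> k') l = b V k l \<oplus>\<^bsub>msec A V\<^esub> b V k' l"
    and b_add_right: "l' \<in> secs L V ==> b V k (l \<oplus>\<^bsub>msec L V\<^esub> l') = b V k l \<oplus>\<^bsub>msec A V\<^esub> b V k l'"
    and b_smult_left: "a \<in> funs V ==> b V (a \<odot>\<^bsub>msec K V\<^esub> k) l = a \<odot>\<^bsub>msec A V\<^esub> b V k l"
    and b_smult_right: "a \<in> funs V ==> b V k (a \<odot>\<^bsub>msec L V\<^esub> l) = a \<odot>\<^bsub>msec A V\<^esub> b V k l"
    and b_res: "opn Z ==> Z \<subseteq> V ==> b Z (mres K V Z k) (mres L V Z l) = mres A V Z (b V k l)"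
    if sm: "small V" and k: "k \<in> secs K V" and l: "l \<in> secs L V" for V k l k' l' a Z
  proof -
    have o: "opn V" using sm unfolding small_def by simp
    have "b V k l \<in> secs A V \<and>
      (k' \<in> secs K V --> b V (k \<oplus>\<^bsub>msec K V\<^esub> k') l = b V k l \<oplus>\<^bsub>msec A V\<^esub> b V k' l) \<and>
      (l' \<in> secs L V --> b V k (l \<oplus>\<^bsub>msec L V\<^esub> l') = b V k l \<oplus>\<^bsub>msec A V\<^esub> b V k l') \<and>
      (a \<in> funs V --> b V (a \<odot>\<^bsub>msec K V\<^esub> k) l = a \<odot>\<^bsub>msec A V\<^esub> b V k l) \<and>
      (a \<in> funs V --> b V k (a \<odot>\<^bsub>msec L V\<^esub> l) = a \<odot>\<^bsub>msec A V\<^esub> b V k l) \<and>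
      (opn Z \<and> Z \<subseteq> V --> b Z (mres K V Z k) (mres L V Z l) = mres A V Z (b V k l))"
    proof (cases "V \<subseteq> U1")
      case True
      note eA = agree_onD(1)[OF AB o True] and eK = agree_onD(1)[OF KC o True]
      have b: "b V k l = \<beta> V k l" for k l using True by (simp add: b_def)
      note k' = k[unfolded eK]
      have "b Z (mres K V Z k) (mres L V Z l) = mres A V Z (\<beta> V k l)" if Z: "opn Z" "Z \<subseteq> V"
      proof -
        have ZU: "Z \<subseteq> U1" using Z True by blast
        show ?thesis
          using p(6)[OF o Z k' l] agree_onD(2)[OF KC o Z True] agree_onD(2)[OF AB o Z True] ZU by (simp add: b_def)
      qed
      then show ?thesis
        unfolding b eA eK using p(1)[OF o k' l] p(2)[OF o k' _ l] p(3)[OF o k' l] p(4)[OF o _ k' l] p(5)[OF o _ k' l] by blast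
    next
      case False
      then have U2: "V \<subseteq> U2" using sm unfolding small_def by blast
      note eA = agree_onD(1)[OF AK o U2]
      interpret MV: module "sec X V" "msec K V" by (rule modules_module[OF MK o])
      have b: "b V k l = \<ll> V l \<odot>\<^bsub>msec K V\<^esub> k" for k l using False by (simp add: b_def eA)
      note c = \<ll>(1)[OF o U2]
      have comm: "\<ll> V l \<odot>\<^bsub>msec K V\<^esub> (a \<odot>\<^bsub>msec K V\<^esub> k) = a \<odot>\<^bsub>msec K V\<^esub> (\<ll> V l \<odot>\<^bsub>msec K V\<^esub> k)" if "a \<in> funs V"
        using that c[OF l] k by (simp add: MV.smult_assoc1[symmetric] MV.R.m_comm)
      have "b Z (mres K V Z k) (mres L V Z l) = mres A V Z (\<ll> V l \<odot>\<^bsub>msec K V\<^esub> k)" if Z: "opn Z" "Z \<subseteq> V"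
      proof -
        have ZU: "Z \<subseteq> U2" using Z U2 by blast
        have "b Z (mres K V Z k) (mres L V Z l) = \<ll> Z (mres L V Z l) \<odot>\<^bsub>msec A Z\<^esub> mres K V Z k"
          by (rule b2[OF Z(1) ZU linear_presheaf_res_closed[OF LK o Z k] linear_presheaf_res_closed[OF LL o Z l]])
        also have "\<dots> = res X V Z (\<ll> V l) \<odot>\<^bsub>msec K Z\<^esub> mres K V Z k"
          unfolding \<ll>_res[OF o U2 l Z] agree_onD(1)[OF AK Z(1) ZU] ..
        also have "\<dots> = mres K V Z (\<ll> V l \<odot>\<^bsub>msec K V\<^esub> k)" by (rule linear_presheaf_res_smult[OF LK o Z c[OF l] k, symmetric])
        finally show ?thesis unfolding agree_onD(2)[OF AK o Z U2] .
      qed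
      then show ?thesis
        unfolding b eA
        using MV.smult_closed[OF c[OF l] k] MV.smult_r_distr[OF c[OF l] k] comm
          \<ll>_add[OF o U2 l] MV.smult_l_distr[OF c[OF l] c _] k \<ll>_smult[OF o U2 l] MV.smult_assoc1[OF _ c[OF l] k]
        by simp
    qed
    then show "b V k l \<in> secs A V"
      "k' \<in> secs K V ==> b V (k \<oplus>\<^bsub>msec K V\<^esub> k') l = b V k l \<oplus>\<^bsub>msec A V\<^esub> b V k' l"
      "l' \<in> secs L V ==> b V k (l \<oplus>\<^bsub>msec L V\<^esub> l') = b V k l \<oplus>\<^bsub>msec A V\<^esub> b V k l'"
      "a \<in> funs V ==> b V (a \<odot>\<^bsub>msec K V\<^esub> k) l = a \<odot>\<^bsub>msec A V\<^esub> b V k l"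
      "a \<in> funs V ==> b V k (a \<odot>\<^bsub>msec L V\<^esub> l) = a \<odot>\<^bsub>msec A V\<^esub> b V k l"
      "opn Z ==> Z \<subseteq> V ==> b Z (mres K V Z k) (mres L V Z l) = mres A V Z (b V k l)" by simp_all
  qed
  have cover: "\<exists>V. small V \<and> x \<in> V \<and> V \<subseteq> W" if W: "opn W" and x: "x \<in> W" for W x
  proof -
    have "x \<in> U1 \<or> x \<in> U2" using U(3) opn_topspace[OF W] x by blast
    then show ?thesis
    proof
      assume "x \<in> U1"
      then show ?thesis unfolding small_def using W U(1) x by (intro exI[of _ "W \<inter> U1"]) auto
    next
      assume "x \<in> U2"
      then show ?thesis unfolding small_def using W U(2) x by (intro exI[of _ "W \<inter> U2"]) auto
    qed
  qed
  have small_opn: "opn V" if "small V" for V using that unfolding small_def by simp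
  have small_sub: "small Z" if "small V" "opn Z" "Z \<subseteq> V" for V Z using that unfolding small_def by blast
  have ex: "\<exists>a. a \<in> secs A W \<and> (\<forall>V. small V \<and> V \<subseteq> W --> mres A W V a = b V (mres K W V k) (mres L W V l))"
    if W: "opn W" and k: "k \<in> secs K W" and l: "l \<in> secs L W" for W k l
  proof -
    have r: "mres K W V k \<in> secs K V" "mres L W V l \<in> secs L V" if "opn V" "V \<subseteq> W" for V
      by (rule linear_presheaf_res_closed[OF LK W that k], rule linear_presheaf_res_closed[OF LL W that l])
    have "\<exists>!a. a \<in> secs A W \<and> (\<forall>V c. opn V \<and> V \<subseteq> W \<and> c \<in> secs A V \<and>
        (small V \<and> c = b V (mres K W V k) (mres L W V l)) --> mres A W V a = c)"
    proof (rule sheaf_glue_described[OF modules_sheaf[OF MA] W])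
      fix x assume "x \<in> W"
      then obtain V where V: "small V" "x \<in> V" "V \<subseteq> W" using cover[OF W] by blast
      note o = small_opn[OF V(1)]
      show "\<exists>V c. opn V \<and> x \<in> V \<and> V \<subseteq> W \<and> c \<in> secs A V \<and> (small V \<and> c = b V (mres K W V k) (mres L W V l))"
        using o V b_closed[OF V(1) r(1)[OF o V(3)] r(2)[OF o V(3)]] by blast
    next
      fix V V' c d assume V: "opn V" "V \<subseteq> W" and V': "opn V'" "V' \<subseteq> W"
        and c: "small V \<and> c = b V (mres K W V k) (mres L W V l)" and d: "small V' \<and> d = b V' (mres K W V' k) (mres L W V' l)"
      let ?Z = "V \<inter> V'"
      have Z: "opn ?Z" "?Z \<subseteq> V" "?Z \<subseteq> V'" using V V' by auto
      have "mres A V ?Z c = b ?Z (mres K W ?Z k) (mres L W ?Z l)"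
        using b_res[OF conjunct1[OF c] r(1)[OF V] r(2)[OF V] Z(1,2)] c
          linear_presheaf_res_res[OF LK W V(1) Z(1,2) V(2) k] linear_presheaf_res_res[OF LL W V(1) Z(1,2) V(2) l] by simp
      moreover have "mres A V' ?Z d = b ?Z (mres K W ?Z k) (mres L W ?Z l)"
        using b_res[OF conjunct1[OF d] r(1)[OF V'] r(2)[OF V'] Z(1,3)] d
          linear_presheaf_res_res[OF LK W V'(1) Z(1,3) V'(2) k] linear_presheaf_res_res[OF LL W V'(1) Z(1,3) V'(2) l] by simp
      ultimately show "mres A V ?Z c = mres A V' ?Z d" by simp
    qed
    then obtain a where a: "a \<in> secs A W"
      and a_loc: "\<forall>V c. opn V \<and> V \<subseteq> W \<and> c \<in> secs A V \<and> (small V \<and> c = b V (mres K W V k) (mres L W V l)) --> mres A W V a = c"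
      by (elim ex1E conjE)
    have "mres A W V a = b V (mres K W V k) (mres L W V l)" if V: "small V" "V \<subseteq> W" for V
      using a_loc small_opn[OF V(1)] V b_closed[OF V(1) r(1)[OF small_opn[OF V(1)] V(2)] r(2)[OF small_opn[OF V(1)] V(2)]] by blast
    with a show ?thesis by blast
  qed
  define \<beta>' where "\<beta>' W k l = (SOME a. a \<in> secs A W \<and>
      (\<forall>V. small V \<and> V \<subseteq> W --> mres A W V a = b V (mres K W V k) (mres L W V l)))" for W k l
  have \<beta>': "\<beta>' W k l \<in> secs A W"
    "\<And>V. small V ==> V \<subseteq> W ==> mres A W V (\<beta>' W k l) = b V (mres K W V k) (mres L W V l)"
    if "opn W" "k \<in> secs K W" "l \<in> secs L W" for W k l
    using someI_ex[OF ex[OF that], folded \<beta>'_def] by simp_all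
  have eqI: "\<beta>' W k l = a"
    if W: "opn W" and k: "k \<in> secs K W" and l: "l \<in> secs L W" and a: "a \<in> secs A W"
      and eq: "\<And>V. small V ==> opn V ==> V \<subseteq> W ==> mres A W V a = b V (mres K W V k) (mres L W V l)" for W k l a
  proof (rule modules_eqI[OF MA W \<beta>'(1)[OF W k l] a])
    fix x assume "x \<in> W"
    then obtain V where V: "small V" "x \<in> V" "V \<subseteq> W" using cover[OF W] by blast
    then show "\<exists>V. opn V \<and> x \<in> V \<and> V \<subseteq> W \<and> mres A W V (\<beta>' W k l) = mres A W V a"
      using \<beta>'(2)[OF W k l V(1,3)] eq[OF V(1) small_opn[OF V(1)] V(3)] small_opn[OF V(1)] by auto
  qed
  have \<beta>'_small: "\<beta>' W k l = b W k l" if sm: "small W" and k: "k \<in> secs K W" and l: "l \<in> secs L W" for W k l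
    by (rule eqI[OF small_opn[OF sm] k l b_closed[OF sm k l]]) (rule b_res[OF sm k l, symmetric])
  have "perfect_pairing K L A \<beta>'"
  proof (rule perfect_pairingI)
    fix W k l assume W: "opn W" and k: "k \<in> secs K W" and l: "l \<in> secs L W"
    interpret MW: module "sec X W" "msec A W" by (rule modules_module[OF MA W])
    note rK = linear_presheaf_res_closed[OF LK W] and rL = linear_presheaf_res_closed[OF LL W]
    note c = \<beta>'(1)[OF W k l]
    show "\<beta>' W k l \<in> secs A W" by (rule c)
    show "\<beta>' W (k \<oplus>\<^bsub>msec K W\<^esub> k') l = \<beta>' W k l \<oplus>\<^bsub>msec A W\<^esub> \<beta>' W k' l" if k': "k' \<in> secs K W" for k'
    proof (rule eqI[OF W linear_presheaf_add_closed[OF LK W k k'] l MW.M.a_closed[OF c \<beta>'(1)[OF W k' l]]])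
      fix V assume V: "small V" "opn V" "V \<subseteq> W"
      show "mres A W V (\<beta>' W k l \<oplus>\<^bsub>msec A W\<^esub> \<beta>' W k' l) = b V (mres K W V (k \<oplus>\<^bsub>msec K W\<^esub> k')) (mres L W V l)"
        unfolding linear_presheaf_res_add[OF LA W V(2,3) c \<beta>'(1)[OF W k' l]] linear_presheaf_res_add[OF LK W V(2,3) k k']
          \<beta>'(2)[OF W k l V(1,3)] \<beta>'(2)[OF W k' l V(1,3)] b_add_left[OF V(1) rK[OF V(2,3) k] rL[OF V(2,3) l] rK[OF V(2,3) k']] ..
    qed
    show "\<beta>' W k (l \<oplus>\<^bsub>msec L W\<^esub> l') = \<beta>' W k l \<oplus>\<^bsub>msec A W\<^esub> \<beta>' W k l'" if l': "l' \<in> secs L W" for l'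
    proof (rule eqI[OF W k linear_presheaf_add_closed[OF LL W l l'] MW.M.a_closed[OF c \<beta>'(1)[OF W k l']]])
      fix V assume V: "small V" "opn V" "V \<subseteq> W"
      show "mres A W V (\<beta>' W k l \<oplus>\<^bsub>msec A W\<^esub> \<beta>' W k l') = b V (mres K W V k) (mres L W V (l \<oplus>\<^bsub>msec L W\<^esub> l'))"
        unfolding linear_presheaf_res_add[OF LA W V(2,3) c \<beta>'(1)[OF W k l']] linear_presheaf_res_add[OF LL W V(2,3) l l']
          \<beta>'(2)[OF W k l V(1,3)] \<beta>'(2)[OF W k l' V(1,3)] b_add_right[OF V(1) rK[OF V(2,3) k] rL[OF V(2,3) l] rL[OF V(2,3) l']] ..
    qed
    show "\<beta>' W (a \<odot>\<^bsub>msec K W\<^esub> k) l = a \<odot>\<^bsub>msec A W\<^esub> \<beta>' W k l" if a: "a \<in> funs W" for a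
    proof (rule eqI[OF W linear_presheaf_smult_closed[OF LK W a k] l MW.smult_closed[OF a c]])
      fix V assume V: "small V" "opn V" "V \<subseteq> W"
      show "mres A W V (a \<odot>\<^bsub>msec A W\<^esub> \<beta>' W k l) = b V (mres K W V (a \<odot>\<^bsub>msec K W\<^esub> k)) (mres L W V l)"
        unfolding linear_presheaf_res_smult[OF LA W V(2,3) a c] linear_presheaf_res_smult[OF LK W V(2,3) a k]
          \<beta>'(2)[OF W k l V(1,3)] b_smult_left[OF V(1) rK[OF V(2,3) k] rL[OF V(2,3) l] res_closed[OF W V(2,3) a]] ..
    qed
    show "\<beta>' W k (a \<odot>\<^bsub>msec L W\<^esub> l) = a \<odot>\<^bsub>msec A W\<^esub> \<beta>' W k l" if a: "a \<in> funs W" for a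
    proof (rule eqI[OF W k linear_presheaf_smult_closed[OF LL W a l] MW.smult_closed[OF a c]])
      fix V assume V: "small V" "opn V" "V \<subseteq> W"
      show "mres A W V (a \<odot>\<^bsub>msec A W\<^esub> \<beta>' W k l) = b V (mres K W V k) (mres L W V (a \<odot>\<^bsub>msec L W\<^esub> l))"
        unfolding linear_presheaf_res_smult[OF LA W V(2,3) a c] linear_presheaf_res_smult[OF LL W V(2,3) a l]
          \<beta>'(2)[OF W k l V(1,3)] b_smult_right[OF V(1) rK[OF V(2,3) k] rL[OF V(2,3) l] res_closed[OF W V(2,3) a]] ..
    qed
    show "\<beta>' V (mres K W V k) (mres L W V l) = mres A W V (\<beta>' W k l)" if V: "opn V" "V \<subseteq> W" for V
    proof (rule eqI[OF V(1) rK[OF V k] rL[OF V l] linear_presheaf_res_closed[OF LA W V c]])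
      fix Z assume Z: "small Z" "opn Z" "Z \<subseteq> V"
      have ZW: "Z \<subseteq> W" using Z V by blast
      show "mres A V Z (mres A W V (\<beta>' W k l)) = b Z (mres K V Z (mres K W V k)) (mres L V Z (mres L W V l))"
        unfolding linear_presheaf_res_res[OF LA W V(1) Z(2,3) V(2) c] linear_presheaf_res_res[OF LK W V(1) Z(2,3) V(2) k]
          linear_presheaf_res_res[OF LL W V(1) Z(2,3) V(2) l] by (rule \<beta>'(2)[OF W k l Z(1) ZW])
    qed
  next
    fix q assume q: "q \<in> topspace (tps X)"
    obtain W x y where W: "q \<in> W" and gx: "generates W C x" and gy: "generates W L y" and gb: "generates W B (\<beta> W x y)"
      using p(7)[OF q] by blast
    note o = generatesD(1)[OF gx] and cx = generatesD(2)[OF gx] and cy = generatesD(2)[OF gy]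
    show "\<exists>W k l. q \<in> W \<and> generates W K k \<and> generates W L l \<and> generates W A (\<beta>' W k l)"
    proof (cases "q \<in> U1")
      case True
      let ?V = "W \<inter> U1"
      let ?x = "mres C W ?V x" and ?y = "mres L W ?V y"
      have V: "opn ?V" "?V \<subseteq> W" "?V \<subseteq> U1" using o U by auto
      have sm: "small ?V" unfolding small_def using V by blast
      have gx': "generates ?V K ?x" by (rule generates_agree[OF agree_on_sym[OF KC] V(3) generates_res[OF LC gx V(1,2)]])
      have gy': "generates ?V L ?y" by (rule generates_res[OF LL gy V(1,2)])
      have "\<beta>' ?V ?x ?y = mres B W ?V (\<beta> W x y)"
        using \<beta>'_small[OF sm generatesD(2)[OF gx'] generatesD(2)[OF gy']] p(6)[OF o V(1,2) cx cy] V(3) by (simp add: b_def)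
      then have "generates ?V A (\<beta>' ?V ?x ?y)"
        using generates_agree[OF agree_on_sym[OF AB] V(3) generates_res[OF LB gb V(1,2)]] by simp
      then show ?thesis using gx' gy' W True by (intro exI[of _ ?V] exI[of _ ?x] exI[of _ ?y]) simp
    next
      case False
      then have q2: "q \<in> U2" using U(3) q by blast
      let ?V = "W \<inter> U2"
      let ?x = "mres C W ?V x" and ?y = "mres L W ?V y"
      have V: "opn ?V" "?V \<subseteq> W" "?V \<subseteq> U2" "q \<in> ?V" using o U W q2 by auto
      have gx': "generates ?V C ?x" by (rule generates_res[OF LC gx V(1,2)])
      have gy': "generates ?V L ?y" by (rule generates_res[OF LL gy V(1,2)])
      note cy' = generatesD(2)[OF gy']
      note r = \<ll>(1)[OF V(1,3) cy']
      (* The pairing is perfect, so that a generator of L acts on C by an invertible function. *)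
      have "generates ?V C (\<ll> ?V ?y \<odot>\<^bsub>msec C ?V\<^esub> ?x)"
        unfolding \<ll>_self[OF V(1,3) cy' generatesD(2)[OF gx'], symmetric] p(6)[OF o V(1,2) cx cy]
        by (rule generates_agree[OF BC V(3) generates_res[OF LB gb V(1,2)]])
      then obtain s where s: "s \<in> funs ?V" "s \<otimes>\<^bsub>sec X ?V\<^esub> \<ll> ?V ?y = \<one>\<^bsub>sec X ?V\<^esub>"
        by (rule generates_coeff_unit[OF MC gx' r])
      obtain Z k where Z: "q \<in> Z" "Z \<subseteq> ?V" "generates Z K k" by (rule line_sheaf_generator[OF K V(1,4)])
      note oZ = generatesD(1)[OF Z(3)] and ck = generatesD(2)[OF Z(3)]
      have ZU: "Z \<subseteq> U2" using Z by blast
      have sm: "small Z" unfolding small_def using oZ ZU by blast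
      let ?l = "mres L ?V Z ?y"
      have gl: "generates Z L ?l" by (rule generates_res[OF LL gy' oZ Z(2)])
      note cl = generatesD(2)[OF gl]
      have "\<beta>' Z k ?l = \<ll> Z ?l \<odot>\<^bsub>msec K Z\<^esub> k"
        unfolding \<beta>'_small[OF sm ck cl] b2[OF oZ ZU ck cl] agree_onD(1)[OF AK oZ ZU] ..
      moreover have "generates Z K (\<ll> Z ?l \<odot>\<^bsub>msec K Z\<^esub> k)"
      proof (rule generates_unit_multiple[OF MK Z(3) \<ll>(1)[OF oZ ZU cl] res_closed[OF V(1) oZ Z(2) s(1)]])
        show "res X ?V Z s \<otimes>\<^bsub>sec X Z\<^esub> \<ll> Z ?l = \<one>\<^bsub>sec X Z\<^esub>"
          unfolding \<ll>_res[OF V(1,3) cy' oZ Z(2)] res_mult[OF V(1) oZ Z(2) s(1) r, symmetric] s(2) by (rule res_one[OF V(1) oZ Z(2)])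
      qed
      ultimately have "generates Z A (\<beta>' Z k ?l)"
        using generates_agree[OF agree_on_sym[OF AK] ZU] by simp
      then show ?thesis using Z gl by blast
    qed
  qed
  then show ?thesis by blast
qed

text \<open>The exchange is carried out for the models of the determinants, where local equality of bundles
  is inherited literally, and is then transported along the isomorphisms with the determinants.\<close>

lemma det_twist_exchange:
  fixes A B C K :: "('p, 'r, 'm) modsheaf" and L :: "('p, 'r, 'l) modsheaf"
  assumes vb: "vector_bundle X n A" "vector_bundle X n B" "vector_bundle X n C" "vector_bundle X n K" and L: "line_sheaf L"
    and U: "opn U1" "opn U2" "topspace (tps X) \<subseteq> U1 \<union> U2"
    and ag: "agree_on U1 A B" "agree_on U1 K C" "agree_on U2 A K" "agree_on U2 B C"
    and iso: "isomorphic X (det_sheaf X n B) (tensor_sheaf X (det_sheaf X n C) L)"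
  shows "isomorphic X (det_sheaf X n A) (tensor_sheaf X (det_sheaf X n K) L)"
proof -
  have lin: "linear_presheaf X E" if "vector_bundle X n E" for E :: "('p, 'r, 'm) modsheaf"
    by (rule modules_linear_presheaf) (use that in \<open>simp add: vector_bundle_def\<close>)
  note model = det_model_line_sheaf and det = det_sheaf_line_sheaf
  have to: "isomorphic X (det_model n E) (det_sheaf X n E)" if "vector_bundle X n E" for E :: "('p, 'r, 'm) modsheaf"
    by (rule det_model_isomorphic[OF lin[OF that]])
  have from_: "isomorphic X (det_sheaf X n E) (det_model n E)" if "vector_bundle X n E" for E :: "('p, 'r, 'm) modsheaf"
    by (rule isomorphic_on_sym[OF line_sheaf_linear[OF model[OF that]] to[OF that]])
  obtain \<beta>1 where "perfect_pairing (det_sheaf X n C) L (det_sheaf X n B) \<beta>1"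
    using isomorphic_tensor_imp_pairing[OF det[OF vb(2)] det[OF vb(3)] L iso] by blast
  from perfect_pairing_transport[OF this line_sheaf_linear[OF model[OF vb(3)]] line_sheaf_linear[OF det[OF vb(2)]] to[OF vb(3)] from_[OF vb(2)]]
  obtain \<beta>2 where "perfect_pairing (det_model n C) L (det_model n B) \<beta>2" by blast
  from perfect_pairing_exchange[OF model[OF vb(1)] model[OF vb(2)] model[OF vb(3)] model[OF vb(4)] L U
      det_model_agree[OF ag(1)] det_model_agree[OF ag(2)] det_model_agree[OF ag(3)] det_model_agree[OF ag(4)] this]
  obtain \<beta>3 where "perfect_pairing (det_model n K) L (det_model n A) \<beta>3" by blast
  from perfect_pairing_transport[OF this line_sheaf_linear[OF det[OF vb(4)]] line_sheaf_linear[OF model[OF vb(1)]] from_[OF vb(4)] to[OF vb(1)]]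
  obtain \<beta>4 where "perfect_pairing (det_sheaf X n K) L (det_sheaf X n A) \<beta>4" by blast
  from pairing_imp_isomorphic_tensor[OF line_sheaf_modules[OF det[OF vb(1)]] line_sheaf_modules[OF det[OF vb(4)]] line_sheaf_modules[OF L] this]
  show ?thesis .
qed

end

lemma submodule_closed:
  assumes "submodule H R M"
  shows submodule_subset: "H \<subseteq> carrier M" and submodule_zero: "\<zero>\<^bsub>M\<^esub> \<in> H"
    and submodule_add: "\<And>x y. x \<in> H ==> y \<in> H ==> x \<oplus>\<^bsub>M\<^esub> y \<in> H"
  using subgroup.subset[OF submodule.axioms(1)[OF assms]] subgroup.one_closed[OF submodule.axioms(1)[OF assms]]
    subgroup.m_closed[OF submodule.axioms(1)[OF assms]] by simp_all

context sheaf_ringed_space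
begin

section \<open>Elementary transforms\<close>

lemma subobj_simps [simp]:
  "secs (subobj E S) U = S U"
  "add (msec (subobj E S) U) = add (msec E U)"
  "smult (msec (subobj E S) U) = smult (msec E U)"
  "ring.zero (msec (subobj E S) U) = ring.zero (msec E U)"
  "mres (subobj E S) = mres E"
  by (simp_all add: subobj_def)

text \<open>The support is defined by the failure of an open condition: \<open>1\<close> belongs to the ideal near the
  point.\<close>

lemma opn_off_divisor: "opn (topspace (tps X) - divisor_support X D)"
proof -
  have "topspace (tps X) - divisor_support X D = \<Union>{U. opn U \<and> \<one>\<^bsub>sec X U\<^esub> \<in> D U}"
    unfolding divisor_support_def using opn_topspace by auto
  moreover have "opn (\<Union>{U. opn U \<and> \<one>\<^bsub>sec X U\<^esub> \<in> D U})" by (rule openin_Union) simp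
  ultimately show ?thesis by simp
qed

lemma zero_off_support:
  assumes Q: "sheaf_of_modules X Q" and W: "opn W" "W \<inter> sheaf_support X Q = {}"
    and s: "s \<in> secs Q W"
  shows "s = \<zero>\<^bsub>msec Q W\<^esub>"
proof (rule modules_eqI[OF Q W(1) s])
  interpret M: module "sec X W" "msec Q W" by (rule modules_module[OF Q W(1)])
  show z: "\<zero>\<^bsub>msec Q W\<^esub> \<in> secs Q W" by simp
  fix x assume x: "x \<in> W"
  have g: "mgerm X Q x W s = mgerm X Q x W \<zero>\<^bsub>msec Q W\<^esub>"
    using W x s opn_topspace[OF W(1)] unfolding sheaf_support_def by blast
  have "(W, \<zero>\<^bsub>msec Q W\<^esub>) \<in> mgerm X Q x W \<zero>\<^bsub>msec Q W\<^esub>"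
    unfolding mgerm_def germ_of_def using W(1) x z by auto
  then have "(W, \<zero>\<^bsub>msec Q W\<^esub>) \<in> mgerm X Q x W s" by (simp only: g)
  then show "\<exists>V. opn V \<and> x \<in> V \<and> V \<subseteq> W \<and> mres Q W V s = mres Q W V \<zero>\<^bsub>msec Q W\<^esub>"
    unfolding mgerm_def germ_of_def by auto
qed

lemma subsheaf_modules:
  assumes E: "sheaf_of_modules X E" and S: "subsheaf X E S"
  shows "sheaf_of_modules X (subobj E S)"
proof -
  have sub: "submodule (S U) (sec X U) (msec E U)" if "opn U" for U
    using S that unfolding subsheaf_def by simp
  have cl: "s \<in> secs E U" if "opn U" "s \<in> S U" for U s
    using submodule_subset[OF sub[OF that(1)]] that(2) by blast
  have m: "module (sec X U) (msec (subobj E S) U)" if "opn U" for U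
    unfolding subobj_def by (simp add: submodule.submodule_is_module[OF sub[OF that] modules_module[OF E that]])
  have sh: "is_sheaf (tps X) (\<lambda>U. secs (subobj E S) U) (mres (subobj E S))"
    using S unfolding subsheaf_def by simp
  show ?thesis unfolding sheaf_of_modules_def
    using sh m sheaf_lin(4,5)[OF E] cl by simp
qed

lemma kernel_sheaf_mem:
  "s \<in> kernel_sheaf X E Q \<phi> U \<longleftrightarrow> opn U \<and> s \<in> secs E U \<and> \<phi> U s = \<zero>\<^bsub>msec Q U\<^esub>"
  unfolding kernel_sheaf_def opens_only_def by auto

lemma induced_apply: "opn U ==> s \<in> S U ==> induced X S \<phi> U s = \<phi> U s"
  unfolding induced_def by (simp add: opn_topspace)

text \<open>A section glued from sections of the kernel lies in the kernel, because the target is separated.\<close>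

lemma kernel_subsheaf:
  assumes E: "sheaf_of_modules X E" and S: "subsheaf X E S" and Q: "sheaf_of_modules X Q"
    and \<phi>: "\<phi> \<in> homs X (subobj E S) Q"
  shows "subsheaf X E (kernel_sheaf X (subobj E S) Q \<phi>)" (is "subsheaf X E ?K")
proof -
  note M = subsheaf_modules[OF E S]
  note ot = opn_topspace
  have sh: "is_sheaf (tps X) S (mres E)" using S unfolding subsheaf_def by simp
  note pre = sheaf_presheaf[OF sh]
  have KS: "?K U \<subseteq> S U" for U by (auto simp: kernel_sheaf_mem)
  have resK: "mres E U V s \<in> ?K V" if "opn U" "opn V" "V \<subseteq> U" "s \<in> ?K U" for U V s
    using that sheaf_hom_res[OF \<phi> that(1-3) ot[OF that(1)], of s] modules_res_zero[OF Q that(1-3)]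
      presheaf_res_closed[OF pre that(1-3), of s]
    by (simp add: kernel_sheaf_mem)
  have sub: "submodule (?K U) (sec X U) (msec E U)" if U: "opn U" for U
  proof -
    interpret Q: module "sec X U" "msec Q U" by (rule modules_module[OF Q U])
    interpret E: module "sec X U" "msec E U" by (rule modules_module[OF E U])
    have sS: "submodule (S U) (sec X U) (msec E U)" using S U unfolding subsheaf_def by simp
    note add = sheaf_hom_add[OF \<phi> U ot[OF U]] and sm = sheaf_hom_smult[OF \<phi> U ot[OF U]]
    have SE: "S U \<subseteq> secs E U" by (rule submodule_subset[OF sS])
    have z: "\<zero>\<^bsub>msec E U\<^esub> \<in> ?K U"
      using sheaf_hom_zero[OF M Q \<phi> U ot[OF U]] submodule_zero[OF sS] U by (simp add: kernel_sheaf_mem)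
    show ?thesis
    proof (rule E.submoduleI)
      show "?K U \<subseteq> secs E U" using KS SE by blast
      show "\<zero>\<^bsub>msec E U\<^esub> \<in> ?K U" by (rule z)
      show sc: "a \<odot>\<^bsub>msec E U\<^esub> s \<in> ?K U" if "a \<in> funs U" "s \<in> ?K U" for a s
        using that sm[of a s] submodule.smult_closed[OF sS that(1), of s] U by (simp add: kernel_sheaf_mem)
      show "s \<oplus>\<^bsub>msec E U\<^esub> t \<in> ?K U" if "s \<in> ?K U" "t \<in> ?K U" for s t
        using that add[of s t] submodule_add[OF sS, of s t] U by (simp add: kernel_sheaf_mem)
      show "\<ominus>\<^bsub>msec E U\<^esub> s \<in> ?K U" if s: "s \<in> ?K U" for s
      proof -
        have sE: "s \<in> secs E U" using KS SE s by blast
        have "\<ominus>\<^bsub>msec E U\<^esub> s = (\<ominus>\<^bsub>sec X U\<^esub> \<one>\<^bsub>sec X U\<^esub>) \<odot>\<^bsub>msec E U\<^esub> s"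
          using E.smult_l_minus[of "\<one>\<^bsub>sec X U\<^esub>" s] sE by simp
        then show ?thesis using sc[of "\<ominus>\<^bsub>sec X U\<^esub> \<one>\<^bsub>sec X U\<^esub>" s] s by simp
      qed
    qed
  qed
  have "is_sheaf (tps X) ?K (mres E)"
    unfolding is_sheaf_def
  proof (intro conjI allI impI ballI)
    show "is_presheaf (tps X) ?K (mres E)"
      unfolding is_presheaf_def
    proof (intro conjI allI impI ballI funcsetI; (elim conjE)?)
      show "mres E U V s \<in> ?K V" if "opn U" "opn V" "V \<subseteq> U" "s \<in> ?K U" for U V s
        using that by (rule resK)
      show "mres E U U s = s" if "opn U" "s \<in> ?K U" for U s
        by (rule presheaf_res_id[OF pre that(1)]) (use that KS in blast)
      show "mres E V W (mres E U V s) = mres E U W s"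
        if "s \<in> ?K U" "opn U" "opn V" "opn W" "W \<subseteq> V" "V \<subseteq> U" for U V W s
        by (rule presheaf_res_res[OF pre that(2-6)]) (use that KS in blast)
    qed
  next
    fix \<U> s t assume o: "\<forall>V\<in>\<U>. opn V" and st: "s \<in> ?K (\<Union>\<U>)" "t \<in> ?K (\<Union>\<U>)"
      and eq: "\<forall>V\<in>\<U>. mres E (\<Union>\<U>) V s = mres E (\<Union>\<U>) V t"
    have oU: "opn (\<Union>\<U>)" using o by blast
    show "s = t"
    proof (rule sheaf_eqI[OF sh oU])
      show "s \<in> S (\<Union>\<U>)" "t \<in> S (\<Union>\<U>)" using st KS by auto
      fix x assume "x \<in> \<Union>\<U>"
      then obtain V where "V \<in> \<U>" "x \<in> V" by blast
      then show "\<exists>V. opn V \<and> x \<in> V \<and> V \<subseteq> \<Union>\<U> \<and> mres E (\<Union>\<U>) V s = mres E (\<Union>\<U>) V t"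
        using o eq by blast
    qed
  next
    fix \<U> f assume o: "\<forall>V\<in>\<U>. opn V"
      and f: "(\<forall>V\<in>\<U>. f V \<in> ?K V) \<and> (\<forall>V\<in>\<U>. \<forall>W\<in>\<U>. mres E V (V \<inter> W) (f V) = mres E W (V \<inter> W) (f W))"
    have oU: "opn (\<Union>\<U>)" using o by blast
    have fS: "\<forall>V\<in>\<U>. f V \<in> S V" using f KS by blast
    have "\<exists>s\<in>S (\<Union>\<U>). \<forall>V\<in>\<U>. mres E (\<Union>\<U>) V s = f V"
      using sh[unfolded is_sheaf_def, THEN conjunct2, THEN spec, THEN mp, OF o, THEN conjunct2, THEN spec, THEN mp, OF conjI,
        OF fS conjunct2[OF f]] .
    then obtain s where s: "s \<in> S (\<Union>\<U>)" "\<And>V. V \<in> \<U> ==> mres E (\<Union>\<U>) V s = f V" by blast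
    have "\<phi> (\<Union>\<U>) s = \<zero>\<^bsub>msec Q (\<Union>\<U>)\<^esub>"
    proof (rule modules_eqI[OF Q oU])
      interpret Q: module "sec X (\<Union>\<U>)" "msec Q (\<Union>\<U>)" by (rule modules_module[OF Q oU])
      show "\<phi> (\<Union>\<U>) s \<in> secs Q (\<Union>\<U>)" using sheaf_hom_closed[OF \<phi> oU ot[OF oU]] s(1) by simp
      show "\<zero>\<^bsub>msec Q (\<Union>\<U>)\<^esub> \<in> secs Q (\<Union>\<U>)" by simp
      fix x assume "x \<in> \<Union>\<U>"
      then obtain V where V: "V \<in> \<U>" "x \<in> V" by blast
      then have oV: "opn V" "V \<subseteq> \<Union>\<U>" using o by auto
      have "mres Q (\<Union>\<U>) V (\<phi> (\<Union>\<U>) s) = \<phi> V (f V)"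
        using sheaf_hom_res[OF \<phi> oU oV ot[OF oU], of s] s V by simp
      also have "\<dots> = \<zero>\<^bsub>msec Q V\<^esub>" using f V(1) by (simp add: kernel_sheaf_mem)
      also have "\<dots> = mres Q (\<Union>\<U>) V \<zero>\<^bsub>msec Q (\<Union>\<U>)\<^esub>" using modules_res_zero[OF Q oU oV] by simp
      finally show "\<exists>V. opn V \<and> x \<in> V \<and> V \<subseteq> \<Union>\<U> \<and> mres Q (\<Union>\<U>) V (\<phi> (\<Union>\<U>) s) = mres Q (\<Union>\<U>) V \<zero>\<^bsub>msec Q (\<Union>\<U>)\<^esub>"
        using V(2) oV by blast
    qed
    then have "s \<in> ?K (\<Union>\<U>)" using s(1) oU by (simp add: kernel_sheaf_mem)
    then show "\<exists>s\<in>?K (\<Union>\<U>). \<forall>V\<in>\<U>. mres E (\<Union>\<U>) V s = f V" using s(2) by blast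
  qed
  moreover have "?K = opens_only X ?K" unfolding kernel_sheaf_def opens_only_def by (rule ext) simp
  ultimately show ?thesis unfolding subsheaf_def using sub by simp
qed

lemma vector_bundle_glue:
  assumes K: "sheaf_of_modules X K" and A: "vector_bundle X n A" and B: "vector_bundle X n B"
    and U: "opn U1" "opn U2" "topspace (tps X) \<subseteq> U1 \<union> U2"
    and ag: "agree_on U1 A K" "agree_on U2 B K"
  shows "vector_bundle X n K"
proof -
  have loc: "\<exists>V. opn V \<and> x \<in> V \<and> isomorphic_on X V (free_sheaf X n) K"
    if A: "vector_bundle X n A" and U: "opn U" "x \<in> U" and ag: "agree_on U A K" for A U x
  proof -
    have "x \<in> topspace (tps X)" using opn_topspace[OF U(1)] U(2) by blast
    then obtain V where V: "opn V" "x \<in> V" and iso: "isomorphic_on X V (free_sheaf X n) A"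
      using A unfolding vector_bundle_def by blast
    obtain \<phi> where \<phi>: "\<phi> \<in> sheaf_hom X V (free_sheaf X n) A"
      and bij: "\<And>W. opn W ==> W \<subseteq> V ==> bij_betw (\<phi> W) (secs (free_sheaf X n) W) (secs A W)"
      using iso unfolding isomorphic_on_def by blast
    let ?\<phi> = "on_opens X (V \<inter> U) \<phi>"
    have \<phi>': "?\<phi> \<in> sheaf_hom X (V \<inter> U) (free_sheaf X n) A" by (rule sheaf_hom_on_subset[OF \<phi>]) simp
    note D = sheaf_homD[OF \<phi>']
    have m: "msec A W = msec K W" if "opn W" "W \<subseteq> V \<inter> U" for W
      by (rule agree_onD(1)[OF ag that(1)]) (use that(2) in simp)
    have r: "mres A W W' = mres K W W'" if "opn W" "opn W'" "W' \<subseteq> W" "W \<subseteq> V \<inter> U" for W W'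
      by (rule agree_onD(2)[OF ag that(1-3)]) (use that(4) in simp)
    have "?\<phi> \<in> sheaf_hom X (V \<inter> U) (free_sheaf X n) K"
    proof (rule sheaf_homI[OF D(1)])
      fix W assume W: "opn W" "W \<subseteq> V \<inter> U"
      note e = m[OF W]
      show "?\<phi> W \<in> secs (free_sheaf X n) W \<rightarrow>\<^sub>E secs K W"
        using D(2)[OF W] unfolding e .
      show "?\<phi> W (s \<oplus>\<^bsub>msec (free_sheaf X n) W\<^esub> t) = ?\<phi> W s \<oplus>\<^bsub>msec K W\<^esub> ?\<phi> W t"
        if "s \<in> secs (free_sheaf X n) W" "t \<in> secs (free_sheaf X n) W" for s t
        using D(3)[OF W that] unfolding e .
      show "?\<phi> W (a \<odot>\<^bsub>msec (free_sheaf X n) W\<^esub> s) = a \<odot>\<^bsub>msec K W\<^esub> ?\<phi> W s"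
        if "a \<in> funs W" "s \<in> secs (free_sheaf X n) W" for s a
        using D(4)[OF W that] unfolding e .
    next
      fix W W' s assume W: "opn W" "opn W'" "W' \<subseteq> W" "W \<subseteq> V \<inter> U" and s: "s \<in> secs (free_sheaf X n) W"
      show "?\<phi> W' (mres (free_sheaf X n) W W' s) = mres K W W' (?\<phi> W s)"
        using D(5)[OF W s] unfolding r[OF W] .
    qed
    moreover have "bij_betw (?\<phi> W) (secs (free_sheaf X n) W) (secs K W)" if W: "opn W" "W \<subseteq> V \<inter> U" for W
    proof -
      have "W \<subseteq> V" using W(2) by simp
      then show ?thesis using bij[OF W(1)] unfolding m[OF W] using on_opens_apply[OF W, of \<phi>] by simp
    qed
    ultimately have "isomorphic_on X (V \<inter> U) (free_sheaf X n) K" unfolding isomorphic_on_def by blast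
    then show ?thesis using V U opn_Int[OF V(1) U(1)] by blast
  qed
  show ?thesis
    unfolding vector_bundle_def
  proof (intro conjI ballI K)
    fix x assume "x \<in> topspace (tps X)"
    then consider "x \<in> U1" | "x \<in> U2" using U(3) by blast
    then show "\<exists>U. opn U \<and> x \<in> U \<and> isomorphic_on X U (free_sheaf X n) K"
      using loc[OF A U(1) _ ag(1)] loc[OF B U(2) _ ag(2)] by cases
  qed
qed

text \<open>Extension by zero of a homomorphism given over \<open>U1\<close>, into a sheaf that vanishes over \<open>U2\<close>.\<close>

lemma glue_hom_zero:
  assumes M: "sheaf_of_modules X M" and N: "sheaf_of_modules X N" and Q: "sheaf_of_modules X Q"
    and U: "opn U1" "opn U2" "topspace (tps X) \<subseteq> U1 \<union> U2"
    and ag: "agree_on U1 M N" and \<phi>: "\<phi> \<in> homs X N Q"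
    and sub: "\<And>W. opn W ==> secs N W \<subseteq> secs M W" and re: "mres N = mres M"
    and z: "\<And>W q. opn W ==> W \<subseteq> U2 ==> q \<in> secs Q W ==> q = \<zero>\<^bsub>msec Q W\<^esub>"
  obtains \<psi> where "\<psi> \<in> homs X M Q"
    and "\<And>W s. opn W ==> s \<in> secs N W ==> \<psi> W s = \<phi> W s"
proof -
  note ot = opn_topspace and L = sheaf_lin[OF M] and LQ = sheaf_lin[OF Q] and H = sheaf_homD[OF \<phi>]
  have o1: "opn (W \<inter> U1)" if "opn W" for W by (rule opn_Int[OF that U(1)])
  have e: "msec N (W \<inter> U1) = msec M (W \<inter> U1)" if "opn W" for W
    by (rule agree_onD(1)[OF ag o1[OF that], symmetric]) simp
  (* Sections of Q are determined by their restriction to U1, since Q vanishes over U2. *)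
  have det: "q = q'" if W: "opn W" and q: "q \<in> secs Q W" "q' \<in> secs Q W"
      and eq: "mres Q W (W \<inter> U1) q = mres Q W (W \<inter> U1) q'" for W q q'
  proof (rule modules_eqI[OF Q W q])
    fix x assume x: "x \<in> W"
    have "x \<in> U1 \<or> x \<in> U2" using x U(3) ot[OF W] by blast
    then show "\<exists>V. opn V \<and> x \<in> V \<and> V \<subseteq> W \<and> mres Q W V q = mres Q W V q'"
    proof
      assume "x \<in> U1" then show ?thesis using eq x o1[OF W] by blast
    next
      assume "x \<in> U2"
      have o2: "opn (W \<inter> U2)" "W \<inter> U2 \<subseteq> W" "W \<inter> U2 \<subseteq> U2" using opn_Int[OF W U(2)] by auto
      have "mres Q W (W \<inter> U2) q = mres Q W (W \<inter> U2) q'"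
        using z[OF o2(1,3) LQ(6)[OF W o2(1,2) q(1)]] z[OF o2(1,3) LQ(6)[OF W o2(1,2) q(2)]] by simp
      then show ?thesis using o2 \<open>x \<in> U2\<close> x by blast
    qed
  qed
  define v where "v W s = \<phi> (W \<inter> U1) (mres M W (W \<inter> U1) s)" for W s
  have rM: "mres M W (W \<inter> U1) s \<in> secs N (W \<inter> U1)" if W: "opn W" and s: "s \<in> secs M W" for W s
    using L(6)[OF W o1[OF W] _ s] unfolding e[OF W] by simp
  have v: "v W s \<in> secs Q (W \<inter> U1)" if W: "opn W" and s: "s \<in> secs M W" for W s
    unfolding v_def by (rule H(6)[OF o1[OF W] ot[OF o1[OF W]] rM[OF W s]])
  have ex: "\<exists>q. q \<in> secs Q W \<and> mres Q W (W \<inter> U1) q = v W s"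
    if W: "opn W" and s: "s \<in> secs M W" for W s
  proof -
    let ?P = "\<lambda>V c. V \<subseteq> U2 \<or> (V \<subseteq> U1 \<and> c = \<phi> V (mres M W V s))"
    have rs: "\<phi> V' (mres M W V' s) = mres Q V V' (\<phi> V (mres M W V s))"
      if V: "opn V" "opn V'" "V' \<subseteq> V" "V \<subseteq> W" "V \<subseteq> U1" for V V'
    proof -
      have "mres M W V s \<in> secs N V"
        using L(6)[OF W V(1,4) s] agree_onD(1)[OF ag V(1,5)] by simp
      from H(5)[OF V(1-3) ot[OF V(1)] this]
      show ?thesis unfolding re by (simp add: L(8)[OF W V(1,2,3,4) s])
    qed
    have "\<exists>!q. q \<in> secs Q W \<and> (\<forall>V c. opn V \<and> V \<subseteq> W \<and> c \<in> secs Q V \<and> ?P V c --> mres Q W V q = c)"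
    proof (rule sheaf_glue_described[OF modules_sheaf[OF Q] W, of ?P])
      fix x assume x: "x \<in> W"
      have "x \<in> U1 \<or> x \<in> U2" using x U(3) ot[OF W] by blast
      then show "\<exists>V c. opn V \<and> x \<in> V \<and> V \<subseteq> W \<and> c \<in> secs Q V \<and> ?P V c"
      proof
        assume "x \<in> U1"
        then show ?thesis using o1[OF W] x v[OF W s] unfolding v_def
          by (intro exI[of _ "W \<inter> U1"] exI[of _ "\<phi> (W \<inter> U1) (mres M W (W \<inter> U1) s)"]) auto
      next
        assume "x \<in> U2"
        have o2: "opn (W \<inter> U2)" by (rule opn_Int[OF W U(2)])
        interpret Q: module "sec X (W \<inter> U2)" "msec Q (W \<inter> U2)" by (rule modules_module[OF Q o2])
        show ?thesis using o2 x \<open>x \<in> U2\<close> Q.zero_closed by blast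
      qed
    next
      fix V V' c d assume V: "opn V" "opn V'" "V \<subseteq> W" "V' \<subseteq> W"
        and c: "c \<in> secs Q V" "d \<in> secs Q V'" and P: "?P V c" "?P V' d"
      have o: "opn (V \<inter> V')" by (rule opn_Int[OF V(1,2)])
      have cl: "mres Q V (V \<inter> V') c \<in> secs Q (V \<inter> V')" "mres Q V' (V \<inter> V') d \<in> secs Q (V \<inter> V')"
        using LQ(6)[OF V(1) o _ c(1)] LQ(6)[OF V(2) o _ c(2)] by auto
      show "mres Q V (V \<inter> V') c = mres Q V' (V \<inter> V') d"
      proof (cases "V \<subseteq> U2 \<or> V' \<subseteq> U2")
        case True
        then have "V \<inter> V' \<subseteq> U2" by blast
        then show ?thesis using z[OF o _ cl(1)] z[OF o _ cl(2)] by simp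
      next
        case False
        then have "V \<subseteq> U1" "V' \<subseteq> U1" "c = \<phi> V (mres M W V s)" "d = \<phi> V' (mres M W V' s)" using P by auto
        then show ?thesis using rs[OF V(1) o _ V(3)] rs[OF V(2) o _ V(4)] by simp
      qed
    qed
    from ex1_implies_ex[OF this] obtain q where q: "q \<in> secs Q W"
      and qr: "\<forall>V c. opn V \<and> V \<subseteq> W \<and> c \<in> secs Q V \<and> ?P V c --> mres Q W V q = c" by (elim exE conjE)
    have "mres Q W (W \<inter> U1) q = v W s"
      by (rule qr[THEN spec, THEN spec, THEN mp]) (use o1[OF W] v[OF W s] in \<open>simp add: v_def\<close>)
    with q show ?thesis by blast
  qed
  define g where "g W s = (SOME q. q \<in> secs Q W \<and> mres Q W (W \<inter> U1) q = v W s)" for W s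
  have g: "g W s \<in> secs Q W" "mres Q W (W \<inter> U1) (g W s) = v W s"
    if "opn W" "s \<in> secs M W" for W s
    using someI_ex[OF ex[OF that]] unfolding g_def by blast+
  have gI: "g W s = q" if "opn W" "s \<in> secs M W" "q \<in> secs Q W" "mres Q W (W \<inter> U1) q = v W s" for W s q
    by (rule det[OF that(1) g(1)[OF that(1,2)] that(3)]) (simp add: g(2)[OF that(1,2)] that(4))
  let ?\<psi> = "on_sections (topspace (tps X)) M g"
  have "?\<psi> \<in> homs X M Q"
  proof (rule on_sections_homI[OF modules_linear_presheaf[OF M]])
    fix W s assume W: "opn W" and s: "s \<in> secs M W"
    note o = o1[OF W] and t = ot[OF o1[OF W]]
    show "g W s \<in> secs Q W" by (rule g[OF W s])
    show "g W (s \<oplus>\<^bsub>msec M W\<^esub> t) = g W s \<oplus>\<^bsub>msec Q W\<^esub> g W t" if t': "t \<in> secs M W" for t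
    proof (rule gI[OF W L(2)[OF W s t'] LQ(2)[OF W g(1)[OF W s] g(1)[OF W t']]])
      have "v W (s \<oplus>\<^bsub>msec M W\<^esub> t) = v W s \<oplus>\<^bsub>msec Q (W \<inter> U1)\<^esub> v W t"
        unfolding v_def using H(3)[OF o t rM[OF W s] rM[OF W t']] L(4)[OF W o _ s t'] e[OF W] by simp
      then show "mres Q W (W \<inter> U1) (g W s \<oplus>\<^bsub>msec Q W\<^esub> g W t) = v W (s \<oplus>\<^bsub>msec M W\<^esub> t)"
        using LQ(4)[OF W o _ g(1)[OF W s] g(1)[OF W t']] g(2)[OF W s] g(2)[OF W t'] by simp
    qed
  next
    fix W a s assume W: "opn W" and a: "a \<in> funs W" and s: "s \<in> secs M W"
    note o = o1[OF W] and t = ot[OF o1[OF W]]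
    have ra: "res X W (W \<inter> U1) a \<in> funs (W \<inter> U1)" by (rule res_closed[OF W o _ a]) simp
    show "g W (a \<odot>\<^bsub>msec M W\<^esub> s) = a \<odot>\<^bsub>msec Q W\<^esub> g W s"
    proof (rule gI[OF W L(3)[OF W a s] LQ(3)[OF W a g(1)[OF W s]]])
      have "v W (a \<odot>\<^bsub>msec M W\<^esub> s) = res X W (W \<inter> U1) a \<odot>\<^bsub>msec Q (W \<inter> U1)\<^esub> v W s"
        unfolding v_def using H(4)[OF o t ra rM[OF W s]] L(5)[OF W o _ a s] e[OF W] by simp
      then show "mres Q W (W \<inter> U1) (a \<odot>\<^bsub>msec Q W\<^esub> g W s) = v W (a \<odot>\<^bsub>msec M W\<^esub> s)"
        using LQ(5)[OF W o _ a g(1)[OF W s]] g(2)[OF W s] by simp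
    qed
  next
    fix W W' s assume W: "opn W" "opn W'" "W' \<subseteq> W" and s: "s \<in> secs M W"
    note s' = L(6)[OF W s] and o = o1[OF W(1)] and o' = o1[OF W(2)]
    have i: "W' \<inter> U1 \<subseteq> W \<inter> U1" "W \<inter> U1 \<subseteq> W" "W' \<inter> U1 \<subseteq> W'" using W(3) by auto
    show "g W' (mres M W W' s) = mres Q W W' (g W s)"
    proof (rule gI[OF W(2) s' LQ(6)[OF W g(1)[OF W(1) s]]])
      have "mres Q W' (W' \<inter> U1) (mres Q W W' (g W s)) = mres Q (W \<inter> U1) (W' \<inter> U1) (mres Q W (W \<inter> U1) (g W s))"
        using LQ(8)[OF W(1,2) o' i(3) W(3) g(1)[OF W(1) s]] LQ(8)[OF W(1) o o' i(1,2) g(1)[OF W(1) s]] by simp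
      also have "\<dots> = mres Q (W \<inter> U1) (W' \<inter> U1) (v W s)" by (simp only: g(2)[OF W(1) s])
      also have "\<dots> = \<phi> (W' \<inter> U1) (mres N (W \<inter> U1) (W' \<inter> U1) (mres M W (W \<inter> U1) s))"
        unfolding v_def using H(5)[OF o o' i(1) ot[OF o] rM[OF W(1) s]] by simp
      also have "\<dots> = v W' (mres M W W' s)"
        unfolding v_def re using L(8)[OF W(1,2) o' i(3) W(3) s] L(8)[OF W(1) o o' i(1,2) s] by simp
      finally show "mres Q W' (W' \<inter> U1) (mres Q W W' (g W s)) = v W' (mres M W W' s)" .
    qed
  qed
  moreover have "?\<psi> W s = \<phi> W s" if W: "opn W" and s: "s \<in> secs N W" for W s
  proof -
    have sM: "s \<in> secs M W" using sub[OF W] s by blast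
    have "g W s = \<phi> W s"
    proof (rule gI[OF W sM H(6)[OF W ot[OF W] s]])
      show "mres Q W (W \<inter> U1) (\<phi> W s) = v W s"
        unfolding v_def using H(5)[OF W o1[OF W] _ ot[OF W] s] unfolding re by simp
    qed
    then show ?thesis using W ot[OF W] sM by simp
  qed
  ultimately show thesis by (rule that)
qed

text \<open>The map \<open>\<psi>\<close> is \<open>\<phi>2\<close> over \<open>U1\<close>, where both stages agree, and zero over \<open>U2\<close>.  All remaining claims are
  local: \<open>K\<close> is \<open>S2\<close> over \<open>U1\<close> and \<open>S0\<close> over \<open>U2\<close>.\<close>

lemma elementary_transforms_commute:
  assumes E: "sheaf_of_modules X E" and S: "subsheaf X E S0" "subsheaf X E S1" "subsheaf X E S2"
    and vb: "vector_bundle X n (subobj E S0)" "vector_bundle X n (subobj E S2)"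
    and Q: "sheaf_of_modules X Q1" "sheaf_of_modules X Q2"
    and U: "opn U1" "opn U2" "topspace (tps X) \<subseteq> U1 \<union> U2"
    and supp: "U1 \<inter> sheaf_support X Q1 = {}" "U2 \<inter> sheaf_support X Q2 = {}"
    and \<phi>1: "surjective_morphism X (subobj E S0) Q1 \<phi>1" and S1: "S1 = kernel_sheaf X (subobj E S0) Q1 \<phi>1"
    and \<phi>2: "surjective_morphism X (subobj E S1) Q2 \<phi>2" and S2: "S2 = kernel_sheaf X (subobj E S1) Q2 \<phi>2"
  obtains \<psi> K where "surjective_morphism X (subobj E S0) Q2 \<psi>" "\<phi>2 = induced X S1 \<psi>"
    and "K = kernel_sheaf X (subobj E S0) Q2 \<psi>"
    and "subsheaf X E K" "vector_bundle X n (subobj E K)" "\<forall>U. S2 U \<subseteq> K U" "\<forall>U. K U \<subseteq> S0 U"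
    and "surjective_morphism X (subobj E K) Q1 (induced X K \<phi>1)"
    and "S2 = kernel_sheaf X (subobj E K) Q1 (induced X K \<phi>1)"
    and "agree_on U1 (subobj E S0) (subobj E S1)" "agree_on U1 (subobj E K) (subobj E S2)"
    and "agree_on U2 (subobj E S0) (subobj E K)" "agree_on U2 (subobj E S1) (subobj E S2)"
proof -
  note ot = opn_topspace
  note M0 = subsheaf_modules[OF E S(1)] and M1 = subsheaf_modules[OF E S(2)]
  have h1: "\<phi>1 \<in> homs X (subobj E S0) Q1" and h2: "\<phi>2 \<in> homs X (subobj E S1) Q2"
    using \<phi>1 \<phi>2 unfolding surjective_morphism_def by simp_all
  have z1: "q = \<zero>\<^bsub>msec Q1 W\<^esub>" if "opn W" "W \<subseteq> U1" "q \<in> secs Q1 W" for W q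
    by (rule zero_off_support[OF Q(1) that(1) _ that(3)]) (use that(2) supp(1) in blast)
  have z2: "q = \<zero>\<^bsub>msec Q2 W\<^esub>" if "opn W" "W \<subseteq> U2" "q \<in> secs Q2 W" for W q
    by (rule zero_off_support[OF Q(2) that(1) _ that(3)]) (use that(2) supp(2) in blast)
  have m1: "s \<in> S1 W \<longleftrightarrow> opn W \<and> s \<in> S0 W \<and> \<phi>1 W s = \<zero>\<^bsub>msec Q1 W\<^esub>" for s W
    unfolding S1 kernel_sheaf_mem by simp
  have m2: "s \<in> S2 W \<longleftrightarrow> opn W \<and> s \<in> S1 W \<and> \<phi>2 W s = \<zero>\<^bsub>msec Q2 W\<^esub>" for s W
    unfolding S2 kernel_sheaf_mem by simp
  have agI: "agree_on U (subobj E S) (subobj E T)"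
    if "\<And>W s. opn W ==> W \<subseteq> U ==> s \<in> S W \<longleftrightarrow> s \<in> T W" for U S T
  proof -
    have "S W = T W" if "opn W" "W \<subseteq> U" for W
      using that \<open>\<And>W s. opn W ==> W \<subseteq> U ==> s \<in> S W \<longleftrightarrow> s \<in> T W\<close> by blast
    then show ?thesis unfolding agree_on_def by (simp add: subobj_def)
  qed
  have ag01: "agree_on U1 (subobj E S0) (subobj E S1)"
  proof (rule agI)
    fix W s assume W: "opn W" "W \<subseteq> U1"
    have "\<phi>1 W s = \<zero>\<^bsub>msec Q1 W\<^esub>" if "s \<in> S0 W"
      by (rule z1[OF W sheaf_hom_closed[OF h1 W(1) ot[OF W(1)]]]) (simp add: that)
    then show "s \<in> S0 W \<longleftrightarrow> s \<in> S1 W" using W(1) unfolding m1 by blast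
  qed
  have ag12: "agree_on U2 (subobj E S1) (subobj E S2)"
  proof (rule agI)
    fix W s assume W: "opn W" "W \<subseteq> U2"
    have "\<phi>2 W s = \<zero>\<^bsub>msec Q2 W\<^esub>" if "s \<in> S1 W"
      by (rule z2[OF W sheaf_hom_closed[OF h2 W(1) ot[OF W(1)]]]) (simp add: that)
    then show "s \<in> S1 W \<longleftrightarrow> s \<in> S2 W" using W(1) unfolding m2 by blast
  qed
  obtain \<psi> where \<psi>: "\<psi> \<in> homs X (subobj E S0) Q2" and \<psi>ext0: "\<And>W s. opn W ==> s \<in> secs (subobj E S1) W ==> \<psi> W s = \<phi>2 W s"
    by (rule glue_hom_zero[OF M0 M1 Q(2) U ag01 h2 _ _ z2]) (auto simp: m1)
  have \<psi>ext: "\<psi> W s = \<phi>2 W s" if "s \<in> S1 W" for W s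
    by (rule \<psi>ext0) (use that m1 in auto)
  have \<psi>s: "surjective_morphism X (subobj E S0) Q2 \<psi>"
    unfolding surjective_morphism_def
  proof (intro conjI allI impI ballI \<psi>)
    fix W t x assume W: "opn W" and t: "t \<in> secs Q2 W" and x: "x \<in> W"
    then obtain V s where V: "opn V" "x \<in> V" "V \<subseteq> W" "s \<in> secs (subobj E S1) V" "\<phi>2 V s = mres Q2 W V t"
      using \<phi>2 unfolding surjective_morphism_def by blast
    then have s: "s \<in> S1 V" by simp
    show "\<exists>V. opn V \<and> x \<in> V \<and> V \<subseteq> W \<and> (\<exists>s\<in>secs (subobj E S0) V. \<psi> V s = mres Q2 W V t)"
      by (intro exI[of _ V] conjI bexI[of _ s]) (use V s \<psi>ext[OF s] m1 in simp_all)
  qed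
  have ind: "\<phi>2 = induced X S1 \<psi>"
  proof (rule sheaf_hom_eqI[OF h2])
    have "\<phi>2 = on_opens X (topspace (tps X)) \<phi>2" by (rule sheaf_hom_on_opens[OF h2])
    also have "\<dots> = induced X S1 \<psi>"
    proof (rule ext)
      fix W
      show "on_opens X (topspace (tps X)) \<phi>2 W = induced X S1 \<psi> W"
      proof (cases "opn W")
        case True
        have "\<phi>2 W \<in> S1 W \<rightarrow>\<^sub>E secs Q2 W" using sheaf_hom_ext[OF h2 True ot[OF True]] by simp
        then have "\<phi>2 W = restrict (\<psi> W) (S1 W)"
          using \<psi>ext by (intro extensionalityI[of _ "S1 W"]) (auto simp: PiE_def)
        then show ?thesis by (simp add: induced_def on_opens_def)
      qed (simp add: induced_def on_opens_def)
    qed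
    finally show "induced X S1 \<psi> \<in> homs X (subobj E S1) Q2" using h2 by simp
  qed (simp add: induced_apply \<psi>ext)
  define K where "K = kernel_sheaf X (subobj E S0) Q2 \<psi>"
  have mK: "s \<in> K W \<longleftrightarrow> opn W \<and> s \<in> S0 W \<and> \<psi> W s = \<zero>\<^bsub>msec Q2 W\<^esub>" for s W
    unfolding K_def kernel_sheaf_mem by simp
  have m2K: "s \<in> S2 W \<longleftrightarrow> s \<in> K W \<and> \<phi>1 W s = \<zero>\<^bsub>msec Q1 W\<^esub>" for s W
    using \<psi>ext[of s W] unfolding m2 mK m1 by auto
  have KS: "subsheaf X E K" unfolding K_def by (rule kernel_subsheaf[OF E S(1) Q(2) \<psi>])
  have agK2: "agree_on U1 (subobj E K) (subobj E S2)"
  proof (rule agI)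
    fix W s assume W: "opn W" "W \<subseteq> U1"
    have "\<phi>1 W s = \<zero>\<^bsub>msec Q1 W\<^esub>" if "s \<in> S0 W"
      by (rule z1[OF W sheaf_hom_closed[OF h1 W(1) ot[OF W(1)]]]) (simp add: that)
    then show "s \<in> K W \<longleftrightarrow> s \<in> S2 W" using W(1) unfolding m2K mK by blast
  qed
  have SK: "s \<in> S0 W \<longleftrightarrow> s \<in> K W" if W: "opn W" "W \<subseteq> U2" for W s
  proof -
    have "\<psi> W s = \<zero>\<^bsub>msec Q2 W\<^esub>" if "s \<in> S0 W"
      by (rule z2[OF W sheaf_hom_closed[OF \<psi> W(1) ot[OF W(1)]]]) (simp add: that)
    then show ?thesis using W(1) unfolding mK by blast
  qed
  have ag0K: "agree_on U2 (subobj E S0) (subobj E K)" by (rule agI) (rule SK)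
  note MK = subsheaf_modules[OF E KS]
  have vbK: "vector_bundle X n (subobj E K)"
    by (rule vector_bundle_glue[OF MK vb(2,1) U agree_on_sym[OF agK2] ag0K])
  have iK: "induced X K \<phi>1 W s = \<phi>1 W s" if "s \<in> K W" for W s
    by (rule induced_apply) (use that mK in auto)
  have hK: "induced X K \<phi>1 \<in> homs X (subobj E K) Q1"
  proof (rule sheaf_homI)
    show "induced X K \<phi>1 = on_opens X (topspace (tps X)) (induced X K \<phi>1)"
      unfolding induced_def on_opens_def by (rule ext) simp
    have K0: "\<And>s W. s \<in> K W ==> s \<in> S0 W" unfolding mK by simp
    note LK = sheaf_lin[OF MK, simplified]
    fix W assume W: "opn W" "W \<subseteq> topspace (tps X)"
    have "induced X K \<phi>1 W = restrict (\<phi>1 W) (K W)" unfolding induced_def by (rule on_opens_apply[OF W])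
    then show "induced X K \<phi>1 W \<in> secs (subobj E K) W \<rightarrow>\<^sub>E secs Q1 W"
      using sheaf_hom_closed[OF h1 W] K0 by simp
    show "induced X K \<phi>1 W (s \<oplus>\<^bsub>msec (subobj E K) W\<^esub> t) = induced X K \<phi>1 W s \<oplus>\<^bsub>msec Q1 W\<^esub> induced X K \<phi>1 W t"
      if "s \<in> secs (subobj E K) W" "t \<in> secs (subobj E K) W" for s t
      using that sheaf_hom_add[OF h1 W, of s t] LK(2)[OF W(1), of s t] K0[of s W] K0[of t W] by (simp add: iK)
    show "induced X K \<phi>1 W (a \<odot>\<^bsub>msec (subobj E K) W\<^esub> s) = a \<odot>\<^bsub>msec Q1 W\<^esub> induced X K \<phi>1 W s"
      if "a \<in> funs W" "s \<in> secs (subobj E K) W" for s a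
      using that sheaf_hom_smult[OF h1 W, of a s] LK(3)[OF W(1), of a s] K0[of s W] by (simp add: iK)
    fix W' s assume W': "opn W'" "W' \<subseteq> W" and s: "s \<in> secs (subobj E K) W"
    show "induced X K \<phi>1 W' (mres (subobj E K) W W' s) = mres Q1 W W' (induced X K \<phi>1 W s)"
      using sheaf_hom_res[OF h1 W(1) W' W(2), of s] LK(6)[OF W(1) W', of s] K0[of s W] s by (simp add: iK)
  qed
  have sK: "surjective_morphism X (subobj E K) Q1 (induced X K \<phi>1)"
    unfolding surjective_morphism_def
  proof (intro conjI allI impI ballI hK)
    fix W t x assume W: "opn W" and t: "t \<in> secs Q1 W" and x: "x \<in> W"
    have "x \<in> U1 \<or> x \<in> U2" using x U(3) ot[OF W] by blast
    then show "\<exists>V. opn V \<and> x \<in> V \<and> V \<subseteq> W \<and> (\<exists>s\<in>secs (subobj E K) V. induced X K \<phi>1 V s = mres Q1 W V t)"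
    proof
      assume "x \<in> U1"
      have o: "opn (W \<inter> U1)" "W \<inter> U1 \<subseteq> W" "W \<inter> U1 \<subseteq> U1" using opn_Int[OF W U(1)] by auto
      interpret K: module "sec X (W \<inter> U1)" "msec (subobj E K) (W \<inter> U1)" by (rule modules_module[OF MK o(1)])
      let ?s = "\<zero>\<^bsub>msec (subobj E K) (W \<inter> U1)\<^esub>"
      have "induced X K \<phi>1 (W \<inter> U1) ?s = \<zero>\<^bsub>msec Q1 (W \<inter> U1)\<^esub>" by (rule sheaf_hom_zero[OF MK Q(1) hK o(1) ot[OF o(1)]])
      also have "\<dots> = mres Q1 W (W \<inter> U1) t"
        using z1[OF o(1,3) sheaf_lin(6)[OF Q(1) W o(1,2) t]] by simp
      finally show ?thesis using o \<open>x \<in> U1\<close> x K.zero_closed by blast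
    next
      assume x2: "x \<in> U2"
      obtain V s where V: "opn V" "x \<in> V" "V \<subseteq> W" "s \<in> secs (subobj E S0) V" "\<phi>1 V s = mres Q1 W V t"
        using \<phi>1 W t x unfolding surjective_morphism_def by blast
      have o: "opn (V \<inter> U2)" "V \<inter> U2 \<subseteq> V" "V \<inter> U2 \<subseteq> U2" using opn_Int[OF V(1) U(2)] by auto
      let ?s = "mres E V (V \<inter> U2) s"
      have "?s \<in> S0 (V \<inter> U2)" using sheaf_lin(6)[OF M0 V(1) o(1,2) V(4)] by simp
      then have sK: "?s \<in> K (V \<inter> U2)" using SK[OF o(1,3)] by blast
      have "\<phi>1 (V \<inter> U2) ?s = mres Q1 V (V \<inter> U2) (mres Q1 W V t)"
        using sheaf_hom_res[OF h1 V(1) o(1,2) ot[OF V(1)] V(4)] V(5) by simp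
      also have "\<dots> = mres Q1 W (V \<inter> U2) t" by (rule sheaf_lin(8)[OF Q(1) W V(1) o(1,2) V(3) t])
      finally have "induced X K \<phi>1 (V \<inter> U2) ?s = mres Q1 W (V \<inter> U2) t" using iK[OF sK] by simp
      moreover have "V \<inter> U2 \<subseteq> W" using V(3) by blast
      ultimately show ?thesis using o(1) x2 V(2) sK
        by (intro exI[of _ "V \<inter> U2"] conjI bexI[of _ ?s]) simp_all
    qed
  qed
  have kK: "S2 = kernel_sheaf X (subobj E K) Q1 (induced X K \<phi>1)"
  proof (rule ext)
    fix W
    show "S2 W = kernel_sheaf X (subobj E K) Q1 (induced X K \<phi>1) W"
    proof (rule Set.set_eqI)
      fix s
      show "s \<in> S2 W \<longleftrightarrow> s \<in> kernel_sheaf X (subobj E K) Q1 (induced X K \<phi>1) W"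
        using iK[of s W] mK[of s W] unfolding m2K kernel_sheaf_mem by auto
    qed
  qed
  show thesis
  proof (rule that[OF \<psi>s ind K_def KS vbK _ _ sK kK ag01 agK2 ag0K ag12])
    show "\<forall>U. S2 U \<subseteq> K U" using m2K by blast
    show "\<forall>U. K U \<subseteq> S0 U" using mK by blast
  qed
qed

section \<open>Interchanging adjacent transforms\<close>

text \<open>The second sequence of \<open>interchange\<close>, as a function of the first.\<close>

definition interchanged ::
  "('p, 'r, 'm) modsheaf \<Rightarrow> nat \<Rightarrow> ('p set \<Rightarrow> 'm \<Rightarrow> 'q) \<Rightarrow> ('p, 'r, 'm, 'q) transforms \<Rightarrow> ('p, 'r, 'm, 'q) transforms" where
  "interchanged E k \<psi> F =
     (let K = kernel_sheaf X (bundle_at E F k) (quo F (Suc k)) \<psi> in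
      \<lparr> stage = (stage F)(Suc k := K),
        dvr = (dvr F)(k := dvr F (Suc k), Suc k := dvr F k),
        quo = (quo F)(k := quo F (Suc k), Suc k := quo F k),
        emap = (emap F)(k := \<psi>, Suc k := induced X K (emap F k)) \<rparr>)"

lemma interchanged_simps:
  "dvr (interchanged E k \<psi> F) = (dvr F)(k := dvr F (Suc k), Suc k := dvr F k)"
  "quo (interchanged E k \<psi> F) = (quo F)(k := quo F (Suc k), Suc k := quo F k)"
  "i \<noteq> Suc k ==> stage (interchanged E k \<psi> F) i = stage F i"
  by (simp_all add: interchanged_def Let_def)

lemma cartier_line_sheaf: "effective_cartier X D ==> line_sheaf (divisor_bundle X D)"
  unfolding divisor_bundle_def effective_cartier_def
  by (rule dual_line_sheaf[OF vector_bundle_line_sheaf]) simp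

lemma adjacent_transforms_interchange:
  fixes E :: "('p, 'r, 'm) modsheaf" and F :: "('p, 'r, 'm, 'q) transforms"
  assumes E: "sheaf_of_modules X E" and F: "transform_filtration X n E h F" and k: "Suc k < h"
    and disj: "divisor_support X (dvr F k) \<inter> divisor_support X (dvr F (Suc k)) = {}"
  obtains \<psi> where "surjective_morphism X (bundle_at E F k) (quo F (Suc k)) \<psi>"
    and "emap F (Suc k) = induced X (stage F (Suc k)) \<psi>"
    and "transform_filtration X n E h (interchanged E k \<psi> F)"
proof -
  note ot = opn_topspace
  have hf: "hierarchical_filtration X n E (det_sheaf X n (bundle_at E F h)) h (stage F) (dvr F)"
    and tr: "\<And>i. i < h ==> coherent X (quo F i) \<and> torsion_sheaf X (quo F i) \<and> nonzero_sheaf X (quo F i) \<and>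
        sheaf_support X (quo F i) \<subseteq> divisor_support X (dvr F i) \<and>
        surjective_morphism X (bundle_at E F i) (quo F i) (emap F i) \<and>
        stage F (Suc i) = kernel_sheaf X (bundle_at E F i) (quo F i) (emap F i)"
    using F unfolding transform_filtration_def by simp_all
  have st0: "stage F 0 = whole X E"
    and sub: "\<And>i. i \<le> h ==> subsheaf X E (stage F i)"
    and vb: "\<And>i. i \<le> h ==> vector_bundle X n (bundle_at E F i)"
    and step: "\<And>i. i < h ==> (\<forall>U. stage F (Suc i) U \<subseteq> stage F i U) \<and>
        effective_cartier X (dvr F i) \<and> divisor_nonzero X (dvr F i) \<and>
        isomorphic X (det_sheaf X n (bundle_at E F i))
          (tensor_sheaf X (det_sheaf X n (bundle_at E F (Suc i))) (divisor_bundle X (dvr F i)))"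
    and end_: "isomorphic X (det_sheaf X n (bundle_at E F h)) (det_sheaf X n (bundle_at E F h))"
    using hf unfolding hierarchical_filtration_def by simp_all
  have kh: "k < h" "k \<le> h" "Suc k \<le> h" "Suc (Suc k) \<le> h" using k by auto
  let ?T = "topspace (tps X)"
  let ?U1 = "?T - divisor_support X (dvr F k)" and ?U2 = "?T - divisor_support X (dvr F (Suc k))"
  have U: "opn ?U1" "opn ?U2" "?T \<subseteq> ?U1 \<union> ?U2" using opn_off_divisor disj by auto
  have Q: "sheaf_of_modules X (quo F i)" if "i < h" for i using tr[OF that] unfolding coherent_def by simp
  have sp: "(?T - divisor_support X (dvr F i)) \<inter> sheaf_support X (quo F i) = {}" if "i < h" for i
    using tr[OF that] by blast
  have su: "surjective_morphism X (bundle_at E F i) (quo F i) (emap F i)" if "i < h" for i using tr[OF that] by simp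
  have ke: "stage F (Suc i) = kernel_sheaf X (bundle_at E F i) (quo F i) (emap F i)" if "i < h" for i using tr[OF that] by simp
  obtain \<psi> K where \<psi>: "surjective_morphism X (bundle_at E F k) (quo F (Suc k)) \<psi>"
    and ind: "emap F (Suc k) = induced X (stage F (Suc k)) \<psi>"
    and K: "K = kernel_sheaf X (bundle_at E F k) (quo F (Suc k)) \<psi>"
    and Ks: "subsheaf X E K" and vbK: "vector_bundle X n (subobj E K)"
    and inc: "\<forall>U. stage F (Suc (Suc k)) U \<subseteq> K U" "\<forall>U. K U \<subseteq> stage F k U"
    and sK: "surjective_morphism X (subobj E K) (quo F k) (induced X K (emap F k))"
    and kK: "stage F (Suc (Suc k)) = kernel_sheaf X (subobj E K) (quo F k) (induced X K (emap F k))"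
    and ag: "agree_on ?U1 (bundle_at E F k) (bundle_at E F (Suc k))" "agree_on ?U1 (subobj E K) (bundle_at E F (Suc (Suc k)))"
      "agree_on ?U2 (bundle_at E F k) (subobj E K)" "agree_on ?U2 (bundle_at E F (Suc k)) (bundle_at E F (Suc (Suc k)))"
    by (rule elementary_transforms_commute[OF E sub[OF kh(2)] sub[OF kh(3)] sub[OF kh(4)] vb[OF kh(2)] vb[OF kh(4)]
      Q[OF kh(1)] Q[OF k] U sp[OF kh(1)] sp[OF k] su[OF kh(1)] ke[OF kh(1)] su[OF k] ke[OF k]])
  have U': "?T \<subseteq> ?U2 \<union> ?U1" using U(3) by blast
  have car: "effective_cartier X (dvr F k)" "effective_cartier X (dvr F (Suc k))"
    and iso: "isomorphic X (det_sheaf X n (bundle_at E F k))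
          (tensor_sheaf X (det_sheaf X n (bundle_at E F (Suc k))) (divisor_bundle X (dvr F k)))"
      "isomorphic X (det_sheaf X n (bundle_at E F (Suc k)))
          (tensor_sheaf X (det_sheaf X n (bundle_at E F (Suc (Suc k)))) (divisor_bundle X (dvr F (Suc k))))"
    using step[OF kh(1)] step[OF k] by simp_all
  (* Over the first open set K is the second stage below k, over the other one it is stage k. *)
  have iso1: "isomorphic X (det_sheaf X n (bundle_at E F k))
      (tensor_sheaf X (det_sheaf X n (subobj E K)) (divisor_bundle X (dvr F (Suc k))))"
    by (rule det_twist_exchange[OF vb[OF kh(2)] vb[OF kh(3)] vb[OF kh(4)] vbK cartier_line_sheaf[OF car(2)] U ag(1,2,3,4) iso(2)])
  have iso2: "isomorphic X (det_sheaf X n (subobj E K))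
      (tensor_sheaf X (det_sheaf X n (bundle_at E F (Suc (Suc k)))) (divisor_bundle X (dvr F k)))"
    by (rule det_twist_exchange[OF vbK vb[OF kh(2)] vb[OF kh(3)] vb[OF kh(4)] cartier_line_sheaf[OF car(1)] U(2,1) U'
      agree_on_sym[OF ag(3)] agree_on_sym[OF ag(4)] ag(2,1) iso(1)])
  let ?G = "interchanged E k \<psi> F"
  have G: "stage ?G = (stage F)(Suc k := K)" "dvr ?G = (dvr F)(k := dvr F (Suc k), Suc k := dvr F k)"
    "quo ?G = (quo F)(k := quo F (Suc k), Suc k := quo F k)" "emap ?G = (emap F)(k := \<psi>, Suc k := induced X K (emap F k))"
    unfolding interchanged_def K by (simp_all add: Let_def)
  have sh: "stage ?G h = stage F h" using k unfolding G by simp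
  have "hierarchical_filtration X n E (det_sheaf X n (bundle_at E F h)) h (stage ?G) (dvr ?G)"
    unfolding hierarchical_filtration_def
  proof (intro conjI)
    show "stage ?G 0 = whole X E" using st0 unfolding G by simp
    show "\<forall>i\<le>h. subsheaf X E (stage ?G i) \<and> vector_bundle X n (bundle_at E ?G i)"
      using sub vb Ks vbK unfolding G by simp
    show "isomorphic X (det_sheaf X n (bundle_at E ?G h)) (det_sheaf X n (bundle_at E F h))"
      unfolding sh by (rule end_)
    show "\<forall>i<h. (\<forall>U. stage ?G (Suc i) U \<subseteq> stage ?G i U) \<and>
        effective_cartier X (dvr ?G i) \<and> divisor_nonzero X (dvr ?G i) \<and>
        isomorphic X (det_sheaf X n (bundle_at E ?G i))
          (tensor_sheaf X (det_sheaf X n (bundle_at E ?G (Suc i))) (divisor_bundle X (dvr ?G i)))"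
    proof (intro allI impI)
      fix i assume i: "i < h"
      consider "i = k" | "i = Suc k" | "i \<noteq> k" "i \<noteq> Suc k" by blast
      then show "(\<forall>U. stage ?G (Suc i) U \<subseteq> stage ?G i U) \<and>
        effective_cartier X (dvr ?G i) \<and> divisor_nonzero X (dvr ?G i) \<and>
        isomorphic X (det_sheaf X n (bundle_at E ?G i))
          (tensor_sheaf X (det_sheaf X n (bundle_at E ?G (Suc i))) (divisor_bundle X (dvr ?G i)))"
      proof cases
        case 1
        then show ?thesis using step[OF k] iso1 inc unfolding G by simp
      next
        case 2
        then show ?thesis using step[OF kh(1)] iso2 inc unfolding G by simp
      next
        case 3
        then show ?thesis using step[OF i] unfolding G by simp
      qed
    qed
  qed
  moreover have "\<forall>i<h. coherent X (quo ?G i) \<and> torsion_sheaf X (quo ?G i) \<and> nonzero_sheaf X (quo ?G i) \<and>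
        sheaf_support X (quo ?G i) \<subseteq> divisor_support X (dvr ?G i) \<and>
        surjective_morphism X (bundle_at E ?G i) (quo ?G i) (emap ?G i) \<and>
        stage ?G (Suc i) = kernel_sheaf X (bundle_at E ?G i) (quo ?G i) (emap ?G i)"
  proof (intro allI impI)
    fix i assume i: "i < h"
    consider "i = k" | "i = Suc k" | "i \<noteq> k" "i \<noteq> Suc k" by blast
    then show "coherent X (quo ?G i) \<and> torsion_sheaf X (quo ?G i) \<and> nonzero_sheaf X (quo ?G i) \<and>
        sheaf_support X (quo ?G i) \<subseteq> divisor_support X (dvr ?G i) \<and>
        surjective_morphism X (bundle_at E ?G i) (quo ?G i) (emap ?G i) \<and>
        stage ?G (Suc i) = kernel_sheaf X (bundle_at E ?G i) (quo ?G i) (emap ?G i)"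
    proof cases
      case 1
      then show ?thesis using tr[OF k] \<psi> K unfolding G by simp
    next
      case 2
      then show ?thesis using tr[OF kh(1)] sK kK unfolding G by simp
    next
      case 3
      then show ?thesis using tr[OF i] unfolding G by simp
    qed
  qed
  ultimately have "transform_filtration X n E h ?G" unfolding transform_filtration_def sh by (rule conjI)
  then show thesis by (rule that[OF \<psi> ind])
qed

section \<open>Sorting a filtration\<close>

lemma sort_into_two_blocks:
  fixes E :: "('p, 'r, 'm) modsheaf" and F :: "('p, 'r, 'm, 'q) transforms"
  assumes E: "sheaf_of_modules X E" and F: "transform_filtration X n E h F"
    and cover: "\<And>i. i < h ==> dvr F i \<in> \<A> \<union> \<B>" and AB: "\<A> \<inter> \<B> = {}"
    and disj: "\<And>D D'. D \<in> \<A> ==> D' \<in> \<B> ==> divisor_support X D \<inter> divisor_support X D' = {}"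
  shows "\<exists>G. (interchange X n E h \<A> \<B>)\<^sup>*\<^sup>* F G \<and> transform_filtration X n E h G \<and>
        (\<forall>i<h. \<forall>j<h. dvr G i \<in> \<A> \<and> dvr G j \<in> \<B> --> i < j)"
  using F cover
proof (induction "\<Sum>i<h. if dvr F i \<in> \<A> then i else 0" arbitrary: F rule: less_induct)
  case less
  show ?case
  proof (cases "\<exists>k. Suc k < h \<and> dvr F k \<in> \<B> \<and> dvr F (Suc k) \<in> \<A>")
    case True
    then obtain k where k: "Suc k < h" "dvr F k \<in> \<B>" "dvr F (Suc k) \<in> \<A>" by blast
    have d: "divisor_support X (dvr F k) \<inter> divisor_support X (dvr F (Suc k)) = {}" using disj[OF k(3,2)] by blast
    obtain \<psi> where \<psi>: "surjective_morphism X (bundle_at E F k) (quo F (Suc k)) \<psi>"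
      "emap F (Suc k) = induced X (stage F (Suc k)) \<psi>" and G: "transform_filtration X n E h (interchanged E k \<psi> F)"
      by (rule adjacent_transforms_interchange[OF E less.prems(1) k(1) d])
    let ?G = "interchanged E k \<psi> F"
    have FG: "interchange X n E h \<A> \<B> F ?G"
      unfolding interchange_def
      by (intro conjI less.prems(1) G exI[of _ k] exI[of _ \<psi>]) (use k \<psi> in \<open>simp_all add: interchanged_def\<close>)
    let ?f = "\<lambda>F :: ('p, 'r, 'm, 'q) transforms. \<lambda>i. if dvr F i \<in> \<A> then i else 0"
    have split: "(\<Sum>i<h. g i) = g k + g (Suc k) + (\<Sum>i\<in>{..<h} - {k, Suc k}. g i)" for g :: "nat \<Rightarrow> nat"
      using sum.subset_diff[of "{k, Suc k}" "{..<h}" g] k(1) by simp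
    have "(\<Sum>i\<in>{..<h} - {k, Suc k}. ?f ?G i) = (\<Sum>i\<in>{..<h} - {k, Suc k}. ?f F i)"
      by (rule sum.cong) (auto simp: interchanged_simps)
    moreover have "?f ?G k + ?f ?G (Suc k) < ?f F k + ?f F (Suc k)"
      using k AB by (auto simp: interchanged_simps)
    (* The divisor of the first collection has moved from position k + 1 to position k. *)
    ultimately have lt: "(\<Sum>i<h. ?f ?G i) < (\<Sum>i<h. ?f F i)"
      unfolding split by simp
    have cov: "dvr ?G i \<in> \<A> \<union> \<B>" if "i < h" for i
      using less.prems(2)[OF that] k by (auto simp: interchanged_simps)
    have "\<exists>H. (interchange X n E h \<A> \<B>)\<^sup>*\<^sup>* ?G H \<and> transform_filtration X n E h H \<and>
        (\<forall>i<h. \<forall>j<h. dvr H i \<in> \<A> \<and> dvr H j \<in> \<B> --> i < j)"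
      by (rule less.hyps[OF lt G]) (rule cov)
    then obtain H where H: "(interchange X n E h \<A> \<B>)\<^sup>*\<^sup>* ?G H" "transform_filtration X n E h H"
        "\<forall>i<h. \<forall>j<h. dvr H i \<in> \<A> \<and> dvr H j \<in> \<B> --> i < j"
      by (elim exE conjE)
    show ?thesis
      by (intro exI[of _ H] conjI converse_rtranclp_into_rtranclp[of "interchange X n E h \<A> \<B>", OF FG H(1)] H(2,3))
  next
    case False
    have B: "dvr F i \<in> \<B>" if "j \<le> i" "i < h" "dvr F j \<in> \<B>" for i j
      using that(1,2)
    proof (induction i rule: dec_induct)
      case base
      show ?case by (rule that(3))
    next
      case (step i)
      then show ?case using False less.prems(2)[of "Suc i"] by auto
    qed
    have "i < j" if "i < h" "dvr F i \<in> \<A>" "dvr F j \<in> \<B>" for i j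
    proof (rule ccontr)
      assume "\<not> i < j"
      then show False using B[of j i] that AB by auto
    qed
    then have "\<forall>i<h. \<forall>j<h. dvr F i \<in> \<A> \<and> dvr F j \<in> \<B> --> i < j" by simp
    then show ?thesis by (intro exI[of _ F] conjI rtranclp.rtrancl_refl less.prems(1))
  qed
qed

text \<open>An increasing permutation satisfies \<open>i \<le> \<sigma> i\<close>, and the two sides have the same sum.\<close>

lemma permutes_no_descent:
  assumes p: "\<sigma> permutes {..<h}" and asc: "\<And>k. Suc k < h ==> \<sigma> k \<le> \<sigma> (Suc k)"
  shows "\<forall>i<h. \<sigma> i = i"
proof -
  have ge: "i \<le> \<sigma> i" if "i < h" for i
    using that
  proof (induction i)
    case (Suc i)
    have "\<sigma> i \<noteq> \<sigma> (Suc i)" using permutes_inj[OF p] by (simp add: inj_eq)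
    then show ?case using Suc asc[OF Suc.prems] by simp
  qed simp
  have eq: "(\<Sum>i<h. i) = (\<Sum>i<h. \<sigma> i)" using sum.permute[OF p, of "\<lambda>i. i"] by (simp add: comp_def)
  have "i = \<sigma> i" if "i < h" for i
    by (rule sum_mono_inv[OF eq]) (use that ge in simp_all)
  then show ?thesis by simp
qed

lemma reorder_transforms:
  fixes E :: "('p, 'r, 'm) modsheaf" and F :: "('p, 'r, 'm, 'q) transforms"
  assumes E: "sheaf_of_modules X E" and F: "transform_filtration X n E h F" and p: "\<sigma> permutes {..<h}"
    and disj: "\<And>i j. i < j ==> j < h ==> \<sigma> j < \<sigma> i ==>
      divisor_support X (dvr F (\<sigma> i)) \<inter> divisor_support X (dvr F (\<sigma> j)) = {}"
  shows "\<exists>G :: ('p, 'r, 'm, 'q) transforms. transform_filtration X n E h G \<and>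
      (\<forall>i<h. dvr G i = dvr F (\<sigma> i) \<and> quo G i = quo F (\<sigma> i)) \<and> stage G h = stage F h"
  using p disj
  (* The weights decrease with i, so that exchanging the values at a descent lowers the sum. *)
proof (induction "\<Sum>i<h. (h - i) * \<sigma> i" arbitrary: \<sigma> rule: less_induct)
  case less
  show ?case
  proof (cases "\<exists>k. Suc k < h \<and> \<sigma> (Suc k) < \<sigma> k")
    case True
    then obtain k where k: "Suc k < h" "\<sigma> (Suc k) < \<sigma> k" by blast
    let ?t = "Transposition.transpose k (Suc k)"
    let ?s = "\<sigma> \<circ> ?t"
    have sp: "?s permutes {..<h}"
      by (rule permutes_compose[OF permutes_swap_id less.prems(1)]) (use k in auto)
    have s: "?s k = \<sigma> (Suc k)" "?s (Suc k) = \<sigma> k" "\<And>i. i \<noteq> k ==> i \<noteq> Suc k ==> ?s i = \<sigma> i" by auto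
    have split: "(\<Sum>i<h. g i) = g k + g (Suc k) + (\<Sum>i\<in>{..<h} - {k, Suc k}. g i)" for g :: "nat \<Rightarrow> nat"
      using sum.subset_diff[of "{k, Suc k}" "{..<h}" g] k(1) by simp
    have r: "(\<Sum>i\<in>{..<h} - {k, Suc k}. (h - i) * ?s i) = (\<Sum>i\<in>{..<h} - {k, Suc k}. (h - i) * \<sigma> i)"
      by (rule sum.cong) (use s(3) in auto)
    have "(h - k) * ?s k + (h - Suc k) * ?s (Suc k) < (h - k) * \<sigma> k + (h - Suc k) * \<sigma> (Suc k)"
    proof -
      obtain m where "h - k = Suc m" "h - Suc k = m" using k(1) by (metis Suc_diff_Suc Suc_lessD)
      then show ?thesis using k(2) s(1,2) by simp
    qed
    then have lt: "(\<Sum>i<h. (h - i) * ?s i) < (\<Sum>i<h. (h - i) * \<sigma> i)"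
      unfolding split using r by linarith
    (* The only pair whose order changes is the one at k and k + 1, and it is no longer inverted. *)
    have dj: "divisor_support X (dvr F (?s i)) \<inter> divisor_support X (dvr F (?s j)) = {}"
      if ij: "i < j" "j < h" "?s j < ?s i" for i j
    proof -
      have "\<not> (i = k \<and> j = Suc k)" using ij(3) k(2) s(1,2) by auto
      then have "?t i < ?t j" using ij(1) by (auto simp: Transposition.transpose_def)
      moreover have "?t j < h" using ij(2) k(1) by (auto simp: Transposition.transpose_def)
      ultimately show ?thesis using less.prems(2)[of "?t i" "?t j"] ij(3) by simp
    qed
    have "\<exists>G :: ('p, 'r, 'm, 'q) transforms. transform_filtration X n E h G \<and>
      (\<forall>i<h. dvr G i = dvr F (?s i) \<and> quo G i = quo F (?s i)) \<and> stage G h = stage F h"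
      by (rule less.hyps[OF lt sp]) (rule dj)
    then obtain G :: "('p, 'r, 'm, 'q) transforms" where G: "transform_filtration X n E h G"
      and Gi: "\<forall>i<h. dvr G i = dvr F (?s i) \<and> quo G i = quo F (?s i)" and Gh: "stage G h = stage F h"
      by (elim exE conjE)
    have Gk: "dvr G k = dvr F (\<sigma> (Suc k))" "dvr G (Suc k) = dvr F (\<sigma> k)"
      "quo G k = quo F (\<sigma> (Suc k))" "quo G (Suc k) = quo F (\<sigma> k)"
      using Gi[THEN spec, of k] Gi[THEN spec, of "Suc k"] k(1) unfolding s by simp_all
    have d: "divisor_support X (dvr G k) \<inter> divisor_support X (dvr G (Suc k)) = {}"
      unfolding Gk using less.prems(2)[of k "Suc k"] k by auto
    obtain \<psi> where H: "transform_filtration X n E h (interchanged E k \<psi> G)"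
      by (rule adjacent_transforms_interchange[OF E G k(1) d])
    have "dvr (interchanged E k \<psi> G) i = dvr F (\<sigma> i) \<and> quo (interchanged E k \<psi> G) i = quo F (\<sigma> i)" if "i < h" for i
      using Gi that s(3)[of i] Gk by (cases "i = k"; cases "i = Suc k") (simp_all add: interchanged_simps)
    moreover have "stage (interchanged E k \<psi> G) h = stage F h"
      using k(1) Gh by (simp add: interchanged_simps)
    ultimately show ?thesis using H by (intro exI[of _ "interchanged E k \<psi> G"] conjI allI impI) simp_all
  next
    case False
    have "\<sigma> k \<le> \<sigma> (Suc k)" if "Suc k < h" for k
      using False that leI by blast
    from permutes_no_descent[OF less.prems(1) this] have "\<forall>i<h. \<sigma> i = i" .
    then show ?thesis using F by (intro exI[of _ F] conjI allI impI) simp_all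
  qed
qed

section \<open>Transforms of a fixed bundle\<close>

text \<open>A map induced on the first kernel vanishes where the map itself does, so that both orders cut out
  the common kernel.\<close>

lemma iterated_kernel:
  fixes E :: "('p, 'r, 'm) modsheaf" and P :: "('p, 'r, 'a) modsheaf" and Q :: "('p, 'r, 'b) modsheaf"
  shows "s \<in> kernel_sheaf X (subobj E (kernel_sheaf X E P \<phi>)) Q (induced X (kernel_sheaf X E P \<phi>) \<psi>) U \<longleftrightarrow>
    opn U \<and> s \<in> secs E U \<and> \<phi> U s = \<zero>\<^bsub>msec P U\<^esub> \<and> \<psi> U s = \<zero>\<^bsub>msec Q U\<^esub>"
proof (cases "s \<in> kernel_sheaf X E P \<phi> U")
  case True
  then have U: "opn U" "s \<in> secs E U" "\<phi> U s = \<zero>\<^bsub>msec P U\<^esub>" unfolding kernel_sheaf_mem by simp_all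
  then show ?thesis
    unfolding kernel_sheaf_mem[of s "subobj E (kernel_sheaf X E P \<phi>)"] induced_apply[where S="kernel_sheaf X E P \<phi>", OF U(1) True] using True by simp
next
  case False
  then show ?thesis
    unfolding kernel_sheaf_mem[of s "subobj E (kernel_sheaf X E P \<phi>)"] by (auto simp: kernel_sheaf_mem)
qed

lemma pair_kernel:
  fixes E :: "('p, 'r, 'm) modsheaf" and P :: "('p, 'r, 'a) modsheaf" and Q :: "('p, 'r, 'b) modsheaf"
  shows "s \<in> kernel_sheaf X E (direct_sum_sheaf P Q) (pair_morphism X E \<phi> \<psi>) U \<longleftrightarrow>
    opn U \<and> s \<in> secs E U \<and> \<phi> U s = \<zero>\<^bsub>msec P U\<^esub> \<and> \<psi> U s = \<zero>\<^bsub>msec Q U\<^esub>"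
proof -
  have "pair_morphism X E \<phi> \<psi> U s = (\<phi> U s, \<psi> U s)" if "opn U" "s \<in> secs E U"
    using that opn_topspace[OF that(1)] unfolding pair_morphism_def by simp
  moreover have "\<zero>\<^bsub>msec (direct_sum_sheaf P Q) U\<^esub> = (\<zero>\<^bsub>msec P U\<^esub>, \<zero>\<^bsub>msec Q U\<^esub>)"
    by (simp add: direct_sum_sheaf_def mk_module_def)
  ultimately show ?thesis unfolding kernel_sheaf_mem by auto
qed

lemma transforms_commute:
  fixes E :: "('p, 'r, 'm) modsheaf" and P :: "('p, 'r, 'a) modsheaf" and Q :: "('p, 'r, 'b) modsheaf"
  shows "kernel_sheaf X (subobj E (kernel_sheaf X E P \<phi>)) Q (induced X (kernel_sheaf X E P \<phi>) \<psi>) =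
      kernel_sheaf X (subobj E (kernel_sheaf X E Q \<psi>)) P (induced X (kernel_sheaf X E Q \<psi>) \<phi>)"
    and "kernel_sheaf X (subobj E (kernel_sheaf X E Q \<psi>)) P (induced X (kernel_sheaf X E Q \<psi>) \<phi>) =
      kernel_sheaf X E (direct_sum_sheaf P Q) (pair_morphism X E \<phi> \<psi>)"
proof -
  have "(s \<in> kernel_sheaf X (subobj E (kernel_sheaf X E P \<phi>)) Q (induced X (kernel_sheaf X E P \<phi>) \<psi>) U) =
      (s \<in> kernel_sheaf X (subobj E (kernel_sheaf X E Q \<psi>)) P (induced X (kernel_sheaf X E Q \<psi>) \<phi>) U)" for U s
    unfolding iterated_kernel by auto
  then show "kernel_sheaf X (subobj E (kernel_sheaf X E P \<phi>)) Q (induced X (kernel_sheaf X E P \<phi>) \<psi>) =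
      kernel_sheaf X (subobj E (kernel_sheaf X E Q \<psi>)) P (induced X (kernel_sheaf X E Q \<psi>) \<phi>)"
    by (intro ext Set.set_eqI)
  have "(s \<in> kernel_sheaf X (subobj E (kernel_sheaf X E Q \<psi>)) P (induced X (kernel_sheaf X E Q \<psi>) \<phi>) U) =
      (s \<in> kernel_sheaf X E (direct_sum_sheaf P Q) (pair_morphism X E \<phi> \<psi>) U)" for U s
    unfolding iterated_kernel pair_kernel by auto
  then show "kernel_sheaf X (subobj E (kernel_sheaf X E Q \<psi>)) P (induced X (kernel_sheaf X E Q \<psi>) \<phi>) =
      kernel_sheaf X E (direct_sum_sheaf P Q) (pair_morphism X E \<phi> \<psi>)"
    by (intro ext Set.set_eqI)
qed

end

theorem corollary3p4:
  fixes k :: "'k ring" and \<iota> :: "'k \<Rightarrow> 'r" and X :: "('p, 'r) ringed_space"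
    and \<rho> h :: nat and E :: "('p, 'r, 'm) modsheaf"
    and F :: "('p, 'r, 'm, 'q) transforms"
    and \<A> \<B> :: "('p, 'r) divisor set"
  assumes variety: "smooth_projective_variety k \<iota> X"
    and vector_bundle: "vector_bundle X \<rho> E"
    and filtration: "transform_filtration X \<rho> E h F"
    and collections: "\<A> \<union> \<B> = dvr F ` {..<h}" "\<A> \<inter> \<B> = {}"
    and disjoint: "\<And>D D'. D \<in> \<A> \<Longrightarrow> D' \<in> \<B> \<Longrightarrow> divisor_support X D \<inter> divisor_support X D' = {}"
  shows
    "(\<forall>Da\<in>\<A>. \<forall>Db\<in>\<B>.
        \<forall>(Qa :: ('p, 'r, 'a) modsheaf) (Qb :: ('p, 'r, 'b) modsheaf) \<phi>a \<phi>b.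
          coherent X Qa \<and> coherent X Qb \<and>
          surjective_morphism X E Qa \<phi>a \<and> surjective_morphism X E Qb \<phi>b \<and>
          sheaf_support X Qa \<subseteq> divisor_support X Da \<and> sheaf_support X Qb \<subseteq> divisor_support X Db \<longrightarrow>
          (let Ka = kernel_sheaf X E Qa \<phi>a; Kb = kernel_sheaf X E Qb \<phi>b in
            kernel_sheaf X (subobj E Ka) Qb (induced X Ka \<phi>b) =
              kernel_sheaf X (subobj E Kb) Qa (induced X Kb \<phi>a) \<and>
            kernel_sheaf X (subobj E Kb) Qa (induced X Kb \<phi>a) =
              kernel_sheaf X E (direct_sum_sheaf Qa Qb) (pair_morphism X E \<phi>a \<phi>b)))
     \<and>
     (\<exists>G. (interchange X \<rho> E h \<A> \<B>)\<^sup>*\<^sup>* F G \<and> transform_filtration X \<rho> E h G \<and>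
        (\<forall>i<h. \<forall>j<h. dvr G i \<in> \<A> \<and> dvr G j \<in> \<B> \<longrightarrow> i < j))
     \<and>
     (\<forall>\<sigma>. \<sigma> permutes {..<h} \<and>
        (\<forall>i<h. \<forall>j<h. i < j \<and> \<sigma> j < \<sigma> i \<longrightarrow>
           divisor_support X (dvr F (\<sigma> i)) \<inter> divisor_support X (dvr F (\<sigma> j)) = {}) \<longrightarrow>
        (\<exists>G :: ('p, 'r, 'm, 'q) transforms. transform_filtration X \<rho> E h G \<and>
           (\<forall>i<h. dvr G i = dvr F (\<sigma> i) \<and> quo G i = quo F (\<sigma> i)) \<and>
           stage G h = stage F h \<and>
           (let \<Lambda> = det_sheaf X \<rho> (bundle_at E F h) in
             hierarchical_filtration X \<rho> E \<Lambda> h (stage G) (dvr G) \<and>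
             (attains_depth X \<rho> E \<Lambda> h (stage F) (dvr F) \<longrightarrow>
              attains_depth X \<rho> E \<Lambda> h (stage G) (dvr G)))))"
proof -
  have "sheaf_of_rings X"
    using variety unfolding smooth_projective_variety_def integral_scheme_def scheme_def locally_ringed_space_def by simp
  then interpret sheaf_ringed_space X by unfold_locales
  have E: "sheaf_of_modules X E" using vector_bundle unfolding vector_bundle_def by simp
  show ?thesis
  proof (intro conjI, goal_cases)
    case 1
    show ?case unfolding Let_def by (intro ballI allI impI conjI transforms_commute)
  next
    case 2
    show ?case
    proof (rule sort_into_two_blocks[OF E filtration _ collections(2) disjoint])
      show "dvr F i \<in> \<A> \<union> \<B>" if "i < h" for i using that unfolding collections(1) by simp
    qed
  next
    case 3
    show ?case
    proof (intro allI impI; elim conjE; goal_cases)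
      case (1 \<sigma>)
      have d: "divisor_support X (dvr F (\<sigma> i)) \<inter> divisor_support X (dvr F (\<sigma> j)) = {}"
        if "i < j" "j < h" "\<sigma> j < \<sigma> i" for i j
        by (rule 1(2)[THEN spec, THEN mp, THEN spec, THEN mp, THEN mp]) (use that in simp_all)
      have "\<exists>G :: ('p, 'r, 'm, 'q) transforms. transform_filtration X \<rho> E h G \<and>
          (\<forall>i<h. dvr G i = dvr F (\<sigma> i) \<and> quo G i = quo F (\<sigma> i)) \<and> stage G h = stage F h"
        by (rule reorder_transforms[OF E filtration 1(1)]) (rule d)
      then obtain G :: "('p, 'r, 'm, 'q) transforms" where G: "transform_filtration X \<rho> E h G"
        "\<forall>i<h. dvr G i = dvr F (\<sigma> i) \<and> quo G i = quo F (\<sigma> i)" "stage G h = stage F h"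
        by (elim exE conjE)
      (* The last stage, hence the normalization of the filtration, has not changed. *)
      have "hierarchical_filtration X \<rho> E (det_sheaf X \<rho> (bundle_at E F h)) h (stage G) (dvr G)"
        using G(1) unfolding transform_filtration_def G(3) by simp
      with G show ?case
        unfolding Let_def attains_depth_def by (intro exI[of _ G] conjI impI) simp_all
    qed
  qed
qed

end
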